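(* In the setting below, one always has $\mu_p\le d+2$, and the following properties are equivalent: (d) $M$ is minimal at $p$; (e) $\mathcal O_{\mathcal L,\underline{\mathcal L}}(\mathcal M,p^c)$ contains a neighborhood of $p^c$ in $\mathcal M$; (f) for every sufficiently small $\delta>0$, the set $\Gamma_{2\mu_p-1}\big((\delta\Delta^m)^{2\mu_p-1}\big)$ (equivalently $\underline\Gamma_{2\mu_p-1}\big((\delta\Delta^m)^{2\mu_p-1}\big)$) contains a neighborhood of $p^c$ in $\mathcal M$; (g) there exist points $w^*\in(\mathbb C^m)^{2\mu_p-1}$ arbitrarily close to $0$ with $\Gamma_{2\mu_p-1}(w^* )=p^c$ such that $\Gamma_{2\mu_p-1}$ is a submersion onto $\mathcal M$ at $w^*$ (and likewise $\underline\Gamma_{2\mu_p-1}$ at $\overline{w^*}$); (h) for every sufficiently small $\delta>0$, the set $\pi_t\big(\underline\Gamma_{2\mu_p-2}((\delta\Delta^m)^{2\mu_p-2})\big)$ contains a neighborhood of $p$ in $\mathbb C^n$ and $\pi_\tau\big(\Gamma_{2\mu_p-2}((\delta\Delta^m)^{2\mu_p-2})\big)$ contains a neighborhood of $\bar p$ in $\mathbb C^n$.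
   Context: Setting: $M\subset\mathbb C^n$ is a real analytic CR-generic submanifold, $p\in M$, $m=\dim_{CR}M\ge1$, $d=\operatorname{codim}_{\mathbb R}M\ge1$, $n=m+d$. Local holomorphic coordinates $t=(w,z)\in\mathbb C^m\times\mathbb C^d$ vanish at $p$ and $M$ is given near $0$ by $z=\bar z+i\bar\Theta(w,\bar w,\bar z)$, equivalently $\bar z=z-i\Theta(\bar w,w,z)$, with $\Theta(\zeta,w,z)$ a $\mathbb C^d$-valued convergent power series ($\bar\Theta$: conjugated coefficients). Extrinsic complexification: $\mathcal M=\{(t,\tau)=(w,z,\zeta,\xi)\ \text{near }0: z=\xi+i\bar\Theta(w,\zeta,\xi)\}$; $p^c=(p,\bar p)$; $\pi_t(t,\tau)=t$, $\pi_\tau(t,\tau)=\tau$. Complexified CR vector fields $\mathcal L^j=\partial/\partial w_j+i\sum_l\partial_{w_j}\bar\Theta_l(w,\zeta,\xi)\partial/\partial z_l$, $\underline{\mathcal L}^j=\partial/\partial\zeta_j-i\sum_l\partial_{\zeta_j}\Theta_l(\zeta,w,z)\partial/\partial\xi_l$; their $m$-flows on $\mathcal M$ are $\mathcal L_w(w_0,z_0,\zeta_0,\xi_0)=(w_0+w,\xi_0+i\bar\Theta(w_0+w,\zeta_0,\xi_0),\zeta_0,\xi_0)$ and $\underline{\mathcal L}_\zeta(w_0,z_0,\zeta_0,\xi_0)=(w_0,z_0,\zeta_0+\zeta,z_0-i\Theta(\zeta_0+\zeta,w_0,z_0))$. Segre $k$-chains: $\Gamma_1(w_1)=\mathcal L_{w_1}(p^c)$,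 $\Gamma_2(w_{(2)})=\underline{\mathcal L}_{w_2}(\Gamma_1(w_1))$, $\Gamma_3(w_{(3)})=\mathcal L_{w_3}(\Gamma_2(w_{(2)}))$, etc., alternating; $\underline\Gamma_k$ likewise starting with $\underline{\mathcal L}_{w_1}(p^c)$; $\Delta$ is the unit disc. Segre multitype: $r_k$ is the generic (maximal) rank of $\Gamma_k$, $e_k:=r_{k+2}-r_{k+1}$ ($k\ge1$), $\kappa_p$ is the integer with $e_1,\dots,e_{\kappa_p}>0$ and $e_l=0$ for $l>\kappa_p$, and the Segre type is $\mu_p:=\kappa_p+2$. $M$ is minimal at $p$ if its CR orbit (the germ of the smallest real analytic submanifold through $p$ whose tangent spaces contain $T^cM$; equivalently the set of points reachable by piecewise integral curves of sections of $T^cM$) contains a neighborhood of $p$ in $M$. $\mathcal O_{\mathcal L,\underline{\mathcal L}}(\mathcal M,p^c)$ is the germ at $p^c$ of the set of endpoints of finite concatenations of flows of the $\mathcal L^j,\underline{\mathcal L}^j$ starting at $p^c$. *)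

theory Defs
  imports "HOL-Analysis.Analysis"
begin

text \<open>Points of C^n = C^m x C^d are pairs (w,z); points of C^n x C^n are
  ((w,z),(zeta,xi)).  The base point p and p^c are the origin.\<close>

type_synonym ('m,'d) pt = "(complex^'m) \<times> (complex^'d)"
type_synonym ('m,'d) cpt = "('m,'d) pt \<times> ('m,'d) pt"
type_synonym ('m,'d) germfun = "complex^'m \<Rightarrow> complex^'m \<Rightarrow> complex^'d \<Rightarrow> complex^'d"

definition vconj :: "complex^'n \<Rightarrow> complex^'n" where
  "vconj x = (\<chi> i. cnj (x $ i))"

definition monom :: "('i::finite \<Rightarrow> nat) \<Rightarrow> complex^'i \<Rightarrow> complex" where
  "monom \<alpha> x = (\<Prod>i\<in>UNIV. (x $ i) ^ (\<alpha> i))"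

definition pdisc :: "real \<Rightarrow> (complex^'n) set" where
  "pdisc r = {x. \<forall>i. norm (x $ i) < r}"

definition conv_power_series :: "('m::finite,'d::finite) germfun \<Rightarrow> bool" where
  "conv_power_series \<Theta> \<longleftrightarrow>
    (\<exists>(c :: 'd \<Rightarrow> ('m \<Rightarrow> nat) \<Rightarrow> ('m \<Rightarrow> nat) \<Rightarrow> ('d \<Rightarrow> nat) \<Rightarrow> complex) (R::real). R > 0 \<and>
      (\<forall>l. (\<lambda>(\<alpha>,\<beta>,\<gamma>). norm (c l \<alpha> \<beta> \<gamma>) * R ^ (sum \<alpha> UNIV + sum \<beta> UNIV + sum \<gamma> UNIV))
              summable_on UNIV) \<and>
      (\<forall>\<zeta> w z l. \<zeta> \<in> pdisc R \<and> w \<in> pdisc R \<and> z \<in> pdisc R \<longrightarrow>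
          \<Theta> \<zeta> w z $ l = (\<Sum>\<^sub>\<infinity>(\<alpha>,\<beta>,\<gamma>). c l \<alpha> \<beta> \<gamma> * monom \<alpha> \<zeta> * monom \<beta> w * monom \<gamma> z)))"

text \<open>The series with conjugated coefficients.\<close>
definition Theta_bar :: "('m::finite,'d::finite) germfun \<Rightarrow> ('m,'d) germfun" where
  "Theta_bar \<Theta> a b c = vconj (\<Theta> (vconj a) (vconj b) (vconj c))"

definition realM :: "('m::finite,'d::finite) germfun \<Rightarrow> ('m,'d) pt set" where
  "realM \<Theta> = {(w,z). z = vconj z + \<i> *s Theta_bar \<Theta> w (vconj w) (vconj z)}"

definition complexM :: "('m::finite,'d::finite) germfun \<Rightarrow> ('m,'d) cpt set" where
  "complexM \<Theta> = {((w,z),(\<zeta>,\<xi>)). z = \<xi> + \<i> *s Theta_bar \<Theta> w \<zeta> \<xi>}"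

text \<open>The m-flows of the complexified CR vector fields.\<close>
definition Lflow :: "('m::finite,'d::finite) germfun \<Rightarrow> complex^'m \<Rightarrow> ('m,'d) cpt \<Rightarrow> ('m,'d) cpt" where
  "Lflow \<Theta> w P = (case P of ((w0,z0),(\<zeta>0,\<xi>0)) \<Rightarrow>
      ((w0 + w, \<xi>0 + \<i> *s Theta_bar \<Theta> (w0 + w) \<zeta>0 \<xi>0), (\<zeta>0, \<xi>0)))"

definition Lbflow :: "('m::finite,'d::finite) germfun \<Rightarrow> complex^'m \<Rightarrow> ('m,'d) cpt \<Rightarrow> ('m,'d) cpt" where
  "Lbflow \<Theta> \<zeta> P = (case P of ((w0,z0),(\<zeta>0,\<xi>0)) \<Rightarrow>
      ((w0, z0), (\<zeta>0 + \<zeta>, z0 - \<i> *s \<Theta> (\<zeta>0 + \<zeta>) w0 z0)))"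

text \<open>Segre k-chains; the argument w_(k) = (w_1,...,w_k) is encoded as a function
  ws with w_j = ws (j-1), only the first k entries being used.\<close>
fun Gamma :: "('m::finite,'d::finite) germfun \<Rightarrow> nat \<Rightarrow> (nat \<Rightarrow> complex^'m) \<Rightarrow> ('m,'d) cpt" where
  "Gamma \<Theta> 0 ws = 0"
| "Gamma \<Theta> (Suc k) ws = (if even k then Lflow \<Theta> (ws k) (Gamma \<Theta> k ws)
                                      else Lbflow \<Theta> (ws k) (Gamma \<Theta> k ws))"

fun Gammab :: "('m::finite,'d::finite) germfun \<Rightarrow> nat \<Rightarrow> (nat \<Rightarrow> complex^'m) \<Rightarrow> ('m,'d) cpt" where
  "Gammab \<Theta> 0 ws = 0"
| "Gammab \<Theta> (Suc k) ws = (if even k then Lbflow \<Theta> (ws k) (Gammab \<Theta> k ws)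
                                       else Lflow \<Theta> (ws k) (Gammab \<Theta> k ws))"

definition chain_dom :: "nat \<Rightarrow> real \<Rightarrow> (nat \<Rightarrow> complex^'m) set" where
  "chain_dom k \<delta> = {ws. \<forall>j<k. ws j \<in> pdisc \<delta>}"

definition flat :: "('m::finite,'d::finite) cpt \<Rightarrow> complex^(('m + 'd) + ('m + 'd))" where
  "flat P = (case P of ((w,z),(\<zeta>,\<xi>)) \<Rightarrow> (\<chi> i. case i of
       Inl (Inl a) \<Rightarrow> w $ a | Inl (Inr b) \<Rightarrow> z $ b | Inr (Inl a) \<Rightarrow> \<zeta> $ a | Inr (Inr b) \<Rightarrow> \<xi> $ b))"

definition jac_rank :: "nat \<Rightarrow> ((nat \<Rightarrow> complex^'m::finite) \<Rightarrow> ('m,'d::finite) cpt) \<Rightarrow> (nat \<Rightarrow> complex^'m) \<Rightarrow> nat" where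
  "jac_rank k F ws = vec.dim
     ((\<lambda>(j,a). \<chi> i. deriv (\<lambda>s. flat (F (ws(j := ws j + s *s axis a 1))) $ i) 0) ` ({..<k} \<times> UNIV))"

definition generic_rank :: "nat \<Rightarrow> ((nat \<Rightarrow> complex^'m::finite) \<Rightarrow> ('m,'d::finite) cpt) \<Rightarrow> nat" where
  "generic_rank k F = (LEAST r. \<exists>\<delta>>0. \<forall>ws\<in>chain_dom k \<delta>. jac_rank k F ws \<le> r)"

definition segre_r :: "('m::finite,'d::finite) germfun \<Rightarrow> nat \<Rightarrow> nat" where
  "segre_r \<Theta> k = generic_rank k (Gamma \<Theta> k)"

definition segre_e :: "('m::finite,'d::finite) germfun \<Rightarrow> nat \<Rightarrow> int" where
  "segre_e \<Theta> k = int (segre_r \<Theta> (k + 2)) - int (segre_r \<Theta> (k + 1))"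

definition segre_kappa :: "('m::finite,'d::finite) germfun \<Rightarrow> nat" where
  "segre_kappa \<Theta> = (THE \<kappa>. (\<forall>l. 1 \<le> l \<and> l \<le> \<kappa> \<longrightarrow> segre_e \<Theta> l > 0) \<and>
                              (\<forall>l. l > \<kappa> \<longrightarrow> segre_e \<Theta> l = 0))"

definition segre_type :: "('m::finite,'d::finite) germfun \<Rightarrow> nat" where
  "segre_type \<Theta> = segre_kappa \<Theta> + 2"

definition tangent_vecs :: "('a::real_normed_vector) set \<Rightarrow> 'a \<Rightarrow> 'a set" where
  "tangent_vecs S q = {v. \<exists>(\<gamma>::real \<Rightarrow> 'a) \<epsilon>. \<epsilon> > 0 \<and> \<gamma> 0 = q \<and>
       (\<forall>t. \<bar>t\<bar> < \<epsilon> \<longrightarrow> \<gamma> t \<in> S) \<and> (\<gamma> has_vector_derivative v) (at 0)}"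

definition cmult :: "complex \<Rightarrow> ('m::finite,'d::finite) pt \<Rightarrow> ('m,'d) pt" where
  "cmult c v = (c *s fst v, c *s snd v)"

definition cplx_tangent :: "('m::finite,'d::finite) pt set \<Rightarrow> ('m,'d) pt \<Rightarrow> ('m,'d) pt set" where
  "cplx_tangent S q = {v \<in> tangent_vecs S q. cmult \<i> v \<in> tangent_vecs S q}"

definition Tc_section :: "('m::finite,'d::finite) pt set \<Rightarrow> ('m,'d) pt set \<Rightarrow> (('m,'d) pt \<Rightarrow> ('m,'d) pt) \<Rightarrow> bool" where
  "Tc_section M V X \<longleftrightarrow> continuous_on (M \<inter> V) X \<and> (\<forall>q\<in>M \<inter> V. X q \<in> cplx_tangent M q)"

inductive_set cr_reach :: "('m::finite,'d::finite) pt set \<Rightarrow> ('m,'d) pt set \<Rightarrow> ('m,'d) pt \<Rightarrow> ('m,'d) pt set"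
  for M V p where
  start: "p \<in> M \<inter> V \<Longrightarrow> p \<in> cr_reach M V p"
| step: "\<lbrakk>q \<in> cr_reach M V p; Tc_section M V X; T \<ge> 0; \<gamma> 0 = q;
          \<forall>t\<in>{0..T}. \<gamma> t \<in> M \<inter> V;
          \<forall>t\<in>{0..T}. (\<gamma> has_vector_derivative X (\<gamma> t)) (at t within {0..T})\<rbrakk>
         \<Longrightarrow> \<gamma> T \<in> cr_reach M V p"

definition minimal_at :: "('m::finite,'d::finite) pt set \<Rightarrow> ('m,'d) pt \<Rightarrow> bool" where
  "minimal_at M p \<longleftrightarrow> (\<forall>V. open V \<and> p \<in> V \<longrightarrow>
      (\<exists>W. open W \<and> p \<in> W \<and> M \<inter> W \<subseteq> cr_reach M V p))"

inductive_set flow_reach :: "('m::finite,'d::finite) germfun \<Rightarrow> ('m,'d) cpt set \<Rightarrow> ('m,'d) cpt set"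
  for \<Theta> V where
  start: "0 \<in> V \<Longrightarrow> 0 \<in> flow_reach \<Theta> V"
| stepL: "\<lbrakk>P \<in> flow_reach \<Theta> V; Lflow \<Theta> w P \<in> V\<rbrakk> \<Longrightarrow> Lflow \<Theta> w P \<in> flow_reach \<Theta> V"
| stepLb: "\<lbrakk>P \<in> flow_reach \<Theta> V; Lbflow \<Theta> w P \<in> V\<rbrakk> \<Longrightarrow> Lbflow \<Theta> w P \<in> flow_reach \<Theta> V"

definition flow_orbit_open :: "('m::finite,'d::finite) germfun \<Rightarrow> bool" where
  "flow_orbit_open \<Theta> \<longleftrightarrow> (\<forall>V. open V \<and> (0::('m,'d) cpt) \<in> V \<longrightarrow>
      (\<exists>W. open W \<and> (0::('m,'d) cpt) \<in> W \<and> W \<inter> complexM \<Theta> \<subseteq> flow_reach \<Theta> V))"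

definition contains_nbhd_in :: "'a::topological_space set \<Rightarrow> 'a \<Rightarrow> 'a set \<Rightarrow> bool" where
  "contains_nbhd_in S x A \<longleftrightarrow> (\<exists>U. open U \<and> x \<in> U \<and> U \<inter> S \<subseteq> A)"

end

theory Submission
  imports Defs "HOL-Complex_Analysis.Conformal_Mappings"
begin

text \<open>
  The complexification is parametrised by \<open>(w, \<zeta>, \<xi>)\<close>, where both families of flows become holomorphic in all
  variables and are exchanged by an antiholomorphic involution with fixed-point set \<open>M\<close>. If the generic
  rank of the Segre chains stabilises at \<open>\<rho>\<close>, then near a point of maximal rank the image of a chain is a
  submanifold invariant under both families; running the chain back to the origin first moves this submanifold to
  one through the origin. If \<open>\<rho>\<close> is smaller than \<open>2m + d\<close>, it is proper and confines the flow orbit as well as the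
  CR orbit, and it cannot contain a neighbourhood in \<open>M\<close>, which is maximally real. If \<open>\<rho> = 2m + d\<close>, a chain of
  length \<open>\<mu>\<close> of full rank followed by its reversal is a submersion mapping to the origin, and it has length
  \<open>2\<mu> - 1\<close> since the two consecutive middle flows merge. For minimality the same is done with the flows of
  the real sections of the complex tangent bundle, complexified in the parameters: a determinant that does not vanish
  identically does not vanish identically on the real parameters.
\<close>

section \<open>Holomorphic maps between spaces of complex vectors\<close>

text \<open>Ranks are controlled only near special parameters, and those of maximal rank need not
  lead to the origin. Near such a parameter both families are tangent to the image of the chain: the
  last step belongs to one family, and appending a step of the other family with parameter 0 keeps
  the end point and cannot raise the rank. A rank bound for small parameters spreads to larger ones
  by the identity theorem, applied to determinants of columns of the Jacobian. Invariance rests on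
  Gronwall's inequality for the coordinates transversal to the submanifold, not on uniqueness of
  flows: the sections of the complex tangent bundle are merely continuous, so that their integral
  curves are not determined by the initial point, but bounded coefficients along the two families
  suffice. The bound \<mu> \<le> d + 2 is a count: chains of length two already have generic rank at
  least 2m, each positive increment adds at least one, and no rank exceeds 2m + d.\<close>

definition shol :: "(complex^'p \<Rightarrow> complex) \<Rightarrow> (complex^'p) set \<Rightarrow> bool" where
  "shol f U \<longleftrightarrow> open U \<and>
     (\<forall>x\<in>U. \<exists>f'. (f has_derivative f') (at x) \<and> (\<forall>c h. f' (c *s h) = c * f' h))"

text \<open>Differentiability is the real one, with a derivative that commutes with complex scalars.
  The real chain rule and the real inverse function theorem then apply unchanged, and only complex
  linearity has to be carried along.\<close>

definition hol :: "(complex^'p \<Rightarrow> complex^'n) \<Rightarrow> (complex^'p) set \<Rightarrow> bool" where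
  "hol f U \<longleftrightarrow> open U \<and>
     (\<forall>x\<in>U. \<exists>f'. (f has_derivative f') (at x) \<and> (\<forall>c h. f' (c *s h) = c *s f' h))"

definition jac :: "(complex^'p \<Rightarrow> complex^'n) \<Rightarrow> complex^'p \<Rightarrow> complex^'p^'n" where
  "jac f x = (\<chi> i j. deriv (\<lambda>s. f (x + s *s axis j 1) $ i) 0)"

lemma shol_open: "shol f U \<Longrightarrow> open U" and hol_open: "hol g U \<Longrightarrow> open U"
  by (auto simp: shol_def hol_def)

lemma shol_subset: "shol f U \<Longrightarrow> open V \<Longrightarrow> V \<subseteq> U \<Longrightarrow> shol f V"
  and hol_subset: "hol g U \<Longrightarrow> open V \<Longrightarrow> V \<subseteq> U \<Longrightarrow> hol g V"
  by (auto simp: shol_def hol_def)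

lemma shol_local:
  assumes "\<And>x. x \<in> U \<Longrightarrow> \<exists>V. x \<in> V \<and> V \<subseteq> U \<and> shol f V"
  shows "shol f U"
proof -
  have "open U"
    using assms by (subst openE open_subopen) (metis shol_open)
  then show ?thesis using assms unfolding shol_def by blast
qed

lemma shol_cong:
  assumes "shol f U" "\<And>x. x \<in> U \<Longrightarrow> f x = g x"
  shows "shol g U"
  using assms unfolding shol_def by (metis has_derivative_transform_within_open)

lemma norm_smult: "norm (c *s (h::complex^'n)) = cmod c * norm h"
  by (simp add: norm_vec_def L2_set_def norm_mult power_mult_distrib sum_distrib_left[symmetric] real_sqrt_mult)

lemma bounded_linear_smult_left: "bounded_linear (\<lambda>s. s *s (h::complex^'n))"
  apply (rule bounded_linear_intro[where K="norm h"])
  by (auto simp: vec.scale_left_distrib norm_smult, simp add: vec_eq_iff)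

lemma scaleR_vec_smult: "r *\<^sub>R (x::complex^'n) = complex_of_real r *s x"
  by (simp add: vec_eq_iff) (simp add: scaleR_conv_of_real)

lemma hol_iff: "hol f U \<longleftrightarrow> open U \<and> (\<forall>i. shol (\<lambda>x. f x $ i) U)"
proof
  assume h: "hol f U"
  have "shol (\<lambda>x. f x $ i) U" for i
    unfolding shol_def
  proof (intro conjI ballI)
    fix x assume "x \<in> U"
    then obtain f' where f': "(f has_derivative f') (at x)" "\<forall>c h. f' (c *s h) = c *s f' h"
      using h unfolding hol_def by blast
    have "((\<lambda>x. f x $ i) has_derivative (\<lambda>h. f' h $ i)) (at x)"
      by (rule bounded_linear.has_derivative[OF bounded_linear_vec_nth f'(1)])
    then show "\<exists>f'. ((\<lambda>x. f x $ i) has_derivative f') (at x) \<and> (\<forall>c h. f' (c *s h) = c * f' h)"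
      using f'(2) by (intro exI[of _ "\<lambda>h. f' h $ i"]) auto
  qed (use h in \<open>simp add: hol_def\<close>)
  then show "open U \<and> (\<forall>i. shol (\<lambda>x. f x $ i) U)" using h by (auto simp: hol_def)
next
  assume h: "open U \<and> (\<forall>i. shol (\<lambda>x. f x $ i) U)"
  show "hol f U" unfolding hol_def
  proof (intro conjI ballI)
    fix x assume "x \<in> U"
    then have "\<forall>i. \<exists>f'. ((\<lambda>x. f x $ i) has_derivative f') (at x) \<and> (\<forall>c h. f' (c *s h) = c * f' h)"
      using h unfolding shol_def by blast
    then obtain F where F: "\<And>i. ((\<lambda>x. f x $ i) has_derivative F i) (at x)" "\<And>i c h. F i (c *s h) = c * F i h"
      by metis
    have "(f has_derivative (\<lambda>h. \<chi> i. F i h)) (at x)"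
    proof (subst has_derivative_componentwise_within, intro ballI)
      fix b :: "complex^'b" assume "b \<in> Basis"
      then obtain i u where b: "b = axis i u" by (auto simp: Basis_vec_def)
      show "((\<lambda>x. f x \<bullet> b) has_derivative (\<lambda>y. (\<chi> i. F i y) \<bullet> b)) (at x)"
        unfolding b inner_axis by (auto intro!: has_derivative_inner_left F(1))
    qed
    then show "\<exists>f'. (f has_derivative f') (at x) \<and> (\<forall>c h. f' (c *s h) = c *s f' h)"
      using F(2) by (intro exI[of _ "\<lambda>h. \<chi> i. F i h"]) (auto simp: vec_eq_iff)
  qed (use h in simp)
qed

lemma shol_const [intro]: "open U \<Longrightarrow> shol (\<lambda>x. c) U"
  unfolding shol_def by (auto intro!: exI[of _ "\<lambda>h. 0"] derivative_intros)

lemma shol_nth [intro]: "open U \<Longrightarrow> shol (\<lambda>x. x $ i) U"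
  unfolding shol_def
  by (auto intro!: exI[of _ "\<lambda>h. h $ i"] bounded_linear_imp_has_derivative)

lemma shol_add: "shol f U \<Longrightarrow> shol g U \<Longrightarrow> shol (\<lambda>x. f x + g x) U"
  unfolding shol_def
  by (clarsimp, drule (1) bspec, drule (1) bspec, clarsimp, rule exI, rule conjI, rule has_derivative_add)
     (auto simp: algebra_simps)

lemma shol_mult: "shol f U \<Longrightarrow> shol g U \<Longrightarrow> shol (\<lambda>x. f x * g x) U"
  unfolding shol_def
  by (clarsimp, drule (1) bspec, drule (1) bspec, clarsimp, rule exI, rule conjI, rule has_derivative_mult)
     (auto simp: algebra_simps)

lemma shol_uminus: "shol f U \<Longrightarrow> shol (\<lambda>x. - f x) U"
  using shol_mult[OF shol_const[of U "-1"], of f] by (simp add: shol_open)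

lemma shol_diff: "shol f U \<Longrightarrow> shol g U \<Longrightarrow> shol (\<lambda>x. f x - g x) U"
  using shol_add[of f U "\<lambda>x. - g x"] by (simp add: shol_uminus)

lemma shol_sum:
  assumes "open U" "\<And>i. i \<in> I \<Longrightarrow> shol (f i) U" shows "shol (\<lambda>x. \<Sum>i\<in>I. f i x) U"
  using assms by (induction I rule: infinite_finite_induct) (auto intro: shol_add)

lemma shol_prod:
  assumes "open U" "\<And>i. i \<in> I \<Longrightarrow> shol (f i) U" shows "shol (\<lambda>x. \<Prod>i\<in>I. f i x) U"
  using assms by (induction I rule: infinite_finite_induct) (auto intro: shol_mult)

lemma shol_power: "shol f U \<Longrightarrow> shol (\<lambda>x. f x ^ k) U"
  by (induction k) (auto intro: shol_mult shol_open)

lemma shol_compose: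
  assumes "shol g V" "hol f U" "f ` U \<subseteq> V"
  shows "shol (\<lambda>x. g (f x)) U"
  unfolding shol_def
proof (intro conjI ballI)
  show "open U" using assms(2) by (simp add: hol_def)
  fix x assume x: "x \<in> U"
  obtain f' where f': "(f has_derivative f') (at x)" "\<forall>c h. f' (c *s h) = c *s f' h"
    using assms(2) x unfolding hol_def by blast
  obtain g' where g': "(g has_derivative g') (at (f x))" "\<forall>c h. g' (c *s h) = c * g' h"
    using assms(1,3) x unfolding shol_def by blast
  show "\<exists>f'. ((\<lambda>x. g (f x)) has_derivative f') (at x) \<and> (\<forall>c h. f' (c *s h) = c * f' h)"
    using has_derivative_compose[OF f'(1) g'(1)] f'(2) g'(2) by auto
qed

lemma hol_compose:
  assumes "hol g V" "hol f U" "f ` U \<subseteq> V"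
  shows "hol (\<lambda>x. g (f x)) U"
  using assms unfolding hol_iff[of g] hol_iff[of "\<lambda>x. g (f x)"]
  by (auto intro: shol_compose hol_open)

lemma hol_vecI: "open U \<Longrightarrow> (\<And>i. shol (\<lambda>x. f x $ i) U) \<Longrightarrow> hol f U"
  by (simp add: hol_iff)

lemma hol_nth: "hol f U \<Longrightarrow> shol (\<lambda>x. f x $ i) U"
  by (simp add: hol_iff)

lemma hol_const: "open U \<Longrightarrow> hol (\<lambda>x. c) U"
  by (rule hol_vecI) auto

lemma hol_id: "open U \<Longrightarrow> hol (\<lambda>x. x) U"
  by (rule hol_vecI) auto

lemma hol_add: "hol f U \<Longrightarrow> hol g U \<Longrightarrow> hol (\<lambda>x. f x + g x) U"
  by (auto simp: hol_iff intro: shol_add)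

lemma hol_sum:
  assumes "open U" "\<And>i. i \<in> I \<Longrightarrow> hol (f i) U" shows "hol (\<lambda>x. \<Sum>i\<in>I. f i x) U"
  using assms by (induction I rule: infinite_finite_induct) (auto intro: hol_add hol_const)

lemma hol_smult: "shol f U \<Longrightarrow> hol g U \<Longrightarrow> hol (\<lambda>x. f x *s g x) U"
  by (auto simp: hol_iff intro: shol_mult)

lemma hol_matrix_vector: "open U \<Longrightarrow> hol (\<lambda>x. A *v x) U"
  by (rule hol_vecI) (auto simp: matrix_vector_mult_def intro!: shol_sum shol_mult)

lemma shol_continuous_on: "shol f U \<Longrightarrow> continuous_on U f"
  unfolding shol_def
  by (meson continuous_at_imp_continuous_on has_derivative_continuous)

lemma hol_continuous_on: "hol f U \<Longrightarrow> continuous_on U f"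
  unfolding hol_def
  by (meson continuous_at_imp_continuous_on has_derivative_continuous)

section \<open>Conjugation of complex vectors\<close>

lemma vconj_simps [simp]:
  "vconj (vconj x) = x" "vconj x $ i = cnj (x $ i)" "vconj 0 = 0" "vconj (x + y) = vconj x + vconj y"
  "vconj (x - y) = vconj x - vconj y" "vconj (- x) = - vconj x" "vconj (c *s x) = cnj c *s vconj x"
  "vconj (r *\<^sub>R x) = r *\<^sub>R vconj x" "norm (vconj x) = norm x"
  by (auto simp: vconj_def vec_eq_iff norm_vec_def)

lemma bounded_linear_vconj: "bounded_linear vconj"
  by (rule bounded_linear_intro[where K=1]) auto

lemma continuous_on_vconj [continuous_intros]: "continuous_on S f \<Longrightarrow> continuous_on S (\<lambda>x. vconj (f x))"
  using bounded_linear.continuous_on[OF bounded_linear_vconj] .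

text \<open>Conjugating both the argument and the value makes the derivative complex linear again.
  This gives the holomorphy of \<open>Theta_bar\<close> and of \<open>Tb\<close>.\<close>

lemma hol_conj:
  assumes "hol f U" shows "hol (\<lambda>x. vconj (f (vconj x))) (vconj -` U)"
  unfolding hol_def
proof (intro conjI ballI)
  show "open (vconj -` U)"
    using hol_open[OF assms] continuous_on_vconj[OF continuous_on_id, of UNIV]
    by (auto simp: continuous_on_open_vimage[OF open_UNIV])
  fix x assume "x \<in> vconj -` U"
  then obtain f' where f': "(f has_derivative f') (at (vconj x))" "\<forall>c h. f' (c *s h) = c *s f' h"
    using assms unfolding hol_def by blast
  have "((\<lambda>x. vconj (f (vconj x))) has_derivative (\<lambda>h. vconj (f' (vconj h)))) (at x)"
  proof (rule bounded_linear.has_derivative[OF bounded_linear_vconj])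
    have "(vconj has_derivative vconj) (at x)"
      by (rule bounded_linear_imp_has_derivative[OF bounded_linear_vconj])
    from has_derivative_compose[OF this, of f f'] f'(1)
    show "((\<lambda>x. f (vconj x)) has_derivative (\<lambda>h. f' (vconj h))) (at x)" by simp
  qed
  then show "\<exists>f'. ((\<lambda>x. vconj (f (vconj x))) has_derivative f') (at x) \<and> (\<forall>c h. f' (c *s h) = c *s f' h)"
    using f'(2) by (intro exI[of _ "\<lambda>h. vconj (f' (vconj h))"]) auto
qed

section \<open>Complex directional derivatives and Jacobian matrices\<close>

lemma shol_deriv_dir:
  fixes f :: "complex^'p \<Rightarrow> complex"
  assumes "(f has_derivative f') (at x)" "\<forall>c h. f' (c *s h) = c * f' h"
  shows "((\<lambda>s. f (x + s *s d)) has_field_derivative f' d) (at 0)"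
proof -
  have 1: "((\<lambda>s. x + s *s d) has_derivative (\<lambda>s. s *s d)) (at 0)"
  proof -
    have "((\<lambda>s. s *s d) has_derivative (\<lambda>s. s *s d)) (at 0)"
      by (rule bounded_linear_imp_has_derivative[OF bounded_linear_smult_left])
    from has_derivative_add[OF has_derivative_const[of x] this] show ?thesis by simp
  qed
  have "((\<lambda>s. f (x + s *s d)) has_derivative (\<lambda>s. f' (s *s d))) (at 0)"
    by (rule has_derivative_compose[OF 1]) (use assms in simp)
  moreover have "(\<lambda>s. f' (s *s d)) = (*) (f' d)" using assms(2) by (auto simp: mult.commute)
  ultimately show ?thesis by (simp add: has_field_derivative_def)
qed

lemma hol_jac:
  assumes "hol f U" "x \<in> U"
  shows "(f has_derivative (\<lambda>h. jac f x *v h)) (at x)"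
proof -
  obtain f' where f': "(f has_derivative f') (at x)" "\<forall>c h. f' (c *s h) = c *s f' h"
    using assms unfolding hol_def by blast
  have "((\<lambda>x. f x $ i) has_derivative (\<lambda>h. f' h $ i)) (at x)" for i
    by (rule bounded_linear.has_derivative[OF bounded_linear_vec_nth f'(1)])
  from shol_deriv_dir[OF this] have "deriv (\<lambda>s. f (x + s *s axis j 1) $ i) 0 = f' (axis j 1) $ i" for i j
    using f'(2) by (intro DERIV_imp_deriv) simp
  then have J: "jac f x = (\<chi> i j. f' (axis j 1) $ i)" by (simp add: jac_def)
  have lin: "Vector_Spaces.linear (*s) (*s) f'"
    by unfold_locales (use f' in \<open>auto simp: linear_add[OF has_derivative_linear]\<close>)
  have "jac f x = matrix f'" unfolding J matrix_def by simp
  then have "f' = (\<lambda>h. jac f x *v h)" using matrix_works[OF lin] by auto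
  then show ?thesis using f'(1) by simp
qed

lemma shol_line_has_field_derivative:
  assumes "shol f U" "x + s *s d \<in> U"
  shows "((\<lambda>s. f (x + s *s d)) has_field_derivative deriv (\<lambda>t. f (x + s *s d + t *s d)) 0) (at s)"
proof -
  obtain f' where f': "(f has_derivative f') (at (x + s *s d))" "\<forall>c h. f' (c *s h) = c * f' h"
    using assms unfolding shol_def by blast
  have D: "((\<lambda>t. f (x + s *s d + t *s d)) has_field_derivative f' d) (at 0)"
    by (rule shol_deriv_dir[OF f'])
  have "((\<lambda>t. f (x + t *s d)) has_field_derivative f' d) (at (0 + s))"
  proof (subst DERIV_shift)
    have "x + s *s d + t *s d = x + (t + s) *s d" for t by (simp add: vec.scale_left_distrib add.commute add.left_commute)
    then show "((\<lambda>t. f (x + (t + s) *s d)) has_field_derivative f' d) (at 0)" using D by (simp only:)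
  qed
  then show ?thesis using DERIV_imp_deriv[OF D] by simp
qed

lemma shol_line:
  assumes "shol f U" "\<And>s. s \<in> A \<Longrightarrow> x + s *s d \<in> U"
  shows "(\<lambda>s. f (x + s *s d)) holomorphic_on A"
  unfolding holomorphic_on_def field_differentiable_def
  using shol_line_has_field_derivative[OF assms(1) assms(2)] has_field_derivative_at_within by blast

lemma jac_compose:
  assumes "hol g V" "hol f U" "x \<in> U" "f x \<in> V"
  shows "jac (\<lambda>x. g (f x)) x = jac g (f x) ** jac f x"
proof -
  have op: "open (U \<inter> f -` V)"
    using hol_continuous_on[OF assms(2)] hol_open[OF assms(1)] hol_open[OF assms(2)]
    by (simp add: continuous_on_open_vimage Int_commute)
  have "hol (\<lambda>x. g (f x)) (U \<inter> f -` V)"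
    by (rule hol_compose[OF assms(1) hol_subset[OF assms(2)]]) (use op in auto)
  then have 1: "((\<lambda>x. g (f x)) has_derivative (\<lambda>h. jac (\<lambda>x. g (f x)) x *v h)) (at x)"
    using hol_jac assms by blast
  have 2: "((\<lambda>x. g (f x)) has_derivative (\<lambda>h. jac g (f x) *v (jac f x *v h))) (at x)"
    by (rule has_derivative_compose[OF hol_jac[OF assms(2,3)] hol_jac[OF assms(1,4)]])
  have "jac (\<lambda>x. g (f x)) x *v h = (jac g (f x) ** jac f x) *v h" for h
    using has_derivative_unique[OF 1 2] by (simp add: fun_eq_iff matrix_vector_mul_assoc)
  then show ?thesis by (simp add: matrix_eq)
qed

lemma jac_unique:
  assumes "(f has_derivative (\<lambda>h. A *v h)) (at x)"
  shows "jac f x = A"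
proof -
  have "((\<lambda>x. f x $ i) has_derivative (\<lambda>h. (A *v h) $ i)) (at x)" for i
    by (rule bounded_linear.has_derivative[OF bounded_linear_vec_nth assms])
  from shol_deriv_dir[OF this]
  have "deriv (\<lambda>s. f (x + s *s axis j 1) $ i) 0 = (A *v axis j 1) $ i" for i j
    by (intro DERIV_imp_deriv) (simp add: vector_scalar_commute)
  moreover have "(A *v axis j 1) $ i = A $ i $ j" for i j
    by (simp add: matrix_vector_mult_def axis_def if_distrib sum.delta cong: if_cong)
  ultimately show ?thesis
    by (simp add: jac_def vec_eq_iff)
qed

lemma shol_partials:
  fixes f :: "complex^'p \<Rightarrow> complex"
  assumes "shol f U" "y \<in> U"
  shows "(f has_derivative (\<lambda>h. \<Sum>i\<in>UNIV. deriv (\<lambda>s. f (y + s *s axis i 1)) 0 * h $ i)) (at y)"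
proof -
  \<comment> \<open>The scalar function is repeated in every component, so that the matrix form of
    the derivative applies to it.\<close>
  let ?g = "\<lambda>x. (\<chi> j. f x) :: complex^'p"
  have "hol ?g U" using assms(1) by (intro hol_vecI) (auto simp: shol_open)
  from hol_jac[OF this assms(2)]
  have "((\<lambda>x. ?g x $ k) has_derivative (\<lambda>h. (jac ?g y *v h) $ k)) (at y)" for k
    by (rule bounded_linear.has_derivative[OF bounded_linear_vec_nth])
  then show ?thesis by (simp add: jac_def matrix_vector_mult_def)
qed

section \<open>Limits and derivatives of holomorphic functions\<close>

lemma norm_axis_complex [simp]: "norm (axis i (1::complex)) = 1"
proof -
  have "(norm (axis i (1::complex) $ j))\<^sup>2 = (if j = i then 1 else 0)" for j
    by (simp add: axis_def)
  then show ?thesis by (simp add: norm_vec_def L2_set_def)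
qed

text \<open>Weierstrass' theorem in several variables. Cauchy's inequality on coordinate lines turns
  uniform convergence of the functions into uniform convergence of the partial derivatives on a
  smaller ball, and the sequence may then be differentiated termwise.\<close>

lemma shol_uniform_limit:
  fixes f :: "nat \<Rightarrow> complex^'p \<Rightarrow> complex"
  assumes hf: "\<And>n. shol (f n) U" and ul: "uniform_limit U f g sequentially"
  shows "shol g U"
proof (rule shol_local)
  fix x assume xU: "x \<in> U"
  have opU: "open U" using hf shol_open by blast
  then obtain R where R: "R > 0" "cball x R \<subseteq> U" using xU open_contains_cball by blast
  \<comment> \<open>Half of the radius leaves room for coordinate lines of length \<open>r\<close>
    through every point of the smaller ball.\<close>
  define r where "r = R/2"
  have r: "r > 0" "\<And>y s (i::'p). y \<in> ball x r \<Longrightarrow> norm s \<le> r \<Longrightarrow> y + s *s axis i 1 \<in> U"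
  proof -
    show "r > 0" using R r_def by simp
    fix y and s::complex and i::'p assume "y \<in> ball x r" "norm s \<le> r"
    then have "dist x (y + s *s axis i 1) \<le> R"
      using norm_triangle_ineq4[of "x - y" "s *s axis i 1"] by (simp add: dist_norm norm_smult r_def algebra_simps)
    then show "y + s *s axis i 1 \<in> U" using R by auto
  qed
  define c where "c n i y = deriv (\<lambda>s. f n (y + s *s axis i 1)) 0" for n and i::'p and y
  have der: "(f n has_derivative (\<lambda>h. \<Sum>i\<in>UNIV. c n i y * h $ i)) (at y within ball x r)" if "y \<in> ball x r" for n y
    unfolding c_def using shol_partials[OF hf, of y n] r(2)[OF that, of 0] r(1) has_derivative_at_withinI by auto
  have cauchy: "norm (c n i y - c m i y) \<le> B / r"
    if "y \<in> ball x r" and B: "\<And>z. z \<in> U \<Longrightarrow> norm (f n z - f m z) \<le> B" for n m i y B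
  proof -
    let ?\<phi> = "\<lambda>s. f n (y + s *s axis i 1) - f m (y + s *s axis i 1)"
    have hh: "(\<lambda>s. f n (y + s *s axis i 1)) holomorphic_on {s. y + s *s axis i 1 \<in> U}" for n
      by (rule shol_line[OF hf]) auto
    have sub: "cball 0 r \<subseteq> {s. y + s *s axis i 1 \<in> U}" using r(2)[OF that(1)] by auto
    have hc: "?\<phi> holomorphic_on cball 0 r"
      by (intro holomorphic_on_diff holomorphic_on_subset[OF hh sub])
    have "norm ((deriv ^^ 1) ?\<phi> 0) \<le> fact 1 * B / r ^ 1"
    proof (rule Cauchy_inequality)
      show "?\<phi> holomorphic_on ball 0 r" using hc by (rule holomorphic_on_subset) auto
      show "continuous_on (cball 0 r) ?\<phi>" using hc holomorphic_on_imp_continuous_on by blast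
      show "norm (?\<phi> s) \<le> B" if "norm (0 - s) = r" for s
        using B r(2)[OF \<open>y \<in> ball x r\<close>, of s] that by simp
    qed (use r in auto)
    moreover have "deriv ?\<phi> 0 = c n i y - c m i y"
    proof -
      have "(\<lambda>s. f k (y + s *s axis i 1)) field_differentiable at 0" for k
        using shol_line_has_field_derivative[OF hf, of y 0 "axis i 1" k] r(1) r(2)[OF that(1), of 0]
        by (auto simp: field_differentiable_def)
      then show ?thesis unfolding c_def by (intro deriv_diff)
    qed
    ultimately show ?thesis by simp
  qed
  have unif: "\<exists>N. \<forall>n\<ge>N. \<forall>m\<ge>N. \<forall>z\<in>U. norm (f n z - f m z) \<le> e" if "e > 0" for e
  proof -
    have "\<exists>N. \<forall>n\<ge>N. \<forall>z\<in>U. dist (f n z) (g z) < e/2"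
      using uniform_limitD[OF ul, of "e/2"] that unfolding eventually_sequentially by simp
    then obtain N where N: "\<And>n z. n \<ge> N \<Longrightarrow> z \<in> U \<Longrightarrow> dist (f n z) (g z) < e/2" by blast
    have "norm (f n z - f m z) \<le> e" if "n \<ge> N" "m \<ge> N" "z \<in> U" for n m z
      using N[OF that(1,3)] N[OF that(2,3)] dist_triangle2[of "f n z" "f m z" "g z"] by (simp add: dist_norm)
    then show ?thesis by blast
  qed
  have cc: "\<exists>N. \<forall>n\<ge>N. \<forall>m\<ge>N. \<forall>y\<in>ball x r. \<forall>i. norm (c n i y - c m i y) \<le> e" if "e > 0" for e
  proof -
    have "e * r > 0" using that r(1) by simp
    from unif[OF this] obtain N where N: "\<And>n m z. n \<ge> N \<Longrightarrow> m \<ge> N \<Longrightarrow> z \<in> U \<Longrightarrow> norm (f n z - f m z) \<le> e * r"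
      by blast
    have "norm (c n i y - c m i y) \<le> e" if "n \<ge> N" "m \<ge> N" "y \<in> ball x r" for n m i y
      using cauchy[OF that(3) N[OF that(1,2)], where i=i] r(1) by simp
    then show ?thesis by blast
  qed
  have "convergent (\<lambda>n. c n i y)" if "y \<in> ball x r" for i y
  proof (rule Cauchy_convergent, rule CauchyI)
    fix e::real assume "e > 0"
    then obtain N where N: "\<And>n m y i. n \<ge> N \<Longrightarrow> m \<ge> N \<Longrightarrow> y \<in> ball x r \<Longrightarrow> norm (c n i y - c m i y) \<le> e/2"
      using cc[of "e/2"] by (metis half_gt_zero)
    have "norm (c m i y - c n i y) < e" if "m \<ge> N" "n \<ge> N" for m n
      using N[OF that \<open>y \<in> ball x r\<close>, of i] \<open>e > 0\<close> by linarith
    then show "\<exists>M. \<forall>m\<ge>M. \<forall>n\<ge>M. norm (c m i y - c n i y) < e" by blast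
  qed
  then have clim: "(\<lambda>n. c n i y) \<longlonglongrightarrow> lim (\<lambda>n. c n i y)" if "y \<in> ball x r" for i y
    using that convergent_LIMSEQ_iff by blast
  define cl where "cl i y = lim (\<lambda>n. c n i y)" for i y
  have "\<exists>h. \<forall>y\<in>ball x r. (\<lambda>n. f n y) \<longlonglongrightarrow> h y \<and>
      (h has_derivative (\<lambda>h. \<Sum>i\<in>UNIV. cl i y * h $ i)) (at y within ball x r)"
  proof (rule has_derivative_sequence[OF _ der])
    show "x \<in> ball x r" using r by simp
    show "(\<lambda>n. f n x) \<longlonglongrightarrow> g x" using tendsto_uniform_limitI[OF ul xU] .
    fix e::real assume e: "e > 0"
    define e' where "e' = e / CARD('p)"
    have "e' > 0" using e by (simp add: e'_def)
    then obtain N where N: "\<And>n m y i. n \<ge> N \<Longrightarrow> m \<ge> N \<Longrightarrow> y \<in> ball x r \<Longrightarrow> norm (c n i y - c m i y) \<le> e'"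
      using cc[of e'] by meson
    have 1: "norm (c n i y - cl i y) \<le> e'" if "n \<ge> N" "y \<in> ball x r" for n i y
    proof (rule Lim_bounded)
      show "(\<lambda>m. norm (c n i y - c m i y)) \<longlonglongrightarrow> norm (c n i y - cl i y)"
        unfolding cl_def by (intro tendsto_intros clim that)
      show "\<forall>m\<ge>N. norm (c n i y - c m i y) \<le> e'" using N that by blast
    qed
    have "norm ((\<Sum>i\<in>UNIV. c n i y * h $ i) - (\<Sum>i\<in>UNIV. cl i y * h $ i)) \<le> e * norm h"
      if "n \<ge> N" "y \<in> ball x r" for n y and h :: "complex^'p"
    proof -
      have "norm (\<Sum>i\<in>UNIV. (c n i y - cl i y) * h $ i) \<le> (\<Sum>i\<in>(UNIV::'p set). e' * norm h)"
        by (rule sum_norm_le) (auto simp: norm_mult intro!: mult_mono 1 that Finite_Cartesian_Product.norm_nth_le less_imp_le[OF \<open>e'>0\<close>])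
      then show ?thesis by (simp add: sum_subtractf left_diff_distrib e'_def)
    qed
    then show "\<forall>\<^sub>F n in sequentially. \<forall>y\<in>ball x r. \<forall>h. norm ((\<Sum>i\<in>UNIV. c n i y * h $ i) - (\<Sum>i\<in>UNIV. cl i y * h $ i)) \<le> e * norm h"
      unfolding eventually_sequentially by blast
  qed simp_all
  then obtain h where h: "\<And>y. y \<in> ball x r \<Longrightarrow> (\<lambda>n. f n y) \<longlonglongrightarrow> h y"
      "\<And>y. y \<in> ball x r \<Longrightarrow> (h has_derivative (\<lambda>h. \<Sum>i\<in>UNIV. cl i y * h $ i)) (at y within ball x r)" by blast
  have bU: "ball x r \<subseteq> U" using R r_def by (auto simp: subset_eq)
  have "h y = g y" if "y \<in> ball x r" for y
    using LIMSEQ_unique[OF h(1)[OF that] tendsto_uniform_limitI[OF ul]] bU that by blast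
  moreover have "shol h (ball x r)"
    unfolding shol_def
  proof (intro conjI ballI)
    fix y assume y: "y \<in> ball x r"
    then show "\<exists>f'. (h has_derivative f') (at y) \<and> (\<forall>c h. f' (c *s h) = c * f' h)"
      using h(2)[OF y] at_within_open[OF y open_ball]
      by (intro exI[of _ "\<lambda>h. \<Sum>i\<in>UNIV. cl i y * h $ i"]) (auto simp: sum_distrib_left mult_ac)
  qed simp
  ultimately have "shol g (ball x r)" by (rule shol_cong[rotated])
  then show "\<exists>V. x \<in> V \<and> V \<subseteq> U \<and> shol g V" using bU r by (intro exI[of _ "ball x r"]) auto
qed

text \<open>The derivative is the uniform limit of the difference quotients with increments
  \<open>hn\<close>, which are holomorphic. Uniformity comes from Taylor's formula along the line,
  with the second derivative bounded by Cauchy's inequality.\<close>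

lemma shol_deriv:
  fixes f :: "complex^'p \<Rightarrow> complex"
  assumes hf: "shol f U"
  shows "shol (\<lambda>x. deriv (\<lambda>s. f (x + s *s d)) 0) U"
proof (rule shol_local)
  fix x assume xU: "x \<in> U"
  have opU: "open U" using hf shol_open by blast
  then obtain R where R: "R > 0" "cball x R \<subseteq> U" using xU open_contains_cball by blast
  define r where "r = R/2"
  \<comment> \<open>With \<open>norm s \<le> \<rho>\<close> the point moves by at most
    \<open>r\<close> in the direction \<open>d\<close>; the summand 1 covers the case
    \<open>d = 0\<close>.\<close>
  define \<rho> where "\<rho> = R / (2 * (norm d + 1))"
  have nd: "norm d + 1 > 0" by (simp add: add_nonneg_pos)
  have \<rho>0: "\<rho> > 0" unfolding \<rho>_def using R nd by (intro divide_pos_pos mult_pos_pos) auto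
  have \<rho>d: "\<rho> * norm d \<le> r"
  proof -
    have "\<rho> * norm d \<le> \<rho> * (norm d + 1)" using \<rho>0 by (intro mult_left_mono) auto
    also have "\<dots> = r" unfolding \<rho>_def r_def using nd by (metis nonzero_divide_eq_eq divide_divide_eq_left order_less_irrefl)
    finally show ?thesis .
  qed
  have inc: "y + s *s d \<in> cball x R" if "y \<in> ball x r" "norm s \<le> \<rho>" for y and s::complex
  proof -
    have "norm s * norm d \<le> \<rho> * norm d" using that by (intro mult_right_mono) auto
    then have "norm (s *s d) \<le> r" using \<rho>d by (simp add: norm_smult)
    then have "dist x (y + s *s d) \<le> R" using that(1) 
      using norm_triangle_ineq4[of "x - y" "s *s d"] by (simp add: dist_norm r_def algebra_simps)
    then show ?thesis by simp
  qed
  have "compact (f ` cball x R)"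
    using continuous_on_subset[OF shol_continuous_on[OF hf] R(2)] by (simp add: compact_continuous_image)
  then obtain B where B: "\<And>z. z \<in> cball x R \<Longrightarrow> norm (f z) \<le> B"
    using compact_imp_bounded bounded_iff by (metis imageI)
  have hol_line: "(\<lambda>s. f (y + s *s d)) holomorphic_on ball 0 \<rho>" if "y \<in> ball x r" for y
    by (rule shol_line[OF hf]) (use inc[OF that] R in \<open>auto simp: subset_eq less_imp_le\<close>)
  \<comment> \<open>Cauchy's bound for the second derivative on discs of radius \<rho>/4; centred at
    points of modulus below \<rho>/2 they stay in the disc of radius \<rho>. The factor 2 is
    \<open>fact 2\<close>.\<close>
  define B2 where "B2 = 2 * B / (\<rho>/4)^2"
  have taylor: "norm (f (y + h *s d) - f y - deriv (\<lambda>s. f (y + s *s d)) 0 * h) \<le> B2 * norm h ^ 2"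
    if y: "y \<in> ball x r" and h: "norm h < \<rho>/2" for y h
  proof -
    let ?\<phi> = "\<lambda>s. f (y + s *s d)"
    have hd: "(deriv ^^ i) ?\<phi> holomorphic_on ball 0 \<rho>" for i
      using hol_line[OF y] by (intro holomorphic_higher_deriv) auto
    have "cmod ((deriv ^^ 0) ?\<phi> h - (\<Sum>i\<le>1. (deriv ^^ i) ?\<phi> 0 * (h - 0) ^ i / fact i)) \<le> B2 * cmod (h - 0) ^ Suc 1 / fact 1"
    proof (rule complex_Taylor[where S = "ball 0 (\<rho>/2)"])
      fix i s assume "s \<in> ball (0::complex) (\<rho>/2)"
      then have "s \<in> ball 0 \<rho>" using \<rho>0 by simp
      then show "((deriv ^^ i) ?\<phi> has_field_derivative (deriv ^^ Suc i) ?\<phi> s) (at s within ball 0 (\<rho>/2))"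
        using holomorphic_derivI[OF hd[of i] open_ball, of s "ball 0 (\<rho>/2)"] by simp
    next
      fix s assume s: "s \<in> ball (0::complex) (\<rho>/2)"
      have sub: "cball s (\<rho>/4) \<subseteq> ball 0 \<rho>"
      proof
        fix z assume "z \<in> cball s (\<rho>/4)"
        then show "z \<in> ball 0 \<rho>" using s norm_triangle_ineq2[of z s] \<rho>0 by (simp add: dist_norm norm_minus_commute)
      qed
      have "norm ((deriv ^^ 2) ?\<phi> s) \<le> fact 2 * B / (\<rho>/4) ^ 2"
      proof (rule Cauchy_inequality)
        show "?\<phi> holomorphic_on ball s (\<rho>/4)"
          using hol_line[OF y] by (rule holomorphic_on_subset) (use sub in \<open>auto simp: subset_eq\<close>)
        show "continuous_on (cball s (\<rho>/4)) ?\<phi>"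
          using hol_line[OF y] sub by (meson continuous_on_subset holomorphic_on_imp_continuous_on)
        show "norm (?\<phi> z) \<le> B" if "norm (s - z) = \<rho>/4" for z
        proof -
          have "z \<in> ball 0 \<rho>" using sub that by (auto simp: subset_eq dist_norm)
          then show ?thesis using B[OF inc[OF y, of z]] by simp
        qed
      qed (use \<rho>0 in auto)
      then show "cmod ((deriv ^^ Suc 1) ?\<phi> s) \<le> B2" by (simp add: B2_def numeral_2_eq_2)
    qed (use h \<rho>0 in auto)
    then show ?thesis by (simp add: power2_eq_square algebra_simps)
  qed
  define hn where "hn n = complex_of_real (\<rho> / (2 * (real n + 2)))" for n
  have hn: "hn n \<noteq> 0" "norm (hn n) < \<rho>/2" for n
  proof -
    show "hn n \<noteq> 0" using \<rho>0 unfolding hn_def of_real_eq_0_iff by simp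
    have "\<rho> / (2 * (real n + 2)) < \<rho>/2" using \<rho>0 by (simp add: field_simps add_pos_nonneg)
    then show "norm (hn n) < \<rho>/2" using \<rho>0 unfolding hn_def norm_of_real by (simp add: abs_of_pos add_pos_nonneg)
  qed
  have lim0: "(\<lambda>n. B2 * norm (hn n)) \<longlonglongrightarrow> 0"
  proof -
    have "(\<lambda>n. \<rho> / (2 * (real n + 2))) \<longlonglongrightarrow> 0" by real_asymp
    then have "hn \<longlonglongrightarrow> complex_of_real 0" unfolding hn_def by (rule tendsto_of_real)
    then show ?thesis using tendsto_mult_right_zero tendsto_norm_zero by fastforce
  qed
  define F where "F n y = (f (y + hn n *s d) - f y) * (1 / hn n)" for n y
  have bU: "ball x r \<subseteq> U" using R r_def by (auto simp: subset_eq)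
  have "shol (\<lambda>x. deriv (\<lambda>s. f (x + s *s d)) 0) (ball x r)"
  proof (rule shol_uniform_limit)
    show "shol (F n) (ball x r)" for n
      unfolding F_def
    proof (intro shol_mult shol_diff shol_const)
      show "shol f (ball x r)" by (rule shol_subset[OF hf _ bU]) simp
      have "hol (\<lambda>y. y + hn n *s d) (ball x r)" by (intro hol_add hol_id hol_const) auto
      moreover have "(\<lambda>y. y + hn n *s d) ` ball x r \<subseteq> U" 
      proof clarify
        fix y assume y: "y \<in> ball x r"
        have "norm (hn n) \<le> \<rho>" using hn(2)[of n] \<rho>0 by linarith
        then show "y + hn n *s d \<in> U" using inc[OF y] R(2) by blast
      qed
      ultimately show "shol (\<lambda>y. f (y + hn n *s d)) (ball x r)" by (rule shol_compose[OF hf])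
    qed auto
    show "uniform_limit (ball x r) F (\<lambda>x. deriv (\<lambda>s. f (x + s *s d)) 0) sequentially"
    proof (rule uniform_limitI)
      fix e::real assume "e > 0"
      then have "\<forall>\<^sub>F n in sequentially. B2 * norm (hn n) < e"
        using order_tendstoD(2)[OF lim0] by blast
      then show "\<forall>\<^sub>F n in sequentially. \<forall>y\<in>ball x r. dist (F n y) (deriv (\<lambda>s. f (y + s *s d)) 0) < e"
      proof (rule eventually_mono, intro ballI)
        fix n y assume n: "B2 * norm (hn n) < e" and y: "y \<in> ball x r"
        have "F n y - deriv (\<lambda>s. f (y + s *s d)) 0 = 
          (f (y + hn n *s d) - f y - deriv (\<lambda>s. f (y + s *s d)) 0 * hn n) / hn n"
          using hn(1)[of n] by (simp add: F_def field_simps)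
        then have "norm (F n y - deriv (\<lambda>s. f (y + s *s d)) 0) \<le> B2 * norm (hn n) ^ 2 / norm (hn n)"
          using taylor[OF y hn(2)[of n]] by (simp add: norm_divide divide_right_mono)
        also have "\<dots> = B2 * norm (hn n)" using hn(1)[of n] by (simp add: power2_eq_square)
        finally show "dist (F n y) (deriv (\<lambda>s. f (y + s *s d)) 0) < e" using n by (simp add: dist_norm)
      qed
    qed
  qed
  then show "\<exists>V. x \<in> V \<and> V \<subseteq> U \<and> shol (\<lambda>x. deriv (\<lambda>s. f (x + s *s d)) 0) V"
    using bU R r_def by (intro exI[of _ "ball x r"]) auto
qed

section \<open>Bounds on Jacobians and the inverse function theorem\<close>

lemma shol_jac_nth: "hol f U \<Longrightarrow> shol (\<lambda>x. jac f x $ i $ j) U"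
  using shol_deriv[OF hol_nth, where d = "axis j 1"] by (simp add: jac_def)

text \<open>A crude upper bound for the operator norm, chosen because its continuity follows at once
  from that of the entries.\<close>

definition mnorm :: "complex^'p^'n \<Rightarrow> real" where
  "mnorm A = (\<Sum>i\<in>UNIV. \<Sum>j\<in>UNIV. cmod (A $ i $ j))"

lemma mnorm_nonneg [simp]: "0 \<le> mnorm A"
  by (simp add: mnorm_def sum_nonneg)

lemma norm_matrix_vector_le: "norm (A *v h) \<le> mnorm A * norm h"
proof -
  have "norm (A *v h) \<le> (\<Sum>i\<in>UNIV. cmod ((A *v h) $ i))"
    unfolding norm_vec_def by (rule L2_set_le_sum) simp
  also have "\<dots> \<le> (\<Sum>i\<in>UNIV. \<Sum>j\<in>UNIV. cmod (A $ i $ j) * norm h)"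
    unfolding matrix_vector_mult_def
    by (auto intro!: sum_mono sum_norm_le mult_left_mono simp: norm_mult Finite_Cartesian_Product.norm_nth_le)
  finally show ?thesis by (simp add: mnorm_def sum_distrib_right)
qed

lemma continuous_on_mnorm:
  assumes "\<And>i j. continuous_on U (\<lambda>x. A x $ i $ j)" shows "continuous_on U (\<lambda>x. mnorm (A x))"
  unfolding mnorm_def by (intro continuous_intros assms)

lemma continuous_on_jac_nth: "hol f U \<Longrightarrow> continuous_on U (\<lambda>x. jac f x $ i $ j)"
  by (intro shol_continuous_on shol_jac_nth)

lemma hol_jac_bound:
  assumes "hol f U" "compact K" "K \<subseteq> U"
  obtains B where "B \<ge> 0" "\<And>x. x \<in> K \<Longrightarrow> mnorm (jac f x) \<le> B"
proof -
  have "continuous_on K (\<lambda>x. mnorm (jac f x))"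
    by (intro continuous_on_mnorm continuous_on_subset[OF continuous_on_jac_nth[OF assms(1)] assms(3)])
  then have "bounded ((\<lambda>x. mnorm (jac f x)) ` K)"
    using assms(2) compact_continuous_image compact_imp_bounded by blast
  then obtain B where "\<forall>x\<in>K. norm (mnorm (jac f x)) \<le> B" by (auto simp: bounded_iff)
  then show ?thesis by (intro that[of "max B 0"]) (auto intro: order_trans)
qed

lemma hol_lipschitz:
  assumes "hol f U" "compact K" "K \<subseteq> U" "convex K"
  obtains B where "B \<ge> 0" "\<And>x y. x \<in> K \<Longrightarrow> y \<in> K \<Longrightarrow> norm (f x - f y) \<le> B * norm (x - y)"
proof -
  obtain B where B: "B \<ge> 0" "\<And>x. x \<in> K \<Longrightarrow> mnorm (jac f x) \<le> B" using hol_jac_bound[OF assms(1-3)] by blast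
  show ?thesis
  proof (rule that[OF B(1)])
    fix x y assume xy: "x \<in> K" "y \<in> K"
    show "norm (f x - f y) \<le> B * norm (x - y)"
    proof (rule differentiable_bound[OF assms(4) _ _ xy])
      fix z assume z: "z \<in> K"
      then show "(f has_derivative (*v) (jac f z)) (at z within K)"
        using hol_jac[OF assms(1), of z] assms(3) has_derivative_at_withinI by blast
      show "onorm ((*v) (jac f z)) \<le> B"
        using norm_matrix_vector_le[of "jac f z"] B(2)[OF z]
        by (intro onorm_bound B(1)) (meson mult_right_mono norm_ge_zero order_trans)
    qed
  qed
qed

text \<open>The derivative of the real local inverse is the inverse of a complex linear bijection,
  hence complex linear. The continuity of the derivative that the real theorem asks for comes from
  the holomorphy of the entries of the Jacobian.\<close>

lemma hol_inverse_function:
  fixes G :: "complex^'n \<Rightarrow> complex^'n"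
  assumes G: "hol G U" and x0: "x0 \<in> U" and det: "det (jac G x0) \<noteq> 0"
  obtains U' V H where "open U'" "U' \<subseteq> U" "x0 \<in> U'" "open V" "G x0 \<in> V" "homeomorphism U' V G H"
    "hol H V" "\<And>y. y \<in> V \<Longrightarrow> jac G (H y) ** jac H y = mat 1"
proof -
  define G' where "G' x = Blinfun (\<lambda>h. jac G x *v h)" for x
  have G'[simp]: "blinfun_apply (G' x) h = jac G x *v h" for x h
    unfolding G'_def by (simp add: bounded_linear_Blinfun_apply matrix_vector_mul_bounded_linear)
  have G'2: "blinfun_apply (G' x) = (\<lambda>h. jac G x *v h)" for x by auto
  obtain A where A: "A ** jac G x0 = mat 1" "jac G x0 ** A = mat 1"
    using det invertible_det_nz[of "jac G x0"] by (auto simp: invertible_def)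
  have inv: "Blinfun (\<lambda>h. A *v h) o\<^sub>L G' x0 = id_blinfun"
    by (rule blinfun_eqI)
       (simp add: bounded_linear_Blinfun_apply matrix_vector_mul_bounded_linear matrix_vector_mul_assoc A)
  have cont: "continuous_on U G'"
  proof (rule continuous_on_blinfun_componentwise)
    fix b :: "complex^'n" 
    have "continuous_on U (\<lambda>x. \<chi> i. \<Sum>j\<in>UNIV. jac G x $ i $ j * b $ j)"
      by (intro continuous_on_vec_lambda continuous_intros continuous_on_jac_nth G)
    then show "continuous_on U (\<lambda>x. blinfun_apply (G' x) b)"
      by (simp add: matrix_vector_mult_def)
  qed
  have der: "(G has_derivative blinfun_apply (G' x)) (at x)" if "x \<in> U" for x
    using hol_jac[OF G that] by (simp add: G'2)
  obtain U' V H H' where r: "open U'" "U' \<subseteq> U" "x0 \<in> U'" "open V" "G x0 \<in> V" "homeomorphism U' V G H"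
    "\<And>y. y \<in> V \<Longrightarrow> (H has_derivative (H' y)) (at y)"
    "\<And>y. y \<in> V \<Longrightarrow> H' y = inv (blinfun_apply (G'(H y)))"
    "\<And>y. y \<in> V \<Longrightarrow> bij (blinfun_apply (G'(H y)))"
    by (rule inverse_function_theorem[OF hol_open[OF G] der cont x0 inv]) (assumption, rule that)
  have lin: "H' y (c *s h) = c *s H' y h" if "y \<in> V" for y c h
  proof -
    have b: "bij (\<lambda>h. jac G (H y) *v h)" using r(9)[OF that] by (simp only: G'2)
    have e: "H' y = inv (\<lambda>h. jac G (H y) *v h)" using r(8)[OF that] by (simp only: G'2)
    have s: "jac G (H y) *v H' y h = h" for h unfolding e using bij_is_surj[OF b] by (simp add: surj_f_inv_f)
    show ?thesis
      by (rule injD[OF bij_is_inj[OF b]]) (simp add: s vector_scalar_commute)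
  qed
  have holH: "hol H V" unfolding hol_def using r(4,7) lin by blast
  have "jac G (H y) ** jac H y = mat 1" if y: "y \<in> V" for y
  proof -
    have HU: "H y \<in> U'" "G (H y) = y" using r(6) y by (auto simp: homeomorphism_def)
    have hG: "hol G U'" using hol_subset[OF G r(1,2)] .
    have 1: "((\<lambda>y. G (H y)) has_derivative (\<lambda>h. jac G (H y) *v (jac H y *v h))) (at y)"
      by (rule has_derivative_compose[OF hol_jac[OF holH y] hol_jac[OF hG HU(1)]])
    have "((\<lambda>y. y) has_derivative (\<lambda>h. jac G (H y) *v (jac H y *v h))) (at y)"
      by (rule has_derivative_transform_within_open[OF 1 r(4) y]) (use r(6) in \<open>auto simp: homeomorphism_def\<close>)
    from has_derivative_unique[OF this has_derivative_ident]
    show ?thesis by (simp add: matrix_eq fun_eq_iff matrix_vector_mul_assoc)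
  qed
  then show ?thesis using that[OF r(1-6) holH] by blast
qed

section \<open>Integrals of holomorphic families and zeros on the real line\<close>

lemma riemann_sum_bound:
  fixes g :: "real \<Rightarrow> complex"
  assumes g: "continuous_on {0..1} g" and N: "N > 0" and e: "e \<ge> 0"
    and osc: "\<And>s t. s \<in> {0..1} \<Longrightarrow> t \<in> {0..1} \<Longrightarrow> \<bar>s - t\<bar> \<le> 1 / real N \<Longrightarrow> norm (g s - g t) \<le> e"
  shows "norm (integral {0..1} g - (\<Sum>j<N. of_real (1 / real N) * g (real j / real N))) \<le> e"
proof -
  \<comment> \<open>Induction over the number of subintervals, each contributing an error of at most
    \<open>e / N\<close>.\<close>
  have "norm (integral {0..real k / real N} g - (\<Sum>j<k. of_real (1 / real N) * g (real j / real N))) \<le> e * (real k / real N)"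
    if "k \<le> N" for k using that
  proof (induction k)
    case (Suc k)
    let ?a = "real k / real N" and ?b = "real (Suc k) / real N"
    have ab: "0 \<le> ?a" "?a \<le> ?b" "?b \<le> 1" using Suc.prems N by (auto simp: field_simps)
    have int: "g integrable_on {0..?b}"
      by (rule integrable_continuous_interval, rule continuous_on_subset[OF g]) (use ab in auto)
    have cab: "continuous_on {?a..?b} g" by (rule continuous_on_subset[OF g]) (use ab in auto)
    have "integral {0..?b} g = integral {0..?a} g + integral {?a..?b} g"
      using Henstock_Kurzweil_Integration.integral_combine[OF ab(1,2) int] by simp
    moreover have "norm (integral {?a..?b} g - of_real (1 / real N) * g ?a) \<le> e * (1 / real N)"
    proof -
      have 1: "?b - ?a = 1 / real N" by (simp add: diff_divide_distrib[symmetric])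
      have "integral {?a..?b} (\<lambda>s. g s - g ?a) = integral {?a..?b} g - of_real (1 / real N) * g ?a"
      proof -
        have "(\<lambda>s. g ?a) integrable_on {?a..?b}" by (rule integrable_const_ivl)
        from integral_diff[OF integrable_continuous_interval[OF cab] this] ab(2) 1
        show ?thesis by (simp add: scaleR_conv_of_real)
      qed
      moreover have "norm (integral {?a..?b} (\<lambda>s. g s - g ?a)) \<le> e * (?b - ?a)"
      proof (rule integral_bound[OF ab(2)])
        show "continuous_on {?a..?b} (\<lambda>s. g s - g ?a)" by (intro continuous_intros cab)
        show "norm (g t - g ?a) \<le> e" if "t \<in> {?a..?b}" for t
        proof (rule osc)
          have t: "?a \<le> t" "t \<le> ?b" using that by auto
          show "t \<in> {0..1}" "?a \<in> {0..1}" using t ab by (auto simp only: atLeastAtMost_iff intro: order_trans)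
          show "\<bar>t - ?a\<bar> \<le> 1 / real N" using t 1 by linarith
        qed
      qed
      ultimately show ?thesis using 1 by simp
    qed
    ultimately have "norm (integral {0..?b} g - (\<Sum>j<Suc k. of_real (1 / real N) * g (real j / real N)))
        \<le> e * ?a + e * (1 / real N)"
      using Suc norm_triangle_ineq[of "integral {0..?a} g - (\<Sum>j<k. of_real (1 / real N) * g (real j / real N))"
          "integral {?a..?b} g - of_real (1 / real N) * g ?a"] by (simp add: algebra_simps)
    then show ?case by (simp add: add_divide_distrib distrib_left)
  qed simp
  from this[of N] N show ?thesis by simp
qed

text \<open>Riemann sums are finite combinations of holomorphic functions. Uniform continuity on a
  compact set makes them converge uniformly in the parameter, so \<open>shol_uniform_limit\<close>
  applies.\<close>

lemma shol_integral:
  fixes f :: "real \<Rightarrow> complex^'p \<Rightarrow> complex"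
  assumes U: "open U" and h: "\<And>s. s \<in> {0..1} \<Longrightarrow> shol (f s) U"
    and c: "continuous_on ({0..1} \<times> U) (\<lambda>(s,u). f s u)"
  shows "shol (\<lambda>u. integral {0..1} (\<lambda>s. f s u)) U"
proof (rule shol_local)
  fix x assume x: "x \<in> U"
  then obtain r where r: "r > 0" "cball x r \<subseteq> U" using U open_contains_cball by blast
  let ?K = "{0..1::real} \<times> cball x r"
  have ck: "continuous_on ?K (\<lambda>(s,u). f s u)" by (rule continuous_on_subset[OF c]) (use r in auto)
  have "compact ?K" by (simp add: compact_Times)
  then have uc: "uniformly_continuous_on ?K (\<lambda>(s,u). f s u)"
    using ck compact_uniformly_continuous by blast
  define R where "R N u = (\<Sum>j<Suc N. of_real (1 / real (Suc N)) * f (real j / real (Suc N)) u)" for N u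
  have "shol (\<lambda>u. integral {0..1} (\<lambda>s. f s u)) (ball x r)"
  proof (rule shol_uniform_limit)
    show "shol (R n) (ball x r)" for n
      unfolding R_def
    proof (intro shol_sum shol_mult shol_const)
      fix j assume "j \<in> {..<Suc n}"
      then show "shol (f (real j / real (Suc n))) (ball x r)"
        by (intro shol_subset[OF h]) (use r in \<open>auto simp: subset_eq\<close>)
    qed auto
    show "uniform_limit (ball x r) R (\<lambda>u. integral {0..1} (\<lambda>s. f s u)) sequentially"
    proof (rule uniform_limitI)
      fix e::real assume e: "e > 0"
      then obtain d where d: "d > 0" "\<And>p q. p \<in> ?K \<Longrightarrow> q \<in> ?K \<Longrightarrow> dist q p < d \<Longrightarrow>
          dist (case q of (s,u) \<Rightarrow> f s u) (case p of (s,u) \<Rightarrow> f s u) < e/2"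
        using uc unfolding uniformly_continuous_on_def by (metis half_gt_zero)
      obtain M where M: "1 / real (Suc M) < d" using d(1) nat_approx_posE by blast
      show "\<forall>\<^sub>F n in sequentially. \<forall>u\<in>ball x r. dist (R n u) (integral {0..1} (\<lambda>s. f s u)) < e"
        unfolding eventually_sequentially
      proof (intro exI[of _ M] allI impI ballI)
        fix n u assume n: "M \<le> n" and u: "u \<in> ball x r"
        have nd: "1 / real (Suc n) < d" using M n by (smt (verit) frac_le of_nat_0_less_iff of_nat_mono Suc_le_mono zero_less_Suc)
        have "norm (integral {0..1} (\<lambda>s. f s u) - R n u) \<le> e/2"
          unfolding R_def
        proof (rule riemann_sum_bound)
          have "continuous_on {0..1} ((\<lambda>(s,u). f s u) \<circ> (\<lambda>s. (s,u)))"
            by (rule continuous_on_compose, intro continuous_intros, rule continuous_on_subset[OF ck]) (use u in auto)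
          then show "continuous_on {0..1} (\<lambda>s. f s u)" by (simp add: o_def)
          fix s t :: real assume "s \<in> {0..1}" "t \<in> {0..1}" "\<bar>s - t\<bar> \<le> 1 / real (Suc n)"
          then show "norm (f s u - f t u) \<le> e/2"
            using d(2)[of "(t,u)" "(s,u)"] u nd by (auto simp: dist_norm dist_Pair_Pair less_imp_le)
        qed (use e in auto)
        then show "dist (R n u) (integral {0..1} (\<lambda>s. f s u)) < e" using e by (simp add: dist_norm norm_minus_commute)
      qed
    qed
  qed
  then show "\<exists>V. x \<in> V \<and> V \<subseteq> U \<and> shol (\<lambda>u. integral {0..1} (\<lambda>s. f s u)) V"
    using r by (intro exI[of _ "ball x r"]) (auto simp: subset_eq)
qed

lemma hol_integral:
  fixes f :: "real \<Rightarrow> complex^'p \<Rightarrow> complex^'n"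
  assumes U: "open U" and h: "\<And>s. s \<in> {0..1} \<Longrightarrow> hol (f s) U"
    and c: "continuous_on ({0..1} \<times> U) (\<lambda>(s,u). f s u)"
  shows "hol (\<lambda>u. integral {0..1} (\<lambda>s. f s u)) U"
proof (rule hol_vecI[OF U])
  fix i
  have "continuous_on ({0..1} \<times> U) (\<lambda>x. (case x of (s,u) \<Rightarrow> f s u) $ i)"
    using c by (intro continuous_intros) 
  then have "shol (\<lambda>u. integral {0..1} (\<lambda>s. f s u $ i)) U"
    by (intro shol_integral U hol_nth h) (simp_all add: case_prod_unfold)
  moreover have "integral {0..1} (\<lambda>s. f s u $ i) = integral {0..1} (\<lambda>s. f s u) $ i" if "u \<in> U" for u
  proof -
    have "continuous_on {0..1} ((\<lambda>(s,u). f s u) \<circ> (\<lambda>s. (s,u)))"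
      by (rule continuous_on_compose, intro continuous_intros, rule continuous_on_subset[OF c]) (use that in auto)
    then have "(\<lambda>s. f s u) integrable_on {0..1}" by (intro integrable_continuous_interval) (simp add: o_def)
    from integral_linear[OF this bounded_linear_vec_nth, of i] show ?thesis by (simp add: o_def)
  qed
  ultimately show "shol (\<lambda>u. integral {0..1} (\<lambda>s. f s u) $ i) U"
    by (rule shol_cong)
qed

text \<open>Zeros at all small positive reals would accumulate at 0 and force \<open>p\<close> to
  vanish on all of \<open>A\<close>. The lemma replaces a complex parameter with nonzero determinant
  by a small positive real one, both for shrinking a parameter and for finding a real one.\<close>

lemma holomorphic_nonzero_real:
  assumes p: "p holomorphic_on A" and A: "open A" "convex A" "0 \<in> A" "l \<in> A" "p l \<noteq> 0" and e: "e > 0"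
  obtains t where "0 < t" "t < e" "complex_of_real t \<in> A" "p (complex_of_real t) \<noteq> 0"
proof (rule ccontr)
  note res = that
  assume neg: "\<not> thesis"
  obtain d where d: "d > 0" "ball 0 d \<subseteq> A" using A(1,3) openE by blast
  define m where "m = min d e"
  let ?U = "complex_of_real ` {0<..<m}"
  have m: "m > 0" using d e by (simp add: m_def)
  have UA: "?U \<subseteq> A" using d by (auto simp: m_def subset_eq)
  have "0 islimpt ?U"
  proof (rule islimptI)
    fix T :: "complex set" assume "0 \<in> T" "open T"
    then obtain k where k: "k > 0" "ball 0 k \<subseteq> T" using openE by blast
    let ?t = "min m k / 2"
    have "complex_of_real ?t \<in> ?U" "complex_of_real ?t \<in> T" "complex_of_real ?t \<noteq> 0"
      using k m by (auto intro!: imageI simp: subset_eq simp del: of_real_divide)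
    then show "\<exists>y\<in>?U. y \<in> T \<and> y \<noteq> 0" by blast
  qed
  moreover have "p z = 0" if "z \<in> ?U" for z
  proof (rule ccontr)
    assume "p z \<noteq> 0"
    moreover obtain t where "z = complex_of_real t" "0 < t" "t < e" using \<open>z \<in> ?U\<close> by (auto simp: m_def)
    ultimately show False using neg res[of t] UA \<open>z \<in> ?U\<close> by blast
  qed
  ultimately have "p l = 0"
    using analytic_continuation[OF p A(1) convex_connected[OF A(2)] UA A(3) _ _ A(4)] by blast
  then show False using A(5) by simp
qed

section \<open>Polydiscs and the chart of the complexification\<close>

lemma open_pdisc [simp]: "open (pdisc r :: (complex^'n) set)"
proof -
  have "pdisc r = (\<Inter>i\<in>UNIV. {x::complex^'n. norm (x $ i) < r})" by (auto simp: pdisc_def)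
  then show ?thesis by (auto intro!: open_INT open_Collect_less continuous_intros)
qed

lemma convex_pdisc [simp]: "convex (pdisc r :: (complex^'n) set)"
proof -
  have "pdisc r = (\<Inter>i\<in>UNIV. (\<lambda>x::complex^'n. x $ i) -` ball 0 r)" by (auto simp: pdisc_def)
  moreover have "convex ((\<lambda>x::complex^'n. x $ i) -` ball 0 r)" for i
    by (intro convex_linear_vimage convex_ball bounded_linear.linear bounded_linear_vec_nth)
  ultimately show ?thesis by (auto intro!: convex_INT)
qed

lemma zero_in_pdisc [simp]: "0 \<in> pdisc r \<longleftrightarrow> 0 < r"
  by (simp add: pdisc_def)

lemma pdisc_mono: "r \<le> s \<Longrightarrow> pdisc r \<subseteq> pdisc s"
  by (auto simp: pdisc_def intro: less_le_trans)

lemma pdisc_uminus [simp]: "- x \<in> pdisc r \<longleftrightarrow> x \<in> pdisc r"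
  by (simp add: pdisc_def)

lemma pdisc_vconj [simp]: "vconj x \<in> pdisc r \<longleftrightarrow> x \<in> pdisc r"
  by (simp add: pdisc_def)

lemma vimage_vconj_pdisc [simp]: "vconj -` pdisc r = pdisc r"
  by auto

lemma pdisc_smult: "x \<in> pdisc r \<Longrightarrow> norm c \<le> 1 \<Longrightarrow> c *s x \<in> pdisc r"
  by (auto simp: pdisc_def norm_mult intro: le_less_trans[OF mult_left_le_one_le])

lemma pdisc_add: "x \<in> pdisc r \<Longrightarrow> y \<in> pdisc s \<Longrightarrow> x + y \<in> pdisc (r + s)"
  by (auto simp: pdisc_def intro: le_less_trans[OF norm_triangle_ineq] add_strict_mono)

lemma pdisc_of_norm: "norm x < r \<Longrightarrow> x \<in> pdisc r"
  by (auto simp: pdisc_def intro: le_less_trans[OF Finite_Cartesian_Product.norm_nth_le])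

lemma pdisc_nbhd:
  fixes U :: "(complex^'n) set"
  assumes "open U" "0 \<in> U" obtains \<delta> where "\<delta> > 0" "pdisc \<delta> \<subseteq> U"
proof -
  obtain e where e: "e > 0" "ball 0 e \<subseteq> U" using assms openE by blast
  \<comment> \<open>The euclidean norm is at most the sum of the moduli of the coordinates, which is
    below \<open>e\<close> for this radius.\<close>
  let ?\<delta> = "e / (real CARD('n) + 1)"
  show ?thesis
  proof (rule that[of ?\<delta>])
    show "?\<delta> > 0" using e by (simp add: add_nonneg_pos)
    show "pdisc ?\<delta> \<subseteq> U"
    proof
      fix x :: "complex^'n" assume x: "x \<in> pdisc ?\<delta>"
      have "norm x \<le> (\<Sum>i\<in>UNIV. norm (x $ i))" unfolding norm_vec_def by (rule L2_set_le_sum) simp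
      also have "\<dots> \<le> (\<Sum>i\<in>(UNIV::'n set). ?\<delta>)" using x by (intro sum_mono) (auto simp: pdisc_def less_imp_le)
      also have "\<dots> = real CARD('n) * ?\<delta>" by simp
      also have "\<dots> < e" using e by (simp add: field_simps)
      finally show "x \<in> U" using e by auto
    qed
  qed
qed

lemma bounded_pdisc: "bounded (pdisc r :: (complex^'n) set)"
proof (rule boundedI)
  fix x :: "complex^'n" assume x: "x \<in> pdisc r"
  have "norm x \<le> (\<Sum>i\<in>UNIV. norm (x $ i))" unfolding norm_vec_def by (rule L2_set_le_sum) simp
  also have "\<dots> \<le> (\<Sum>i\<in>(UNIV::'n set). r)" using x by (intro sum_mono) (auto simp: pdisc_def less_imp_le)
  finally show "norm x \<le> real CARD('n) * r" by simp
qed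

lemma closure_pdisc_subset: "r < s \<Longrightarrow> closure (pdisc r) \<subseteq> pdisc s"
proof -
  assume rs: "r < s"
  have "pdisc r \<subseteq> {x. \<forall>i. norm (x $ i) \<le> r}" by (auto simp: pdisc_def less_imp_le)
  moreover have "closed {x::complex^'b. \<forall>i. norm (x $ i) \<le> r}"
    by (auto intro!: closed_Collect_all closed_Collect_le continuous_intros)
  ultimately have "closure (pdisc r) \<subseteq> {x. \<forall>i. norm (x $ i) \<le> r}" by (rule closure_minimal)
  then show ?thesis using rs by (auto simp: pdisc_def subset_eq intro: le_less_trans)
qed

lemma compact_closure_pdisc: "compact (closure (pdisc r :: (complex^'n) set))"
  using bounded_pdisc compact_closure by blast

lemma convex_closure_pdisc: "convex (closure (pdisc r :: (complex^'n) set))"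
  by (simp add: convex_closure)

section \<open>The chart coordinates (w, \<zeta>, \<xi>), of total dimension 2m + d\<close>

definition mk :: "complex^'m::finite \<Rightarrow> complex^'m \<Rightarrow> complex^'d::finite \<Rightarrow> complex^('m + ('m + 'd))" where
  "mk w \<zeta> \<xi> = (\<chi> i. case i of Inl a \<Rightarrow> w $ a | Inr j \<Rightarrow> (case j of Inl a \<Rightarrow> \<zeta> $ a | Inr b \<Rightarrow> \<xi> $ b))"

definition pw :: "complex^('m::finite + ('m + 'd::finite)) \<Rightarrow> complex^'m" where "pw y = (\<chi> a. y $ Inl a)"
definition pz :: "complex^('m::finite + ('m + 'd::finite)) \<Rightarrow> complex^'m" where "pz y = (\<chi> a. y $ Inr (Inl a))"
definition px :: "complex^('m::finite + ('m + 'd::finite)) \<Rightarrow> complex^'d" where "px y = (\<chi> a. y $ Inr (Inr a))"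

lemma mk_nth [simp]: "mk w \<zeta> \<xi> $ Inl a = w $ a" "mk w \<zeta> \<xi> $ Inr (Inl a) = \<zeta> $ a" "mk w \<zeta> \<xi> $ Inr (Inr b) = \<xi> $ b"
  by (simp_all add: mk_def)

lemma proj_nth [simp]: "pw y $ a = y $ Inl a" "pz y $ a = y $ Inr (Inl a)" "px y $ b = y $ Inr (Inr b)"
  by (simp_all add: pw_def pz_def px_def)

lemma chart_eqI:
  fixes x y :: "complex^('m::finite + ('m + 'd::finite))"
  assumes "pw x = pw y" "pz x = pz y" "px x = px y" shows "x = y"
proof -
  have "x $ i = y $ i" for i
    using assms by (cases i rule: sum.exhaust; (cases "projr i" rule: sum.exhaust)?) (metis proj_nth sum.sel)+
  then show ?thesis by (simp add: vec_eq_iff)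
qed

lemma proj_mk [simp]: "pw (mk w \<zeta> \<xi>) = w" "pz (mk w \<zeta> \<xi>) = \<zeta>" "px (mk w \<zeta> \<xi>) = \<xi>"
  by (simp_all add: vec_eq_iff)

lemma mk_proj [simp]: "mk (pw y) (pz y) (px y) = y"
  by (rule chart_eqI) auto

lemma proj_simps [simp]:
  "pw (x + y) = pw x + pw y" "pz (x + y) = pz x + pz y" "px (x + y) = px x + px y"
  "pw (x - y) = pw x - pw y" "pz (x - y) = pz x - pz y" "px (x - y) = px x - px y"
  "pw (- x) = - pw x" "pz (- x) = - pz x" "px (- x) = - px x"
  "pw (c *s x) = c *s pw x" "pz (c *s x) = c *s pz x" "px (c *s x) = c *s px x"
  "pw (vconj x) = vconj (pw x)" "pz (vconj x) = vconj (pz x)" "px (vconj x) = vconj (px x)"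
  "pw 0 = 0" "pz 0 = 0" "px 0 = 0"
  by (simp_all add: vec_eq_iff)

lemma mk_simps [simp]: "mk 0 0 0 = 0" "vconj (mk w \<zeta> \<xi>) = mk (vconj w) (vconj \<zeta>) (vconj \<xi>)"
  by (auto intro!: chart_eqI)

lemma mk_pdisc: "mk w \<zeta> \<xi> \<in> pdisc r \<longleftrightarrow> w \<in> pdisc r \<and> \<zeta> \<in> pdisc r \<and> \<xi> \<in> pdisc r"
  unfolding pdisc_def by (auto simp: split_sum_all)

lemma hol_mk: "hol f U \<Longrightarrow> hol g U \<Longrightarrow> hol h U \<Longrightarrow> hol (\<lambda>x. mk (f x) (g x) (h x)) U"
  unfolding hol_iff by (auto simp: split_sum_all)

lemma hol_proj: "open U \<Longrightarrow> hol pw U" "open U \<Longrightarrow> hol pz U" "open U \<Longrightarrow> hol px U"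
  by (rule hol_vecI; auto)+

lemma norm_monom_le: "x \<in> pdisc R \<Longrightarrow> norm (monom \<alpha> x) \<le> R ^ sum \<alpha> UNIV"
  unfolding monom_def power_sum prod_norm[symmetric]
  by (rule prod_mono) (auto simp: pdisc_def norm_power less_imp_le intro!: power_mono)

text \<open>The summable majorant at radius \<open>R\<close> makes suitable finite partial sums
  converge uniformly on the polydisc. The three projections of \<open>v\<close> stand for (\<zeta>,
  w, z) here, in the order of the arguments of \<Theta>.\<close>

lemma conv_power_series_hol:
  fixes \<Theta> :: "('m::finite,'d::finite) germfun"
  assumes "conv_power_series \<Theta>"
  obtains R where "R > 0" "hol (\<lambda>v. \<Theta> (pw v) (pz v) (px v)) (pdisc R)"
proof -
  obtain c R where R: "R > 0" 
    and sm: "\<And>l. (\<lambda>(\<alpha>,\<beta>,\<gamma>). norm (c l \<alpha> \<beta> \<gamma>) * R ^ (sum \<alpha> UNIV + sum \<beta> UNIV + sum \<gamma> UNIV)) summable_on UNIV"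
    and eq: "\<And>\<zeta> w z l. \<zeta> \<in> pdisc R \<Longrightarrow> w \<in> pdisc R \<Longrightarrow> z \<in> pdisc R \<Longrightarrow>
          \<Theta> \<zeta> w z $ l = (\<Sum>\<^sub>\<infinity>(\<alpha>,\<beta>,\<gamma>). c l \<alpha> \<beta> \<gamma> * monom \<alpha> \<zeta> * monom \<beta> w * monom \<gamma> z)"
    using assms unfolding conv_power_series_def by blast
  have "shol (\<lambda>v. \<Theta> (pw v) (pz v) (px v) $ l) (pdisc R)" for l
  proof -
    define N where "N = (\<lambda>(\<alpha>,\<beta>,\<gamma>). norm (c l \<alpha> \<beta> \<gamma>) * R ^ (sum \<alpha> UNIV + sum \<beta> UNIV + sum \<gamma> UNIV))"
    define t where "t = (\<lambda>(v::complex^('m::finite+('m+'d::finite))) (\<alpha>,\<beta>,\<gamma>). c l \<alpha> \<beta> \<gamma> * monom \<alpha> (pw v) * monom \<beta> (pz v) * monom \<gamma> (px v))"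
    have Ns: "N summable_on UNIV" unfolding N_def by (rule sm)
    have tN: "norm (t v x) \<le> N x" if v: "v \<in> pdisc R" for v x
    proof -
      obtain \<alpha> \<beta> \<gamma> where x: "x = (\<alpha>,\<beta>,\<gamma>)" by (cases x) auto
      have "pw v \<in> pdisc R" "pz v \<in> pdisc R" "px v \<in> pdisc R" using v by (auto simp: pdisc_def)
      then have "norm (monom \<alpha> (pw v)) * norm (monom \<beta> (pz v)) * norm (monom \<gamma> (px v))
          \<le> R ^ sum \<alpha> UNIV * R ^ sum \<beta> UNIV * R ^ sum \<gamma> UNIV"
        using R by (intro mult_mono norm_monom_le) auto
      then show ?thesis using mult_left_mono[OF _ norm_ge_zero[of "c l \<alpha> \<beta> \<gamma>"]]
        by (fastforce simp: x t_def N_def norm_mult power_add mult.assoc)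
    qed
    have ts: "t v summable_on A" if "v \<in> pdisc R" for v A
    proof (rule abs_summable_summable)
      show "(\<lambda>x. norm (t v x)) summable_on A"
        by (rule summable_on_comparison_test[OF summable_on_subset_banach[OF Ns]]) (use tN that in auto)
    qed
    \<comment> \<open>The series is summed over an unordered index set, so finite sets with tail at
      most 1/(n+1) take the place of initial segments.\<close>
    have "\<exists>F. finite F \<and> infsum N (UNIV - F) \<le> 1 / real (Suc n)" for n
    proof -
      have "(N has_sum infsum N UNIV) UNIV" using Ns by simp
      then obtain F where F: "finite F" "dist (sum N F) (infsum N UNIV) \<le> 1 / real (Suc n)"
        using has_sum_finite_approximation[where \<epsilon> = "1 / real (Suc n)"] by (metis of_nat_0_less_iff zero_less_Suc zero_less_divide_1_iff)
      have "infsum N (UNIV - F) = infsum N UNIV - infsum N F"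
        by (rule infsum_Diff) (use Ns F in auto)
      then show ?thesis using F by (intro exI[of _ F]) (auto simp: dist_real_def)
    qed
    then obtain F where F: "\<And>n. finite (F n)" "\<And>n. infsum N (UNIV - F n) \<le> 1 / real (Suc n)" by metis
    have "shol (\<lambda>v. infsum (t v) UNIV) (pdisc R)"
    proof (rule shol_uniform_limit)
      fix n
      have "shol (\<lambda>v. t v x) (pdisc R)" for x
        unfolding t_def monom_def
        by (cases x) (auto intro!: shol_mult shol_const shol_prod shol_power shol_nth)
      then show "shol (\<lambda>v. sum (t v) (F n)) (pdisc R)" by (intro shol_sum) auto
    next
      show "uniform_limit (pdisc R) (\<lambda>n v. sum (t v) (F n)) (\<lambda>v. infsum (t v) UNIV) sequentially"
      proof (rule uniform_limitI)
        fix e::real assume "e > 0"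
        then obtain M where M: "1 / real (Suc M) < e" using nat_approx_posE by blast
        show "\<forall>\<^sub>F n in sequentially. \<forall>v\<in>pdisc R. dist (sum (t v) (F n)) (infsum (t v) UNIV) < e"
          unfolding eventually_sequentially
        proof (intro exI[of _ M] allI impI ballI)
          fix n and v :: "complex^('m+('m+'d))" assume n: "n \<ge> M" and v: "v \<in> pdisc R"
          have "infsum (t v) (UNIV - F n) = infsum (t v) UNIV - infsum (t v) (F n)"
            by (rule infsum_Diff) (use ts v F in auto)
          moreover have "norm (infsum (t v) (UNIV - F n)) \<le> infsum N (UNIV - F n)"
            by (rule norm_infsum_le[OF has_sum_infsum[OF ts[OF v]]
                  has_sum_infsum[OF summable_on_subset_banach[OF Ns]] tN[OF v]]) auto
          moreover have "1 / real (Suc n) \<le> 1 / real (Suc M)" using n by (simp add: frac_le)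
          ultimately show "dist (sum (t v) (F n)) (infsum (t v) UNIV) < e"
            using F(2)[of n] M F(1)[of n] by (simp add: dist_norm norm_minus_commute)
        qed
      qed
    qed
    then show ?thesis
    proof (rule shol_cong)
      fix v :: "complex^('m::finite+('m+'d::finite))" assume v: "v \<in> pdisc R"
      then have "pw v \<in> pdisc R" "pz v \<in> pdisc R" "px v \<in> pdisc R" by (auto simp: pdisc_def)
      then show "infsum (t v) UNIV = \<Theta> (pw v) (pz v) (px v) $ l" by (simp add: eq t_def)
    qed
  qed
  then show ?thesis by (intro that[OF R] hol_vecI) auto
qed

section \<open>Ranks of chains of maps\<close>

definition colmat :: "('n \<Rightarrow> complex^'n) \<Rightarrow> complex^'n^'n" where
  "colmat f = (\<chi> i j. f j $ i)"

lemma colmat_mult: "colmat f *v x = (\<Sum>j\<in>UNIV. x $ j *s f j)"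
  by (simp add: colmat_def matrix_vector_mult_def vec_eq_iff mult.commute)

lemma det_colmat_nonzero_iff:
  "det (colmat f) \<noteq> 0 \<longleftrightarrow> (\<forall>x. (\<Sum>j\<in>UNIV. x $ j *s f j) = 0 \<longrightarrow> x = 0)"
  by (metis colmat_mult invertible_det_nz invertible_left_inverse matrix_left_invertible_ker)

lemma det_colmat_indep:
  fixes f :: "'n::finite \<Rightarrow> complex^'n"
  assumes "det (colmat f) \<noteq> 0"
  shows "inj f" "vec.independent (range f)"
proof -
  have *: "c = 0" if "(\<Sum>j\<in>UNIV. c $ j *s f j) = 0" for c
    using assms that det_colmat_nonzero_iff by blast
  show inj: "inj f"
  proof (rule injI, rule ccontr)
    fix a b assume ab: "f a = f b" "a \<noteq> b"
    let ?c = "axis a 1 - axis b 1 :: complex^'n"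
    have "(\<Sum>j\<in>UNIV. ?c $ j *s f j) = (\<Sum>j\<in>UNIV. (if j = a then f a else 0) - (if j = b then f b else 0))"
      by (rule sum.cong) (auto simp: axis_def)
    also have "\<dots> = 0" using ab by (simp add: sum_subtractf)
    finally have "?c = 0" by (rule *)
    then have "?c $ a = 0" by simp
    then show False using ab by (simp add: axis_def)
  qed
  show "vec.independent (range f)"
  proof (rule vec.independent_if_scalars_zero)
    fix u x assume 0: "(\<Sum>x\<in>range f. u x *s x) = 0" and x: "x \<in> range f"
    have "(\<Sum>j\<in>UNIV. (\<chi> j. u (f j)) $ j *s f j) = 0"
      using 0 by (simp add: sum.reindex[OF inj])
    then have "(\<chi> j. u (f j)) = 0" by (rule *)
    then show "u x = 0" using x by (auto simp: vec_eq_iff)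
  qed simp
qed

text \<open>Independent vectors of \<open>S\<close> are completed to a basis, and \<open>I\<close>
  marks the columns taken from \<open>S\<close>. A lower bound on a rank thus becomes a nonvanishing
  determinant, which depends holomorphically on parameters.\<close>

lemma exists_colmat:
  fixes S :: "(complex^'n::finite) set"
  assumes "k \<le> vec.dim S"
  obtains I and f :: "'n \<Rightarrow> complex^'n" where "card I = k" "\<And>j. j \<in> I \<Longrightarrow> f j \<in> S" "det (colmat f) \<noteq> 0"
proof -
  obtain B where B: "B \<subseteq> S" "vec.independent B" "card B = vec.dim S"
    by (rule vec.basis_exists[of S])
  obtain B' where B': "B' \<subseteq> B" "card B' = k" "finite B'"
    using obtain_subset_with_card_n[of k B] assms B(3) by auto
  have indB': "vec.independent B'" by (rule vec.independent_mono[OF B(2) B'(1)])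
  obtain C where C: "B' \<subseteq> C" "C \<subseteq> UNIV" "vec.independent C" "UNIV \<subseteq> vec.span C"
    by (rule vec.maximal_independent_subset_extend[OF subset_UNIV indB'])
  have fC: "finite C" "card C = CARD('n)"
    using vec.basis_card_eq_dim[OF C(2,4,3)] vec.finiteI_independent[OF C(3)] by (simp_all add: card_cart_basis)
  obtain f where f: "bij_betw f (UNIV::'n set) C"
    using finite_same_card_bij[of "UNIV::'n set" C] fC by auto
  have "det (colmat f) \<noteq> 0"
    unfolding det_colmat_nonzero_iff
  proof (intro allI impI)
    fix x :: "complex^'n" assume 0: "(\<Sum>j\<in>UNIV. x $ j *s f j) = 0"
    let ?u = "\<lambda>y. x $ (inv_into UNIV f y)"
    have inj: "inj f" and ran: "range f = C" using f by (auto simp: bij_betw_def)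
    have "(\<Sum>y\<in>C. ?u y *s y) = (\<Sum>j\<in>UNIV. ?u (f j) *s f j)"
      unfolding ran[symmetric] by (simp add: sum.reindex[OF inj])
    also have "\<dots> = 0" using 0 inj by simp
    finally have S0: "(\<Sum>y\<in>C. ?u y *s y) = 0" .
    have "?u y = 0" if "y \<in> C" for y
      by (rule vec.independentD[OF C(3) fC(1) subset_refl S0 that])
    then have "?u (f j) = 0" for j using ran by blast
    then show "x = 0" using inj by (simp add: vec_eq_iff)
  qed
  moreover have "card (f -` B') = k"
    using f B' C(1) by (subst card_vimage_inj) (auto simp: bij_betw_def)
  ultimately show ?thesis using B' B(1) by (intro that[of "f -` B'" f]) auto
qed

lemma card_le_dim_colmat:
  fixes f :: "'n::finite \<Rightarrow> complex^'n"
  assumes "det (colmat f) \<noteq> 0" "\<And>j. j \<in> I \<Longrightarrow> f j \<in> S"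
  shows "card I \<le> vec.dim S"
proof -
  have "vec.independent (f ` I)" by (rule vec.independent_mono[OF det_colmat_indep(2)[OF assms(1)]]) auto
  moreover have "f ` I \<subseteq> S" using assms(2) by auto
  ultimately have "card (f ` I) \<le> vec.dim S"
    using vec.dim_subset[of "f ` I" S] vec.dim_eq_card_independent[of "f ` I"] by simp
  then show ?thesis using det_colmat_indep(1)[OF assms(1)] by (metis card_image inj_on_subset subset_UNIV)
qed

lemma span_colmat:
  fixes f :: "'n::finite \<Rightarrow> complex^'n"
  assumes "det (colmat f) \<noteq> 0" "\<And>j. j \<in> I \<Longrightarrow> f j \<in> S" "vec.dim S \<le> card I"
  shows "S \<subseteq> vec.span (f ` I)"
proof -
  have ind: "vec.independent (f ` I)" by (rule vec.independent_mono[OF det_colmat_indep(2)[OF assms(1)]]) auto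
  have "card (f ` I) = card I" using det_colmat_indep(1)[OF assms(1)] by (metis card_image inj_on_subset subset_UNIV)
  moreover have "f ` I \<subseteq> S" using assms(2) by auto
  ultimately show ?thesis using vec.card_ge_dim_independent[of "f ` I" S] ind assms(3) by simp
qed

lemma span_image_colmat:
  fixes f :: "'n::finite \<Rightarrow> complex^'n"
  assumes "y \<in> vec.span (f ` I)" 
  obtains w where "y = colmat f *v w" "\<And>j. j \<notin> I \<Longrightarrow> w $ j = 0"
proof -
  have "\<exists>w. y = colmat f *v w \<and> (\<forall>j. j \<notin> I \<longrightarrow> w $ j = 0)"
    using assms
  proof (induction rule: vec.span_induct_alt)
    case base
    then show ?case by (intro exI[of _ 0]) auto
  next
    case (step c x y)
    then obtain j w where j: "j \<in> I" "x = f j" and w: "y = colmat f *v w" "\<forall>j. j \<notin> I \<longrightarrow> w $ j = 0" by blast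
    have "colmat f *v axis j 1 = f j"
      by (simp add: matrix_vector_mult_def colmat_def axis_def if_distrib vec_eq_iff cong: if_cong)
    then have "c *s x + y = colmat f *v (c *s axis j 1 + w)"
      using j w by (simp add: matrix_vector_right_distrib vector_scalar_commute)
    then show ?case using j w by (intro exI[of _ "c *s axis j 1 + w"]) (auto simp: axis_def)
  qed
  then show ?thesis using that by blast
qed

section \<open>Joined vectors, for joint holomorphy in a parameter and a point\<close>

definition jn :: "complex^'q \<Rightarrow> complex^'n \<Rightarrow> complex^('q::finite + 'n::finite)" where
  "jn s y = (\<chi> i. case i of Inl a \<Rightarrow> s $ a | Inr b \<Rightarrow> y $ b)"
definition jl :: "complex^('q::finite + 'n::finite) \<Rightarrow> complex^'q" where "jl v = (\<chi> a. v $ Inl a)"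
definition jr :: "complex^('q::finite + 'n::finite) \<Rightarrow> complex^'n" where "jr v = (\<chi> a. v $ Inr a)"

lemma jn_simps [simp]: "jn s y $ Inl a = s $ a" "jn s y $ Inr b = y $ b" "jl v $ a = v $ Inl a" "jr v $ b = v $ Inr b"
  "jl (jn s y) = s" "jr (jn s y) = y"
  by (simp_all add: jn_def jl_def jr_def)

lemma jn_jl_jr [simp]: "jn (jl v) (jr v) = v"
  unfolding vec_eq_iff split_sum_all by simp

lemma jn_pdisc: "jn s y \<in> pdisc r \<longleftrightarrow> s \<in> pdisc r \<and> y \<in> pdisc r"
  unfolding pdisc_def by (auto simp: split_sum_all)

lemma hol_jn: "hol f U \<Longrightarrow> hol g U \<Longrightarrow> hol (\<lambda>x. jn (f x) (g x)) U"
  unfolding hol_iff by (auto simp: split_sum_all)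

lemma hol_jl: "open U \<Longrightarrow> hol jl U" and hol_jr: "open U \<Longrightarrow> hol jr U"
  by (rule hol_vecI; auto)+

lemma hol_compose2:
  assumes "hol (\<lambda>v. g (jl v) (jr v)) (pdisc r)" "hol f U" "hol h U"
    "\<And>x. x \<in> U \<Longrightarrow> f x \<in> pdisc r" "\<And>x. x \<in> U \<Longrightarrow> h x \<in> pdisc r"
  shows "hol (\<lambda>x. g (f x) (h x)) U"
proof -
  have "(\<lambda>x. jn (f x) (h x)) ` U \<subseteq> pdisc r" using assms(4,5) by (auto simp: jn_pdisc)
  from hol_compose[OF assms(1) hol_jn[OF assms(2,3)] this] show ?thesis by simp
qed

lemma continuous_on_compose2_jn:
  assumes "hol (\<lambda>v. g (jl v) (jr v)) (pdisc r)" "continuous_on U f" "continuous_on U h"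
    "\<And>x. x \<in> U \<Longrightarrow> f x \<in> pdisc r" "\<And>x. x \<in> U \<Longrightarrow> h x \<in> pdisc r"
  shows "continuous_on U (\<lambda>x. g (f x) (h x))"
proof -
  have "continuous_on U (\<lambda>x. jn (f x) (h x))"
    unfolding jn_def
  proof (rule continuous_on_vec_lambda)
    fix i show "continuous_on U (\<lambda>x. case i of Inl a \<Rightarrow> f x $ a | Inr b \<Rightarrow> h x $ b)"
      by (cases i) (auto intro!: continuous_intros assms)
  qed
  moreover have "(\<lambda>x. jn (f x) (h x)) ` U \<subseteq> pdisc r" using assms(4,5) by (auto simp: jn_pdisc)
  ultimately show ?thesis using continuous_on_compose2[OF hol_continuous_on[OF assms(1)]] by fastforce
qed

text \<open>Chain parameters are sequences, of which a chain reads an initial segment. Holomorphy in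
  them is tested along finite-dimensional affine families such as this one, through \<theta> in the
  directions \<open>d i\<close>.\<close>

definition lin :: "(nat \<Rightarrow> complex^'q) \<Rightarrow> ('p \<Rightarrow> nat \<Rightarrow> complex^'q) \<Rightarrow> complex^'p \<Rightarrow> nat \<Rightarrow> complex^'q" where
  "lin \<theta> d u = (\<lambda>j. \<theta> j + (\<Sum>i\<in>UNIV. u $ i *s d i j))"

lemma lin_add: "lin \<theta> d (u + v) = lin (lin \<theta> d u) d v"
  by (simp add: lin_def fun_eq_iff vec.scale_left_distrib sum.distrib)

lemma lin_axis: "lin \<theta> d (s *s axis i 1) = (\<lambda>j. \<theta> j + s *s d i j)"
proof -
  have "(\<Sum>k\<in>UNIV. (s *s axis i 1) $ k *s d k j) = (\<Sum>k\<in>UNIV. if k = i then s *s d i j else 0)" for j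
    by (rule sum.cong) (auto simp: axis_def)
  then show ?thesis by (simp add: lin_def fun_eq_iff)
qed

lemma lin_0 [simp]: "lin \<theta> d 0 = \<theta>"
  by (simp add: lin_def)

lemma hol_lin: "open U \<Longrightarrow> hol (\<lambda>u. lin \<theta> d u j) U"
  unfolding lin_def by (intro hol_add hol_const hol_sum hol_smult shol_nth) auto

lemma open_lin_chain_dom: "open {u. lin \<theta> d u \<in> chain_dom k \<delta>}"
proof -
  have "{u. lin \<theta> d u \<in> chain_dom k \<delta>} = (\<Inter>j\<in>{..<k}. (\<lambda>u. lin \<theta> d u j) -` pdisc \<delta>)"
    by (auto simp: chain_dom_def)
  moreover have "open ((\<lambda>u. lin \<theta> d u j) -` pdisc \<delta>)" for j
    using hol_continuous_on[OF hol_lin[OF open_UNIV, of \<theta> d j]]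
    by (intro open_vimage) auto
  ultimately show ?thesis by auto
qed

lemma chain_dom_mono: "\<delta> \<le> \<epsilon> \<Longrightarrow> chain_dom k \<delta> \<subseteq> chain_dom k \<epsilon>"
  using pdisc_mono by (fastforce simp: chain_dom_def)

lemma chain_dom_le: "j \<le> k \<Longrightarrow> chain_dom k \<delta> \<subseteq> chain_dom j \<delta>"
  by (auto simp: chain_dom_def)

section \<open>Chains of steps, their derivatives and their ranks\<close>

lemma jlr_0 [simp]: "jl 0 = 0" "jr 0 = 0"
  by (simp_all add: vec_eq_iff)

primrec chain :: "(nat \<Rightarrow> complex^'q \<Rightarrow> complex^'n \<Rightarrow> complex^'n) \<Rightarrow> complex^'n \<Rightarrow> nat \<Rightarrow> (nat \<Rightarrow> complex^'q) \<Rightarrow> complex^'n" where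
  "chain St Q 0 \<theta> = Q"
| "chain St Q (Suc k) \<theta> = St k (\<theta> k) (chain St Q k \<theta>)"

definition dirD :: "((nat \<Rightarrow> complex^'q) \<Rightarrow> complex^'n) \<Rightarrow> (nat \<Rightarrow> complex^'q) \<Rightarrow> (nat \<Rightarrow> complex^'q) \<Rightarrow> complex^'n" where
  "dirD F \<theta> e = (\<chi> i. deriv (\<lambda>s. F (\<lambda>j. \<theta> j + s *s e j) $ i) 0)"

lemma chain_cong: "(\<And>j. j < k \<Longrightarrow> \<theta> j = \<theta>' j) \<Longrightarrow> chain St Q k \<theta> = chain St Q k \<theta>'"
  by (induction k) auto

lemma deriv_vec:
  assumes "(\<phi> has_derivative (\<lambda>s. s *s w)) (at (0::complex))"
  shows "(\<chi> i. deriv (\<lambda>s. \<phi> s $ i) 0) = w"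
proof -
  have "((\<lambda>s. \<phi> s $ i) has_derivative (\<lambda>s. (s *s w) $ i)) (at 0)" for i
    by (rule bounded_linear.has_derivative[OF bounded_linear_vec_nth assms])
  moreover have "(\<lambda>s. (s *s w) $ i) = (*) (w $ i)" for i by (auto simp: mult.commute)
  ultimately have "((\<lambda>s. \<phi> s $ i) has_field_derivative w $ i) (at 0)" for i
    unfolding has_field_derivative_def by metis
  then have "deriv (\<lambda>s. \<phi> s $ i) 0 = w $ i" for i by (rule DERIV_imp_deriv)
  then show ?thesis by (simp add: vec_eq_iff)
qed

definition rk :: "((nat \<Rightarrow> complex^'q) \<Rightarrow> complex^'n) \<Rightarrow> (nat \<Rightarrow> complex^'q) \<Rightarrow> nat" where
  "rk F \<theta> = vec.dim (range (dirD F \<theta>))"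

definition cdir :: "nat \<Rightarrow> 'q \<Rightarrow> nat \<Rightarrow> complex^'q::finite" where
  "cdir j a = (\<lambda>_. 0)(j := axis a 1)"

lemma jac_lin: "jac (\<lambda>u. F (lin \<theta> d u)) u = (\<chi> i j. dirD F (lin \<theta> d u) (d j) $ i)"
  unfolding jac_def dirD_def lin_add lin_axis by (simp add: vec_eq_iff)

text \<open>What the Segre steps and the flows of combined CR fields have in common: a step is
  undone by the negated parameter, and steps of equal parity coincide. A group law in the parameter
  is reserved for \<open>flow_sys\<close>, since flows of combinations of noncommuting fields do not
  have one in general.\<close>

locale chain_sys =
  fixes St :: "nat \<Rightarrow> complex^'q::finite \<Rightarrow> complex^'n::finite \<Rightarrow> complex^'n" and r :: real
  assumes r_pos: "r > 0"
    and St_hol: "hol (\<lambda>v. St j (jl v) (jr v)) (pdisc r)"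
    and St_zero: "y \<in> pdisc r \<Longrightarrow> St j 0 y = y"
    and St_inv: "s \<in> pdisc r \<Longrightarrow> y \<in> pdisc r \<Longrightarrow> St j (- s) (St j s y) = y"
    and St_par: "St (Suc (Suc j)) = St j"
begin

abbreviation "F \<equiv> chain St"

definition small :: "nat \<Rightarrow> real \<Rightarrow> bool" where
  "small k \<delta> \<longleftrightarrow> 0 < \<delta> \<and> \<delta> \<le> r \<and> (\<forall>Q\<in>pdisc \<delta>. \<forall>\<theta>\<in>chain_dom k \<delta>. \<forall>j\<le>k. F Q j \<theta> \<in> pdisc r)"

lemma smallD: "small k \<delta> \<Longrightarrow> Q \<in> pdisc \<delta> \<Longrightarrow> \<theta> \<in> chain_dom k \<delta> \<Longrightarrow> j \<le> k \<Longrightarrow> F Q j \<theta> \<in> pdisc r"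
  by (auto simp: small_def)

lemma small_pos: "small k \<delta> \<Longrightarrow> 0 < \<delta>" and small_le: "small k \<delta> \<Longrightarrow> \<delta> \<le> r"
  by (auto simp: small_def)

lemma small_mono: "small k \<delta> \<Longrightarrow> 0 < \<delta>' \<Longrightarrow> \<delta>' \<le> \<delta> \<Longrightarrow> small k \<delta>'"
  unfolding small_def using chain_dom_mono[of \<delta>' \<delta> k] pdisc_mono[of \<delta>' \<delta>] by (meson order_trans subsetD)

lemma small_len: "small k \<delta> \<Longrightarrow> l \<le> k \<Longrightarrow> small l \<delta>"
proof -
  assume s: "small k \<delta>" and l: "l \<le> k"
  have "F Q j \<theta> \<in> pdisc r" if "Q \<in> pdisc \<delta>" "\<theta> \<in> chain_dom l \<delta>" "j \<le> l" for Q \<theta> j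
  proof -
    let ?\<theta> = "\<lambda>i. if i < l then \<theta> i else 0"
    have "?\<theta> \<in> chain_dom k \<delta>" using that s by (auto simp: chain_dom_def small_def)
    then have "F Q j ?\<theta> \<in> pdisc r" using smallD[OF s that(1)] that l by auto
    also have "F Q j ?\<theta> = F Q j \<theta>" by (rule chain_cong) (use that in auto)
    finally show ?thesis .
  qed
  then show ?thesis using s by (auto simp: small_def)
qed

text \<open>Every step sends the point 0 with parameter 0 to 0, so continuity yields the radius step
  by step.\<close>

lemma chain_small:
  assumes "\<epsilon> > 0"
  obtains \<delta> where "\<delta> > 0" "\<delta> \<le> \<epsilon>"
    "\<And>Q \<theta> j. Q \<in> pdisc \<delta> \<Longrightarrow> \<theta> \<in> chain_dom k \<delta> \<Longrightarrow> j \<le> k \<Longrightarrow> F Q j \<theta> \<in> pdisc \<epsilon>"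
proof -
  have "\<exists>\<delta>>0. \<delta> \<le> \<epsilon> \<and> (\<forall>Q\<in>pdisc \<delta>. \<forall>\<theta>\<in>chain_dom k \<delta>. \<forall>j\<le>k. F Q j \<theta> \<in> pdisc \<epsilon>)"
    using assms
  proof (induction k arbitrary: \<epsilon>)
    case 0
    then show ?case by auto
  next
    case (Suc k)
    define e where "e = min \<epsilon> r"
    have e: "e > 0" using Suc r_pos by (simp add: e_def)
    let ?g = "\<lambda>v. St k (jl v) (jr v)"
    have "continuous_on (pdisc r) ?g" using hol_continuous_on[OF St_hol] .
    then have "open (pdisc r \<inter> ?g -` pdisc e)" by (simp add: continuous_on_open_vimage Int_commute)
    moreover have "0 \<in> pdisc r \<inter> ?g -` pdisc e" using St_zero[of 0 k] r_pos e by simp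
    ultimately obtain \<eta> where \<eta>: "\<eta> > 0" "pdisc \<eta> \<subseteq> pdisc r \<inter> ?g -` pdisc e"
      using pdisc_nbhd by metis
    have st: "St k s y \<in> pdisc e" if "s \<in> pdisc \<eta>" "y \<in> pdisc \<eta>" for s y
    proof -
      have "jn s y \<in> pdisc \<eta>" using that by (simp add: jn_pdisc)
      then have "jn s y \<in> ?g -` pdisc e" using \<eta>(2) by blast
      then show ?thesis by simp
    qed
    obtain \<delta> where \<delta>: "\<delta> > 0" "\<delta> \<le> min e \<eta>"
      "\<And>Q \<theta> j. Q \<in> pdisc \<delta> \<Longrightarrow> \<theta> \<in> chain_dom k \<delta> \<Longrightarrow> j \<le> k \<Longrightarrow> F Q j \<theta> \<in> pdisc (min e \<eta>)"
      using Suc.IH[of "min e \<eta>"] e \<eta> by (metis min_less_iff_conj)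
    have "F Q j \<theta> \<in> pdisc \<epsilon>" if "Q \<in> pdisc \<delta>" "\<theta> \<in> chain_dom (Suc k) \<delta>" "j \<le> Suc k" for Q \<theta> j
    proof (cases "j = Suc k")
      case True
      have "\<theta> k \<in> pdisc \<eta>" using that pdisc_mono[of \<delta> \<eta>] \<delta> by (auto simp: chain_dom_def)
      moreover have "F Q k \<theta> \<in> pdisc \<eta>" using \<delta>(3)[of Q \<theta> k] that pdisc_mono[of "min e \<eta>" \<eta>] chain_dom_le[of k "Suc k" \<delta>] by auto
      ultimately show ?thesis using st pdisc_mono[of e \<epsilon>] True by (auto simp: e_def)
    next
      case False
      then have "F Q j \<theta> \<in> pdisc (min e \<eta>)" using \<delta>(3)[of Q \<theta> j] that chain_dom_le[of k "Suc k" \<delta>] by auto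
      moreover have "min e \<eta> \<le> \<epsilon>" by (simp add: e_def)
      ultimately show ?thesis using pdisc_mono by blast
    qed
    then show ?case using \<delta> by (intro exI[of _ \<delta>]) (auto simp: e_def)
  qed
  then show ?thesis using that by blast
qed

lemma small_ex: obtains \<delta> where "small k \<delta>"
proof -
  obtain \<delta> where "\<delta> > 0" "\<delta> \<le> r"
    "\<And>Q \<theta> j. Q \<in> pdisc \<delta> \<Longrightarrow> \<theta> \<in> chain_dom k \<delta> \<Longrightarrow> j \<le> k \<Longrightarrow> F Q j \<theta> \<in> pdisc r"
    using chain_small[OF r_pos, of k] by metis
  then show ?thesis using that unfolding small_def by blast
qed

lemma chain_hol:
  fixes d :: "'p::finite \<Rightarrow> nat \<Rightarrow> complex^'q"
  assumes s: "small k \<delta>" and Q: "Q \<in> pdisc \<delta>"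
  shows "hol (\<lambda>u. F Q k (lin \<theta> d u)) {u. lin \<theta> d u \<in> chain_dom k \<delta>}"
proof -
  let ?U = "{u. lin \<theta> d u \<in> chain_dom k \<delta>}"
  have "hol (\<lambda>u. F Q j (lin \<theta> d u)) ?U" if "j \<le> k" for j
    using that
  proof (induction j)
    case 0
    then show ?case by (simp add: hol_const open_lin_chain_dom)
  next
    case (Suc j)
    have "hol (\<lambda>u. St j (lin \<theta> d u j) (F Q j (lin \<theta> d u))) ?U"
    proof (rule hol_compose2[OF St_hol])
      show "hol (\<lambda>u. lin \<theta> d u j) ?U" by (rule hol_lin[OF open_lin_chain_dom])
      show "hol (\<lambda>u. F Q j (lin \<theta> d u)) ?U" using Suc by simp
      fix u assume u: "u \<in> ?U"
      then show "lin \<theta> d u j \<in> pdisc r" using Suc(2) pdisc_mono[OF small_le[OF s]] by (auto simp: chain_dom_def)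
      show "F Q j (lin \<theta> d u) \<in> pdisc r" using smallD[OF s Q] u Suc(2) by simp
    qed
    then show ?case by simp
  qed
  then show ?thesis by simp
qed

lemma chain_line_deriv:
  assumes s: "small k \<delta>" and Q: "Q \<in> pdisc \<delta>" and \<theta>: "\<theta> \<in> chain_dom k \<delta>"
  shows "((\<lambda>s. F Q k (\<lambda>j. \<theta> j + s *s e j)) has_derivative (\<lambda>s. s *s dirD (F Q k) \<theta> e)) (at 0)"
proof -
  \<comment> \<open>A one-parameter family, indexed by the unit type, reduces the line to
    \<open>chain_hol\<close>.\<close>
  let ?d = "\<lambda>_::unit. e"
  let ?G = "\<lambda>u. F Q k (lin \<theta> ?d u)"
  have h: "hol ?G {u. lin \<theta> ?d u \<in> chain_dom k \<delta>}" by (rule chain_hol[OF s Q])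
  have 1: "((\<lambda>s. s *s axis () (1::complex)) has_derivative (\<lambda>s. s *s axis () 1)) (at 0)"
    by (rule bounded_linear_imp_has_derivative[OF bounded_linear_smult_left])
  have "((\<lambda>s. ?G (s *s axis () 1)) has_derivative (\<lambda>s. jac ?G (0 *s axis () 1) *v (s *s axis () 1))) (at 0)"
    by (rule has_derivative_compose[OF 1 hol_jac[OF h]]) (use \<theta> in simp)
  then have D: "((\<lambda>s. F Q k (\<lambda>j. \<theta> j + s *s e j)) has_derivative (\<lambda>s. s *s (jac ?G 0 *v axis () 1))) (at 0)"
    by (simp add: lin_axis vector_scalar_commute)
  then have "dirD (F Q k) \<theta> e = jac ?G 0 *v axis () 1"
    unfolding dirD_def by (rule deriv_vec)
  then show ?thesis using D by simp
qed

text \<open>The directional derivatives are the columns of the Jacobian of the chain along a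
  finite-dimensional family, whence their linearity in the direction.\<close>

lemma dirD_lin:
  fixes d :: "'p::finite \<Rightarrow> nat \<Rightarrow> complex^'q"
  assumes s: "small k \<delta>" and Q: "Q \<in> pdisc \<delta>" and \<theta>: "\<theta> \<in> chain_dom k \<delta>"
  shows "dirD (F Q k) \<theta> (\<lambda>j. \<Sum>i\<in>UNIV. h $ i *s d i j) = (\<Sum>i\<in>UNIV. h $ i *s dirD (F Q k) \<theta> (d i))"
proof -
  let ?G = "\<lambda>u. F Q k (lin \<theta> d u)"
  have hh: "hol ?G {u. lin \<theta> d u \<in> chain_dom k \<delta>}" by (rule chain_hol[OF s Q])
  have 1: "((\<lambda>s. s *s h) has_derivative (\<lambda>s. s *s h)) (at 0)"
    by (rule bounded_linear_imp_has_derivative[OF bounded_linear_smult_left])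
  have "((\<lambda>s. ?G (s *s h)) has_derivative (\<lambda>s. jac ?G (0 *s h) *v (s *s h))) (at 0)"
    by (rule has_derivative_compose[OF 1 hol_jac[OF hh]]) (use \<theta> in simp)
  moreover have "lin \<theta> d (s *s h) = (\<lambda>j. \<theta> j + s *s (\<Sum>i\<in>UNIV. h $ i *s d i j))" for s
    by (simp add: lin_def fun_eq_iff vec.scale_sum_right)
  ultimately have "((\<lambda>s. F Q k (\<lambda>j. \<theta> j + s *s (\<Sum>i\<in>UNIV. h $ i *s d i j))) has_derivative
      (\<lambda>s. s *s (jac ?G 0 *v h))) (at 0)"
    by (simp add: vector_scalar_commute)
  then have "dirD (F Q k) \<theta> (\<lambda>j. \<Sum>i\<in>UNIV. h $ i *s d i j) = jac ?G 0 *v h"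
    unfolding dirD_def by (rule deriv_vec)
  also have "\<dots> = (\<Sum>i\<in>UNIV. h $ i *s dirD (F Q k) \<theta> (d i))"
    by (simp add: jac_lin matrix_vector_mult_def vec_eq_iff mult.commute)
  finally show ?thesis .
qed

lemma dirD_add:
  assumes "small k \<delta>" "Q \<in> pdisc \<delta>" "\<theta> \<in> chain_dom k \<delta>"
  shows "dirD (F Q k) \<theta> (\<lambda>j. a *s e j + b *s e' j) = a *s dirD (F Q k) \<theta> e + b *s dirD (F Q k) \<theta> e'"
  using dirD_lin[OF assms, of "\<chi> t. if t then a else b" "\<lambda>t. if t then e else e'"]
  by (simp add: UNIV_bool add.commute)

lemma dirD_smult:
  assumes "small k \<delta>" "Q \<in> pdisc \<delta>" "\<theta> \<in> chain_dom k \<delta>"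
  shows "dirD (F Q k) \<theta> (\<lambda>j. a *s e j) = a *s dirD (F Q k) \<theta> e"
  using dirD_add[OF assms, of a e 0 e] by simp

lemma dirD_0: "dirD f \<theta> (\<lambda>j. 0) = 0"
  by (simp add: dirD_def vec_eq_iff)

lemma dirD_sum:
  assumes "small k \<delta>" "Q \<in> pdisc \<delta>" "\<theta> \<in> chain_dom k \<delta>" "finite A"
  shows "dirD (F Q k) \<theta> (\<lambda>j. \<Sum>x\<in>A. c x *s e x j) = (\<Sum>x\<in>A. c x *s dirD (F Q k) \<theta> (e x))"
  using assms(4)
proof induction
  case (insert x A)
  then show ?case using dirD_add[OF assms(1-3), of "c x" "e x" 1 "\<lambda>j. \<Sum>x\<in>A. c x *s e x j"] by simp
qed (simp add: dirD_0)

lemma subspace_dirD: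
  assumes "small k \<delta>" "Q \<in> pdisc \<delta>" "\<theta> \<in> chain_dom k \<delta>"
  shows "vec.subspace (range (dirD (F Q k) \<theta>))"
proof (rule vec.subspaceI)
  show "0 \<in> range (dirD (F Q k) \<theta>)" using dirD_0 by (metis rangeI)
  fix x y assume "x \<in> range (dirD (F Q k) \<theta>)" "y \<in> range (dirD (F Q k) \<theta>)"
  then obtain e e' where "x = dirD (F Q k) \<theta> e" "y = dirD (F Q k) \<theta> e'" by blast
  then show "x + y \<in> range (dirD (F Q k) \<theta>)" using dirD_add[OF assms, of 1 e 1 e'] by (auto intro!: range_eqI[where x = "\<lambda>j. e j + e' j"])
next
  fix c x assume "x \<in> range (dirD (F Q k) \<theta>)"
  then obtain e where "x = dirD (F Q k) \<theta> e" by blast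
  then have "c *s x = dirD (F Q k) \<theta> (\<lambda>j. c *s e j)" using dirD_smult[OF assms, of c e] by simp
  then show "c *s x \<in> range (dirD (F Q k) \<theta>)" by blast
qed

lemma dirD_cong: "(\<And>j. j < k \<Longrightarrow> e j = e' j) \<Longrightarrow> dirD (F Q k) \<theta> e = dirD (F Q k) \<theta> e'"
proof -
  assume "\<And>j. j < k \<Longrightarrow> e j = e' j"
  then have "F Q k (\<lambda>j. \<theta> j + s *s e j) = F Q k (\<lambda>j. \<theta> j + s *s e' j)" for s by (intro chain_cong) simp
  then show ?thesis by (simp add: dirD_def)
qed

lemma dirD_cong_base: "(\<And>j. j < k \<Longrightarrow> \<theta> j = \<theta>' j) \<Longrightarrow> dirD (F Q k) \<theta> e = dirD (F Q k) \<theta>' e"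
proof -
  assume "\<And>j. j < k \<Longrightarrow> \<theta> j = \<theta>' j"
  then have "F Q k (\<lambda>j. \<theta> j + s *s e j) = F Q k (\<lambda>j. \<theta>' j + s *s e j)" for s by (intro chain_cong) simp
  then show ?thesis by (simp add: dirD_def)
qed

text \<open>Entries of a direction beyond \<open>k\<close> do not enter the chain, so it may be
  replaced by a finite combination of the \<open>cdir\<close>. These give the columns that occur in
  \<open>jac_rank\<close>.\<close>

lemma range_dirD_span:
  assumes "small k \<delta>" "Q \<in> pdisc \<delta>" "\<theta> \<in> chain_dom k \<delta>"
  shows "range (dirD (F Q k) \<theta>) = vec.span ((\<lambda>(j,a). dirD (F Q k) \<theta> (cdir j a)) ` ({..<k} \<times> UNIV))"
    (is "_ = vec.span ?C")
proof
  show "vec.span ?C \<subseteq> range (dirD (F Q k) \<theta>)"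
    by (rule vec.span_minimal[OF _ subspace_dirD[OF assms]]) auto
  show "range (dirD (F Q k) \<theta>) \<subseteq> vec.span ?C"
  proof clarify
    fix e :: "nat \<Rightarrow> complex^'q"
    have "(\<Sum>x\<in>{..<k} \<times> UNIV. (e (fst x) $ snd x) *s cdir (fst x) (snd x) j) = e j" if "j < k" for j
    proof -
      have "(\<Sum>x\<in>{..<k} \<times> UNIV. (e (fst x) $ snd x) *s cdir (fst x) (snd x) j)
          = (\<Sum>i<k. \<Sum>a\<in>UNIV. (e i $ a) *s cdir i a j)"
        by (simp add: sum.cartesian_product case_prod_unfold)
      also have "\<dots> = (\<Sum>i<k. if i = j then \<Sum>a\<in>UNIV. (e j $ a) *s axis a 1 else 0)"
        by (rule sum.cong) (auto simp: cdir_def intro!: sum.neutral)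
      also have "\<dots> = (\<Sum>a\<in>UNIV. (e j $ a) *s axis a 1)" using that by simp
      also have "\<dots> = e j" by (rule basis_expansion)
      finally show ?thesis .
    qed
    then have "dirD (F Q k) \<theta> e = dirD (F Q k) \<theta> (\<lambda>j. \<Sum>x\<in>{..<k} \<times> UNIV. (e (fst x) $ snd x) *s cdir (fst x) (snd x) j)"
      by (intro dirD_cong) simp
    also have "\<dots> = (\<Sum>x\<in>{..<k} \<times> UNIV. (e (fst x) $ snd x) *s dirD (F Q k) \<theta> (cdir (fst x) (snd x)))"
      by (rule dirD_sum[OF assms]) simp
    also have "\<dots> \<in> vec.span ?C"
      by (intro vec.span_sum vec.span_scale vec.span_base) (auto simp: image_iff)
    finally show "dirD (F Q k) \<theta> e \<in> vec.span ?C" .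
  qed
qed

lemma rk_cols:
  assumes "small k \<delta>" "Q \<in> pdisc \<delta>" "\<theta> \<in> chain_dom k \<delta>"
  shows "rk (F Q k) \<theta> = vec.dim ((\<lambda>(j,a). dirD (F Q k) \<theta> (cdir j a)) ` ({..<k} \<times> UNIV))"
  unfolding rk_def range_dirD_span[OF assms] by (rule vec.dim_span)

lemma det_holomorphic:
  assumes s: "small k \<delta>" and Q: "Q \<in> pdisc \<delta>"
  shows "(\<lambda>l. det (colmat (\<lambda>j. if j \<in> I then dirD (F Q k) (\<lambda>i. \<theta> i + l *s D i) (d j) else v j)))
      holomorphic_on {l. (\<lambda>i. \<theta> i + l *s D i) \<in> chain_dom k \<delta>}"
proof -
  let ?A = "{l. (\<lambda>i. \<theta> i + l *s D i) \<in> chain_dom k \<delta>}"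
  have 1: "(\<lambda>l. dirD (F Q k) (\<lambda>i. \<theta> i + l *s D i) e $ i) holomorphic_on ?A" for e i
  proof -
    \<comment> \<open>A two-parameter family indexed by truth values: \<open>False\<close> moves the
      base point along \<open>D\<close>, \<open>True\<close> is the direction of
      differentiation.\<close>
    let ?d = "\<lambda>t. if t then e else D"
    let ?G = "\<lambda>u. F Q k (lin \<theta> ?d u)"
    have "shol (\<lambda>u. jac ?G u $ i $ True) {u. lin \<theta> ?d u \<in> chain_dom k \<delta>}"
      by (rule shol_jac_nth[OF chain_hol[OF s Q]])
    then have "(\<lambda>l. jac ?G (0 + l *s axis False 1) $ i $ True) holomorphic_on ?A"
      by (rule shol_line) (simp add: lin_axis)
    then show ?thesis by (simp add: jac_lin lin_axis)
  qed
  show ?thesis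
    unfolding det_def
  proof (intro holomorphic_on_sum holomorphic_on_mult holomorphic_on_const holomorphic_on_prod)
    fix p i 
    show "(\<lambda>l. colmat (\<lambda>j. if j \<in> I then dirD (F Q k) (\<lambda>i. \<theta> i + l *s D i) (d j) else v j) $ i $ p i) holomorphic_on ?A"
      using 1 by (cases "p i \<in> I") (auto simp: colmat_def intro: holomorphic_intros)
  qed
qed

lemma line_dom:
  shows "open {l. (\<lambda>i. \<theta> i + l *s D i) \<in> chain_dom k \<delta>}" "convex {l. (\<lambda>i. \<theta> i + l *s D i) \<in> chain_dom k \<delta>}"
proof -
  have eq: "{l. (\<lambda>i. \<theta> i + l *s D i) \<in> chain_dom k \<delta>} = (\<Inter>i\<in>{..<k}. (\<lambda>l. \<theta> i + l *s D i) -` pdisc \<delta>)"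
    by (auto simp: chain_dom_def)
  have "open ((\<lambda>l. \<theta> i + l *s D i) -` pdisc \<delta>)" for i
    by (intro open_vimage continuous_on_add continuous_on_const linear_continuous_on bounded_linear_smult_left) auto
  then show "open {l. (\<lambda>i. \<theta> i + l *s D i) \<in> chain_dom k \<delta>}" unfolding eq by auto
  have "convex ((\<lambda>l. \<theta> i + l *s D i) -` pdisc \<delta>)" for i
  proof (rule convexI)
    fix x y u v assume h: "x \<in> (\<lambda>l. \<theta> i + l *s D i) -` pdisc \<delta>" "y \<in> (\<lambda>l. \<theta> i + l *s D i) -` pdisc \<delta>"
      "0 \<le> (u::real)" "0 \<le> v" "u + v = 1"
    have "u *\<^sub>R (\<theta> i + x *s D i) + v *\<^sub>R (\<theta> i + y *s D i) \<in> pdisc \<delta>"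
      using h convexD[OF convex_pdisc] by auto
    also have "u *\<^sub>R (\<theta> i + x *s D i) + v *\<^sub>R (\<theta> i + y *s D i) = (u + v) *\<^sub>R \<theta> i + (u *\<^sub>R x + v *\<^sub>R y) *s D i"
      by (simp add: scaleR_vec_smult vec_eq_iff algebra_simps) (simp add: scaleR_conv_of_real algebra_simps)
    finally show "u *\<^sub>R x + v *\<^sub>R y \<in> (\<lambda>l. \<theta> i + l *s D i) -` pdisc \<delta>" using h by simp
  qed
  then show "convex {l. (\<lambda>i. \<theta> i + l *s D i) \<in> chain_dom k \<delta>}" unfolding eq by (intro convex_INT) auto
qed

lemma det_nonzero_near:
  assumes s: "small k \<delta>" and Q: "Q \<in> pdisc \<delta>" and \<theta>: "\<theta> \<in> chain_dom k \<delta>"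
    and l: "(\<lambda>i. \<theta> i + l *s D i) \<in> chain_dom k \<delta>"
    and nz: "det (colmat (\<lambda>j. if j \<in> I then dirD (F Q k) (\<lambda>i. \<theta> i + l *s D i) (d j) else v j)) \<noteq> 0"
    and e: "e > 0"
  obtains t where "0 < t" "t < e" "(\<lambda>i. \<theta> i + complex_of_real t *s D i) \<in> chain_dom k \<delta>"
    "det (colmat (\<lambda>j. if j \<in> I then dirD (F Q k) (\<lambda>i. \<theta> i + complex_of_real t *s D i) (d j) else v j)) \<noteq> 0"
proof -
  have 0: "0 \<in> {l. (\<lambda>i. \<theta> i + l *s D i) \<in> chain_dom k \<delta>}" using \<theta> by simp
  show ?thesis
    by (rule holomorphic_nonzero_real[OF det_holomorphic[OF s Q, of I \<theta> D d v] line_dom 0 _ nz e])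
       (use l that in auto)
qed

text \<open>By the chain rule the columns of the first chain are images of columns of the second
  under the Jacobian of \<open>h\<close>, since each line of parameters of the first is, near 0, the
  image under \<open>h\<close> of a line of the second.\<close>

lemma rk_le_chain:
  assumes s2: "small k' \<delta>'" "Q' \<in> pdisc \<delta>'" "\<theta>' \<in> chain_dom k' \<delta>'"
    and h: "hol h V" "F Q' k' \<theta>' \<in> V"
    and eq: "\<And>e. \<exists>e'. \<exists>W. open W \<and> 0 \<in> W \<and> (\<forall>s\<in>W. F Q k (\<lambda>j. \<theta> j + s *s e j) = h (F Q' k' (\<lambda>j. \<theta>' j + s *s e' j)))"
  shows "rk (F Q k) \<theta> \<le> rk (F Q' k') \<theta>'"
proof -
  let ?A = "jac h (F Q' k' \<theta>')"
  have "dirD (F Q k) \<theta> e \<in> (*v) ?A ` range (dirD (F Q' k') \<theta>')" for e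
  proof -
    obtain e' W where W: "open W" "0 \<in> W" "\<And>s. s \<in> W \<Longrightarrow> F Q k (\<lambda>j. \<theta> j + s *s e j) = h (F Q' k' (\<lambda>j. \<theta>' j + s *s e' j))"
      using eq by meson
    have 1: "((\<lambda>s. h (F Q' k' (\<lambda>j. \<theta>' j + s *s e' j))) has_derivative (\<lambda>s. ?A *v (s *s dirD (F Q' k') \<theta>' e'))) (at 0)"
      by (rule has_derivative_compose[OF chain_line_deriv[OF s2]]) (use hol_jac[OF h] in simp)
    have "((\<lambda>s. F Q k (\<lambda>j. \<theta> j + s *s e j)) has_derivative (\<lambda>s. s *s (?A *v dirD (F Q' k') \<theta>' e'))) (at 0)"
      using has_derivative_transform_within_open[OF 1 W(1,2)] W(3) by (simp add: vector_scalar_commute)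
    from deriv_vec[OF this] show ?thesis unfolding dirD_def[of "F Q k"] by blast
  qed
  then have "range (dirD (F Q k) \<theta>) \<subseteq> (*v) ?A ` range (dirD (F Q' k') \<theta>')" by blast
  then have "rk (F Q k) \<theta> \<le> vec.dim ((*v) ?A ` range (dirD (F Q' k') \<theta>'))"
    unfolding rk_def by (rule vec.dim_subset)
  also have "\<dots> \<le> rk (F Q' k') \<theta>'"
    unfolding rk_def by (rule vec.dim_image_le[OF matrix_vector_mul_linear_gen])
  finally show ?thesis .
qed

text \<open>With its parameter frozen, the last step is undone by a fixed holomorphic map, so the
  columns of the shorter chain are images of columns of the longer one.\<close>

lemma rk_le_Suc:
  assumes s: "small (Suc k) \<delta>" "Q \<in> pdisc \<delta>" "\<theta> \<in> chain_dom (Suc k) \<delta>"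
  shows "rk (F Q k) \<theta> \<le> rk (F Q (Suc k)) \<theta>"
proof (rule rk_le_chain[OF s])
  have tk: "\<theta> k \<in> pdisc r" using s(3) pdisc_mono[OF small_le[OF s(1)]] by (auto simp: chain_dom_def)
  show "hol (\<lambda>y. St k (- \<theta> k) y) (pdisc r)"
    by (rule hol_compose2[OF St_hol]) (use tk in \<open>auto intro: hol_const hol_id\<close>)
  show "F Q (Suc k) \<theta> \<in> pdisc r" using smallD[OF s] by blast
  fix e :: "nat \<Rightarrow> complex^'q"
  let ?e = "e(k := 0)"
  let ?W = "{l. (\<lambda>i. \<theta> i + l *s ?e i) \<in> chain_dom (Suc k) \<delta>}"
  have "F Q k (\<lambda>j. \<theta> j + l *s e j) = St k (- \<theta> k) (F Q (Suc k) (\<lambda>j. \<theta> j + l *s ?e j))" if "l \<in> ?W" for l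
  proof -
    have "F Q k (\<lambda>j. \<theta> j + l *s e j) = F Q k (\<lambda>j. \<theta> j + l *s ?e j)" by (rule chain_cong) auto
    moreover have "F Q k (\<lambda>j. \<theta> j + l *s ?e j) \<in> pdisc r" using smallD[OF s(1,2), of _ k] that by simp
    ultimately show ?thesis using St_inv[OF tk] by simp
  qed
  moreover have "0 \<in> ?W" using s(3) by simp
  ultimately show "\<exists>e'. \<exists>W. open W \<and> 0 \<in> W \<and> (\<forall>s\<in>W. F Q k (\<lambda>j. \<theta> j + s *s e j) = St k (- \<theta> k) (F Q (Suc k) (\<lambda>j. \<theta> j + s *s e' j)))"
    by (intro exI[of _ ?e] exI[of _ ?W] conjI line_dom(1)) auto
qed

lemma rk_mono:
  assumes s: "small k' \<delta>" "Q \<in> pdisc \<delta>" "\<theta> \<in> chain_dom k' \<delta>" and "k \<le> k'"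
  shows "rk (F Q k) \<theta> \<le> rk (F Q k') \<theta>"
  using assms(4)
proof (induction rule: inc_induct)
  case (step j)
  have "rk (F Q j) \<theta> \<le> rk (F Q (Suc j)) \<theta>"
    by (rule rk_le_Suc[OF small_len[OF s(1)] s(2)]) (use step s(3) chain_dom_le[of "Suc j" k' \<delta>] in auto)
  then show ?case using step.IH by (rule order_trans)
qed simp

text \<open>A chain of \<open>K\<close> steps, a step with parameter 0, and the inverse steps in
  reverse order. Without the step in the middle the inverse of step \<open>K - 1\<close> would sit
  at position \<open>K\<close>, which has the other parity; now position \<open>j\<close> undoes
  step \<open>2 * K - j\<close>, of the same parity.\<close>

definition rev_par :: "nat \<Rightarrow> (nat \<Rightarrow> complex^'q) \<Rightarrow> nat \<Rightarrow> complex^'q" where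
  "rev_par K \<theta> = (\<lambda>j. if j < K then \<theta> j else if j = K then 0 else - \<theta> (2 * K - j))"

lemma rev_par_dom: "0 < \<delta> \<Longrightarrow> \<theta> \<in> chain_dom K \<delta> \<Longrightarrow> rev_par K \<theta> \<in> chain_dom (2 * K + 1) \<delta>"
  by (auto simp: chain_dom_def rev_par_def)

lemma St_par': "even (i + j) \<Longrightarrow> St i = St j"
proof -
  have "St (2 * k + j) = St j" for k j by (induction k) (auto simp: St_par)
  moreover assume "even (i + j)"
  then have "i = 2 * ((i - j) div 2) + j \<or> j = 2 * ((j - i) div 2) + i" by presburger
  ultimately show ?thesis by metis
qed

lemma chain_rev_par:
  assumes s: "small K \<delta>" "Q \<in> pdisc \<delta>" "\<theta> \<in> chain_dom K \<delta>"
  shows "F Q (2 * K + 1) (rev_par K \<theta>) = Q"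
proof -
  have "F Q (K + 1 + i) (rev_par K \<theta>) = F Q (K - i) \<theta>" if "i \<le> K" for i
    using that
  proof (induction i)
    case 0
    have "F Q K (rev_par K \<theta>) = F Q K \<theta>" by (rule chain_cong) (simp add: rev_par_def)
    then show ?case using St_zero smallD[OF s] by (simp add: rev_par_def)
  next
    case (Suc i)
    define m where "m = K - Suc i"
    have Km: "K - i = Suc m" and p: "2 * K - (K + 1 + i) = m" "even (K + 1 + i + m)" using Suc.prems by (auto simp: m_def)
    have "F Q (K + 1 + Suc i) (rev_par K \<theta>) = St (K + 1 + i) (- \<theta> m) (F Q (K + 1 + i) (rev_par K \<theta>))"
      using p by (simp add: rev_par_def)
    also have "\<dots> = St m (- \<theta> m) (F Q (Suc m) \<theta>)"
      using Suc Km St_par'[OF p(2)] by simp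
    also have "\<dots> = F Q m \<theta>"
    proof -
      have "\<theta> m \<in> pdisc r" using s(3) pdisc_mono[OF small_le[OF s(1)]] Suc.prems by (auto simp: chain_dom_def m_def)
      moreover have "F Q m \<theta> \<in> pdisc r" using smallD[OF s] by (simp add: m_def)
      ultimately show ?thesis using St_inv by simp
    qed
    finally show ?case by (simp add: m_def)
  qed
  from this[of K] show ?thesis by (simp add: mult_2)
qed

end

section \<open>Chains of holomorphic flows\<close>

text \<open>The square of \<open>norm (z t)\<close> times \<open>exp (- 2 * K * t)\<close> has
  nonpositive derivative. No equation for \<open>z\<close> enters, only a bound on its velocity,
  which is what transversal coordinates satisfy.\<close>

lemma gronwall_zero:
  fixes z :: "real \<Rightarrow> 'a::real_inner"
  assumes der: "\<And>t. t \<in> {0..T} \<Longrightarrow> (z has_vector_derivative z' t) (at t within {0..T})"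
    and le: "\<And>t. t \<in> {0..T} \<Longrightarrow> norm (z' t) \<le> K * norm (z t)" and z0: "z 0 = 0" and t: "t \<in> {0..T}"
  shows "z t = 0"
proof (cases "t = 0")
  case False
  then have t0: "0 < t" using t by simp
  define h where "h s = (z s \<bullet> z s) * exp (- 2 * K * s)" for s
  have cz: "continuous_on {0..T} z"
    using der has_vector_derivative_continuous by (metis continuous_on_eq_continuous_within)
  have "h t \<le> h 0"
  proof (rule DERIV_nonpos_imp_decreasing_open[OF less_imp_le[OF t0]])
    show "continuous_on {0..t} h"
      unfolding h_def by (intro continuous_intros continuous_on_subset[OF cz]) (use t in auto)
    fix s assume s: "0 < s" "s < t"
    then have sT: "s \<in> {0..T}" using t by auto
    have at: "at s within {0..T} = at s" using s t by (intro at_within_interior) auto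
    have D: "(z has_derivative (\<lambda>x. x *\<^sub>R z' s)) (at s)"
      using der[OF sT] unfolding at by (simp add: has_vector_derivative_def)
    have "((\<lambda>s. z s \<bullet> z s) has_derivative (\<lambda>x. z s \<bullet> (x *\<^sub>R z' s) + (x *\<^sub>R z' s) \<bullet> z s)) (at s)"
      by (rule has_derivative_inner[OF D D])
    then have 1: "((\<lambda>s. z s \<bullet> z s) has_real_derivative 2 * (z s \<bullet> z' s)) (at s)"
      unfolding has_field_derivative_def by (rule has_derivative_eq_rhs) (auto simp: inner_commute)
    have 2: "(h has_real_derivative 2 * (z s \<bullet> z' s) * exp (- 2 * K * s) + (exp (- 2 * K * s) * (- 2 * K)) * (z s \<bullet> z s)) (at s)"
      unfolding h_def by (rule DERIV_mult[OF 1]) (auto intro!: derivative_eq_intros)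
    have "z s \<bullet> z' s \<le> norm (z s) * norm (z' s)" by (rule norm_cauchy_schwarz)
    also have "\<dots> \<le> norm (z s) * (K * norm (z s))" by (intro mult_left_mono le[OF sT]) auto
    finally have "z s \<bullet> z' s \<le> K * (z s \<bullet> z s)" by (simp add: power2_norm_eq_inner[symmetric] power2_eq_square mult_ac)
    then have "exp (- 2 * K * s) * (2 * (z s \<bullet> z' s - K * (z s \<bullet> z s))) \<le> 0"
      by (intro mult_nonneg_nonpos) auto
    then show "\<exists>y. DERIV h s :> y \<and> y \<le> 0" using 2 by (intro exI conjI) (auto simp: algebra_simps)
  qed
  then have "(z t \<bullet> z t) * exp (- 2 * K * t) \<le> 0" using z0 by (simp add: h_def)
  then have "z t \<bullet> z t \<le> 0" by (simp add: mult_le_0_iff)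
  then show ?thesis using inner_gt_zero_iff[of "z t"] by (metis not_le)
qed (use z0 in simp)

text \<open>Adds the group law in the parameter, as it holds within each of the two families
  separately. It lets consecutive steps of one family merge.\<close>

locale flow_sys = chain_sys St r for St :: "nat \<Rightarrow> complex^'q::finite \<Rightarrow> complex^'n::finite \<Rightarrow> complex^'n" and r +
  assumes St_add: "\<lbrakk>s \<in> pdisc r; s' \<in> pdisc r; s + s' \<in> pdisc r; y \<in> pdisc r; St j s' y \<in> pdisc r\<rbrakk>
      \<Longrightarrow> St j (s + s') y = St j s (St j s' y)"
begin

text \<open>The infinitesimal generator of step \<open>j\<close>. For Segre chains,
  \<open>Y 0 b\<close> and \<open>Y 1 b\<close> are the combinations with constant coefficients
  \<open>b\<close> of the complexified CR fields of the two families, written in the chart.\<close>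

definition Y :: "nat \<Rightarrow> complex^'q \<Rightarrow> complex^'n \<Rightarrow> complex^'n" where
  "Y j b y = jac (\<lambda>s. St j s y) 0 *v b"

lemma Y_par: "even (i + j) \<Longrightarrow> Y i = Y j"
  using St_par'[of i j] by (simp add: Y_def fun_eq_iff)

lemma Y_0 [simp]: "Y j 0 y = 0"
  by (simp add: Y_def)

lemma St_hol_left: "y \<in> pdisc r \<Longrightarrow> hol (\<lambda>s. St j s y) (pdisc r)"
  by (rule hol_compose2[OF St_hol]) (auto intro: hol_const hol_id)

lemma St_hol_right: "s \<in> pdisc r \<Longrightarrow> hol (\<lambda>y. St j s y) (pdisc r)"
  by (rule hol_compose2[OF St_hol]) (auto intro: hol_const hol_id)

lemma St_has_derivative:
  "y \<in> pdisc r \<Longrightarrow> ((\<lambda>s. St j s y) has_derivative (\<lambda>s. Y j s y)) (at 0)"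
  unfolding Y_def by (rule hol_jac[OF St_hol_left]) (use r_pos in auto)

lemma St_line_derivative:
  assumes "y \<in> pdisc r" shows "((\<lambda>s. St j (s *s b) y) has_derivative (\<lambda>s. s *s Y j b y)) (at 0)"
proof -
  have 1: "((\<lambda>s. s *s b) has_derivative (\<lambda>s. s *s b)) (at 0)"
    by (rule bounded_linear_imp_has_derivative[OF bounded_linear_smult_left])
  have "((\<lambda>s. St j (s *s b) y) has_derivative (\<lambda>s. Y j (s *s b) y)) (at 0)"
    by (rule has_derivative_compose[OF 1]) (use St_has_derivative[OF assms, of j] in simp)
  then show ?thesis by (simp add: Y_def vector_scalar_commute)
qed

lemma Y_hol: "hol (Y j b) (pdisc r)"
proof (rule hol_vecI)
  fix i
  let ?g = "\<lambda>v. St j (jl v) (jr v)"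
  have e: "jac (\<lambda>s. St j s y) 0 $ i $ a = jac ?g (jn 0 y) $ i $ Inl a" for y a
  proof -
    have "jl (jn 0 y + s *s axis (Inl a) 1) = s *s axis a 1" "jr (jn 0 y + s *s axis (Inl a) 1) = y" for s
      by (simp_all add: vec_eq_iff axis_def)
    then show ?thesis by (simp add: jac_def)
  qed
  have "shol (\<lambda>y. jac ?g (jn 0 y) $ i $ k) (pdisc r)" for k
    by (rule shol_compose[OF shol_jac_nth[OF St_hol] hol_jn[OF hol_const hol_id]])
       (use r_pos in \<open>auto simp: jn_pdisc\<close>)
  then show "shol (\<lambda>y. Y j b y $ i) (pdisc r)"
    by (simp add: Y_def matrix_vector_mult_def e shol_sum shol_mult shol_const)
qed simp

lemma Y_linear: "Y j b y = (\<Sum>a\<in>UNIV. b $ a *s Y j (axis a 1) y)"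
proof -
  have "Y j (axis a 1) y $ i = jac (\<lambda>s. St j s y) 0 $ i $ a" for a i
    by (simp add: Y_def matrix_vector_mult_def axis_def if_distrib cong: if_cong)
  then show ?thesis unfolding Y_def by (simp add: vec_eq_iff matrix_vector_mult_def mult.commute)
qed

text \<open>The group law turns differentiation at time \<open>t\<close> into differentiation at
  time 0 from the point reached.\<close>

lemma flow_curve:
  assumes s: "s \<in> pdisc r" and y: "y \<in> pdisc r" and t: "\<bar>t\<bar> \<le> 1" and c: "St j (complex_of_real t *s s) y \<in> pdisc r"
  shows "((\<lambda>t. St j (complex_of_real t *s s) y) has_vector_derivative Y j s (St j (complex_of_real t *s s) y)) (at t within S)"
proof -
  let ?c = "St j (complex_of_real t *s s) y"
  have ts: "complex_of_real t *s s \<in> pdisc r" using pdisc_smult[OF s, of "complex_of_real t"] t by simp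
  have 1: "((\<lambda>h. complex_of_real (h - t)) has_derivative complex_of_real) (at t)"
    by (auto intro!: derivative_eq_intros)
  have "((\<lambda>h. St j (complex_of_real (h - t) *s s) ?c) has_derivative (\<lambda>h. complex_of_real h *s Y j s ?c)) (at t)"
    by (rule has_derivative_compose[OF 1]) (use St_line_derivative[OF c, of j s] in simp)
  then have D: "((\<lambda>h. St j (complex_of_real (h - t) *s s) ?c) has_vector_derivative Y j s ?c) (at t)"
    by (simp add: has_vector_derivative_def scaleR_vec_smult)
  let ?W = "(\<lambda>h. complex_of_real h *s s) -` pdisc r \<inter> (\<lambda>h. complex_of_real (h - t) *s s) -` pdisc r"
  have op: "open ?W"
    by (intro open_Int open_vimage open_pdisc continuous_on_compose2[OF linear_continuous_on[OF bounded_linear_smult_left]])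
       (auto intro!: continuous_intros)
  have tW: "t \<in> ?W" using ts r_pos by simp
  have "((\<lambda>t. St j (complex_of_real t *s s) y) has_vector_derivative Y j s ?c) (at t)"
  proof (rule has_vector_derivative_transform_within_open[OF D op tW])
    fix h assume h: "h \<in> ?W"
    have "complex_of_real h *s s = complex_of_real (h - t) *s s + complex_of_real t *s s"
      by (simp add: vec.scale_left_diff_distrib)
    then show "St j (complex_of_real (h - t) *s s) ?c = St j (complex_of_real h *s s) y"
      using St_add[of "complex_of_real (h - t) *s s" "complex_of_real t *s s" y j] h ts y c by simp
  qed
  then show ?thesis by (rule has_vector_derivative_at_within)
qed

lemma dirD_new:
  assumes "F Q k \<theta> \<in> pdisc r"
  shows "dirD (F Q (Suc k)) (\<theta>(k := 0)) (\<lambda>j. if j = k then b else 0) = Y k b (F Q k \<theta>)"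
proof -
  have "F Q k (\<lambda>j. (\<theta>(k := 0)) j + s *s (if j = k then b else 0)) = F Q k \<theta>" for s
    by (rule chain_cong) auto
  then show ?thesis unfolding dirD_def using deriv_vec[OF St_line_derivative[OF assms, of k b]] by simp
qed

lemma dirD_old:
  assumes s: "small k \<delta>" "Q \<in> pdisc \<delta>" "\<theta> \<in> chain_dom k \<delta>"
  shows "dirD (F Q (Suc k)) (\<theta>(k := 0)) (e(k := 0)) = dirD (F Q k) \<theta> e"
proof -
  let ?W = "{l. (\<lambda>i. \<theta> i + l *s e i) \<in> chain_dom k \<delta>}"
  have "((\<lambda>l. F Q (Suc k) (\<lambda>j. (\<theta>(k := 0)) j + l *s (e(k := 0)) j)) has_derivative (\<lambda>s. s *s dirD (F Q k) \<theta> e)) (at 0)"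
  proof (rule has_derivative_transform_within_open[OF chain_line_deriv[OF s] line_dom(1)])
    show "0 \<in> ?W" using s by simp
    fix l assume l: "l \<in> ?W"
    have "F Q k (\<lambda>j. (\<theta>(k := 0)) j + l *s (e(k := 0)) j) = F Q k (\<lambda>j. \<theta> j + l *s e j)"
      by (rule chain_cong) auto
    moreover have "F Q k (\<lambda>j. \<theta> j + l *s e j) \<in> pdisc r" using smallD[OF s(1,2)] l by simp
    ultimately show "F Q k (\<lambda>j. \<theta> j + l *s e j) = F Q (Suc k) (\<lambda>j. (\<theta>(k := 0)) j + l *s (e(k := 0)) j)"
      using St_zero by simp
  qed
  from deriv_vec[OF this] show ?thesis by (simp add: dirD_def)
qed

text \<open>By the group law, varying the last parameter is a further step from the end point. Hence
  the generator of the last family lies in the column space at the end point.\<close>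

lemma dirD_last:
  assumes s: "small (Suc k) \<delta>" "Q \<in> pdisc \<delta>" "\<theta> \<in> chain_dom (Suc k) \<delta>"
  shows "dirD (F Q (Suc k)) \<theta> (\<lambda>j. if j = k then b else 0) = Y k b (F Q (Suc k) \<theta>)"
proof -
  let ?y = "F Q (Suc k) \<theta>"
  have y: "?y \<in> pdisc r" "F Q k \<theta> \<in> pdisc r" using smallD[OF s, of "Suc k"] smallD[OF s, of k] by auto
  have tk: "\<theta> k \<in> pdisc r" using s(3) pdisc_mono[OF small_le[OF s(1)]] by (auto simp: chain_dom_def)
  let ?W = "(\<lambda>l. l *s b) -` pdisc r \<inter> (\<lambda>l. \<theta> k + l *s b) -` pdisc r"
  have op: "open ?W"
    by (intro open_Int open_vimage open_pdisc continuous_on_add continuous_on_const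
        linear_continuous_on[OF bounded_linear_smult_left])
  have "((\<lambda>l. F Q (Suc k) (\<lambda>j. \<theta> j + l *s (if j = k then b else 0))) has_derivative (\<lambda>s. s *s Y k b ?y)) (at 0)"
  proof (rule has_derivative_transform_within_open[OF St_line_derivative[OF y(1)] op])
    show "0 \<in> ?W" using tk r_pos by simp
    fix l assume l: "l \<in> ?W"
    have "F Q k (\<lambda>j. \<theta> j + l *s (if j = k then b else 0)) = F Q k \<theta>" by (rule chain_cong) auto
    then show "St k (l *s b) ?y = F Q (Suc k) (\<lambda>j. \<theta> j + l *s (if j = k then b else 0))"
      using St_add[of "l *s b" "\<theta> k" "F Q k \<theta>" k] l tk y by (simp add: add.commute)
  qed
  from deriv_vec[OF this] show ?thesis by (simp add: dirD_def)
qed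

text \<open>The last step factors into a step with parameter near 0 followed by the holomorphic step
  with the fixed parameter \<open>\<theta> k\<close>, and the latter cannot raise the rank. Setting
  the last parameter to 0 thus loses nothing; this shortens the final submersion from
  \<open>2 * \<mu> + 1\<close> to \<open>2 * \<mu> - 1\<close> steps.\<close>

lemma rk_zero_last:
  assumes s: "small (Suc k) \<delta>" "Q \<in> pdisc \<delta>" "\<theta> \<in> chain_dom (Suc k) \<delta>"
  shows "rk (F Q (Suc k)) \<theta> \<le> rk (F Q (Suc k)) (\<theta>(k := 0))"
proof (rule rk_le_chain[OF s(1,2)])
  have tk: "\<theta> k \<in> pdisc r" using s(3) pdisc_mono[OF small_le[OF s(1)]] by (auto simp: chain_dom_def)
  show dom: "\<theta>(k := 0) \<in> chain_dom (Suc k) \<delta>" using s(3) small_pos[OF s(1)] by (auto simp: chain_dom_def)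
  show "hol (St k (\<theta> k)) (pdisc r)" by (rule St_hol_right[OF tk])
  show "F Q (Suc k) (\<theta>(k := 0)) \<in> pdisc r" using smallD[OF s(1,2) dom] by blast
  fix e :: "nat \<Rightarrow> complex^'q"
  let ?W = "{l. (\<lambda>i. \<theta> i + l *s e i) \<in> chain_dom (Suc k) \<delta>} \<inter> (\<lambda>l. l *s e k) -` pdisc r"
  have op: "open ?W"
    by (intro open_Int line_dom(1) open_vimage open_pdisc linear_continuous_on[OF bounded_linear_smult_left])
  have "F Q (Suc k) (\<lambda>j. \<theta> j + l *s e j) = St k (\<theta> k) (F Q (Suc k) (\<lambda>j. (\<theta>(k := 0)) j + l *s e j))" if l: "l \<in> ?W" for l
  proof -
    let ?y = "F Q k (\<lambda>j. \<theta> j + l *s e j)"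
    have "F Q k (\<lambda>j. (\<theta>(k := 0)) j + l *s e j) = ?y" by (rule chain_cong) auto
    moreover have y: "?y \<in> pdisc r" using smallD[OF s(1,2), of _ k] l by simp
    moreover have tl: "\<theta> k + l *s e k \<in> pdisc r" using l pdisc_mono[OF small_le[OF s(1)]] by (auto simp: chain_dom_def)
    have "St k (\<theta> k + l *s e k) ?y = St k (\<theta> k) (St k (l *s e k) ?y)"
    proof -
      \<comment> \<open>The end point of the full step is known to lie in the domain, so the group
        law is applied to \<open>- \<theta> k\<close> after
        \<open>\<theta> k + l *s e k\<close>.\<close>
      have "St k (l *s e k) ?y = St k (- \<theta> k) (St k (\<theta> k + l *s e k) ?y)" 
      proof -
        have "St k (\<theta> k + l *s e k) ?y \<in> pdisc r" using smallD[OF s(1,2), of "\<lambda>i. \<theta> i + l *s e i" "Suc k"] l by simp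
        then show ?thesis using St_add[of "- \<theta> k" "\<theta> k + l *s e k" ?y k] tk tl y l by simp
      qed
      moreover have "St k (- (- \<theta> k)) (St k (- \<theta> k) (St k (\<theta> k + l *s e k) ?y)) = St k (\<theta> k + l *s e k) ?y"
        by (rule St_inv) (use tk smallD[OF s(1,2), of "\<lambda>i. \<theta> i + l *s e i" "Suc k"] l in auto)
      ultimately show ?thesis by simp
    qed
    ultimately show ?thesis by simp
  qed
  moreover have "0 \<in> ?W" using s(3) r_pos by simp
  ultimately show "\<exists>e'. \<exists>W. open W \<and> 0 \<in> W \<and> (\<forall>l\<in>W. F Q (Suc k) (\<lambda>j. \<theta> j + l *s e j) = St k (\<theta> k) (F Q (Suc k) (\<lambda>j. (\<theta>(k := 0)) j + l *s e' j)))"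
    using op by (intro exI[of _ e] exI[of _ ?W]) auto
qed

end

section \<open>Submanifolds invariant under both families of flows\<close>

context flow_sys begin

text \<open>Local coordinates \<open>H\<close> in which the common zero set of the components
  outside \<open>I\<close> is an invariant submanifold through \<open>P\<close> of dimension
  \<open>card I\<close>. Invariance is stated for curves with arbitrary bounded coefficients
  \<open>a\<close> and \<open>b\<close>, so that it covers flow lines as well as integral curves of
  merely continuous sections.\<close>

definition straightening :: "complex^'n \<Rightarrow> (complex^'n) set \<Rightarrow> (complex^'n \<Rightarrow> complex^'n) \<Rightarrow> 'n set \<Rightarrow> bool" where
  "straightening P V H I \<longleftrightarrow> open V \<and> P \<in> V \<and> V \<subseteq> pdisc r \<and> hol H V \<and> (\<forall>y\<in>V. det (jac H y) \<noteq> 0) \<and>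
     (\<forall>i. i \<notin> I \<longrightarrow> H P $ i = 0) \<and>
     (\<forall>c a b T K. (\<forall>t\<in>{0..T}. c t \<in> V \<and> norm (a t) \<le> K \<and> norm (b t) \<le> K \<and>
          (c has_vector_derivative (Y 0 (a t) (c t) + Y 1 (b t) (c t))) (at t within {0..T})) \<and>
        (\<forall>i. i \<notin> I \<longrightarrow> H (c 0) $ i = 0) \<longrightarrow>
        (\<forall>t\<in>{0..T::real}. \<forall>i. i \<notin> I \<longrightarrow> H (c t) $ i = 0))"

lemma Y_lipschitz:
  assumes G: "hol G U" "\<And>u. u \<in> U \<Longrightarrow> G u \<in> pdisc r" and K: "compact K" "K \<subseteq> U" "convex K"
  obtains L where "L \<ge> 0"
    "\<And>b u v. u \<in> K \<Longrightarrow> v \<in> K \<Longrightarrow> norm (Y j b (G u) - Y j b (G v)) \<le> L * norm b * norm (u - v)"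
proof -
  have "\<exists>L\<ge>0. \<forall>u\<in>K. \<forall>v\<in>K. norm (Y j (axis a 1) (G u) - Y j (axis a 1) (G v)) \<le> L * norm (u - v)" for a
  proof -
    have "hol (\<lambda>u. Y j (axis a 1) (G u)) U"
      by (rule hol_compose[OF Y_hol G(1)]) (use G(2) in auto)
    from hol_lipschitz[OF this K] show ?thesis by metis
  qed
  then obtain L where L: "\<And>a. L a \<ge> 0"
    "\<And>a u v. u \<in> K \<Longrightarrow> v \<in> K \<Longrightarrow> norm (Y j (axis a 1) (G u) - Y j (axis a 1) (G v)) \<le> L a * norm (u - v)"
    by metis
  show ?thesis
  proof (rule that[of "sum L UNIV"])
    show "0 \<le> sum L UNIV" using L by (simp add: sum_nonneg)
    fix b :: "complex^'q" and u v assume uv: "u \<in> K" "v \<in> K"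
    have "Y j b (G u) - Y j b (G v) = (\<Sum>a\<in>UNIV. b $ a *s (Y j (axis a 1) (G u) - Y j (axis a 1) (G v)))"
      by (subst (1 2) Y_linear) (simp add: sum_subtractf vec.scale_right_diff_distrib)
    also have "norm \<dots> \<le> (\<Sum>a\<in>UNIV. norm b * (L a * norm (u - v)))"
      by (intro sum_norm_le, unfold norm_smult) (intro mult_mono L uv Finite_Cartesian_Product.norm_nth_le, auto)
    also have "\<dots> = sum L UNIV * norm b * norm (u - v)"
      by (simp add: sum_distrib_left sum_distrib_right mult_ac)
    finally show "norm (Y j b (G u) - Y j b (G v)) \<le> sum L UNIV * norm b * norm (u - v)" .
  qed
qed

text \<open>The rank is maximal at \<open>\<theta>0\<close>, so the image of the chain is a
  submanifold of dimension \<rho> there. It is tangent to the field of the last step, and also to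
  that of the next step, because the longer chain with last parameter 0 has the same end point and
  all the old columns, yet no larger rank. Gronwall's inequality keeps curves with such velocities
  on the submanifold.\<close>

lemma straightening_exists:
  assumes s: "small (Suc (Suc k)) \<delta>" and Q: "Q \<in> pdisc \<delta>"
    and r1: "\<And>\<theta>. \<theta> \<in> chain_dom (Suc k) \<delta> \<Longrightarrow> rk (F Q (Suc k)) \<theta> \<le> \<rho>"
    and r2: "\<And>\<theta>. \<theta> \<in> chain_dom (Suc (Suc k)) \<delta> \<Longrightarrow> rk (F Q (Suc (Suc k))) \<theta> \<le> \<rho>"
    and \<theta>0: "\<theta>0 \<in> chain_dom (Suc k) \<delta>" and rk0: "rk (F Q (Suc k)) \<theta>0 \<ge> \<rho>"
  obtains V H I where "straightening (F Q (Suc k) \<theta>0) V H I" "card I = \<rho>"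
proof -
  let ?F = "F Q (Suc k)"
  have s1: "small (Suc k) \<delta>" by (rule small_len[OF s]) simp
  obtain I f where I: "card I = \<rho>" "\<And>j. j \<in> I \<Longrightarrow> f j \<in> range (dirD ?F \<theta>0)" "det (colmat f) \<noteq> 0"
    using exists_colmat rk0 unfolding rk_def by metis
  have "\<forall>j. \<exists>e. j \<in> I \<longrightarrow> f j = dirD ?F \<theta>0 e" using I(2) by blast
  then obtain d0 where d0: "\<And>j. j \<in> I \<Longrightarrow> f j = dirD ?F \<theta>0 (d0 j)" by metis
  define d where "d j = (if j \<in> I then d0 j else (\<lambda>_. 0))" for j
  define A where "A = colmat (\<lambda>j. if j \<in> I then 0 else f j)"
  define col where "col u j = (if j \<in> I then dirD ?F (lin \<theta>0 d u) (d0 j) else f j)" for u j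
  \<comment> \<open>The coordinates in \<open>I\<close> move along the chain, the others along the
    constant columns completing the tangent space to a basis; hence \<open>G\<close> is a local
    biholomorphism.\<close>
  define G where "G u = ?F (lin \<theta>0 d u) + A *v u" for u
  define U0 where "U0 = {u. lin \<theta>0 d u \<in> chain_dom (Suc k) \<delta>}"
  have hF: "hol (\<lambda>u. ?F (lin \<theta>0 d u)) U0" unfolding U0_def by (rule chain_hol[OF s1 Q])
  have oU0: "open U0" using hol_open[OF hF] .
  have hG: "hol G U0" unfolding G_def by (intro hol_add hF hol_matrix_vector oU0)
  have jG: "jac G u = colmat (col u)" if u: "u \<in> U0" for u
  proof (rule jac_unique)
    have "(G has_derivative (\<lambda>h. jac (\<lambda>u. ?F (lin \<theta>0 d u)) u *v h + A *v h)) (at u)"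
      unfolding G_def by (intro has_derivative_add hol_jac[OF hF u] bounded_linear_imp_has_derivative matrix_vector_mul_bounded_linear)
    moreover have "jac (\<lambda>u. ?F (lin \<theta>0 d u)) u + A = colmat (col u)"
      unfolding jac_lin by (simp add: A_def col_def colmat_def vec_eq_iff d_def dirD_0 del: chain.simps)
    ultimately show "(G has_derivative (*v) (colmat (col u))) (at u)"
      by (simp add: matrix_vector_mult_add_rdistrib[symmetric])
  qed
  have 0: "0 \<in> U0" using \<theta>0 by (simp add: U0_def)
  have col0: "col 0 = f" using d0 by (auto simp: col_def)
  define U1 where "U1 = U0 \<inter> G -` pdisc r"
  have oU1: "open U1" unfolding U1_def using hol_continuous_on[OF hG] oU0
    by (simp add: continuous_on_open_vimage Int_commute)
  have G0: "G 0 = ?F \<theta>0" by (simp add: G_def)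
  have 01: "0 \<in> U1" using 0 smallD[OF s1 Q \<theta>0, of "Suc k"] G0 by (simp add: U1_def)
  have hG1: "hol G U1" by (rule hol_subset[OF hG oU1]) (auto simp: U1_def)
  obtain U' V' H where inv: "open U'" "U' \<subseteq> U1" "0 \<in> U'" "open V'" "G 0 \<in> V'" "homeomorphism U' V' G H"
    "hol H V'" "\<And>y. y \<in> V' \<Longrightarrow> jac G (H y) ** jac H y = mat 1"
    using hol_inverse_function[OF hG1 01] jG[OF 0] I(3) col0 by metis
  obtain \<eta>2 where \<eta>2: "\<eta>2 > 0" "pdisc \<eta>2 \<subseteq> U'" using pdisc_nbhd[OF inv(1,3)] .
  \<comment> \<open>Halving the radius puts the closed polydisc inside \<open>U'\<close>; its
    compactness supplies the bounds on \<open>jac H\<close> and the Lipschitz constants.\<close>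
  define \<eta> where "\<eta> = \<eta>2 / 2"
  have \<eta>: "\<eta> > 0" "closure (pdisc \<eta>) \<subseteq> U'"
    using \<eta>2 closure_pdisc_subset[of \<eta> \<eta>2] by (auto simp: \<eta>_def)
  have GH: "\<And>u. u \<in> U' \<Longrightarrow> H (G u) = u" "\<And>y. y \<in> V' \<Longrightarrow> G (H y) = y" "\<And>u. u \<in> U' \<Longrightarrow> G u \<in> V'" "\<And>y. y \<in> V' \<Longrightarrow> H y \<in> U'"
    using inv(6) by (auto simp: homeomorphism_def)
  define V where "V = V' \<inter> H -` pdisc \<eta>"
  have oV: "open V" unfolding V_def using hol_continuous_on[OF inv(7)] inv(4)
    by (simp add: continuous_on_open_vimage Int_commute)
  have PV: "?F \<theta>0 \<in> V" using GH(1)[OF inv(3)] inv(5) G0 \<eta> by (simp add: V_def)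
  have VV': "V \<subseteq> V'" by (auto simp: V_def)
  have Vr: "V \<subseteq> pdisc r"
  proof
    fix y assume "y \<in> V"
    then have "H y \<in> U1" "G (H y) = y" using GH inv(2) by (auto simp: V_def)
    then show "y \<in> pdisc r" by (auto simp: U1_def)
  qed
  have detH: "det (jac H y) \<noteq> 0" if "y \<in> V" for y
    using inv(8)[of y] that VV' by (metis det_I det_mul mult_zero_right subsetD zero_neq_one)
  let ?K = "closure (pdisc \<eta>) :: (complex^'n) set"
  have cK: "compact (G ` ?K)" "G ` ?K \<subseteq> V'"
  proof -
    have "continuous_on ?K G" using hol_continuous_on[OF hG1] \<eta>(2) inv(2) continuous_on_subset by (metis subset_trans)
    then show "compact (G ` ?K)" using compact_closure_pdisc compact_continuous_image by blast
    show "G ` ?K \<subseteq> V'" using \<eta>(2) GH(3) by auto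
  qed
  obtain B where B: "B \<ge> 0" "\<And>y. y \<in> G ` ?K \<Longrightarrow> mnorm (jac H y) \<le> B"
    using hol_jac_bound[OF inv(7) cK] by blast
  have lip: "\<exists>L\<ge>0. \<forall>b u v. u \<in> ?K \<longrightarrow> v \<in> ?K \<longrightarrow> norm (Y j b (G u) - Y j b (G v)) \<le> L * norm b * norm (u - v)" for j
    using Y_lipschitz[OF hG1 _ compact_closure_pdisc _ convex_closure_pdisc, of \<eta> j] \<eta>(2) inv(2)
    by (smt (verit, best) IntD2 U1_def subset_trans vimageD)
  obtain L0 where L0: "L0 \<ge> 0" "\<And>b u v. u \<in> ?K \<Longrightarrow> v \<in> ?K \<Longrightarrow> norm (Y 0 b (G u) - Y 0 b (G v)) \<le> L0 * norm b * norm (u - v)"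
    using lip[of 0] by blast
  obtain L1 where L1: "L1 \<ge> 0" "\<And>b u v. u \<in> ?K \<Longrightarrow> v \<in> ?K \<Longrightarrow> norm (Y 1 b (G u) - Y 1 b (G v)) \<le> L1 * norm b * norm (u - v)"
    using lip[of 1] by blast
  \<comment> \<open>Projection to the coordinates in \<open>I\<close>. It leaves the chain
    parameters unchanged and removes the transversal part, so \<open>G (msk u)\<close> lies on the
    image of the chain.\<close>
  define msk where "msk u = (\<chi> i. if i \<in> I then u $ i else 0)" for u :: "complex^'n"
  have linmsk: "lin \<theta>0 d (msk u) = lin \<theta>0 d u" for u
    unfolding lin_def msk_def d_def by (auto simp: fun_eq_iff intro!: sum.cong)
  have Amsk: "A *v msk u = 0" for u
    unfolding A_def colmat_mult msk_def by (rule sum.neutral) auto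
  have mskp: "msk u \<in> pdisc \<eta>" if "u \<in> pdisc \<eta>" for u using that \<eta>(1) by (auto simp: pdisc_def msk_def)
  have pU: "u \<in> pdisc \<eta> \<Longrightarrow> u \<in> U' \<and> u \<in> U0" for u using \<eta>(2) inv(2) closure_subset by (auto simp: U1_def)
  have tang: "Y j b (G (msk u)) \<in> vec.span (col u ` I)" if u: "u \<in> pdisc \<eta>" for u j b
  proof -
    let ?\<theta> = "lin \<theta>0 d u"
    have \<theta>: "?\<theta> \<in> chain_dom (Suc k) \<delta>" using pU[OF u] by (simp add: U0_def)
    have Gm: "G (msk u) = ?F ?\<theta>" by (simp add: G_def linmsk Amsk)
    have det: "det (colmat (col u)) \<noteq> 0"
    proof -
      have "jac G u ** jac H (G u) = mat 1" using inv(8)[OF GH(3), of u] GH(1) pU[OF u] by simp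
      then have "det (jac G u) \<noteq> 0" by (metis det_I det_mul mult_zero_left zero_neq_one)
      then show ?thesis using jG pU[OF u] by simp
    qed
    have cI: "col u j = dirD ?F ?\<theta> (d0 j)" if "j \<in> I" for j using that by (simp add: col_def)
    have S1: "range (dirD ?F ?\<theta>) \<subseteq> vec.span (col u ` I)"
      by (rule span_colmat[OF det]) (use cI r1[OF \<theta>] I(1) in \<open>auto simp: rk_def\<close>)
    have "dirD ?F ?\<theta> (\<lambda>j. if j = k then b else 0) = Y k b (?F ?\<theta>)" by (rule dirD_last[OF s1 Q \<theta>])
    then have k1: "Y k b (?F ?\<theta>) \<in> vec.span (col u ` I)" using S1 by (metis rangeI subsetD)
    \<comment> \<open>One more step with parameter 0: the old columns persist, so the rank bound
      \<rho> forces the generator of the new step into their span.\<close>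
    let ?F2 = "F Q (Suc (Suc k))" and ?\<theta>2 = "?\<theta>(Suc k := 0)"
    have \<theta>2: "?\<theta>2 \<in> chain_dom (Suc (Suc k)) \<delta>" using \<theta> small_pos[OF s] by (auto simp: chain_dom_def)
    have S2: "range (dirD ?F2 ?\<theta>2) \<subseteq> vec.span (col u ` I)"
    proof (rule span_colmat[OF det])
      show "col u j \<in> range (dirD ?F2 ?\<theta>2)" if "j \<in> I" for j
        using dirD_old[OF s1 Q \<theta>, of "d0 j"] cI[OF that] by (metis rangeI)
    qed (use r2[OF \<theta>2] I(1) in \<open>auto simp: rk_def\<close>)
    have "dirD ?F2 ?\<theta>2 (\<lambda>j. if j = Suc k then b else 0) = Y (Suc k) b (?F ?\<theta>)"
      by (rule dirD_new) (use smallD[OF s1 Q \<theta>, of "Suc k"] in simp)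
    then have k2: "Y (Suc k) b (?F ?\<theta>) \<in> vec.span (col u ` I)" using S2 by (metis rangeI subsetD)
    show ?thesis
      using k1 k2 Y_par[of j k] Y_par[of j "Suc k"] unfolding Gm by (cases "even (j + k)") auto
  qed
  have curve: "\<forall>t\<in>{0..T}. \<forall>i. i \<notin> I \<longrightarrow> H (c t) $ i = 0"
    if c: "\<forall>t\<in>{0..T}. c t \<in> V \<and> norm (a t) \<le> K \<and> norm (b t) \<le> K \<and>
          (c has_vector_derivative (Y 0 (a t) (c t) + Y 1 (b t) (c t))) (at t within {0..T})"
      and i0: "\<forall>i. i \<notin> I \<longrightarrow> H (c 0) $ i = 0" for c a b T K
  proof (intro ballI)
    fix t0 assume t0: "t0 \<in> {0..T}"
    \<comment> \<open>The transversal part of the curve in the coordinates \<open>H\<close>, to be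
      shown to vanish.\<close>
    define z where "z t = H (c t) - msk (H (c t))" for t
    define w where "w t = jac H (c t) *v (Y 0 (a t) (c t) + Y 1 (b t) (c t))" for t
    define C where "C = B * ((L0 + L1) * K)"
    have K0: "0 \<le> K" using c t0 by (meson norm_ge_zero order_trans)
    have blm: "bounded_linear (\<lambda>u. u - msk u)"
    proof -
      have "(\<lambda>u::complex^'n. u - msk u) = (\<lambda>u. (\<chi> i j. if i = j \<and> i \<notin> I then 1 else 0) *v u)"
        by (auto simp: fun_eq_iff vec_eq_iff msk_def matrix_vector_mult_def if_distrib if_distribR sum.delta cong: if_cong)
      then show ?thesis by (simp only: matrix_vector_mul_bounded_linear)
    qed
    have nm: "norm (x - msk x) \<le> norm x" for x
      unfolding norm_vec_def by (rule L2_set_mono) (auto simp: msk_def)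
    have "z t0 = 0"
    proof (rule gronwall_zero[where T = T and K = C and z' = "\<lambda>t. w t - msk (w t)"])
      fix t assume t: "t \<in> {0..T}"
      have ct: "c t \<in> V" "norm (a t) \<le> K" "norm (b t) \<le> K"
        and D: "(c has_derivative (\<lambda>x. x *\<^sub>R (Y 0 (a t) (c t) + Y 1 (b t) (c t)))) (at t within {0..T})"
        using c t by (auto simp: has_vector_derivative_def)
      have "((\<lambda>t. H (c t)) has_derivative (\<lambda>x. jac H (c t) *v (x *\<^sub>R (Y 0 (a t) (c t) + Y 1 (b t) (c t))))) (at t within {0..T})"
        by (rule has_derivative_compose[OF D hol_jac[OF inv(7)]]) (use ct VV' in auto)
      then have "((\<lambda>t. H (c t)) has_vector_derivative w t) (at t within {0..T})"
        by (simp only: has_vector_derivative_def w_def scaleR_vec_smult vector_scalar_commute)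
      then show "(z has_vector_derivative (w t - msk (w t))) (at t within {0..T})"
        unfolding z_def by (rule bounded_linear.has_vector_derivative[OF blm])
      define u where "u = H (c t)"
      have u: "u \<in> pdisc \<eta>" "G u = c t" using ct(1) GH(2) by (auto simp: V_def u_def)
      let ?X = "\<lambda>y. Y 0 (a t) y + Y 1 (b t) y"
      have "?X (G (msk u)) \<in> vec.span (col u ` I)" by (intro vec.span_add tang u)
      then obtain w' where w': "?X (G (msk u)) = colmat (col u) *v w'" "\<And>j. j \<notin> I \<Longrightarrow> w' $ j = 0"
        using span_image_colmat by blast
      have "jac G u ** jac H (c t) = mat 1" using inv(8)[of "c t"] ct(1) VV' u_def by auto
      then have inv': "jac H (c t) ** jac G u = mat 1" by (simp add: matrix_left_right_inverse)
      have jGu: "jac G u = colmat (col u)" using jG pU[OF u(1)] by simp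
      have e1: "jac H (c t) *v ?X (G (msk u)) = w'"
      proof -
        have "jac H (c t) *v ?X (G (msk u)) = jac H (c t) *v (colmat (col u) *v w')"
          by (rule arg_cong[OF w'(1)])
        also have "\<dots> = w'" unfolding jGu[symmetric] matrix_vector_mul_assoc inv' by simp
        finally show ?thesis .
      qed
      \<comment> \<open>At the projected point the velocity is tangent, so its image
        \<open>w'\<close> has no transversal part. What remains is the change of the velocity
        between \<open>G (msk u)\<close> and \<open>G u\<close>, bounded by a constant times the
        transversal part of \<open>u\<close>.\<close>
      define q where "q = jac H (c t) *v (?X (G u) - ?X (G (msk u)))"
      have "q = jac H (c t) *v ?X (G u) - w'" unfolding q_def matrix_vector_mult_diff_distrib e1 ..
      moreover have "w t = jac H (c t) *v ?X (G u)" unfolding w_def u(2) ..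
      ultimately have wq: "w t = q + w'" by (simp only: diff_add_cancel)
      have "msk w' = w'" using w'(2) by (auto simp: msk_def vec_eq_iff)
      moreover have "msk (q + w') = msk q + msk w'" by (simp add: msk_def vec_eq_iff)
      ultimately have "w t - msk (w t) = q - msk q" unfolding wq by simp
      then have "norm (w t - msk (w t)) \<le> norm q" using nm by simp
      also have "norm q \<le> mnorm (jac H (c t)) * norm (?X (G u) - ?X (G (msk u)))"
        unfolding q_def by (rule norm_matrix_vector_le)
      also have "\<dots> \<le> B * ((L0 + L1) * K * norm (u - msk u))"
      proof (rule mult_mono)
        show "mnorm (jac H (c t)) \<le> B" by (rule B(2)) (use u closure_subset in \<open>metis imageI subsetD\<close>)
        have uK: "u \<in> ?K" "msk u \<in> ?K" using u(1) mskp closure_subset by (metis subsetD)+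
        have "?X (G u) - ?X (G (msk u)) = (Y 0 (a t) (G u) - Y 0 (a t) (G (msk u))) + (Y 1 (b t) (G u) - Y 1 (b t) (G (msk u)))" by simp
        also have "norm \<dots> \<le> L0 * norm (a t) * norm (u - msk u) + L1 * norm (b t) * norm (u - msk u)"
          by (rule order_trans[OF norm_triangle_ineq add_mono[OF L0(2)[OF uK] L1(2)[OF uK]]])
        also have "\<dots> \<le> L0 * K * norm (u - msk u) + L1 * K * norm (u - msk u)"
          using ct L0(1) L1(1) by (intro add_mono mult_right_mono mult_left_mono) auto
        finally show "norm (?X (G u) - ?X (G (msk u))) \<le> (L0 + L1) * K * norm (u - msk u)"
          by (simp add: algebra_simps)
      qed (use B(1) in auto)
      finally show "norm (w t - msk (w t)) \<le> C * norm (z t)" by (simp add: C_def z_def u_def)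
    next
      show "z 0 = 0" using i0 by (simp add: z_def msk_def vec_eq_iff)
    qed (rule t0)
    moreover have "z t0 $ i = H (c t0) $ i" if "i \<notin> I" for i using that by (simp add: z_def msk_def)
    ultimately show "\<forall>i. i \<notin> I \<longrightarrow> H (c t0) $ i = 0" by simp
  qed
  have "straightening (?F \<theta>0) V H I"
    unfolding straightening_def
  proof (intro conjI oV PV Vr ballI detH)
    show "hol H V" by (rule hol_subset[OF inv(7) oV VV'])
    show "\<forall>i. i \<notin> I \<longrightarrow> H (?F \<theta>0) $ i = 0" using GH(1)[OF inv(3)] G0 by simp
    show "\<forall>c a b T K. (\<forall>t\<in>{0..T}. c t \<in> V \<and> norm (a t) \<le> K \<and> norm (b t) \<le> K \<and>
          (c has_vector_derivative (Y 0 (a t) (c t) + Y 1 (b t) (c t))) (at t within {0..T})) \<and>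
        (\<forall>i. i \<notin> I \<longrightarrow> H (c 0) $ i = 0) \<longrightarrow> (\<forall>t\<in>{0..T::real}. \<forall>i. i \<notin> I \<longrightarrow> H (c t) $ i = 0)"
      using curve by blast
  qed
  then show ?thesis using that I(1) by blast
qed

end

section \<open>Straightening and stabilisation of the generic rank\<close>

context chain_sys begin

text \<open>A determinant containing \<open>Suc \<rho>\<close> columns of the chain that is nonzero
  at \<eta> is, by the identity theorem on the complex line through \<eta>, nonzero at some small
  positive multiple of \<eta>, where the bound \<open>le\<close> is available.\<close>

lemma rk_bound_extend:
  assumes s: "small k \<delta>" and Q: "Q \<in> pdisc \<delta>" and \<delta>': "\<delta>' > 0"
    and le: "\<And>\<eta>. \<eta> \<in> chain_dom k \<delta>' \<Longrightarrow> rk (F Q k) \<eta> \<le> \<rho>" and \<eta>: "\<eta> \<in> chain_dom k \<delta>"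
  shows "rk (F Q k) \<eta> \<le> \<rho>"
proof (rule ccontr)
  assume "\<not> ?thesis"
  then have "Suc \<rho> \<le> vec.dim (range (dirD (F Q k) \<eta>))" by (simp add: rk_def)
  then obtain I f where I: "card I = Suc \<rho>" "\<And>j. j \<in> I \<Longrightarrow> f j \<in> range (dirD (F Q k) \<eta>)" "det (colmat f) \<noteq> 0"
    using exists_colmat by metis
  have "\<forall>j. \<exists>e. j \<in> I \<longrightarrow> f j = dirD (F Q k) \<eta> e" using I(2) by blast
  then obtain d where d: "\<And>j. j \<in> I \<Longrightarrow> f j = dirD (F Q k) \<eta> (d j)" by metis
  have eq: "(\<lambda>j. if j \<in> I then dirD (F Q k) (\<lambda>i. 0 + 1 *s \<eta> i) (d j) else f j) = f" using d by auto
  \<comment> \<open>Scaling by less than this factor maps the polydisc of radius \<delta> into that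
    of radius \<delta>'.\<close>
  define e where "e = min \<delta>' \<delta> / \<delta>"
  have e0: "e > 0" using \<delta>' small_pos[OF s] by (simp add: e_def)
  obtain t where t: "0 < t" "t < e"
    "det (colmat (\<lambda>j. if j \<in> I then dirD (F Q k) (\<lambda>i. 0 + complex_of_real t *s \<eta> i) (d j) else f j)) \<noteq> 0"
    by (rule det_nonzero_near[OF s Q, of "\<lambda>i. 0" 1 \<eta> I d f e])
       (use \<eta> eq I(3) small_pos[OF s] e0 in \<open>auto simp: chain_dom_def\<close>)
  let ?\<theta> = "\<lambda>i. 0 + complex_of_real t *s \<eta> i"
  have "?\<theta> \<in> chain_dom k \<delta>'"
  proof -
    have "norm (t * x) < \<delta>'" if "norm x < \<delta>" for x :: complex
    proof -
      have "t * norm x \<le> t * \<delta>" using that t by (intro mult_left_mono) auto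
      also have "\<dots> < e * \<delta>" using t small_pos[OF s] by (intro mult_strict_right_mono) auto
      also have "\<dots> \<le> \<delta>'" using small_pos[OF s] by (simp add: e_def)
      finally show ?thesis using t by (simp add: norm_mult)
    qed
    then show ?thesis using \<eta> by (simp add: chain_dom_def pdisc_def)
  qed
  then have "rk (F Q k) ?\<theta> \<le> \<rho>" by (rule le)
  moreover have "card I \<le> vec.dim (range (dirD (F Q k) ?\<theta>))"
    by (rule card_le_dim_colmat[OF t(3)]) auto
  ultimately show False using I(1) by (simp add: rk_def)
qed

text \<open>Parameter 0 fixes the points of the domain, so by continuity small parameters keep the
  whole chain near its start.\<close>

lemma chain_near:
  assumes "open V" "P \<in> V" "V \<subseteq> pdisc r"
  obtains \<delta> where "\<delta> > 0" "\<And>\<eta> j. \<eta> \<in> chain_dom k \<delta> \<Longrightarrow> j \<le> k \<Longrightarrow> F P j \<eta> \<in> V"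
proof -
  have "\<exists>\<delta>>0. \<exists>W. open W \<and> P \<in> W \<and> (\<forall>Q\<in>W. \<forall>\<eta>\<in>chain_dom k \<delta>. \<forall>j\<le>k. F Q j \<eta> \<in> V)"
    using assms
  proof (induction k arbitrary: V)
    case 0
    then show ?case by (intro exI[of _ 1] conjI exI[of _ V]) auto
  next
    case (Suc k)
    let ?g = "\<lambda>v. St k (jl v) (jr v)"
    have Pr: "P \<in> pdisc r" using Suc by auto
    have "continuous_on (pdisc r) ?g" using hol_continuous_on[OF St_hol] .
    then have op: "open (pdisc r \<inter> ?g -` V)" using Suc by (simp add: continuous_on_open_vimage Int_commute)
    have op2: "open ((\<lambda>v. jn 0 P + v) -` (pdisc r \<inter> ?g -` V))"
      by (intro open_vimage op continuous_intros)
    have "0 \<in> (\<lambda>v. jn 0 P + v) -` (pdisc r \<inter> ?g -` V)"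
      using Pr r_pos St_zero[OF Pr] Suc by (simp add: jn_pdisc)
    then obtain \<eta> where \<eta>: "\<eta> > 0" "pdisc \<eta> \<subseteq> (\<lambda>v. jn 0 P + v) -` (pdisc r \<inter> ?g -` V)"
      by (rule pdisc_nbhd[OF op2])
    have st: "St k s y \<in> V" if "s \<in> pdisc \<eta>" "y - P \<in> pdisc \<eta>" for s y
    proof -
      have "jn s (y - P) \<in> pdisc \<eta>" using that by (simp add: jn_pdisc)
      then have "jn 0 P + jn s (y - P) \<in> ?g -` V" using \<eta>(2) by blast
      moreover have "jl (jn 0 P + jn s (y - P)) = s" "jr (jn 0 P + jn s (y - P)) = y" by (simp_all add: vec_eq_iff)
      ultimately show ?thesis by simp
    qed
    let ?V = "V \<inter> (\<lambda>y. y - P) -` pdisc \<eta>"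
    have vO: "open ?V" by (intro open_Int Suc open_vimage open_pdisc continuous_intros)
    have vP: "P \<in> ?V" "?V \<subseteq> pdisc r" using Suc \<eta> by auto
    obtain \<delta> W where W0: "\<delta> > 0" "open W" "P \<in> W" "\<forall>Q\<in>W. \<forall>\<eta>\<in>chain_dom k \<delta>. \<forall>j\<le>k. F Q j \<eta> \<in> ?V"
      using Suc.IH[OF vO vP] by (elim exE conjE) (rule that)
    have W: "\<delta> > 0" "open W" "P \<in> W" "\<And>Q \<eta>' j. Q \<in> W \<Longrightarrow> \<eta>' \<in> chain_dom k \<delta> \<Longrightarrow> j \<le> k \<Longrightarrow> F Q j \<eta>' \<in> ?V"
      using W0 by simp_all
    have "F Q j \<omega> \<in> V" if Q: "Q \<in> W" and \<omega>: "\<omega> \<in> chain_dom (Suc k) (min \<delta> \<eta>)" and j: "j \<le> Suc k" for Q \<omega> j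
    proof -
      have k1: "\<omega> \<in> chain_dom k \<delta>" using \<omega> chain_dom_le[of k "Suc k" "min \<delta> \<eta>"] chain_dom_mono[of "min \<delta> \<eta>" \<delta> k] by auto
      show ?thesis
      proof (cases "j = Suc k")
        case True
        have "\<omega> k \<in> pdisc \<eta>" using \<omega> pdisc_mono[of "min \<delta> \<eta>" \<eta>] by (auto simp: chain_dom_def)
        then show ?thesis using st[of "\<omega> k" "F Q k \<omega>"] W(4)[OF Q k1, of k] True by simp
      next
        case False
        then show ?thesis using W(4)[OF Q k1, of j] j by simp
      qed
    qed
    then show ?case using W(1-3) \<eta>(1) by (intro exI[of _ "min \<delta> \<eta>"] conjI exI[of _ W]) auto
  qed
  then show ?thesis using that by blast
qed

text \<open>The generic rank near the origin; it is attained arbitrarily close to the origin.\<close>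
definition gen :: "nat \<Rightarrow> nat \<Rightarrow> bool" where
  "gen k \<rho> \<longleftrightarrow> (\<exists>\<delta>>0. \<forall>\<theta>\<in>chain_dom k \<delta>. rk (F 0 k) \<theta> \<le> \<rho>) \<and> (\<forall>\<delta>>0. \<exists>\<theta>\<in>chain_dom k \<delta>. \<rho> \<le> rk (F 0 k) \<theta>)"

end

context flow_sys begin

lemma straightening_flow:
  assumes S: "straightening P V H I" and s: "s \<in> pdisc r" and y: "y \<in> pdisc r"
    and V: "\<And>t. t \<in> {0..1} \<Longrightarrow> St j (complex_of_real t *s s) y \<in> V"
    and 0: "\<And>i. i \<notin> I \<Longrightarrow> H y $ i = 0" and i: "i \<notin> I"
  shows "H (St j s y) $ i = 0"
proof -
  let ?c = "\<lambda>t. St j (complex_of_real t *s s) y"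
  let ?a = "\<lambda>t::real. if even j then s else 0" and ?b = "\<lambda>t::real. if even j then 0 else s"
  have Vr: "V \<subseteq> pdisc r" using S by (simp add: straightening_def)
  have curve: "\<And>c a b T K. (\<forall>t\<in>{0..T}. c t \<in> V \<and> norm (a t) \<le> K \<and> norm (b t) \<le> K \<and>
          (c has_vector_derivative (Y 0 (a t) (c t) + Y 1 (b t) (c t))) (at t within {0..T})) \<and>
        (\<forall>i. i \<notin> I \<longrightarrow> H (c 0) $ i = 0) \<Longrightarrow>
        (\<forall>t\<in>{0..T::real}. \<forall>i. i \<notin> I \<longrightarrow> H (c t) $ i = 0)"
    using S unfolding straightening_def by blast
  have "\<forall>t\<in>{0..1}. \<forall>i. i \<notin> I \<longrightarrow> H (?c t) $ i = 0"
  proof (rule curve[where a = ?a and b = ?b and K = "norm s"], intro conjI ballI)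
    fix t :: real assume t: "t \<in> {0..1}"
    show "?c t \<in> V" using V[OF t] .
    have "(?c has_vector_derivative Y j s (?c t)) (at t within {0..1})"
      by (rule flow_curve[OF s y]) (use t V[OF t] Vr in auto)
    moreover have "Y j s (?c t) = Y 0 (?a t) (?c t) + Y 1 (?b t) (?c t)"
      using Y_par[of j 0] Y_par[of j 1] by auto
    ultimately show "(?c has_vector_derivative (Y 0 (?a t) (?c t) + Y 1 (?b t) (?c t))) (at t within {0..1})"
      by simp
  qed (use 0 St_zero[OF y] in auto)
  from this[rule_format, of 1 i] i show ?thesis by simp
qed

lemma straightening_chain:
  assumes S: "straightening P V H I" and \<delta>: "\<delta> > 0" "\<delta> \<le> r"
    and V: "\<And>\<eta> j. \<eta> \<in> chain_dom k \<delta> \<Longrightarrow> j \<le> k \<Longrightarrow> F P j \<eta> \<in> V"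
    and \<eta>: "\<eta> \<in> chain_dom k \<delta>" and "j \<le> k" and i: "i \<notin> I"
  shows "H (F P j \<eta>) $ i = 0"
  using \<open>j \<le> k\<close> i
proof (induction j arbitrary: i)
  case 0
  then show ?case using S by (simp add: straightening_def)
next
  case (Suc j)
  have Vr: "V \<subseteq> pdisc r" using S by (simp add: straightening_def)
  have "\<eta> j \<in> pdisc r" using \<eta> Suc(2) pdisc_mono[OF \<delta>(2)] by (auto simp: chain_dom_def)
  moreover have "F P j \<eta> \<in> pdisc r" using V[OF \<eta>, of j] Suc(2) Vr by auto
  moreover have "St j (complex_of_real t *s \<eta> j) (F P j \<eta>) \<in> V" if "t \<in> {0..1}" for t
  proof -
    \<comment> \<open>Shortening the parameter of this step runs through its flow line, which
      therefore stays in \<open>V\<close> by the assumption on chains.\<close>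
    let ?\<eta> = "\<eta>(j := complex_of_real t *s \<eta> j)"
    have "?\<eta> \<in> chain_dom k \<delta>" using \<eta> that by (auto simp: chain_dom_def intro!: pdisc_smult)
    then have "F P (Suc j) ?\<eta> \<in> V" using V[of ?\<eta> "Suc j"] Suc(2) by simp
    moreover have "F P j ?\<eta> = F P j \<eta>" by (rule chain_cong) auto
    ultimately show ?thesis by simp
  qed
  ultimately have "H (St j (\<eta> j) (F P j \<eta>)) $ i = 0"
    by (rule straightening_flow[OF S]) (use Suc in auto)
  then show ?case by simp
qed

text \<open>The chains stay in the invariant submanifold, so the components of \<open>H\<close>
  outside \<open>I\<close> are constant along them, and the invertible Jacobian of \<open>H\<close>
  maps every column into the span of the axes in \<open>I\<close>.\<close>

lemma rk_le_straightening:
  assumes S: "straightening P V H I" and \<delta>: "\<delta> > 0" and sm: "small k \<delta>" and P: "P \<in> pdisc \<delta>"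
    and V: "\<And>\<eta> j. \<eta> \<in> chain_dom k \<delta>' \<Longrightarrow> j \<le> k \<Longrightarrow> F P j \<eta> \<in> V"
    and \<delta>': "0 < \<delta>'" "\<delta>' \<le> \<delta>" and \<eta>: "\<eta> \<in> chain_dom k \<delta>'"
  shows "rk (F P k) \<eta> \<le> card I"
proof -
  let ?A = "jac H (F P k \<eta>)" and ?R = "range (dirD (F P k) \<eta>)"
  have hH: "hol H V" and FV: "F P k \<eta> \<in> V" and det: "det ?A \<noteq> 0"
    using S V[OF \<eta>, of k] by (auto simp: straightening_def)
  have \<eta>\<delta>: "\<eta> \<in> chain_dom k \<delta>" using \<eta> chain_dom_mono[OF \<delta>'(2)] by blast
  have z: "(?A *v dirD (F P k) \<eta> e) $ i = 0" if "i \<notin> I" for e i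
  proof -
    let ?W = "{l. (\<lambda>i. \<eta> i + l *s e i) \<in> chain_dom k \<delta>'}"
    have "((\<lambda>l. H (F P k (\<lambda>j. \<eta> j + l *s e j))) has_derivative (\<lambda>l. ?A *v (l *s dirD (F P k) \<eta> e))) (at 0)"
      by (rule has_derivative_compose[OF chain_line_deriv[OF sm P \<eta>\<delta>]]) (use hol_jac[OF hH FV] in simp)
    then have D: "((\<lambda>l. H (F P k (\<lambda>j. \<eta> j + l *s e j)) $ i) has_derivative (\<lambda>l. (?A *v (l *s dirD (F P k) \<eta> e)) $ i)) (at 0)"
      by (rule bounded_linear.has_derivative[OF bounded_linear_vec_nth])
    have "((\<lambda>l. 0) has_derivative (\<lambda>l. (?A *v (l *s dirD (F P k) \<eta> e)) $ i)) (at (0::complex))"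
    proof (rule has_derivative_transform_within_open[OF D line_dom(1)])
      show "0 \<in> ?W" using \<eta> by simp
      fix l assume "l \<in> ?W"
      then show "H (F P k (\<lambda>j. \<eta> j + l *s e j)) $ i = 0"
        using straightening_chain[OF S \<delta>'(1) _ V, of k] \<delta>'(2) small_le[OF sm] that by auto
    qed
    from has_derivative_unique[OF this has_derivative_const] have "(?A *v (1 *s dirD (F P k) \<eta> e)) $ i = 0"
      by metis
    then show ?thesis by simp
  qed
  have sub: "(*v) ?A ` ?R \<subseteq> vec.span ((\<lambda>j. axis j 1) ` I)"
  proof clarify
    fix e
    let ?x = "?A *v dirD (F P k) \<eta> e"
    have "?x = (\<Sum>j\<in>UNIV. ?x $ j *s axis j 1)" by (rule basis_expansion[symmetric])
    also have "\<dots> = (\<Sum>j\<in>I. ?x $ j *s axis j 1)"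
      by (rule sum.mono_neutral_right) (use z in auto)
    also have "\<dots> \<in> vec.span ((\<lambda>j. axis j 1) ` I)"
      by (intro vec.span_sum vec.span_scale vec.span_base) auto
    finally show "?x \<in> vec.span ((\<lambda>j. axis j 1) ` I)" .
  qed
  have "inj ((*v) ?A)"
    using det invertible_det_nz[of ?A] inj_matrix_vector_mult by blast
  then have "vec.dim ?R = vec.dim ((*v) ?A ` ?R)"
    by (intro vec.dim_image_eq[symmetric] matrix_vector_mul_linear_gen) (auto intro: inj_on_subset)
  also have "\<dots> \<le> vec.dim (vec.span ((\<lambda>j. axis j (1::complex)) ` I))" by (rule vec.dim_subset[OF sub])
  also have "\<dots> \<le> card ((\<lambda>j. axis j (1::complex)) ` I)" by (simp add: vec.dim_le_card')
  also have "\<dots> \<le> card I" by (rule card_image_le) simp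
  finally show ?thesis by (simp add: rk_def)
qed

text \<open>The chain is first run backwards from \<open>F 0 (Suc k) \<theta>0\<close> to the origin and then forwards along
  \<open>\<theta>\<close>; the shift by \<open>k mod 2\<close> makes the parities of the steps match.\<close>
definition back_forth :: "nat \<Rightarrow> (nat \<Rightarrow> complex^'q) \<Rightarrow> (nat \<Rightarrow> complex^'q) \<Rightarrow> nat \<Rightarrow> complex^'q" where
  "back_forth k \<theta>0 \<theta> i = (let sh = k mod 2 in
     if i < sh then 0 else if i < sh + Suc k then - \<theta>0 (k - (i - sh))
     else if i = sh + Suc k then 0 else \<theta> (i - (sh + Suc (Suc k))))"

lemma chain_back_forth:
  assumes s: "small (Suc k) \<delta>" "\<theta>0 \<in> chain_dom (Suc k) \<delta>"
  shows "F (F 0 (Suc k) \<theta>0) (k mod 2 + Suc (Suc k) + l) (back_forth k \<theta>0 \<theta>) = F 0 l \<theta>"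
proof -
  let ?sh = "k mod 2" and ?P = "F 0 (Suc k) \<theta>0" and ?w = "back_forth k \<theta>0 \<theta>"
  have 0: "(0::complex^'n) \<in> pdisc \<delta>" using small_pos[OF s(1)] by simp
  have Pr: "?P \<in> pdisc r" using smallD[OF s(1) 0 s(2)] by blast
  have sh: "F ?P ?sh ?w = ?P"
  proof (cases "?sh = 0")
    case False
    then have "?sh = Suc 0" by simp
    moreover have "?w 0 = 0" using False by (simp add: back_forth_def Let_def)
    ultimately show ?thesis using St_zero[OF Pr] by simp
  qed simp
  have bk: "F ?P (?sh + i) ?w = F 0 (Suc k - i) \<theta>0" if "i \<le> Suc k" for i
    using that
  proof (induction i)
    case (Suc i)
    define m where "m = k - i"
    have m: "Suc k - i = Suc m" "Suc k - Suc i = m" "m < Suc k" using Suc.prems by (auto simp: m_def)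
    have p: "even (?sh + i + m)" using Suc.prems unfolding m_def by (simp add: even_iff_mod_2_eq_zero) presburger
    have "?w (?sh + i) = - \<theta>0 m" using Suc.prems by (simp add: back_forth_def Let_def m_def)
    then have "F ?P (?sh + Suc i) ?w = St (?sh + i) (- \<theta>0 m) (F 0 (Suc m) \<theta>0)"
      using Suc m(1) by simp
    also have "\<dots> = St m (- \<theta>0 m) (St m (\<theta>0 m) (F 0 m \<theta>0))" using St_par'[OF p] by simp
    also have "\<dots> = F 0 m \<theta>0"
    proof (rule St_inv)
      show "\<theta>0 m \<in> pdisc r" using s(2) m(3) pdisc_mono[OF small_le[OF s(1)]] by (auto simp: chain_dom_def)
      show "F 0 m \<theta>0 \<in> pdisc r" using smallD[OF s(1) 0 s(2), of m] m(3) by simp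
    qed
    finally show ?case using m(2) by simp
  qed (use sh in simp)
  have mid: "F ?P (?sh + Suc (Suc k)) ?w = 0"
    using bk[of "Suc k"] St_zero[of 0] r_pos by (simp add: back_forth_def Let_def)
  show ?thesis
  proof (induction l)
    case 0
    then show ?case using mid by simp
  next
    case (Suc l)
    have p: "even (?sh + Suc (Suc k) + l + l)" by (simp add: even_iff_mod_2_eq_zero) presburger
    have "?w (?sh + Suc (Suc k) + l) = \<theta> l" by (simp add: back_forth_def Let_def)
    then show ?case using Suc St_par'[OF p] by simp
  qed
qed

text \<open>A point of maximal rank has an invariant submanifold, which bounds the rank of all
  chains from that point with small parameters. The identity theorem extends the bound to larger
  parameters, among them those that lead back to the origin and then follow an arbitrary
  \<open>\<theta>\<close>.\<close>

lemma gen_stable: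
  assumes g1: "gen (Suc k) \<rho>" and g2: "gen (Suc (Suc k)) \<rho>"
  shows "\<exists>\<delta>>0. \<forall>\<theta>\<in>chain_dom l \<delta>. rk (F 0 l) \<theta> \<le> \<rho>"
proof -
  \<comment> \<open>The length of the parity shift, of the reversed chain with its separating step,
    and of the chain to be bounded.\<close>
  define L where "L = k mod 2 + Suc (Suc k) + l"
  obtain \<delta> where \<delta>: "small L \<delta>" by (rule small_ex)
  have \<delta>0: "\<delta> > 0" using small_pos[OF \<delta>] .
  obtain \<delta>1 where \<delta>1: "\<delta>1 > 0" "\<delta>1 \<le> \<delta>"
    "\<And>Q \<theta> j. Q \<in> pdisc \<delta>1 \<Longrightarrow> \<theta> \<in> chain_dom (Suc (Suc k)) \<delta>1 \<Longrightarrow> j \<le> Suc (Suc k) \<Longrightarrow> F Q j \<theta> \<in> pdisc \<delta>"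
    using chain_small[OF \<delta>0, of "Suc (Suc k)"] by metis
  obtain \<delta>2 \<delta>3 where \<delta>23: "\<delta>2 > 0" "\<delta>3 > 0" "\<And>\<theta>. \<theta> \<in> chain_dom (Suc k) \<delta>2 \<Longrightarrow> rk (F 0 (Suc k)) \<theta> \<le> \<rho>"
    "\<And>\<theta>. \<theta> \<in> chain_dom (Suc (Suc k)) \<delta>3 \<Longrightarrow> rk (F 0 (Suc (Suc k))) \<theta> \<le> \<rho>"
    using g1 g2 unfolding gen_def by metis
  define \<delta>4 where "\<delta>4 = min \<delta>1 (min \<delta>2 \<delta>3)"
  have \<delta>4: "\<delta>4 > 0" "\<delta>4 \<le> \<delta>1" "\<delta>4 \<le> \<delta>2" "\<delta>4 \<le> \<delta>3" "\<delta>4 \<le> \<delta>" using \<delta>1 \<delta>23 by (auto simp: \<delta>4_def)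
  have s4: "small (Suc (Suc k)) \<delta>4" using small_mono[OF small_len[OF \<delta>, of "Suc (Suc k)"]] \<delta>4 by (simp add: L_def)
  have 04: "(0::complex^'n) \<in> pdisc \<delta>4" using \<delta>4 by simp
  obtain \<theta>0 where \<theta>0: "\<theta>0 \<in> chain_dom (Suc k) \<delta>4" "\<rho> \<le> rk (F 0 (Suc k)) \<theta>0"
    using g1 \<delta>4(1) unfolding gen_def by blast
  let ?P = "F 0 (Suc k) \<theta>0"
  obtain V H I where S: "straightening ?P V H I" "card I = \<rho>"
  proof (rule straightening_exists[OF s4 04 _ _ \<theta>0])
    show "rk (F 0 (Suc k)) \<theta> \<le> \<rho>" if "\<theta> \<in> chain_dom (Suc k) \<delta>4" for \<theta>
      using \<delta>23(3) chain_dom_mono[OF \<delta>4(3)] that by blast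
    show "rk (F 0 (Suc (Suc k))) \<theta> \<le> \<rho>" if "\<theta> \<in> chain_dom (Suc (Suc k)) \<delta>4" for \<theta>
      using \<delta>23(4) chain_dom_mono[OF \<delta>4(4)] that by blast
  qed
  have P: "?P \<in> pdisc \<delta>"
  proof -
    let ?\<theta> = "\<theta>0(Suc k := 0)"
    have "?\<theta> \<in> chain_dom (Suc (Suc k)) \<delta>1" using \<theta>0(1) \<delta>1(1) pdisc_mono[OF \<delta>4(2)] by (auto simp: chain_dom_def)
    then have "F 0 (Suc k) ?\<theta> \<in> pdisc \<delta>" using \<delta>1(3)[of 0 ?\<theta> "Suc k"] \<delta>1(1) by simp
    also have "F 0 (Suc k) ?\<theta> = ?P" by (rule chain_cong) auto
    finally show ?thesis .
  qed
  have V: "open V" "?P \<in> V" "V \<subseteq> pdisc r" using S(1) by (auto simp: straightening_def)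
  obtain \<delta>5 where \<delta>5: "\<delta>5 > 0" "\<And>\<eta> j. \<eta> \<in> chain_dom L \<delta>5 \<Longrightarrow> j \<le> L \<Longrightarrow> F ?P j \<eta> \<in> V"
    using chain_near[OF V, of L] by metis
  define \<delta>6 where "\<delta>6 = min \<delta> \<delta>5"
  have \<delta>6: "\<delta>6 > 0" "\<delta>6 \<le> \<delta>" "\<delta>6 \<le> \<delta>5" using \<delta>5 \<delta>0 by (auto simp: \<delta>6_def)
  have near: "rk (F ?P L) \<eta> \<le> \<rho>" if "\<eta> \<in> chain_dom L \<delta>6" for \<eta>
    using rk_le_straightening[OF S(1) \<delta>0 \<delta> P _ \<delta>6(1,2) that] \<delta>5(2) chain_dom_mono[OF \<delta>6(3)] S(2) by blast
  have all: "rk (F ?P L) \<eta> \<le> \<rho>" if "\<eta> \<in> chain_dom L \<delta>" for \<eta>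
    by (rule rk_bound_extend[OF \<delta> P \<delta>6(1) near that])
  have "rk (F 0 l) \<theta> \<le> \<rho>" if \<theta>: "\<theta> \<in> chain_dom l \<delta>" for \<theta>
  proof -
    let ?w = "back_forth k \<theta>0 \<theta>"
    have \<theta>0\<delta>: "\<theta>0 \<in> chain_dom (Suc k) \<delta>" using \<theta>0(1) chain_dom_mono[OF \<delta>4(5)] by blast
    have sk: "small (Suc k) \<delta>" using small_len[OF \<delta>, of "Suc k"] by (simp add: L_def)
    have "?w \<in> chain_dom L \<delta>"
      using \<theta> \<theta>0\<delta> \<delta>0 by (auto simp: chain_dom_def back_forth_def Let_def L_def)
    moreover have "dirD (F 0 l) \<theta> e \<in> range (dirD (F ?P L) ?w)" for e
    proof -
      \<comment> \<open>Only the last \<open>l\<close> parameters vary; on them the chain from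
        \<open>?P\<close> agrees with the chain from the origin.\<close>
      let ?e = "\<lambda>i. if i < k mod 2 + Suc (Suc k) then 0 else e (i - (k mod 2 + Suc (Suc k)))"
      have bf: "(\<lambda>i. ?w i + t *s ?e i) = back_forth k \<theta>0 (\<lambda>i. \<theta> i + t *s e i)" for t
        by (auto simp: back_forth_def Let_def fun_eq_iff)
      have "F ?P L (\<lambda>i. ?w i + t *s ?e i) = F 0 l (\<lambda>i. \<theta> i + t *s e i)" for t
        unfolding L_def bf by (rule chain_back_forth[OF sk \<theta>0\<delta>])
      then have "dirD (F 0 l) \<theta> e = dirD (F ?P L) ?w ?e" by (simp only: dirD_def)
      then show ?thesis by (simp only: rangeI)
    qed
    then have "rk (F 0 l) \<theta> \<le> rk (F ?P L) ?w" unfolding rk_def by (intro vec.dim_subset) blast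
    ultimately show ?thesis using all by (meson order_trans)
  qed
  then show ?thesis using \<delta>0 by blast
qed

text \<open>The first \<open>Suc K\<close> parameters of the reversal are \<open>\<theta>\<close>
  with 0 at place \<open>K\<close>; the remaining steps are appended and cannot lower the
  rank.\<close>

lemma rev_par_rank:
  assumes s: "small (2 * K + 1) \<delta>" "Q \<in> pdisc \<delta>" "\<theta> \<in> chain_dom K \<delta>"
  shows "rk (F Q (Suc K)) (\<theta>(K := 0)) \<le> rk (F Q (2 * K + 1)) (rev_par K \<theta>)"
proof -
  have "dirD (F Q (Suc K)) (\<theta>(K := 0)) = dirD (F Q (Suc K)) (rev_par K \<theta>)"
    by (rule ext, rule dirD_cong_base) (auto simp: rev_par_def)
  then have "rk (F Q (Suc K)) (\<theta>(K := 0)) = rk (F Q (Suc K)) (rev_par K \<theta>)" by (simp add: rk_def)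
  also have "\<dots> \<le> rk (F Q (2 * K + 1)) (rev_par K \<theta>)"
    by (rule rk_mono[OF s(1,2) rev_par_dom[OF small_pos[OF s(1)] s(3)]]) simp
  finally show ?thesis .
qed

text \<open>The chain followed by its reversal keeps the rank \<rho> and ends at the origin, and
  \<open>gen_stable\<close> bounds the ranks of the longer chains that
  \<open>straightening_exists\<close> involves.\<close>

lemma straightening_0:
  assumes g1: "gen (Suc k) \<rho>" and g2: "gen (Suc (Suc k)) \<rho>"
  obtains V H I where "straightening 0 V H I" "card I = \<rho>"
proof -
  \<comment> \<open>\<open>Suc ?N\<close> is the length of \<open>rev_par (Suc k) \<theta>\<close>;
    the chain longer by one step yields tangency of the other family.\<close>
  let ?N = "2 * Suc k"
  obtain \<delta> where \<delta>: "small (Suc (Suc ?N)) \<delta>" by (rule small_ex)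
  have \<delta>0: "\<delta> > 0" using small_pos[OF \<delta>] .
  obtain \<delta>2 \<delta>3 where \<delta>23: "\<delta>2 > 0" "\<delta>3 > 0" "\<And>\<theta>. \<theta> \<in> chain_dom (Suc ?N) \<delta>2 \<Longrightarrow> rk (F 0 (Suc ?N)) \<theta> \<le> \<rho>"
    "\<And>\<theta>. \<theta> \<in> chain_dom (Suc (Suc ?N)) \<delta>3 \<Longrightarrow> rk (F 0 (Suc (Suc ?N))) \<theta> \<le> \<rho>"
    using gen_stable[OF g1 g2] by metis
  define \<delta>4 where "\<delta>4 = min \<delta> (min \<delta>2 \<delta>3)"
  have \<delta>4: "\<delta>4 > 0" "\<delta>4 \<le> \<delta>2" "\<delta>4 \<le> \<delta>3" "\<delta>4 \<le> \<delta>" using \<delta>0 \<delta>23 by (auto simp: \<delta>4_def)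
  have s4: "small (Suc (Suc ?N)) \<delta>4" using small_mono[OF \<delta>] \<delta>4 by blast
  have 04: "(0::complex^'n) \<in> pdisc \<delta>4" using \<delta>4 by simp
  obtain \<theta> where \<theta>: "\<theta> \<in> chain_dom (Suc k) \<delta>4" "\<rho> \<le> rk (F 0 (Suc k)) \<theta>"
    using g1 \<delta>4(1) unfolding gen_def by blast
  let ?w = "rev_par (Suc k) \<theta>"
  have sN: "small (Suc ?N) \<delta>4" by (rule small_len[OF s4]) simp
  have w: "?w \<in> chain_dom (Suc ?N) \<delta>4" using rev_par_dom[OF \<delta>4(1) \<theta>(1)] by simp
  have "dirD (F 0 (Suc k)) \<theta> = dirD (F 0 (Suc k)) ?w"
    by (rule ext, rule dirD_cong_base) (auto simp: rev_par_def)
  then have "\<rho> \<le> rk (F 0 (Suc k)) ?w" using \<theta>(2) by (simp add: rk_def)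
  also have "\<dots> \<le> rk (F 0 (Suc ?N)) ?w" by (rule rk_mono[OF sN 04 w]) simp
  finally have rw: "\<rho> \<le> rk (F 0 (Suc ?N)) ?w" .
  have F0: "F 0 (Suc ?N) ?w = 0"
    using chain_rev_par[OF small_len[OF sN, of "Suc k"] 04 \<theta>(1)] by simp
  obtain V H I where "straightening (F 0 (Suc ?N) ?w) V H I" "card I = \<rho>"
  proof (rule straightening_exists[OF s4 04 _ _ w rw])
    show "rk (F 0 (Suc ?N)) \<theta> \<le> \<rho>" if "\<theta> \<in> chain_dom (Suc ?N) \<delta>4" for \<theta>
      using \<delta>23(3) chain_dom_mono[OF \<delta>4(2)] that by blast
    show "rk (F 0 (Suc (Suc ?N))) \<theta> \<le> \<rho>" if "\<theta> \<in> chain_dom (Suc (Suc ?N)) \<delta>4" for \<theta>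
      using \<delta>23(4) chain_dom_mono[OF \<delta>4(3)] that by blast
  qed
  then show ?thesis using that F0 by simp
qed

end

section \<open>Segre chains in the complexification\<close>

text \<open>The coordinate z of the point of the complexification with chart coordinates
  \<open>y\<close>.\<close>

definition Zf :: "('m::finite,'d::finite) germfun \<Rightarrow> complex^('m + ('m + 'd)) \<Rightarrow> complex^'d" where
  "Zf \<Theta> y = px y + \<i> *s Theta_bar \<Theta> (pw y) (pz y) (px y)"

text \<open>In the chart \<open>(w, \<zeta>, \<xi>)\<close> of the complexification the conjugated map \<open>vconj \<circ> Tm\<close> is the
  antiholomorphic involution \<open>(t, \<tau>) \<mapsto> (cnj \<tau>, cnj t)\<close>, whose fixed points are the real points, and
  \<open>Tm\<close> conjugates the flows of the two families of vector fields.\<close>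
definition Tm :: "('m::finite,'d::finite) germfun \<Rightarrow> complex^('m + ('m + 'd)) \<Rightarrow> complex^('m + ('m + 'd))" where
  "Tm \<Theta> y = mk (pz y) (pw y) (Zf \<Theta> y)"

text \<open>\<open>Tm\<close> with conjugated coefficients; by the reality of M it is the inverse of
  \<open>Tm\<close> near 0.\<close>

definition Tb :: "('m::finite,'d::finite) germfun \<Rightarrow> complex^('m + ('m + 'd)) \<Rightarrow> complex^('m + ('m + 'd))" where
  "Tb \<Theta> y = vconj (Tm \<Theta> (vconj y))"

definition io :: "complex^'m::finite \<Rightarrow> complex^('m + ('m + 'd::finite))" where
  "io s = mk s 0 0"

text \<open>The first family fixes \<zeta> and \<xi>, so in the chart its flows are translations in
  w. \<open>Tm\<close> exchanges the families, and the flows of the second one are translations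
  conjugated by \<open>Tm\<close>.\<close>

definition Sf :: "('m::finite,'d::finite) germfun \<Rightarrow> nat \<Rightarrow> complex^'m \<Rightarrow> complex^('m + ('m + 'd)) \<Rightarrow> complex^('m + ('m + 'd))" where
  "Sf \<Theta> j s y = (if even j then y + io s else Tb \<Theta> (Tm \<Theta> y + io s))"

definition Phi :: "('m::finite,'d::finite) germfun \<Rightarrow> complex^('m + ('m + 'd)) \<Rightarrow> ('m,'d) cpt" where
  "Phi \<Theta> y = ((pw y, Zf \<Theta> y), (pz y, px y))"

definition chart :: "('m::finite,'d::finite) cpt \<Rightarrow> complex^('m + ('m + 'd))" where
  "chart P = mk (fst (fst P)) (fst (snd P)) (snd (snd P))"

lemma chart_Phi [simp]: "chart (Phi \<Theta> y) = y"
  by (simp add: chart_def Phi_def)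

lemma complexM_iff: "P \<in> complexM \<Theta> \<longleftrightarrow> P = Phi \<Theta> (chart P)"
  by (auto simp: complexM_def Phi_def chart_def Zf_def split: prod.splits)

lemma Phi_in_complexM [simp]: "Phi \<Theta> y \<in> complexM \<Theta>"
  by (simp add: complexM_iff)

lemma io_simps [simp]: "io 0 = 0" "io (- s) = - io s" "io (s + t) = io s + io t" "vconj (io s) = io (vconj s)"
  "pw (io s) = s" "pz (io s) = 0" "px (io s) = 0" "io (c *s s) = c *s io s"
  by (auto simp: io_def intro!: chart_eqI)

lemma io_pdisc: "r > 0 \<Longrightarrow> io s \<in> pdisc r \<longleftrightarrow> s \<in> pdisc r"
  by (simp add: io_def mk_pdisc)

lemma hol_io: "hol f U \<Longrightarrow> hol (\<lambda>x. io (f x)) U"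
  unfolding io_def by (intro hol_mk) (auto intro: hol_const hol_open)

lemma Tb_mk: "Tb \<Theta> (mk a b c) = mk b a (c - \<i> *s \<Theta> a b c)"
  by (simp add: Tb_def Tm_def Zf_def Theta_bar_def vec.scale_minus_left)

lemma Lflow_Phi: "Lflow \<Theta> w (Phi \<Theta> y) = Phi \<Theta> (y + io w)"
  by (simp add: Lflow_def Phi_def Zf_def)

lemma Lbflow_Phi:
  assumes "Tm \<Theta> (Tb \<Theta> (Tm \<Theta> y + io s)) = Tm \<Theta> y + io s"
  shows "Lbflow \<Theta> s (Phi \<Theta> y) = Phi \<Theta> (Tb \<Theta> (Tm \<Theta> y + io s))"
proof -
  let ?v = "Tm \<Theta> y + io s"
  have v: "?v = mk (pz y + s) (pw y) (Zf \<Theta> y)" by (rule chart_eqI) (simp_all add: Tm_def)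
  have "px (Tm \<Theta> (Tb \<Theta> ?v)) = Zf \<Theta> y" unfolding assms by (simp add: Tm_def)
  then have "Zf \<Theta> (Tb \<Theta> ?v) = Zf \<Theta> y" by (simp add: Tm_def)
  moreover have "Tb \<Theta> ?v = mk (pw y) (pz y + s) (Zf \<Theta> y - \<i> *s \<Theta> (pz y + s) (pw y) (Zf \<Theta> y))"
    unfolding v by (rule Tb_mk)
  ultimately show ?thesis by (simp add: Lbflow_def Phi_def)
qed

text \<open>On radius \<open>R\<close> the maps \<open>Tm\<close> and \<open>Tb\<close> undo each
  other. On the smaller radius \<open>r\<close> the value of \<open>Tm\<close> and the parameter
  each take at most half of \<open>R\<close>, so their sum stays in the domain of
  \<open>Tb\<close>.\<close>

locale segre =
  fixes \<Theta> :: "('m::finite,'d::finite) germfun" and R r :: real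
  assumes R_pos: "R > 0" and r_pos': "r > 0" and r_le: "r \<le> R / 2"
    and Tm_hol: "hol (Tm \<Theta>) (pdisc R)"
    and Tm_0: "Tm \<Theta> 0 = 0"
    and Tb_Tm: "y \<in> pdisc R \<Longrightarrow> Tb \<Theta> (Tm \<Theta> y) = y"
    and Tm_small: "y \<in> pdisc r \<Longrightarrow> Tm \<Theta> y \<in> pdisc (R / 2)"
begin

lemma Tm_Tb: "y \<in> pdisc R \<Longrightarrow> Tm \<Theta> (Tb \<Theta> y) = y"
  using Tb_Tm[of "vconj y"] by (simp add: Tb_def) (metis vconj_simps(1))

lemma Tb_hol: "hol (Tb \<Theta>) (pdisc R)"
  using hol_conj[OF Tm_hol] by (simp add: Tb_def[abs_def])

lemma r_R: "y \<in> pdisc r \<Longrightarrow> y \<in> pdisc R"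
  using pdisc_mono[of r R] r_le R_pos by auto

lemma Tm_io_R: "y \<in> pdisc r \<Longrightarrow> s \<in> pdisc r \<Longrightarrow> Tm \<Theta> y + io s \<in> pdisc R"
proof -
  assume y: "y \<in> pdisc r" and s: "s \<in> pdisc r"
  have "io s \<in> pdisc (R / 2)" using s pdisc_mono[OF r_le] R_pos by (auto simp: io_pdisc)
  then show ?thesis using pdisc_add[OF Tm_small[OF y], of "io s" "R / 2"] by simp
qed

sublocale flow_sys "Sf \<Theta>" r
proof
  show "0 < r" by (rule r_pos')
  show "hol (\<lambda>v. Sf \<Theta> j (jl v) (jr v)) (pdisc r)" for j
  proof (cases "even j")
    case True
    then show ?thesis by (simp add: Sf_def hol_add hol_io hol_jl hol_jr)
  next
    case False
    have jr: "jr v \<in> pdisc r" "jl v \<in> pdisc r" if "v \<in> pdisc r" for v :: "complex^('m + ('m + ('m + 'd)))"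
      using that by (auto simp: pdisc_def)
    have 1: "hol (\<lambda>v::complex^('m + ('m + ('m + 'd))). Tm \<Theta> (jr v)) (pdisc r)"
      by (rule hol_compose[OF Tm_hol hol_jr]) (use jr r_R in auto)
    have "hol (\<lambda>v. Tb \<Theta> (Tm \<Theta> (jr v) + io (jl v))) (pdisc r)"
      by (rule hol_compose[OF Tb_hol hol_add[OF 1 hol_io[OF hol_jl]]]) (use jr Tm_io_R in auto)
    then show ?thesis using False by (simp add: Sf_def)
  qed
  show "Sf \<Theta> j 0 y = y" if "y \<in> pdisc r" for j y
    using Tb_Tm[OF r_R[OF that]] by (simp add: Sf_def)
  show "Sf \<Theta> j (- s) (Sf \<Theta> j s y) = y" if "s \<in> pdisc r" "y \<in> pdisc r" for j s y
    using Tb_Tm[OF r_R[OF that(2)]] Tm_Tb[OF Tm_io_R[OF that(2,1)]] by (simp add: Sf_def)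
  show "Sf \<Theta> (Suc (Suc j)) = Sf \<Theta> j" for j by (auto simp: Sf_def fun_eq_iff)
  show "Sf \<Theta> j (s + s') y = Sf \<Theta> j s (Sf \<Theta> j s' y)"
    if "s \<in> pdisc r" "s' \<in> pdisc r" "s + s' \<in> pdisc r" "y \<in> pdisc r" "Sf \<Theta> j s' y \<in> pdisc r" for j s s' y
    using Tm_Tb[OF Tm_io_R[OF that(4,2)]] by (simp add: Sf_def add_ac)
qed

lemma Gamma_step:
  assumes "y \<in> pdisc r" "s \<in> pdisc r"
  shows "(if even k then Lflow \<Theta> s (Phi \<Theta> y) else Lbflow \<Theta> s (Phi \<Theta> y)) = Phi \<Theta> (Sf \<Theta> k s y)"
  using Lbflow_Phi[OF Tm_Tb[OF Tm_io_R[OF assms]]] by (simp add: Sf_def Lflow_Phi)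

lemma Zf_0: "Zf \<Theta> 0 = 0"
proof -
  have "px (Tm \<Theta> 0) = 0" by (simp add: Tm_0)
  then show ?thesis by (simp add: Tm_def)
qed

lemma Phi_0: "Phi \<Theta> 0 = 0"
  by (simp add: Phi_def Zf_0 zero_prod_def)

lemma Gamma_chain:
  assumes s: "small k \<delta>" and ws: "ws \<in> chain_dom k \<delta>" and "j \<le> k"
  shows "Gamma \<Theta> j ws = Phi \<Theta> (F 0 j ws)"
  using \<open>j \<le> k\<close>
proof (induction j)
  case 0
  then show ?case by (simp add: Phi_0)
next
  case (Suc j)
  have "F 0 j ws \<in> pdisc r" using smallD[OF s _ ws, of 0 j] small_pos[OF s] Suc by simp
  moreover have "ws j \<in> pdisc r" using ws Suc pdisc_mono[OF small_le[OF s]] by (auto simp: chain_dom_def)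
  ultimately show ?case using Suc Gamma_step[of "F 0 j ws" "ws j" j] by (simp split: if_splits)
qed

lemma Zf_hol: "hol (Zf \<Theta>) (pdisc R)"
proof -
  have "Zf \<Theta> = (\<lambda>y. px (Tm \<Theta> y))" by (simp add: Tm_def fun_eq_iff)
  then show ?thesis using hol_compose[OF hol_proj(3)[OF open_UNIV] Tm_hol] by simp
qed

lemma flat_Phi_hol: "hol (\<lambda>y. flat (Phi \<Theta> y)) (pdisc R)"
proof (rule hol_vecI)
  fix i :: "('m + 'd) + ('m + 'd)"
  consider a where "i = Inl (Inl a)" | b where "i = Inl (Inr b)" | a where "i = Inr (Inl a)" | b where "i = Inr (Inr b)"
    by (cases i; metis sum.exhaust)
  then show "shol (\<lambda>y. flat (Phi \<Theta> y) $ i) (pdisc R)"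
    by cases (auto simp: flat_def Phi_def intro: hol_nth Zf_hol)
qed simp

text \<open>\<open>Phi\<close> parametrises a graph over the chart, so forgetting the coordinate z
  is a holomorphic left inverse. Hence the ranks of \<open>Gamma\<close> and of its chart version
  agree.\<close>

lemma jac_flat_Phi_inj:
  assumes y: "y \<in> pdisc R" shows "inj ((*v) (jac (\<lambda>y. flat (Phi \<Theta> y)) y))"
proof -
  define B :: "complex^(('m + 'd) + ('m + 'd)) \<Rightarrow> complex^('m + ('m + 'd))" where
    "B v = mk (\<chi> a. v $ Inl (Inl a)) (\<chi> a. v $ Inr (Inl a)) (\<chi> a. v $ Inr (Inr a))" for v
  have hB: "hol B UNIV" unfolding B_def by (intro hol_mk hol_vecI) auto
  have BP: "B (flat (Phi \<Theta> y)) = y" for y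
    by (rule chart_eqI) (simp_all add: B_def flat_def Phi_def vec_eq_iff)
  have "jac (\<lambda>y. B (flat (Phi \<Theta> y))) y = jac B (flat (Phi \<Theta> y)) ** jac (\<lambda>y. flat (Phi \<Theta> y)) y"
    by (rule jac_compose[OF hB flat_Phi_hol y]) simp
  moreover have "jac (\<lambda>y. y) y = mat 1"
    by (rule jac_unique) (simp add: has_derivative_ident)
  ultimately have "jac B (flat (Phi \<Theta> y)) ** jac (\<lambda>y. flat (Phi \<Theta> y)) y = mat 1" by (simp add: BP)
  then show ?thesis using matrix_left_invertible_injective by blast
qed

lemma Gamma_line_deriv:
  assumes s: "small k \<delta>" and ws: "ws \<in> chain_dom k \<delta>"
  shows "((\<lambda>l. flat (Gamma \<Theta> k (\<lambda>i. ws i + l *s e i))) has_derivative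
    (\<lambda>l. l *s (jac (\<lambda>y. flat (Phi \<Theta> y)) (F 0 k ws) *v dirD (F 0 k) ws e))) (at 0)"
proof -
  let ?A = "jac (\<lambda>y. flat (Phi \<Theta> y)) (F 0 k ws)"
  let ?W = "{l. (\<lambda>i. ws i + l *s e i) \<in> chain_dom k \<delta>}"
  have 0: "(0::complex^('m + ('m + 'd))) \<in> pdisc \<delta>" using small_pos[OF s] by simp
  have FR: "F 0 k ws \<in> pdisc R" using smallD[OF s 0 ws, of k] r_R by blast
  have "((\<lambda>l. flat (Phi \<Theta> (F 0 k (\<lambda>i. ws i + l *s e i)))) has_derivative (\<lambda>l. ?A *v (l *s dirD (F 0 k) ws e))) (at 0)"
    by (rule has_derivative_compose[OF chain_line_deriv[OF s 0 ws]]) (use hol_jac[OF flat_Phi_hol FR] in simp)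
  then have D: "((\<lambda>l. flat (Phi \<Theta> (F 0 k (\<lambda>i. ws i + l *s e i)))) has_derivative (\<lambda>l. l *s (?A *v dirD (F 0 k) ws e))) (at 0)"
    by (simp only: vector_scalar_commute)
  show ?thesis
  proof (rule has_derivative_transform_within_open[OF D line_dom(1)])
    show "0 \<in> ?W" using ws by simp
    fix l assume "l \<in> ?W"
    then show "flat (Phi \<Theta> (F 0 k (\<lambda>i. ws i + l *s e i))) = flat (Gamma \<Theta> k (\<lambda>i. ws i + l *s e i))"
      using Gamma_chain[OF s, of _ k] by simp
  qed
qed

lemma fun_upd_cdir: "ws(j := ws j + t *s axis a 1) = (\<lambda>i. ws i + t *s cdir j a i)"
  by (auto simp: cdir_def fun_eq_iff)

lemma jac_rank_Gamma:
  assumes s: "small k \<delta>" and ws: "ws \<in> chain_dom k \<delta>"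
  shows "jac_rank k (Gamma \<Theta> k) ws = rk (F 0 k) ws"
proof -
  let ?A = "jac (\<lambda>y. flat (Phi \<Theta> y)) (F 0 k ws)"
  have 0: "(0::complex^('m + ('m + 'd))) \<in> pdisc \<delta>" using small_pos[OF s] by simp
  have FR: "F 0 k ws \<in> pdisc R" using smallD[OF s 0 ws, of k] r_R by blast
  have col: "(\<chi> i. deriv (\<lambda>t. flat (Gamma \<Theta> k (ws(j := ws j + t *s axis a 1))) $ i) 0) = ?A *v dirD (F 0 k) ws (cdir j a)" for j a
    unfolding fun_upd_cdir by (rule deriv_vec[OF Gamma_line_deriv[OF s ws]])
  let ?C = "(\<lambda>(j,a). dirD (F 0 k) ws (cdir j a)) ` ({..<k} \<times> UNIV)"
  have "jac_rank k (Gamma \<Theta> k) ws = vec.dim ((*v) ?A ` ?C)"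
    unfolding jac_rank_def col by (simp add: image_image case_prod_unfold)
  also have "\<dots> = vec.dim ?C"
    by (rule vec.dim_image_eq[OF matrix_vector_mul_linear_gen]) (rule inj_on_subset[OF jac_flat_Phi_inj[OF FR]], simp)
  also have "\<dots> = rk (F 0 k) ws" by (rule rk_cols[OF s 0 ws, symmetric])
  finally show ?thesis .
qed

end

text \<open>The radii are shrunk until the reality condition applies to \<open>y\<close> together
  with its coordinate \<open>Zf \<Theta> y\<close>; there it says that \<open>Tb\<close> recovers
  \<xi> from z.\<close>

lemma segre_exists:
  fixes \<Theta> :: "('m::finite,'d::finite) germfun"
  assumes conv: "conv_power_series \<Theta>"
    and p_in_M: "\<Theta> 0 0 0 = 0"
    and reality: "\<exists>\<epsilon>>0. \<forall>w z \<zeta> \<xi>. w \<in> pdisc \<epsilon> \<and> z \<in> pdisc \<epsilon> \<and> \<zeta> \<in> pdisc \<epsilon> \<and> \<xi> \<in> pdisc \<epsilon> \<longrightarrow>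
                    (z = \<xi> + \<i> *s Theta_bar \<Theta> w \<zeta> \<xi> \<longleftrightarrow> \<xi> = z - \<i> *s \<Theta> \<zeta> w z)"
  obtains R r where "segre \<Theta> R r"
proof -
  obtain R0 where R0: "R0 > 0" "hol (\<lambda>v. \<Theta> (pw v) (pz v) (px v)) (pdisc R0)"
    using conv_power_series_hol[OF conv] .
  obtain \<epsilon> where \<epsilon>: "\<epsilon> > 0" "\<And>w z \<zeta> \<xi>. \<lbrakk>w \<in> pdisc \<epsilon>; z \<in> pdisc \<epsilon>; \<zeta> \<in> pdisc \<epsilon>; \<xi> \<in> pdisc \<epsilon>\<rbrakk> \<Longrightarrow>
       (z = \<xi> + \<i> *s Theta_bar \<Theta> w \<zeta> \<xi> \<longleftrightarrow> \<xi> = z - \<i> *s \<Theta> \<zeta> w z)" using reality by blast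
  have "hol (\<lambda>v. Theta_bar \<Theta> (pw v) (pz v) (px v)) (pdisc R0)"
    using hol_conj[OF R0(2)] by (simp add: Theta_bar_def)
  then have T: "hol (Tm \<Theta>) (pdisc R0)"
    unfolding Tm_def[abs_def] Zf_def by (intro hol_mk hol_proj hol_add hol_smult shol_const) auto
  have T0: "Tm \<Theta> 0 = 0" by (simp add: Tm_def Zf_def Theta_bar_def p_in_M)
  have small: "\<exists>\<delta>>0. \<delta> \<le> b \<and> (\<forall>y\<in>pdisc \<delta>. Tm \<Theta> y \<in> pdisc a)" if "a > 0" "b > 0" for a b
  proof -
    have "open (pdisc R0 \<inter> Tm \<Theta> -` pdisc a)"
      using hol_continuous_on[OF T] by (simp add: continuous_on_open_vimage Int_commute)
    then obtain \<delta> where "\<delta> > 0" "pdisc \<delta> \<subseteq> pdisc R0 \<inter> Tm \<Theta> -` pdisc a"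
      by (rule pdisc_nbhd) (use R0(1) T0 \<open>a > 0\<close> in simp)
    then show ?thesis using that pdisc_mono[of "min \<delta> b" \<delta>] by (intro exI[of _ "min \<delta> b"]) auto
  qed
  obtain \<delta> where \<delta>: "\<delta> > 0" "\<delta> \<le> \<epsilon>" "\<And>y. y \<in> pdisc \<delta> \<Longrightarrow> Tm \<Theta> y \<in> pdisc \<epsilon>" using small[OF \<epsilon>(1) \<epsilon>(1)] by blast
  define R where "R = min R0 \<delta>"
  have R: "R > 0" "R \<le> R0" "R \<le> \<delta>" using R0 \<delta> by (auto simp: R_def)
  obtain r where r: "r > 0" "r \<le> R / 2" "\<And>y. y \<in> pdisc r \<Longrightarrow> Tm \<Theta> y \<in> pdisc (R / 2)"
    using small[of "R / 2" "R / 2"] R by auto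
  have "segre \<Theta> R r"
  proof
    show "hol (Tm \<Theta>) (pdisc R)" by (rule hol_subset[OF T open_pdisc pdisc_mono[OF R(2)]])
    show "Tb \<Theta> (Tm \<Theta> y) = y" if y: "y \<in> pdisc R" for y
    proof -
      have y\<delta>: "y \<in> pdisc \<delta>" using y pdisc_mono[OF R(3)] by auto
      then have "y \<in> pdisc \<epsilon>" using pdisc_mono[OF \<delta>(2)] by auto
      then have p: "pw y \<in> pdisc \<epsilon>" "pz y \<in> pdisc \<epsilon>" "px y \<in> pdisc \<epsilon>" by (auto simp: pdisc_def)
      have "px (Tm \<Theta> y) \<in> pdisc \<epsilon>" using \<delta>(3)[OF y\<delta>] by (auto simp: pdisc_def)
      then have Z: "Zf \<Theta> y \<in> pdisc \<epsilon>" by (simp add: Tm_def)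
      have e: "px y = Zf \<Theta> y - \<i> *s \<Theta> (pz y) (pw y) (Zf \<Theta> y)"
        using \<epsilon>(2)[OF p(1) Z p(2,3)] by (simp add: Zf_def)
      show ?thesis by (simp add: Tm_def Tb_mk e[symmetric])
    qed
  qed (use R r T0 in auto)
  then show ?thesis using that by blast
qed

text \<open>The sequence grows strictly from index 2 on until its first repetition and is constant
  afterwards. So exactly one \<kappa> satisfies the description, and \<kappa> increments of at least
  1 must fit between \<open>a\<close> and \<open>a + d\<close>.\<close>

lemma kappa_numbers:
  fixes f :: "nat \<Rightarrow> nat" and e :: "nat \<Rightarrow> int"
  assumes mono: "\<And>k. f k \<le> f (Suc k)" and stab: "\<And>k l. f (Suc k) = f (Suc (Suc k)) \<Longrightarrow> f l \<le> f (Suc k)"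
    and ub: "\<And>k. f k \<le> a + d" and lb: "a \<le> f 2"
    and e: "\<And>k. e k = int (f (k + 2)) - int (f (k + 1))"
    and \<kappa>: "\<kappa> = (THE \<kappa>. (\<forall>l. 1 \<le> l \<and> l \<le> \<kappa> \<longrightarrow> e l > 0) \<and> (\<forall>l. l > \<kappa> \<longrightarrow> e l = 0))"
  shows "\<kappa> \<le> d" "f l \<le> f (\<kappa> + 2)"
proof -
  have "\<exists>l. f (l + 2) = f (l + 3)"
  proof (rule ccontr)
    assume neg: "\<not> ?thesis"
    have "f (l + 2) \<ge> a + l" for l
    proof (induction l)
      case 0
      then show ?case using lb by (simp add: numeral_2_eq_2)
    next
      case (Suc l)
      then show ?case using neg mono[of "l + 2"] by (metis Suc_leI add_Suc add_Suc_right le_neq_implies_less le_trans not_less_eq_eq numeral_3_eq_3 numeral_2_eq_2 order_less_le)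
    qed
    from this[of "Suc d"] ub[of "Suc d + 2"] show False by simp
  qed
  then obtain k where k: "f (k + 2) = f (k + 3)" "\<And>l. l < k \<Longrightarrow> f (l + 2) \<noteq> f (l + 3)"
    using exists_least_iff[of "\<lambda>l. f (l + 2) = f (l + 3)"] by blast
  have mono': "i \<le> j \<Longrightarrow> f i \<le> f j" for i j using mono by (simp add: lift_Suc_mono_le)
  have st: "f l \<le> f (k + 2)" for l
    using stab[of "Suc k" l] k(1) by (simp add: numeral_2_eq_2 numeral_3_eq_3)
  have pos: "e l > 0" if "1 \<le> l" "l \<le> k" for l
  proof -
    have "f (l - 1 + 2) \<noteq> f (l - 1 + 3)" using k(2)[of "l - 1"] that by auto
    moreover have "l - 1 + 2 = l + 1" "l - 1 + 3 = l + 2" using that by auto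
    ultimately show ?thesis using mono'[of "l + 1" "l + 2"] by (simp add: e)
  qed
  have zero: "e l = 0" if "l > k" for l
    using st[of "l + 2"] st[of "l + 1"] mono'[of "k + 2" "l + 1"] mono'[of "k + 2" "l + 2"] that by (simp add: e)
  have "\<kappa> = k"
    unfolding \<kappa>
  proof (rule the_equality)
    show "(\<forall>l. 1 \<le> l \<and> l \<le> k \<longrightarrow> e l > 0) \<and> (\<forall>l. l > k \<longrightarrow> e l = 0)" using pos zero by blast
    fix k' assume k': "(\<forall>l. 1 \<le> l \<and> l \<le> k' \<longrightarrow> e l > 0) \<and> (\<forall>l. l > k' \<longrightarrow> e l = 0)"
    show "k' = k"
    proof (rule ccontr)
      assume "k' \<noteq> k"
      then consider "k' < k" | "k < k'" by linarith
      then show False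
      proof cases
        case 1 then show ?thesis using k' pos[of k] by (metis le_less less_irrefl One_nat_def Suc_leI bot_nat_0.not_eq_extremum not_less_zero)
      next
        case 2 then show ?thesis using k' zero[of k'] by (metis One_nat_def Suc_leI le_less less_irrefl less_nat_zero_code bot_nat_0.not_eq_extremum)
      qed
    qed
  qed
  have "f (l + 2) \<ge> a + l" if "l \<le> k" for l
    using that
  proof (induction l)
    case 0
    then show ?case using lb by (simp add: numeral_2_eq_2)
  next
    case (Suc l)
    have "f (l + 2) < f (l + 3)" using k(2)[of l] Suc.prems mono'[of "l + 2" "l + 3"] by force
    moreover have "a + l \<le> f (l + 2)" using Suc by linarith
    moreover have "Suc l + 2 = l + 3" by simp
    ultimately show ?case by (metis Suc_leI add_Suc_right le_trans not_less_eq_eq)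
  qed
  from this[of k] ub[of "k + 2"] have "k \<le> d" by simp
  then show "\<kappa> \<le> d" "f l \<le> f (\<kappa> + 2)" using \<open>\<kappa> = k\<close> st by auto
qed

section \<open>Open images and identically vanishing coordinates\<close>

lemma (in chain_sys) open_chain_image:
  assumes s: "small k \<delta>" and Q: "Q \<in> pdisc \<delta>" and \<theta>: "\<theta> \<in> chain_dom k \<delta>"
    and rk: "CARD('n) \<le> rk (F Q k) \<theta>"
  obtains U where "open U" "F Q k \<theta> \<in> U" "U \<subseteq> F Q k ` chain_dom k \<delta>"
proof -
  obtain I f where I: "card I = CARD('n)" "\<And>j. j \<in> I \<Longrightarrow> f j \<in> range (dirD (F Q k) \<theta>)" "det (colmat f) \<noteq> 0"
    using exists_colmat[of "CARD('n)" "range (dirD (F Q k) \<theta>)"] rk unfolding rk_def by blast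
  then have "I = UNIV" by (metis card_subset_eq finite subset_UNIV)
  then have "\<forall>j. \<exists>e. f j = dirD (F Q k) \<theta> e" using I(2) by blast
  then obtain d where d: "\<And>j. f j = dirD (F Q k) \<theta> (d j)" by metis
  let ?G = "\<lambda>u. F Q k (lin \<theta> d u)"
  have h: "hol ?G {u. lin \<theta> d u \<in> chain_dom k \<delta>}" by (rule chain_hol[OF s Q])
  have det: "det (jac ?G 0) \<noteq> 0" using I(3) d by (simp add: jac_lin colmat_def)
  obtain U' V H where "open U'" "U' \<subseteq> {u. lin \<theta> d u \<in> chain_dom k \<delta>}" "0 \<in> U'" "open V" "?G 0 \<in> V" "homeomorphism U' V ?G H"
    by (rule hol_inverse_function[OF h _ det]) (use \<theta> in auto)
  then show ?thesis using that[of V] by (auto simp: homeomorphism_def)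
qed

text \<open>Serves to exclude proper invariant submanifolds: a component of \<open>H\<close>
  vanishing on an open set contradicts the invertibility of its Jacobian.\<close>

lemma jac_row_zero:
  assumes "open U" "y \<in> U" "\<And>x. x \<in> U \<Longrightarrow> H x $ i = 0"
  shows "det (jac H y) = 0"
proof -
  have "jac H y $ i $ j = 0" for j
  proof -
    let ?W = "(\<lambda>s. y + s *s axis j 1) -` U"
    have op: "open ?W"
      by (intro open_vimage assms(1) continuous_on_add continuous_on_const linear_continuous_on bounded_linear_smult_left)
    have "((\<lambda>s. 0) has_field_derivative 0) (at (0::complex))" by simp
    then have "((\<lambda>s. H (y + s *s axis j 1) $ i) has_field_derivative 0) (at 0)"
      by (rule has_field_derivative_transform_within_open[OF _ op]) (use assms in auto)
    then show ?thesis by (simp add: jac_def DERIV_imp_deriv)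
  qed
  then have "row i (jac H y) = 0" by (simp add: row_def vec_eq_iff)
  then show ?thesis by (rule det_zero_row)
qed

section \<open>The antiholomorphic involution exchanging the two families\<close>

definition cpt_conj :: "('m::finite,'d::finite) cpt \<Rightarrow> ('m,'d) cpt" where
  "cpt_conj P = ((vconj (fst (snd P)), vconj (snd (snd P))), (vconj (fst (fst P)), vconj (snd (fst P))))"

lemma cpt_conj_conj [simp]: "cpt_conj (cpt_conj P) = P"
  by (simp add: cpt_conj_def)

lemma cpt_conj_0 [simp]: "cpt_conj 0 = 0"
  by (simp add: cpt_conj_def zero_prod_def)

lemma continuous_cpt_conj: "continuous_on S cpt_conj"
  unfolding cpt_conj_def by (intro continuous_intros)

lemma Lflow_conj: "Lbflow \<Theta> (vconj w) (cpt_conj P) = cpt_conj (Lflow \<Theta> w P)"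
  by (cases P) (auto simp: Lflow_def Lbflow_def cpt_conj_def Theta_bar_def vec.scale_minus_left split: prod.splits)

lemma Lbflow_conj: "Lflow \<Theta> (vconj w) (cpt_conj P) = cpt_conj (Lbflow \<Theta> w P)"
  by (cases P) (auto simp: Lflow_def Lbflow_def cpt_conj_def Theta_bar_def vec.scale_minus_left split: prod.splits)

lemma Gammab_conj: "Gammab \<Theta> k (\<lambda>j. vconj (ws j)) = cpt_conj (Gamma \<Theta> k ws)"
  by (induction k) (auto simp: Lflow_conj Lbflow_conj)

lemma chain_dom_vconj: "(\<lambda>j. vconj (ws j)) \<in> chain_dom k \<delta> \<longleftrightarrow> ws \<in> chain_dom k \<delta>"
  by (simp add: chain_dom_def)

lemma Gammab_image: "Gammab \<Theta> k ` chain_dom k \<delta> = cpt_conj ` Gamma \<Theta> k ` chain_dom k \<delta>"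
proof -
  have "Gammab \<Theta> k ws = cpt_conj (Gamma \<Theta> k (\<lambda>j. vconj (ws j)))" for ws
    using Gammab_conj[of \<Theta> k "\<lambda>j. vconj (ws j)"] by simp
  then have "Gammab \<Theta> k ws \<in> cpt_conj ` Gamma \<Theta> k ` chain_dom k \<delta>" if "ws \<in> chain_dom k \<delta>" for ws
    using that chain_dom_vconj by blast
  moreover have "cpt_conj (Gamma \<Theta> k ws) \<in> Gammab \<Theta> k ` chain_dom k \<delta>" if "ws \<in> chain_dom k \<delta>" for ws
    using that chain_dom_vconj Gammab_conj by (metis imageI)
  ultimately show ?thesis by blast
qed

text \<open>Conjugation is not complex linear, but it maps spanning sets to spanning sets. Applying
  the resulting inequality to the conjugated set gives the converse.\<close>

lemma dim_vconj_image: "vec.dim (vconj ` S) = vec.dim (S :: (complex^'n) set)"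
proof -
  have le: "vec.dim (vconj ` S) \<le> vec.dim S" for S :: "(complex^'n) set"
  proof -
    obtain B where B: "B \<subseteq> S" "vec.independent B" "S \<subseteq> vec.span B" "card B = vec.dim S" by (rule vec.basis_exists)
    have "vconj x \<in> vec.span (vconj ` B)" if "x \<in> vec.span B" for x
      using that
    proof (induction rule: vec.span_induct_alt)
      case (step c x y)
      have "vconj x \<in> vec.span (vconj ` B)" using step by (intro vec.span_base imageI)
      then have "cnj c *s vconj x + vconj y \<in> vec.span (vconj ` B)"
        using step by (intro vec.span_add vec.span_scale)
      then show ?case by simp
    qed (simp add: vec.span_zero)
    then have "vconj ` S \<subseteq> vec.span (vconj ` B)" using B(3) by blast
    then have "vec.dim (vconj ` S) \<le> vec.dim (vconj ` B)" using vec.dim_subset[of _ "vec.span (vconj ` B)"] by simp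
    also have "\<dots> \<le> card (vconj ` B)" using vec.finiteI_independent[OF B(2)] by (intro vec.dim_le_card') simp
    also have "\<dots> \<le> card B" using vec.finiteI_independent[OF B(2)] by (rule card_image_le)
    finally show ?thesis using B(4) by simp
  qed
  show ?thesis using le[of S] le[of "vconj ` S"] by (simp add: image_image)
qed

text \<open>\<open>flat\<close> lists the coordinates of (t, \<tau>); besides conjugating, the
  involution exchanges the two halves of the list.\<close>

definition swap_idx :: "complex^('a::finite + 'a) \<Rightarrow> complex^('a + 'a)" where
  "swap_idx v = (\<chi> i. case i of Inl a \<Rightarrow> v $ Inr a | Inr a \<Rightarrow> v $ Inl a)"

lemma swap_idx_nth [simp]: "swap_idx v $ Inl a = v $ Inr a" "swap_idx v $ Inr a = v $ Inl a"
  by (simp_all add: swap_idx_def)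

lemma swap_idx_swap [simp]: "swap_idx (swap_idx v) = v"
  unfolding vec_eq_iff split_sum_all by simp

lemma linear_swap_idx: "Vector_Spaces.linear (*s) (*s) swap_idx"
  by unfold_locales (unfold vec_eq_iff split_sum_all, auto)

lemma norm_swap_idx: "bounded_linear swap_idx"
proof -
  have "swap_idx = (*v) (matrix swap_idx)" by (rule ext) (simp only: matrix_works[OF linear_swap_idx])
  then show ?thesis by (subst \<open>swap_idx = _\<close>) (rule matrix_vector_mul_bounded_linear)
qed

lemma flat_cpt_conj: "flat (cpt_conj P) = swap_idx (vconj (flat P))"
  unfolding vec_eq_iff split_sum_all by (simp add: flat_def cpt_conj_def split: prod.splits)

section \<open>Generic ranks and the Segre type\<close>

context segre begin

text \<open>\<open>Gammab\<close> is \<open>Gamma\<close> conjugated in the argument and in the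
  value, so its columns are those of \<open>Gamma\<close>, conjugated and with halves swapped.
  Neither operation changes the dimension of the span.\<close>

lemma jac_rank_Gammab:
  assumes s: "small k \<delta>" and ws: "ws \<in> chain_dom k \<delta>"
  shows "jac_rank k (Gammab \<Theta> k) (\<lambda>j. vconj (ws j)) = jac_rank k (Gamma \<Theta> k) ws"
proof -
  let ?A = "jac (\<lambda>y. flat (Phi \<Theta> y)) (F 0 k ws)"
  let ?c = "\<lambda>j a. ?A *v dirD (F 0 k) ws (cdir j a)"
  let ?h = "\<lambda>v::complex^(('m + 'd) + ('m + 'd)). swap_idx (vconj v)"
  have bl: "bounded_linear ?h"
    by (rule bounded_linear_compose[OF norm_swap_idx bounded_linear_vconj])
  have col: "(\<chi> i. deriv (\<lambda>t. flat (Gamma \<Theta> k (ws(j := ws j + t *s axis a 1))) $ i) 0) = ?c j a" for j a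
    unfolding fun_upd_cdir by (rule deriv_vec[OF Gamma_line_deriv[OF s ws]])
  have colb: "(\<chi> i. deriv (\<lambda>t. flat (Gammab \<Theta> k ((\<lambda>j. vconj (ws j))(j := vconj (ws j) + t *s axis a 1))) $ i) 0) = ?h (?c j a)" for j a
  proof -
    have cd: "vconj (cdir j a i) = cdir j a i" for i
      by (simp add: cdir_def vec_eq_iff axis_def)
    \<comment> \<open>An increment \<open>t\<close> of the conjugated parameter is the increment
      \<open>cnj t\<close> of the original one; the conjugation contained in \<open>?h\<close>
      restores complex linearity in \<open>t\<close>.\<close>
    have e: "(\<lambda>j. vconj (ws j))(j := vconj (ws j) + t *s axis a 1) = (\<lambda>i. vconj (ws i + cnj t *s cdir j a i))" for t
      using fun_upd_cdir[of "\<lambda>j. vconj (ws j)" j t a] by (simp add: cd)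
    have "flat (Gammab \<Theta> k ((\<lambda>j. vconj (ws j))(j := vconj (ws j) + t *s axis a 1))) = ?h (flat (Gamma \<Theta> k (\<lambda>i. ws i + cnj t *s cdir j a i)))" for t
      unfolding e Gammab_conj flat_cpt_conj ..
    moreover have "((\<lambda>t. ?h (flat (Gamma \<Theta> k (\<lambda>i. ws i + cnj t *s cdir j a i)))) has_derivative (\<lambda>t. ?h (cnj t *s ?c j a))) (at 0)"
    proof (rule bounded_linear.has_derivative[OF bl])
      have 1: "(cnj has_derivative cnj) (at 0)" by (rule bounded_linear_imp_has_derivative[OF bounded_linear_cnj])
      have "((\<lambda>l. flat (Gamma \<Theta> k (\<lambda>i. ws i + l *s cdir j a i))) has_derivative (\<lambda>l. l *s ?c j a)) (at (cnj 0))"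
        using Gamma_line_deriv[OF s ws] by simp
      from has_derivative_compose[OF 1 this]
      show "((\<lambda>t. flat (Gamma \<Theta> k (\<lambda>i. ws i + cnj t *s cdir j a i))) has_derivative (\<lambda>t. cnj t *s ?c j a)) (at 0)" .
    qed
    moreover have "?h (cnj t *s ?c j a) = t *s ?h (?c j a)" for t
      using vec.linear_scale[OF linear_swap_idx] by simp
    ultimately have "((\<lambda>t. flat (Gammab \<Theta> k ((\<lambda>j. vconj (ws j))(j := vconj (ws j) + t *s axis a 1)))) has_derivative (\<lambda>t. t *s ?h (?c j a))) (at 0)"
      by (simp only:)
    then show ?thesis by (rule deriv_vec)
  qed
  let ?C = "(\<lambda>(j,a). ?c j a) ` ({..<k} \<times> UNIV)"
  have "jac_rank k (Gammab \<Theta> k) (\<lambda>j. vconj (ws j)) = vec.dim (swap_idx ` vconj ` ?C)"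
    unfolding jac_rank_def colb by (simp add: image_image case_prod_unfold)
  also have "\<dots> = vec.dim (vconj ` ?C)"
  proof (rule vec.dim_image_eq[OF linear_swap_idx])
    show "inj_on swap_idx (vec.span (vconj ` ?C))" by (rule inj_on_inverseI) (rule swap_idx_swap)
  qed
  also have "\<dots> = vec.dim ?C" by (rule dim_vconj_image)
  also have "\<dots> = jac_rank k (Gamma \<Theta> k) ws" unfolding jac_rank_def col ..
  finally show ?thesis .
qed

lemma rk_le_dim: "rk f \<theta> \<le> 2 * CARD('m) + CARD('d)" for f :: "(nat \<Rightarrow> complex^'m) \<Rightarrow> complex^('m + ('m + 'd))"
proof -
  have "rk f \<theta> \<le> CARD('m + ('m + 'd))" unfolding rk_def by (rule dim_subset_UNIV_cart_gen)
  then show ?thesis by (simp add: card_sum)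
qed

text \<open>\<open>segre_r\<close> is a least upper bound taken over small domains. Were it not
  attained in one of them, \<open>segre_r \<Theta> k - 1\<close> would be an upper bound in a
  smaller one.\<close>

lemma gen_segre_r: "gen k (segre_r \<Theta> k)"
proof -
  obtain \<delta> where \<delta>: "small k \<delta>" by (rule small_ex)
  let ?P = "\<lambda>r. \<exists>\<delta>>0. \<forall>ws\<in>chain_dom k \<delta>. jac_rank k (Gamma \<Theta> k) ws \<le> r"
  have r: "segre_r \<Theta> k = (LEAST r. ?P r)" by (simp add: segre_r_def generic_rank_def)
  have "?P (2 * CARD('m) + CARD('d))"
    using jac_rank_Gamma[OF \<delta>] rk_le_dim small_pos[OF \<delta>] by (intro exI[of _ \<delta>]) auto
  then have "?P (segre_r \<Theta> k)" unfolding r by (rule LeastI)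
  then obtain \<delta>1 where \<delta>1: "\<delta>1 > 0" "\<And>ws. ws \<in> chain_dom k \<delta>1 \<Longrightarrow> jac_rank k (Gamma \<Theta> k) ws \<le> segre_r \<Theta> k" by blast
  have "\<exists>\<delta>>0. \<forall>\<theta>\<in>chain_dom k \<delta>. rk (F 0 k) \<theta> \<le> segre_r \<Theta> k"
  proof (intro exI[of _ "min \<delta> \<delta>1"] conjI ballI)
    fix \<theta> :: "nat \<Rightarrow> complex^'m" assume "\<theta> \<in> chain_dom k (min \<delta> \<delta>1)"
    then have "\<theta> \<in> chain_dom k \<delta>" "\<theta> \<in> chain_dom k \<delta>1" using chain_dom_mono[of "min \<delta> \<delta>1" \<delta> k] chain_dom_mono[of "min \<delta> \<delta>1" \<delta>1 k] by auto
    then show "rk (F 0 k) \<theta> \<le> segre_r \<Theta> k" using \<delta>1(2)[of \<theta>] jac_rank_Gamma[OF \<delta>, of \<theta>] by simp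
  qed (use \<delta>1 small_pos[OF \<delta>] in auto)
  moreover have "\<exists>\<theta>\<in>chain_dom k \<delta>'. segre_r \<Theta> k \<le> rk (F 0 k) \<theta>" if \<delta>': "\<delta>' > 0" for \<delta>'
  proof (rule ccontr)
    assume neg: "\<not> ?thesis"
    let ?\<delta> = "min \<delta> \<delta>'"
    have 0: "(\<lambda>_. 0) \<in> chain_dom k \<delta>'" using \<delta>' by (simp add: chain_dom_def)
    then have pos: "segre_r \<Theta> k > 0" using neg by (metis gr_zeroI zero_le)
    have "?P (segre_r \<Theta> k - 1)"
    proof (intro exI[of _ ?\<delta>] conjI ballI)
      fix ws :: "nat \<Rightarrow> complex^'m" assume "ws \<in> chain_dom k ?\<delta>"
      then have "ws \<in> chain_dom k \<delta>" "ws \<in> chain_dom k \<delta>'" using chain_dom_mono[of ?\<delta> \<delta> k] chain_dom_mono[of ?\<delta> \<delta>' k] by auto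
      then have "jac_rank k (Gamma \<Theta> k) ws < segre_r \<Theta> k" using neg jac_rank_Gamma[OF \<delta>, of ws] by (metis not_le)
      then show "jac_rank k (Gamma \<Theta> k) ws \<le> segre_r \<Theta> k - 1" by simp
    qed (use \<delta>' small_pos[OF \<delta>] in auto)
    then have "segre_r \<Theta> k \<le> segre_r \<Theta> k - 1" by (subst r) (rule Least_le)
    then show False using pos by simp
  qed
  ultimately show ?thesis unfolding gen_def by blast
qed

lemma segre_r_bound: "segre_r \<Theta> k \<le> 2 * CARD('m) + CARD('d)"
  using gen_segre_r[of k] rk_le_dim unfolding gen_def by (meson order_trans zero_less_one)

lemma segre_r_mono: "segre_r \<Theta> k \<le> segre_r \<Theta> (Suc k)"
proof -
  obtain \<delta> where \<delta>: "small (Suc k) \<delta>" by (rule small_ex)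
  obtain \<delta>1 where \<delta>1: "\<delta>1 > 0" "\<And>\<theta>. \<theta> \<in> chain_dom (Suc k) \<delta>1 \<Longrightarrow> rk (F 0 (Suc k)) \<theta> \<le> segre_r \<Theta> (Suc k)"
    using gen_segre_r[of "Suc k"] unfolding gen_def by blast
  let ?\<delta> = "min \<delta> \<delta>1"
  have d: "?\<delta> > 0" using \<delta>1 small_pos[OF \<delta>] by simp
  obtain \<theta> where \<theta>: "\<theta> \<in> chain_dom k ?\<delta>" "segre_r \<Theta> k \<le> rk (F 0 k) \<theta>"
    using gen_segre_r[of k] d unfolding gen_def by blast
  let ?\<theta> = "\<theta>(k := 0)"
  have dom: "?\<theta> \<in> chain_dom (Suc k) ?\<delta>" using \<theta>(1) d by (auto simp: chain_dom_def)
  have "dirD (F 0 k) \<theta> = dirD (F 0 k) ?\<theta>" by (rule ext, rule dirD_cong_base) simp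
  then have "rk (F 0 k) \<theta> = rk (F 0 k) ?\<theta>" by (simp add: rk_def)
  also have "\<dots> \<le> rk (F 0 (Suc k)) ?\<theta>"
    by (rule rk_le_Suc[OF \<delta>]) (use dom chain_dom_mono[of ?\<delta> \<delta> "Suc k"] small_pos[OF \<delta>] in auto)
  also have "\<dots> \<le> segre_r \<Theta> (Suc k)"
    by (rule \<delta>1(2)) (use dom chain_dom_mono[of ?\<delta> \<delta>1 "Suc k"] in auto)
  finally show ?thesis using \<theta>(2) by simp
qed

lemma segre_r_stable:
  assumes "segre_r \<Theta> (Suc k) = segre_r \<Theta> (Suc (Suc k))" shows "segre_r \<Theta> l \<le> segre_r \<Theta> (Suc k)"
proof -
  obtain \<delta> where \<delta>: "\<delta> > 0" "\<And>\<theta>. \<theta> \<in> chain_dom l \<delta> \<Longrightarrow> rk (F 0 l) \<theta> \<le> segre_r \<Theta> (Suc k)"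
    using gen_stable[of k "segre_r \<Theta> (Suc k)" l] gen_segre_r[of "Suc k"] gen_segre_r[of "Suc (Suc k)"] assms by auto
  then obtain \<theta> where "\<theta> \<in> chain_dom l \<delta>" "segre_r \<Theta> l \<le> rk (F 0 l) \<theta>"
    using gen_segre_r[of l] unfolding gen_def by blast
  then show ?thesis using \<delta>(2) by (meson order_trans)
qed

text \<open>After two steps from the origin the coordinates (w, \<zeta>) are the two parameters
  themselves, so the projection of the column space to them is onto.\<close>

lemma segre_r_2: "2 * CARD('m) \<le> segre_r \<Theta> 2"
proof -
  obtain \<delta> where \<delta>: "small 2 \<delta>" by (rule small_ex)
  obtain \<delta>1 where \<delta>1: "\<delta>1 > 0" "\<And>\<theta>. \<theta> \<in> chain_dom 2 \<delta>1 \<Longrightarrow> rk (F 0 2) \<theta> \<le> segre_r \<Theta> 2"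
    using gen_segre_r[of 2] unfolding gen_def by blast
  define p :: "complex^('m + ('m + 'd)) \<Rightarrow> complex^('m + 'm)" where "p y = jn (pw y) (pz y)" for y
  have lp: "Vector_Spaces.linear (*s) (*s) p"
    unfolding p_def by unfold_locales (unfold vec_eq_iff split_sum_all, auto)
  have pF: "p (F 0 2 \<theta>) = jn (\<theta> 0) (\<theta> 1)" for \<theta>
  proof -
    have T: "Tm \<Theta> (io (\<theta> 0)) + io (\<theta> (Suc 0)) = mk (\<theta> (Suc 0)) (\<theta> 0) (Zf \<Theta> (io (\<theta> 0)))"
      by (rule chart_eqI) (simp_all add: Tm_def)
    show ?thesis by (simp add: numeral_2_eq_2 Sf_def p_def T Tb_mk)
  qed
  let ?R = "range (dirD (F 0 2) (\<lambda>_. 0))"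
  have 00: "(\<lambda>_. 0) \<in> chain_dom 2 \<delta>" "(0::complex^('m + ('m + 'd))) \<in> pdisc \<delta>"
    using small_pos[OF \<delta>] by (auto simp: chain_dom_def)
  have "v \<in> p ` ?R" for v
  proof -
    let ?e = "\<lambda>j. if j = 0 then jl v else jr v"
    have "((\<lambda>s. F 0 2 (\<lambda>j. 0 + s *s ?e j)) has_derivative (\<lambda>s. s *s dirD (F 0 2) (\<lambda>_. 0) ?e)) (at 0)"
      by (rule chain_line_deriv[OF \<delta> 00(2,1)])
    moreover have "bounded_linear p"
    proof -
      have "p = (*v) (matrix p)" by (rule ext) (simp only: matrix_works[OF lp])
      then show ?thesis by (subst \<open>p = _\<close>) (rule matrix_vector_mul_bounded_linear)
    qed
    ultimately have "((\<lambda>s. p (F 0 2 (\<lambda>j. 0 + s *s ?e j))) has_derivative (\<lambda>s. p (s *s dirD (F 0 2) (\<lambda>_. 0) ?e))) (at 0)"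
      using bounded_linear.has_derivative by blast
    moreover have "p (F 0 2 (\<lambda>j. 0 + s *s ?e j)) = s *s v" for s
      unfolding pF vec_eq_iff split_sum_all by simp
    ultimately have "((\<lambda>s. s *s v) has_derivative (\<lambda>s. s *s p (dirD (F 0 2) (\<lambda>_. 0) ?e))) (at 0)"
      using vec.linear_scale[OF lp] by simp
    from has_derivative_unique[OF this bounded_linear_imp_has_derivative[OF bounded_linear_smult_left]]
    have "1 *s p (dirD (F 0 2) (\<lambda>_. 0) ?e) = 1 *s v" by metis
    then have "v = p (dirD (F 0 2) (\<lambda>_. 0) ?e)" by simp
    then show ?thesis by blast
  qed
  then have "p ` ?R = UNIV" by blast
  then have "CARD('m + 'm) = vec.dim (p ` ?R)" by (simp only: vec_dim_card)
  also have "\<dots> \<le> vec.dim ?R" by (rule vec.dim_image_le[OF lp])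
  also have "\<dots> \<le> segre_r \<Theta> 2" using \<delta>1(2)[of "\<lambda>_. 0"] \<delta>1(1) by (simp add: rk_def chain_dom_def)
  finally show ?thesis by (simp add: card_sum)
qed

lemma segre_type_facts:
  shows "segre_type \<Theta> \<le> CARD('d) + 2" "segre_r \<Theta> l \<le> segre_r \<Theta> (segre_type \<Theta>)" "2 \<le> segre_type \<Theta>"
  unfolding segre_type_def
  using kappa_numbers[of "segre_r \<Theta>" "2 * CARD('m)" "CARD('d)" "segre_e \<Theta>" "segre_kappa \<Theta>",
      OF segre_r_mono segre_r_stable segre_r_bound segre_r_2 segre_e_def segre_kappa_def] by auto

end

section \<open>Continuity of the chart and elementary properties of reachable points\<close>

lemma continuous_on_mk:
  fixes f :: "'x::topological_space \<Rightarrow> complex^'m::finite" and h :: "'x \<Rightarrow> complex^'d::finite"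
  assumes "continuous_on S f" "continuous_on S g" "continuous_on S h"
  shows "continuous_on S (\<lambda>x. mk (f x) (g x) (h x))"
  unfolding mk_def
proof (rule continuous_on_vec_lambda)
  fix i :: "'m + ('m + 'd)"
  show "continuous_on S (\<lambda>x. case i of Inl a \<Rightarrow> f x $ a | Inr j \<Rightarrow> (case j of Inl a \<Rightarrow> g x $ a | Inr b \<Rightarrow> h x $ b))"
  proof (cases i)
    case (Inr j)
    then show ?thesis using assms by (cases j) (auto intro!: continuous_intros)
  qed (use assms in \<open>auto intro!: continuous_intros\<close>)
qed

lemma pdisc_proj: "y \<in> pdisc r \<Longrightarrow> pw y \<in> pdisc r" "y \<in> pdisc r \<Longrightarrow> pz y \<in> pdisc r" "y \<in> pdisc r \<Longrightarrow> px y \<in> pdisc r"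
  by (auto simp: pdisc_def)

lemma continuous_on_proj:
  "continuous_on S f \<Longrightarrow> continuous_on S (\<lambda>x. pw (f x))"
  "continuous_on S f \<Longrightarrow> continuous_on S (\<lambda>x. pz (f x))"
  "continuous_on S f \<Longrightarrow> continuous_on S (\<lambda>x. px (f x))"
  unfolding pw_def pz_def px_def by (auto intro!: continuous_on_vec_lambda continuous_intros)

lemma continuous_on_chart: "continuous_on S chart"
  unfolding chart_def by (intro continuous_on_mk continuous_intros)

lemma chart_0 [simp]: "chart 0 = 0"
  by (simp add: chart_def)

lemma Gamma_snd: "even k \<Longrightarrow> snd (Gamma \<Theta> (Suc k) ws) = snd (Gamma \<Theta> k ws)"
  by (simp add: Lflow_def split: prod.splits)

lemma Gamma_reach: "(\<And>j. j \<le> k \<Longrightarrow> Gamma \<Theta> j ws \<in> V) \<Longrightarrow> Gamma \<Theta> k ws \<in> flow_reach \<Theta> V"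
proof (induction k)
  case 0
  have "Gamma \<Theta> 0 ws \<in> V" by (rule 0) simp
  then show ?case by (auto intro: flow_reach.start)
next
  case (Suc k)
  have "Gamma \<Theta> k ws \<in> flow_reach \<Theta> V" by (rule Suc.IH) (use Suc.prems in auto)
  moreover have "Gamma \<Theta> (Suc k) ws \<in> V" by (rule Suc.prems) simp
  ultimately show ?case by (auto intro: flow_reach.intros split: if_splits)
qed

text \<open>The involution exchanges the projections to t and \<tau> up to conjugation, so the two
  halves of the projection statement are equivalent.\<close>

lemma contains_nbhd_snd_fst:
  assumes "contains_nbhd_in UNIV 0 (snd ` A)"
  shows "contains_nbhd_in UNIV 0 (fst ` cpt_conj ` A)"
proof -
  obtain U where U: "open U" "0 \<in> U" "U \<subseteq> snd ` A" using assms by (auto simp: contains_nbhd_in_def)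
  let ?c = "\<lambda>p. (vconj (fst p), vconj (snd p))"
  have "open (?c -` U)" by (intro open_vimage U continuous_intros)
  moreover have "0 \<in> ?c -` U" using U(2) by (simp add: zero_prod_def)
  moreover have "?c -` U \<subseteq> fst ` cpt_conj ` A"
  proof
    fix p assume "p \<in> ?c -` U"
    then obtain P where P: "P \<in> A" "?c p = snd P" using U(3) by blast
    have "fst (cpt_conj P) = p" using P(2)[symmetric] by (simp add: cpt_conj_def)
    then show "p \<in> fst ` cpt_conj ` A" using P(1) by blast
  qed
  ultimately show ?thesis by (auto simp: contains_nbhd_in_def)
qed

section \<open>Neighbourhoods, submersions and orbits in the complexification\<close>

context segre begin

lemma continuous_on_Zf: "continuous_on (pdisc R) (Zf \<Theta>)"
  using hol_continuous_on[OF Zf_hol] .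

lemma continuous_on_Phi: "continuous_on (pdisc R) (Phi \<Theta>)"
  unfolding Phi_def[abs_def] by (intro continuous_on_Pair continuous_on_proj continuous_on_id continuous_on_Zf)

lemma open_Phi_vimage: "open U \<Longrightarrow> open (pdisc R \<inter> Phi \<Theta> -` U)"
  using continuous_on_Phi by (simp add: continuous_on_open_vimage Int_commute)

lemma Gamma_small:
  assumes "open V" "0 \<in> V"
  obtains \<delta> where "\<delta> > 0" "\<And>ws j. ws \<in> chain_dom k \<delta> \<Longrightarrow> j \<le> k \<Longrightarrow> Gamma \<Theta> j ws \<in> V"
proof -
  have "0 \<in> pdisc R \<inter> Phi \<Theta> -` V" using assms R_pos Phi_0 by simp
  then obtain \<eta> where \<eta>: "\<eta> > 0" "pdisc \<eta> \<subseteq> pdisc R \<inter> Phi \<Theta> -` V"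
    by (rule pdisc_nbhd[OF open_Phi_vimage[OF assms(1)]])
  obtain \<delta>1 where \<delta>1: "\<delta>1 > 0" "\<And>Q \<theta> j. Q \<in> pdisc \<delta>1 \<Longrightarrow> \<theta> \<in> chain_dom k \<delta>1 \<Longrightarrow> j \<le> k \<Longrightarrow> F Q j \<theta> \<in> pdisc \<eta>"
    using chain_small[OF \<eta>(1), of k] by metis
  obtain \<delta>2 where \<delta>2: "small k \<delta>2" by (rule small_ex)
  let ?\<delta> = "min \<delta>1 \<delta>2"
  have "Gamma \<Theta> j ws \<in> V" if ws: "ws \<in> chain_dom k ?\<delta>" and j: "j \<le> k" for ws j
  proof -
    have "ws \<in> chain_dom k \<delta>1" "ws \<in> chain_dom k \<delta>2"
      using ws chain_dom_mono[of ?\<delta> \<delta>1 k] chain_dom_mono[of ?\<delta> \<delta>2 k] by auto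
    then have "Gamma \<Theta> j ws = Phi \<Theta> (F 0 j ws)" "F 0 j ws \<in> pdisc \<eta>"
      using Gamma_chain[OF \<delta>2 _ j] \<delta>1(1) \<delta>1(2)[of 0 ws j] j by auto
    then show ?thesis using \<eta>(2) by auto
  qed
  then show ?thesis using that[of ?\<delta>] \<delta>1(1) small_pos[OF \<delta>2] by simp
qed

text \<open>By the reality of M, the involution maps points of the complexification near the origin
  to points of the complexification, and so it transports neighbourhoods.\<close>

lemma contains_nbhd_conj:
  assumes "contains_nbhd_in (complexM \<Theta>) 0 A"
  shows "contains_nbhd_in (complexM \<Theta>) 0 (cpt_conj ` A)"
proof -
  obtain U where U: "open U" "0 \<in> U" "U \<inter> complexM \<Theta> \<subseteq> A" using assms by (auto simp: contains_nbhd_in_def)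
  let ?U = "cpt_conj -` U \<inter> chart -` pdisc R"
  have "open ?U" by (intro open_Int open_vimage open_pdisc U continuous_cpt_conj continuous_on_chart)
  moreover have "0 \<in> ?U" using U(2) R_pos by simp
  moreover have "?U \<inter> complexM \<Theta> \<subseteq> cpt_conj ` A"
  proof
    fix P assume P: "P \<in> ?U \<inter> complexM \<Theta>"
    define y where "y = chart P"
    have y: "y \<in> pdisc R" "P = Phi \<Theta> y" using P complexM_iff[of P \<Theta>] by (auto simp: y_def)
    let ?s = "vconj (Tm \<Theta> y)"
    have s: "Tm \<Theta> ?s = vconj y" using Tb_Tm[OF y(1)] by (metis Tb_def vconj_simps(1))
    have "Zf \<Theta> ?s = px (Tm \<Theta> ?s)" by (simp add: Tm_def)
    then have "Phi \<Theta> ?s = cpt_conj P" unfolding s by (simp add: y(2) Phi_def cpt_conj_def Tm_def)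
    then have "cpt_conj P \<in> U \<inter> complexM \<Theta>" using P by (metis IntE IntI Phi_in_complexM vimageD)
    then show "P \<in> cpt_conj ` A" using U(3) by (metis cpt_conj_conj image_eqI subsetD)
  qed
  ultimately show ?thesis unfolding contains_nbhd_in_def by blast
qed

lemma contains_nbhd_Gammab_iff:
  "contains_nbhd_in (complexM \<Theta>) 0 (Gammab \<Theta> k ` chain_dom k \<delta>) \<longleftrightarrow>
   contains_nbhd_in (complexM \<Theta>) 0 (Gamma \<Theta> k ` chain_dom k \<delta>)"
proof -
  have "cpt_conj ` cpt_conj ` A = A" for A :: "('m,'d) cpt set" by (simp add: image_image)
  then show ?thesis unfolding Gammab_image using contains_nbhd_conj by metis
qed

definition full :: bool where
  "full \<longleftrightarrow> segre_r \<Theta> (segre_type \<Theta>) = 2 * CARD('m) + CARD('d)"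

text \<open>A parameter of full rank for \<mu> = K + 1 steps keeps full rank when its last entry is
  set to 0. That entry becomes the zero in the middle of \<open>rev_par K \<theta>\<close>, whose
  chain has length 2K + 1 = 2 \<mu> - 1 and returns to the origin.\<close>

lemma full_submersion:
  assumes full and \<epsilon>: "\<epsilon> > 0" and N: "N = 2 * segre_type \<Theta> - 1"
  shows "\<exists>ws. ws \<in> chain_dom N \<epsilon> \<and> Gamma \<Theta> N ws = 0 \<and>
    jac_rank N (Gamma \<Theta> N) ws = 2 * CARD('m) + CARD('d) \<and>
    jac_rank N (Gammab \<Theta> N) (\<lambda>j. vconj (ws j)) = 2 * CARD('m) + CARD('d)"
proof -
  obtain K where K: "segre_type \<Theta> = Suc K" using segre_type_facts(3) by (metis Suc_le_D numeral_2_eq_2)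
  have N': "N = 2 * K + 1" using K N by simp
  obtain \<delta>1 where \<delta>1: "small N \<delta>1" by (rule small_ex)
  define \<delta> where "\<delta> = min \<delta>1 \<epsilon>"
  have \<delta>: "\<delta> > 0" "\<delta> \<le> \<epsilon>" "small N \<delta>" using \<epsilon> small_mono[OF \<delta>1, of \<delta>] small_pos[OF \<delta>1] by (auto simp: \<delta>_def)
  have Q: "(0::complex^('m + ('m + 'd))) \<in> pdisc \<delta>" using \<delta> by simp
  obtain \<theta> where \<theta>: "\<theta> \<in> chain_dom (Suc K) \<delta>" "2 * CARD('m) + CARD('d) \<le> rk (F 0 (Suc K)) \<theta>"
    using gen_segre_r[of "Suc K"] \<open>full\<close> \<delta>(1) unfolding gen_def full_def K by metis
  have sK: "small (Suc K) \<delta>" using small_len[OF \<delta>(3), of "Suc K"] by (simp add: N')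
  have \<theta>K: "\<theta> \<in> chain_dom K \<delta>" using \<theta>(1) chain_dom_le[of K "Suc K" \<delta>] by auto
  let ?w = "rev_par K \<theta>"
  have w: "?w \<in> chain_dom N \<delta>" using rev_par_dom[OF \<delta>(1) \<theta>K] by (simp add: N')
  have "2 * CARD('m) + CARD('d) \<le> rk (F 0 (Suc K)) (\<theta>(K := 0))"
    using \<theta>(2) rk_zero_last[OF sK Q \<theta>(1)] by simp
  also have "\<dots> \<le> rk (F 0 N) ?w" unfolding N' by (rule rev_par_rank[OF _ Q \<theta>K]) (use \<delta>(3) N' in simp)
  finally have rkw: "rk (F 0 N) ?w = 2 * CARD('m) + CARD('d)" using rk_le_dim by (simp add: le_antisym)
  have "F 0 N ?w = 0" unfolding N' by (rule chain_rev_par[OF small_len[OF sK, of K] Q \<theta>K]) simp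
  then have "Gamma \<Theta> N ?w = 0" using Gamma_chain[OF \<delta>(3) w, of N] Phi_0 by simp
  then show ?thesis
    using rkw w jac_rank_Gamma[OF \<delta>(3) w] jac_rank_Gammab[OF \<delta>(3) w] chain_dom_mono[OF \<delta>(2), of N] by (intro exI[of _ ?w]) auto
qed

lemma submersion_imp_nbhd:
  assumes g: "\<And>\<epsilon>. \<epsilon> > 0 \<Longrightarrow> \<exists>ws. ws \<in> chain_dom N \<epsilon> \<and> Gamma \<Theta> N ws = 0 \<and>
    jac_rank N (Gamma \<Theta> N) ws = 2 * CARD('m) + CARD('d)"
  shows "\<exists>\<delta>0>0. \<forall>\<delta>. 0 < \<delta> \<and> \<delta> < \<delta>0 \<longrightarrow> contains_nbhd_in (complexM \<Theta>) 0 (Gamma \<Theta> N ` chain_dom N \<delta>)"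
proof -
  obtain \<delta>0 where \<delta>0: "small N \<delta>0" by (rule small_ex)
  have "contains_nbhd_in (complexM \<Theta>) 0 (Gamma \<Theta> N ` chain_dom N \<delta>)" if \<delta>: "0 < \<delta>" "\<delta> < \<delta>0" for \<delta>
  proof -
    have s: "small N \<delta>" using small_mono[OF \<delta>0, of \<delta>] \<delta> by simp
    have Q: "(0::complex^('m + ('m + 'd))) \<in> pdisc \<delta>" using \<delta> by simp
    obtain ws where ws: "ws \<in> chain_dom N \<delta>" "Gamma \<Theta> N ws = 0" "jac_rank N (Gamma \<Theta> N) ws = 2 * CARD('m) + CARD('d)"
      using g[OF \<delta>(1)] by blast
    have "F 0 N ws = chart (Gamma \<Theta> N ws)" using Gamma_chain[OF s ws(1), of N] by simp
    then have F0: "F 0 N ws = 0" using ws(2) by simp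
    have "CARD('m + ('m + 'd)) \<le> rk (F 0 N) ws" using ws(3) jac_rank_Gamma[OF s ws(1)] by (simp add: card_sum)
    then obtain U where U: "open U" "F 0 N ws \<in> U" "U \<subseteq> F 0 N ` chain_dom N \<delta>"
      by (rule open_chain_image[OF s Q ws(1)])
    have "open (chart -` U :: ('m,'d) cpt set)" by (intro open_vimage U continuous_on_chart)
    moreover have "0 \<in> (chart -` U :: ('m,'d) cpt set)" using U(2) F0 by simp
    moreover have "chart -` U \<inter> complexM \<Theta> \<subseteq> Gamma \<Theta> N ` chain_dom N \<delta>"
    proof
      fix P assume P: "P \<in> chart -` U \<inter> complexM \<Theta>"
      then obtain ws' where ws': "ws' \<in> chain_dom N \<delta>" "chart P = F 0 N ws'" using U(3) by blast
      have "P = Phi \<Theta> (F 0 N ws')" using P ws'(2) complexM_iff[of P \<Theta>] by simp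
      then show "P \<in> Gamma \<Theta> N ` chain_dom N \<delta>" using Gamma_chain[OF s ws'(1) order_refl] ws'(1) by (intro image_eqI[of _ _ ws']) simp_all
    qed
    ultimately show ?thesis unfolding contains_nbhd_in_def by blast
  qed
  then show ?thesis using small_pos[OF \<delta>0] by blast
qed

text \<open>The last step belongs to the first family and leaves \<tau> fixed, so it disappears
  under projection. Every \<tau> near 0 lifts to the complexification with w = 0.\<close>

lemma nbhd_imp_projection:
  assumes "contains_nbhd_in (complexM \<Theta>) 0 (Gamma \<Theta> (Suc k) ` chain_dom (Suc k) \<delta>)" and k: "even k"
  shows "contains_nbhd_in UNIV 0 (snd ` Gamma \<Theta> k ` chain_dom k \<delta>)"
proof -
  obtain U where U: "open U" "0 \<in> U" "U \<inter> complexM \<Theta> \<subseteq> Gamma \<Theta> (Suc k) ` chain_dom (Suc k) \<delta>"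
    using assms by (auto simp: contains_nbhd_in_def)
  let ?i = "\<lambda>\<tau>::('m,'d) pt. mk 0 (fst \<tau>) (snd \<tau>)"
  let ?W = "?i -` (pdisc R \<inter> Phi \<Theta> -` U)"
  have "open ?W" by (intro open_vimage open_Phi_vimage U continuous_on_mk continuous_intros)
  moreover have "0 \<in> ?W" using U(2) R_pos Phi_0 by simp
  moreover have "?W \<subseteq> snd ` Gamma \<Theta> k ` chain_dom k \<delta>"
  proof
    fix \<tau> assume "\<tau> \<in> ?W"
    then have "Phi \<Theta> (?i \<tau>) \<in> U \<inter> complexM \<Theta>" by simp
    then obtain ws where ws: "ws \<in> chain_dom (Suc k) \<delta>" "Phi \<Theta> (?i \<tau>) = Gamma \<Theta> (Suc k) ws" using U(3) by blast
    have "\<tau> = snd (Phi \<Theta> (?i \<tau>))" by (simp add: Phi_def)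
    also have "\<dots> = snd (Gamma \<Theta> k ws)" unfolding ws(2) by (rule Gamma_snd[OF k])
    finally have "\<tau> = snd (Gamma \<Theta> k ws)" .
    moreover have "ws \<in> chain_dom k \<delta>" using ws(1) chain_dom_le[of k "Suc k" \<delta>] by auto
    ultimately show "\<tau> \<in> snd ` Gamma \<Theta> k ` chain_dom k \<delta>" by (simp only: imageI)
  qed
  ultimately show ?thesis unfolding contains_nbhd_in_def by blast
qed

text \<open>A point of the complexification is determined by w and \<tau>. Once a chain has reached
  the right \<tau>, a single flow of the first family adjusts w.\<close>

lemma projection_imp_orbit_open:
  assumes h: "\<exists>\<delta>0>0. \<forall>\<delta>. 0 < \<delta> \<and> \<delta> < \<delta>0 \<longrightarrow> contains_nbhd_in UNIV 0 (snd ` Gamma \<Theta> k ` chain_dom k \<delta>)"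
  shows "flow_orbit_open \<Theta>"
  unfolding flow_orbit_open_def
proof (intro allI impI)
  fix V :: "('m,'d) cpt set" assume V: "open V \<and> 0 \<in> V"
  obtain \<delta>0 where \<delta>0: "\<delta>0 > 0" "\<And>\<delta>. 0 < \<delta> \<Longrightarrow> \<delta> < \<delta>0 \<Longrightarrow> contains_nbhd_in UNIV 0 (snd ` Gamma \<Theta> k ` chain_dom k \<delta>)"
    using h by blast
  obtain \<delta>1 where \<delta>1: "\<delta>1 > 0" "\<And>ws j. ws \<in> chain_dom k \<delta>1 \<Longrightarrow> j \<le> k \<Longrightarrow> Gamma \<Theta> j ws \<in> V"
    using Gamma_small[of V k] V by metis
  define \<delta> where "\<delta> = min \<delta>0 \<delta>1 / 2"
  have \<delta>: "0 < \<delta>" "\<delta> < \<delta>0" "\<delta> \<le> \<delta>1" using \<delta>0 \<delta>1 by (auto simp: \<delta>_def)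
  obtain U where U: "open U" "0 \<in> U" "U \<subseteq> snd ` Gamma \<Theta> k ` chain_dom k \<delta>"
    using \<delta>0(2)[OF \<delta>(1,2)] by (auto simp: contains_nbhd_in_def)
  let ?W = "V \<inter> snd -` U"
  have "open ?W" using V U by (intro open_Int open_vimage_snd) auto
  moreover have "0 \<in> ?W" using V U by simp
  moreover have "?W \<inter> complexM \<Theta> \<subseteq> flow_reach \<Theta> V"
  proof
    fix P assume P: "P \<in> ?W \<inter> complexM \<Theta>"
    then obtain ws where ws: "ws \<in> chain_dom k \<delta>" "snd P = snd (Gamma \<Theta> k ws)" using U(3) by blast
    have "ws \<in> chain_dom k \<delta>1" using ws(1) chain_dom_mono[OF \<delta>(3)] by blast
    then have reach: "Gamma \<Theta> k ws \<in> flow_reach \<Theta> V" by (intro Gamma_reach \<delta>1(2))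
    let ?w = "fst (fst P) - fst (fst (Gamma \<Theta> k ws))"
    have "Lflow \<Theta> ?w (Gamma \<Theta> k ws) = P"
      using P ws(2) by (cases P; cases "Gamma \<Theta> k ws") (auto simp: Lflow_def complexM_def)
    then show "P \<in> flow_reach \<Theta> V" using flow_reach.stepL[OF reach, of ?w] P by simp
  qed
  ultimately show "\<exists>W. open W \<and> 0 \<in> W \<and> W \<inter> complexM \<Theta> \<subseteq> flow_reach \<Theta> V" by blast
qed

text \<open>From length \<mu> on the generic rank is constant, which gives an invariant submanifold
  through the origin; its dimension is below 2m + d, so some component lies outside
  \<open>I\<close>.\<close>

lemma not_full_straightening:
  assumes "\<not> full"
  obtains V H I i where "straightening 0 V H I" "i \<notin> I"
proof -
  obtain k where k: "segre_type \<Theta> = Suc k" using segre_type_facts(3) by (metis Suc_le_D numeral_2_eq_2)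
  let ?\<rho> = "segre_r \<Theta> (Suc k)"
  have "segre_r \<Theta> (Suc (Suc k)) = ?\<rho>"
    using segre_type_facts(2)[of "Suc (Suc k)"] segre_r_mono[of "Suc k"] k by (simp add: le_antisym)
  then obtain V H I where S: "straightening 0 V H I" "card I = ?\<rho>"
    using straightening_0[of k ?\<rho>] gen_segre_r[of "Suc k"] gen_segre_r[of "Suc (Suc k)"] by metis
  have "?\<rho> < CARD('m + ('m + 'd))" using assms segre_r_bound[of "Suc k"] k by (simp add: full_def card_sum)
  then have "I \<noteq> UNIV" using S(2) by auto
  then show ?thesis using that S(1) by blast
qed

text \<open>Steps in \<open>flow_reach\<close> constrain only their end points. In a small polydisc
  the end points force the parameter to be small, so the flow line in between stays in
  \<open>V\<close> and cannot leave the invariant submanifold.\<close>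

lemma orbit_open_imp_full:
  assumes e: "flow_orbit_open \<Theta>"
  shows full
proof (rule ccontr)
  assume "\<not> full"
  then obtain V H I i where S: "straightening 0 V H I" and i: "i \<notin> I" by (rule not_full_straightening)
  have V: "open V" "0 \<in> V" "V \<subseteq> pdisc r" "hol H V" "det (jac H 0) \<noteq> 0" "\<And>i. i \<notin> I \<Longrightarrow> H 0 $ i = 0"
    using S by (auto simp: straightening_def)
  obtain \<eta> where \<eta>: "\<eta> > 0" "pdisc \<eta> \<subseteq> V" by (rule pdisc_nbhd[OF V(1,2)])
  obtain \<delta> where \<delta>: "\<delta> > 0" "\<delta> \<le> \<eta>" "\<And>Q \<theta> j. Q \<in> pdisc \<delta> \<Longrightarrow> \<theta> \<in> chain_dom 2 \<delta> \<Longrightarrow> j \<le> 2 \<Longrightarrow> F Q j \<theta> \<in> pdisc \<eta>"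
    using chain_small[OF \<eta>(1), of 2] by metis
  have \<delta>r: "y \<in> pdisc \<delta> \<Longrightarrow> y \<in> pdisc r" for y :: "complex^('m + ('m + 'd))"
    using pdisc_mono[OF \<delta>(2)] \<eta>(2) V(3) by blast
  have ioV: "s \<in> pdisc \<delta> \<Longrightarrow> s \<in> pdisc r" for s :: "complex^'m"
    using \<delta>r[of "io s"] \<delta>(1) r_pos' by (simp add: io_pdisc)
  have stp: "Sf \<Theta> j s y \<in> V" if "s \<in> pdisc \<delta>" "y \<in> pdisc \<delta>" for j s y
  proof -
    \<comment> \<open>A chain of two steps with one parameter 0 realises a step of either family,
      whence the length 2 in the choice of \<delta>.\<close>
    let ?\<theta>0 = "\<lambda>l. if l = 0 then s else 0" and ?\<theta>1 = "\<lambda>l. if l = 1 then s else 0"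
    have d: "?\<theta>0 \<in> chain_dom 2 \<delta>" "?\<theta>1 \<in> chain_dom 2 \<delta>" using that \<delta>(1) by (auto simp: chain_dom_def)
    have "F y 1 ?\<theta>0 \<in> pdisc \<eta>" by (rule \<delta>(3)[OF that(2) d(1)]) simp
    moreover have "F y 2 ?\<theta>1 \<in> pdisc \<eta>" by (rule \<delta>(3)[OF that(2) d(2)]) simp
    moreover have "F y 1 ?\<theta>0 = Sf \<Theta> 0 s y" "F y 2 ?\<theta>1 = Sf \<Theta> 1 s y"
      using St_zero[OF \<delta>r[OF that(2)], of 0] by (auto simp: numeral_2_eq_2)
    moreover have "Sf \<Theta> j = Sf \<Theta> 0 \<or> Sf \<Theta> j = Sf \<Theta> 1" by (cases "even j") (auto simp: Sf_def fun_eq_iff)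
    ultimately show ?thesis using \<eta>(2) by auto
  qed
  \<comment> \<open>The flow parameter is the difference of two coordinate vectors, hence the radius
    \<delta>/2 for a parameter in the polydisc of radius \<delta>.\<close>
  define V1 where "V1 = {P :: ('m,'d) cpt. chart P \<in> pdisc (\<delta>/2)}"
  have "open V1" "0 \<in> V1"
  proof -
    have "V1 = chart -` pdisc (\<delta>/2)" by (auto simp: V1_def)
    then show "open V1" by (auto intro!: open_vimage continuous_on_chart)
  qed (use \<delta>(1) in \<open>simp add: V1_def\<close>)
  then obtain W where W: "open W" "0 \<in> W" "W \<inter> complexM \<Theta> \<subseteq> flow_reach \<Theta> V1"
    using e unfolding flow_orbit_open_def by blast
  have sm: "s \<in> pdisc \<delta>" if "x + s \<in> pdisc (\<delta>/2)" "x \<in> pdisc (\<delta>/2)" for x s :: "complex^'m"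
    using pdisc_add[of "x + s" "\<delta>/2" "-x" "\<delta>/2"] that by simp
  have step: "H (Sf \<Theta> j s y) $ i = 0"
    if "y \<in> pdisc (\<delta>/2)" "s \<in> pdisc \<delta>" "\<And>i. i \<notin> I \<Longrightarrow> H y $ i = 0" "i \<notin> I" for j s y i
  proof (rule straightening_flow[OF S])
    have y: "y \<in> pdisc \<delta>" using that(1) pdisc_mono[of "\<delta>/2" \<delta>] \<delta>(1) by auto
    show "s \<in> pdisc r" "y \<in> pdisc r" using ioV[OF that(2)] \<delta>r[OF y] by auto
    show "Sf \<Theta> j (complex_of_real t *s s) y \<in> V" if "t \<in> {0..1}" for t
      by (rule stp[OF pdisc_smult[OF \<open>s \<in> pdisc \<delta>\<close>] y]) (use that in auto)
  qed (use that in auto)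
  have inv: "P = Phi \<Theta> (chart P) \<and> chart P \<in> pdisc (\<delta>/2) \<and> (\<forall>i. i \<notin> I \<longrightarrow> H (chart P) $ i = 0)"
    if "P \<in> flow_reach \<Theta> V1" for P
    using that
  proof induction
    case start
    then show ?case using V(6) \<delta>(1) by (simp add: Phi_0)
  next
    case (stepL P w)
    define y where "y = chart P"
    have y: "P = Phi \<Theta> y" "y \<in> pdisc (\<delta>/2)" "\<And>i. i \<notin> I \<Longrightarrow> H y $ i = 0" using stepL by (auto simp: y_def)
    have L: "Lflow \<Theta> w P = Phi \<Theta> (Sf \<Theta> 0 w y)" unfolding y(1) Lflow_Phi by (simp add: Sf_def)
    have c: "Sf \<Theta> 0 w y \<in> pdisc (\<delta>/2)" using stepL(2) unfolding L V1_def by simp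
    have "pw (Sf \<Theta> 0 w y) = pw y + w" by (simp add: Sf_def)
    moreover have "pw (Sf \<Theta> 0 w y) \<in> pdisc (\<delta>/2)" "pw y \<in> pdisc (\<delta>/2)" using c y(2) by (auto simp: pdisc_def)
    ultimately have "w \<in> pdisc \<delta>" using sm[of "pw y" w] by simp
    then show ?case using step[OF y(2) _ y(3)] c unfolding L by simp
  next
    case (stepLb P w)
    define y where "y = chart P"
    have y: "P = Phi \<Theta> y" "y \<in> pdisc (\<delta>/2)" "\<And>i. i \<notin> I \<Longrightarrow> H y $ i = 0" using stepLb by (auto simp: y_def)
    have "chart (Lbflow \<Theta> w P) \<in> pdisc (\<delta>/2)" using stepLb(2) by (simp add: V1_def)
    moreover have "pz (chart (Lbflow \<Theta> w P)) = pz y + w" by (simp add: y(1) Phi_def Lbflow_def chart_def)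
    ultimately have "pz y + w \<in> pdisc (\<delta>/2)" using pdisc_proj(2) by metis
    moreover have "pz y \<in> pdisc (\<delta>/2)" using y(2) by (auto simp: pdisc_def)
    ultimately have w: "w \<in> pdisc \<delta>" by (rule sm)
    have yr: "y \<in> pdisc r" using \<delta>r y(2) pdisc_mono[of "\<delta>/2" \<delta>] \<delta>(1) by auto
    have L: "Lbflow \<Theta> w P = Phi \<Theta> (Sf \<Theta> 1 w y)"
      unfolding y(1) using Gamma_step[OF yr ioV[OF w], of 1] by simp
    have c: "Sf \<Theta> 1 w y \<in> pdisc (\<delta>/2)" using stepLb(2) unfolding L V1_def by simp
    then show ?case using step[OF y(2) w y(3)] unfolding L by simp
  qed
  let ?U = "pdisc R \<inter> Phi \<Theta> -` W"
  have "H y $ i = 0" if "y \<in> ?U" for y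
    using inv[of "Phi \<Theta> y"] W(3) that i by auto
  then have "det (jac H 0) = 0"
    by (intro jac_row_zero[OF open_Phi_vimage[OF W(1)]]) (use W(2) Phi_0 R_pos in auto)
  then show False using V(5) by simp
qed

end

section \<open>Minimality implies full generic rank\<close>

text \<open>M in the chart of its complexification, where \<zeta> and \<xi> are the conjugates of w
  and z. The map is only real linear; its image contains the fixed points of the involution.\<close>

definition emb :: "('m::finite,'d::finite) pt \<Rightarrow> complex^('m + ('m + 'd))" where
  "emb q = mk (fst q) (vconj (fst q)) (vconj (snd q))"

definition unemb :: "complex^('m::finite + ('m + 'd::finite)) \<Rightarrow> ('m,'d) pt" where
  "unemb y = (pw y, vconj (px y))"

lemma unemb_emb [simp]: "unemb (emb q) = q"
  by (simp add: unemb_def emb_def)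

lemma emb_0 [simp]: "emb 0 = 0"
  by (simp add: emb_def)

lemma realM_iff: "q \<in> realM \<Theta> \<longleftrightarrow> Tm \<Theta> (emb q) = vconj (emb q)"
proof -
  have "q \<in> realM \<Theta> \<longleftrightarrow> Zf \<Theta> (emb q) = snd q"
    by (cases q) (auto simp: realM_def Zf_def emb_def)
  also have "\<dots> \<longleftrightarrow> Tm \<Theta> (emb q) = vconj (emb q)"
  proof
    assume "Zf \<Theta> (emb q) = snd q"
    then show "Tm \<Theta> (emb q) = vconj (emb q)" by (simp add: Tm_def emb_def)
  next
    assume "Tm \<Theta> (emb q) = vconj (emb q)"
    then have "px (Tm \<Theta> (emb q)) = px (vconj (emb q))" by simp
    then show "Zf \<Theta> (emb q) = snd q" by (simp add: Tm_def emb_def)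
  qed
  finally show ?thesis .
qed

lemma emb_unemb:
  assumes "Tm \<Theta> y = vconj y" shows "emb (unemb y) = y"
proof -
  have "pw (Tm \<Theta> y) = pw (vconj y)" using assms by simp
  then have "pz y = vconj (pw y)" by (simp add: Tm_def)
  then show ?thesis by (intro chart_eqI) (simp_all add: emb_def unemb_def)
qed

lemma continuous_on_emb: "continuous_on S emb"
  unfolding emb_def by (intro continuous_on_mk continuous_intros)

lemma continuous_on_unemb: "continuous_on S unemb"
  unfolding unemb_def by (intro continuous_on_Pair continuous_on_vconj continuous_on_proj continuous_on_id)

lemma bounded_linear_emb: "bounded_linear (emb :: ('m::finite,'d::finite) pt \<Rightarrow> _)"
proof -
  have "linear (emb :: ('m,'d) pt \<Rightarrow> _)"
    by (rule linearI) (rule chart_eqI; simp add: emb_def vec_eq_iff)+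
  then show ?thesis by (simp add: linear_conv_bounded_linear)
qed

lemma bounded_linear_unemb: "bounded_linear (unemb :: complex^('m::finite + ('m + 'd::finite)) \<Rightarrow> _)"
proof -
  have "linear (unemb :: complex^('m + ('m + 'd)) \<Rightarrow> _)"
    by (rule linearI) (simp_all add: unemb_def vec_eq_iff)
  then show ?thesis by (simp add: linear_conv_bounded_linear)
qed

text \<open>Multiplication by \<i> becomes multiplication by - \<i> in the conjugated coordinates
  \<zeta> and \<xi>; the second summand corrects the coordinate w.\<close>

lemma emb_cmult_i: "emb (cmult \<i> v) = (- \<i>) *s emb v + (2 * \<i>) *s io (fst v)"
  by (rule chart_eqI) (simp_all add: emb_def cmult_def vec_eq_iff)

context segre begin

lemma Y_even: "y \<in> pdisc r \<Longrightarrow> Y 0 s y = io s"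
proof -
  assume y: "y \<in> pdisc r"
  have "((\<lambda>l. Sf \<Theta> 0 (l *s s) y) has_derivative (\<lambda>l. l *s Y 0 s y)) (at 0)" by (rule St_line_derivative[OF y])
  then have 1: "((\<lambda>l. y + l *s io s) has_derivative (\<lambda>l. l *s Y 0 s y)) (at 0)" by (simp add: Sf_def)
  have "((\<lambda>l. y + l *s io s) has_derivative (\<lambda>l. 0 + l *s io s)) (at 0)"
    by (intro has_derivative_add has_derivative_const bounded_linear_imp_has_derivative bounded_linear_smult_left)
  from has_derivative_unique[OF 1 this] have "1 *s Y 0 s y = 0 + 1 *s io s" by metis
  then show ?thesis by simp
qed

lemma Y_odd: "y \<in> pdisc r \<Longrightarrow> Y 1 s y = jac (Tb \<Theta>) (Tm \<Theta> y) *v io s"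
proof -
  assume y: "y \<in> pdisc r"
  have "((\<lambda>l. Sf \<Theta> 1 (l *s s) y) has_derivative (\<lambda>l. l *s Y 1 s y)) (at 0)" by (rule St_line_derivative[OF y])
  then have 1: "((\<lambda>l. Tb \<Theta> (Tm \<Theta> y + l *s io s)) has_derivative (\<lambda>l. l *s Y 1 s y)) (at 0)" by (simp add: Sf_def)
  have 2: "((\<lambda>l. Tm \<Theta> y + l *s io s) has_derivative (\<lambda>l. 0 + l *s io s)) (at 0)"
    by (intro has_derivative_add has_derivative_const bounded_linear_imp_has_derivative bounded_linear_smult_left)
  have "Tm \<Theta> y \<in> pdisc R" using Tm_io_R[OF y, of 0] r_pos' by simp
  then have "((\<lambda>l. Tb \<Theta> (Tm \<Theta> y + l *s io s)) has_derivative (\<lambda>l. jac (Tb \<Theta>) (Tm \<Theta> y) *v (0 + l *s io s))) (at 0)"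
    by (intro has_derivative_compose[OF 2]) (use hol_jac[OF Tb_hol] in simp)
  from has_derivative_unique[OF 1 this] have "1 *s Y 1 s y = jac (Tb \<Theta>) (Tm \<Theta> y) *v (0 + 1 *s io s)" by metis
  then show ?thesis by simp
qed

lemma jac_Tb:
  assumes "y \<in> pdisc R" shows "jac (Tb \<Theta>) (vconj y) *v vconj h = vconj (jac (Tm \<Theta>) y *v h)"
proof -
  have 1: "(Tb \<Theta> has_derivative (\<lambda>h. jac (Tb \<Theta>) (vconj y) *v h)) (at (vconj y))"
    by (rule hol_jac[OF Tb_hol]) (use assms in simp)
  have 2: "(vconj has_derivative vconj) (at (vconj y))"
    by (rule bounded_linear_imp_has_derivative[OF bounded_linear_vconj])
  have "((\<lambda>x. Tm \<Theta> (vconj x)) has_derivative (\<lambda>h. jac (Tm \<Theta>) y *v vconj h)) (at (vconj y))"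
    by (rule has_derivative_compose[OF 2]) (use hol_jac[OF Tm_hol assms] in simp)
  then have "((\<lambda>x. vconj (Tm \<Theta> (vconj x))) has_derivative (\<lambda>h. vconj (jac (Tm \<Theta>) y *v vconj h))) (at (vconj y))"
    by (rule bounded_linear.has_derivative[OF bounded_linear_vconj])
  then have "(Tb \<Theta> has_derivative (\<lambda>h. vconj (jac (Tm \<Theta>) y *v vconj h))) (at (vconj y))"
    by (simp add: Tb_def[abs_def])
  from has_derivative_unique[OF 1 this]
  have "jac (Tb \<Theta>) (vconj y) *v vconj h = vconj (jac (Tm \<Theta>) y *v vconj (vconj h))" by metis
  then show ?thesis by simp
qed

text \<open>This is the fixed-point equation \<open>realM_iff\<close> differentiated along a curve
  in M.\<close>

lemma tangent_realM:
  assumes v: "v \<in> tangent_vecs (realM \<Theta>) q" and q: "emb q \<in> pdisc R"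
  shows "jac (Tm \<Theta>) (emb q) *v emb v = vconj (emb v)"
proof -
  obtain \<gamma> \<epsilon> where g: "\<epsilon> > 0" "\<gamma> 0 = q" "\<And>t. \<bar>t\<bar> < \<epsilon> \<Longrightarrow> \<gamma> t \<in> realM \<Theta>" "(\<gamma> has_vector_derivative v) (at 0)"
    using v by (auto simp: tangent_vecs_def)
  have D: "((\<lambda>t. emb (\<gamma> t)) has_vector_derivative emb v) (at 0)"
    by (rule bounded_linear.has_vector_derivative[OF bounded_linear_emb g(4)])
  have "((\<lambda>t. Tm \<Theta> (emb (\<gamma> t))) has_derivative (\<lambda>t. jac (Tm \<Theta>) (emb q) *v (t *\<^sub>R emb v))) (at 0)"
    by (rule has_derivative_compose[OF D[unfolded has_vector_derivative_def]]) (use hol_jac[OF Tm_hol q] g(2) in simp)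
  then have 1: "((\<lambda>t. Tm \<Theta> (emb (\<gamma> t))) has_vector_derivative (jac (Tm \<Theta>) (emb q) *v emb v)) (at 0)"
    by (simp only: has_vector_derivative_def scaleR_vec_smult vector_scalar_commute)
  have 2: "((\<lambda>t. vconj (emb (\<gamma> t))) has_vector_derivative vconj (emb v)) (at 0)"
    by (rule bounded_linear.has_vector_derivative[OF bounded_linear_vconj D])
  have "((\<lambda>t. vconj (emb (\<gamma> t))) has_vector_derivative (jac (Tm \<Theta>) (emb q) *v emb v)) (at 0)"
    by (rule has_vector_derivative_transform_within_open[OF 1 open_greaterThanLessThan[of "-\<epsilon>" \<epsilon>]])
       (use g in \<open>auto simp: realM_iff\<close>)
  from vector_derivative_unique_at[OF this 2] show ?thesis .
qed

text \<open>Since v and \<i> v are both tangent, both satisfy the linearised equation of M.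
  Eliminating between the two equations determines \<open>emb v\<close> from its w-part as a
  combination of both families with conjugate coefficients.\<close>

lemma cplx_tangent_emb:
  assumes q: "q \<in> realM \<Theta>" "emb q \<in> pdisc r" and v: "v \<in> cplx_tangent (realM \<Theta>) q"
  shows "emb v = Y 0 (fst v) (emb q) + Y 1 (vconj (fst v)) (emb q)"
proof -
  let ?y = "emb q" and ?a = "fst v"
  let ?J = "jac (Tm \<Theta>) ?y"
  have yR: "?y \<in> pdisc R" by (rule r_R[OF q(2)])
  have e1: "?J *v emb v = vconj (emb v)"
    by (rule tangent_realM[OF _ yR]) (use v in \<open>simp add: cplx_tangent_def\<close>)
  have "?J *v emb (cmult \<i> v) = vconj (emb (cmult \<i> v))"
    by (rule tangent_realM[OF _ yR]) (use v in \<open>simp add: cplx_tangent_def\<close>)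
  moreover have "?J *v emb (cmult \<i> v) = (- \<i>) *s vconj (emb v) + (2 * \<i>) *s (?J *v io ?a)"
    unfolding emb_cmult_i by (simp only: matrix_vector_right_distrib vector_scalar_commute e1)
  moreover have "vconj (emb (cmult \<i> v)) = \<i> *s vconj (emb v) + (- 2 * \<i>) *s io (vconj ?a)"
    unfolding emb_cmult_i by simp
  ultimately have "(- \<i>) *s vconj (emb v) + (2 * \<i>) *s (?J *v io ?a) = \<i> *s vconj (emb v) + (- 2 * \<i>) *s io (vconj ?a)"
    by simp
  then have "(2 * \<i>) *s (?J *v io ?a) = (2 * \<i>) *s (vconj (emb v) - io (vconj ?a))"
    by (simp add: vec_eq_iff algebra_simps)
  then have "?J *v io ?a = vconj (emb v) - io (vconj ?a)" by (simp only: vec.scale_cancel_left) simp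
  then have "vconj (emb v) = io (vconj ?a) + ?J *v io ?a" by simp
  then have "emb v = vconj (io (vconj ?a) + ?J *v io ?a)" by (metis vconj_simps(1))
  also have "\<dots> = io ?a + vconj (?J *v io ?a)" by simp
  also have "vconj (?J *v io ?a) = jac (Tb \<Theta>) (vconj ?y) *v io (vconj ?a)"
    using jac_Tb[OF yR, of "io ?a"] by simp
  also have "\<dots> = Y 1 (vconj ?a) ?y" using Y_odd[OF q(2)] q(1) by (simp add: realM_iff)
  finally show ?thesis using Y_even[OF q(2)] by simp
qed

text \<open>Along an integral curve the coefficients in the two families are the w-part of the
  section and its conjugate, and these are bounded by continuity on a compact time interval.\<close>

lemma straightening_cr_reach:
  assumes S: "straightening 0 V H I" and i: "i \<notin> I"
    and q: "q \<in> cr_reach (realM \<Theta>) (emb -` V) 0"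
  shows "H (emb q) $ i = 0"
proof -
  have curve: "\<And>c a b T K. (\<forall>t\<in>{0..T}. c t \<in> V \<and> norm (a t) \<le> K \<and> norm (b t) \<le> K \<and>
          (c has_vector_derivative (Y 0 (a t) (c t) + Y 1 (b t) (c t))) (at t within {0..T})) \<and>
        (\<forall>i. i \<notin> I \<longrightarrow> H (c 0) $ i = 0) \<Longrightarrow>
        (\<forall>t\<in>{0..T::real}. \<forall>i. i \<notin> I \<longrightarrow> H (c t) $ i = 0)"
    using S unfolding straightening_def by blast
  have Vr: "V \<subseteq> pdisc r" using S by (simp add: straightening_def)
  have "\<forall>i. i \<notin> I \<longrightarrow> H (emb q) $ i = 0" using q
  proof induction
    case start
    then show ?case using S by (auto simp: straightening_def)
  next
    case (step q X T \<gamma>)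
    let ?V = "emb -` V"
    have X: "continuous_on (realM \<Theta> \<inter> ?V) X" "\<And>q. q \<in> realM \<Theta> \<inter> ?V \<Longrightarrow> X q \<in> cplx_tangent (realM \<Theta>) q"
      using step(2) by (auto simp: Tc_section_def)
    have \<gamma>V: "\<gamma> t \<in> realM \<Theta> \<inter> ?V" if "t \<in> {0..T}" for t using step(5) that by auto
    have D: "(\<gamma> has_vector_derivative X (\<gamma> t)) (at t within {0..T})" if "t \<in> {0..T}" for t using step(6) that by blast
    have c\<gamma>: "continuous_on {0..T} \<gamma>"
      using D has_vector_derivative_continuous by (metis continuous_on_eq_continuous_within)
    have "continuous_on {0..T} (\<lambda>t. X (\<gamma> t))"
      by (rule continuous_on_compose2[OF X(1) c\<gamma>]) (use \<gamma>V in blast)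
    then have "bounded ((\<lambda>t. fst (X (\<gamma> t))) ` {0..T})"
      by (intro compact_imp_bounded compact_continuous_image continuous_intros) auto
    then obtain K where "\<forall>t\<in>{0..T}. norm (fst (X (\<gamma> t))) \<le> K" unfolding bounded_iff by auto
    then have K: "\<And>t. t \<in> {0..T} \<Longrightarrow> norm (fst (X (\<gamma> t))) \<le> K" by blast
    have "\<forall>t\<in>{0..T}. \<forall>i. i \<notin> I \<longrightarrow> H (emb (\<gamma> t)) $ i = 0"
    proof (rule curve[where a = "\<lambda>t. fst (X (\<gamma> t))" and b = "\<lambda>t. vconj (fst (X (\<gamma> t)))" and K = K], intro conjI ballI)
      fix t assume t: "t \<in> {0..T}"
      show "emb (\<gamma> t) \<in> V" using \<gamma>V[OF t] by simp
      show "norm (fst (X (\<gamma> t))) \<le> K" "norm (vconj (fst (X (\<gamma> t)))) \<le> K" using K[OF t] by auto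
      have "emb (X (\<gamma> t)) = Y 0 (fst (X (\<gamma> t))) (emb (\<gamma> t)) + Y 1 (vconj (fst (X (\<gamma> t)))) (emb (\<gamma> t))"
        by (rule cplx_tangent_emb) (use \<gamma>V[OF t] X(2) Vr in auto)
      then show "((\<lambda>t. emb (\<gamma> t)) has_vector_derivative (Y 0 (fst (X (\<gamma> t))) (emb (\<gamma> t)) + Y 1 (vconj (fst (X (\<gamma> t)))) (emb (\<gamma> t)))) (at t within {0..T})"
        using bounded_linear.has_vector_derivative[OF bounded_linear_emb D[OF t]] by simp
    qed (use step in auto)
    then show ?case using step(3) by simp
  qed
  then show ?thesis using i by blast
qed

text \<open>Near the origin the antiholomorphic involution \<open>y \<mapsto> vconj (Tm y)\<close> is linearised by
  \<open>y \<mapsto> y + jac Tb 0 *v Tm y\<close>, so its fixed points form a maximally real submanifold.\<close>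
lemma hol_vanishing_realM:
  assumes H: "hol H V" "0 \<in> V" and W: "open W" "0 \<in> W"
    and z: "\<And>q. q \<in> realM \<Theta> \<inter> W \<Longrightarrow> H (emb q) $ i = 0"
  shows "det (jac H 0) = 0"
proof -
  define A where "A = jac (Tm \<Theta>) 0"
  define B where "B = jac (Tb \<Theta>) 0"
  have R0: "(0::complex^('m + ('m + 'd))) \<in> pdisc R" using R_pos by simp
  have Bc: "B *v vconj h = vconj (A *v h)" for h using jac_Tb[OF R0] by (simp add: A_def B_def)
  have BA: "B ** A = mat 1"
  proof -
    have "jac (\<lambda>y. Tb \<Theta> (Tm \<Theta> y)) 0 = B ** A"
      using jac_compose[OF Tb_hol Tm_hol R0] Tm_0 R0 by (simp add: A_def B_def)
    moreover have "((\<lambda>y. Tb \<Theta> (Tm \<Theta> y)) has_derivative (\<lambda>h. h)) (at 0)"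
      by (rule has_derivative_transform_within_open[OF has_derivative_ident open_pdisc R0]) (simp add: Tb_Tm)
    then have "jac (\<lambda>y. Tb \<Theta> (Tm \<Theta> y)) 0 = mat 1" by (intro jac_unique) simp
    ultimately show ?thesis by simp
  qed
  then have AB: "A ** B = mat 1" by (simp add: matrix_left_right_inverse)
  define \<phi> where "\<phi> y = y + B *v Tm \<Theta> y" for y
  have h\<phi>: "hol \<phi> (pdisc R)" unfolding \<phi>_def
    by (intro hol_add hol_id hol_compose[OF hol_matrix_vector[OF open_UNIV] Tm_hol]) auto
  have j\<phi>: "(\<phi> has_derivative (\<lambda>h. h + h)) (at 0)"
  proof -
    have "((\<lambda>y. B *v Tm \<Theta> y) has_derivative (\<lambda>h. B *v (A *v h))) (at 0)"
      unfolding A_def by (rule bounded_linear.has_derivative[OF matrix_vector_mul_bounded_linear hol_jac[OF Tm_hol R0]])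
    then have "((\<lambda>y. B *v Tm \<Theta> y) has_derivative (\<lambda>h. h)) (at 0)" by (simp add: matrix_vector_mul_assoc BA)
    then show ?thesis unfolding \<phi>_def by (intro has_derivative_add has_derivative_ident)
  qed
  have jac\<phi>: "jac \<phi> 0 *v h = h + h" for h
    using has_derivative_unique[OF hol_jac[OF h\<phi> R0] j\<phi>] by metis
  have det: "det (jac \<phi> 0) \<noteq> 0"
  proof -
    have "x = 0" if "jac \<phi> 0 *v x = 0" for x using that unfolding jac\<phi> by (simp add: vec_eq_iff)
    then show ?thesis by (metis invertible_det_nz invertible_left_inverse matrix_left_invertible_ker)
  qed
  have \<phi>0: "\<phi> 0 = 0" by (simp add: \<phi>_def Tm_0)
  obtain U' V' \<psi> where inv: "open U'" "U' \<subseteq> pdisc R" "0 \<in> U'" "open V'" "\<phi> 0 \<in> V'" "homeomorphism U' V' \<phi> \<psi>"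
    "hol \<psi> V'" "\<And>y. y \<in> V' \<Longrightarrow> jac \<phi> (\<psi> y) ** jac \<psi> y = mat 1"
    by (rule hol_inverse_function[OF h\<phi> R0 det]) (rule that)
  have 0: "0 \<in> V'" using inv(5) \<phi>0 by simp
  have \<psi>\<phi>: "\<And>u. u \<in> U' \<Longrightarrow> \<psi> (\<phi> u) = u" "\<And>y. y \<in> V' \<Longrightarrow> \<phi> (\<psi> y) = y" "\<And>y. y \<in> V' \<Longrightarrow> \<psi> y \<in> U'"
    using inv(6) by (auto simp: homeomorphism_def)
  have \<psi>0: "\<psi> 0 = 0" using \<psi>\<phi>(1)[OF inv(3)] \<phi>0 by simp
  have j\<psi>: "jac \<psi> 0 *v x + jac \<psi> 0 *v x = x" for x
  proof -
    have "jac \<phi> 0 *v (jac \<psi> 0 *v x) = x" using inv(8)[OF 0] \<psi>0 by (simp add: matrix_vector_mul_assoc)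
    then show ?thesis by (simp only: jac\<phi>)
  qed
  \<comment> \<open>The real line through a fixed vector of the linear involution is carried by
    \<psi> to a curve of real points, on which the component of \<open>H\<close> vanishes; its
    derivative at 0 is then 0.\<close>
  have fixed: "(jac H 0 *v x) $ i = 0" if x: "A *v x = vconj x" for x
  proof -
    let ?y = "\<lambda>t::real. \<psi> (complex_of_real t *s x)"
    define P where "P = V' \<inter> \<psi> -` (U' \<inter> V \<inter> (pdisc R \<inter> (\<lambda>y. vconj (Tm \<Theta> y)) -` U') \<inter> unemb -` W)"
    have oV: "open V" using hol_open[OF H(1)] .
    have op1: "open (pdisc R \<inter> (\<lambda>y. vconj (Tm \<Theta> y)) -` U')"
      using continuous_on_vconj[OF hol_continuous_on[OF Tm_hol]] inv(1) by (simp add: continuous_on_open_vimage Int_commute)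
    have "open (U' \<inter> V \<inter> (pdisc R \<inter> (\<lambda>y. vconj (Tm \<Theta> y)) -` U') \<inter> unemb -` W)"
      by (rule open_Int[OF open_Int[OF open_Int[OF inv(1) oV] op1] open_vimage[OF W(1) continuous_on_unemb]])
    moreover have "open (V' \<inter> \<psi> -` B)" if "open B" for B
      using hol_continuous_on[OF inv(7)] inv(4) that by (simp add: continuous_on_open_vimage Int_commute)
    ultimately have oP: "open P" unfolding P_def by blast
    have zP: "0 \<in> P" using 0 \<psi>0 inv(3) H(2) R0 W(2) by (simp add: P_def Tm_0 unemb_def zero_prod_def)
    let ?T = "(\<lambda>t::real. complex_of_real t *s x) -` P"
    have ct: "continuous_on UNIV (\<lambda>t::real. complex_of_real t *s x)"
      using continuous_on_compose2[OF linear_continuous_on[OF bounded_linear_smult_left], of UNIV complex_of_real UNIV x]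
      by (auto intro!: continuous_intros)
    have oT: "open ?T" by (rule open_vimage[OF oP ct])
    have vanish: "H (?y t) $ i = 0" if t: "t \<in> ?T" for t
    proof -
      let ?x = "complex_of_real t *s x"
      have tP: "?x \<in> V'" "?y t \<in> U'" "?y t \<in> V" "?y t \<in> pdisc R" "vconj (Tm \<Theta> (?y t)) \<in> U'" "unemb (?y t) \<in> W"
        using t by (auto simp: P_def)
      have Tms: "Tm \<Theta> (vconj (Tm \<Theta> (?y t))) = vconj (?y t)"
        using Tb_Tm[OF tP(4)] by (metis Tb_def vconj_simps(1))
      \<comment> \<open>Since \<phi> conjugates the involution to its linear part, the point and its
        image under the involution have the same value of \<phi>, and injectivity makes the point
        real.\<close>
      have "\<phi> (vconj (Tm \<Theta> (?y t))) = vconj (Tm \<Theta> (?y t)) + vconj (A *v ?y t)"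
        by (simp only: \<phi>_def Tms Bc)
      also have "\<dots> = vconj (A *v \<phi> (?y t))"
        by (simp add: \<phi>_def matrix_vector_right_distrib matrix_vector_mul_assoc AB add.commute)
      also have "\<dots> = vconj (A *v ?x)" using \<psi>\<phi>(2)[OF tP(1)] by simp
      also have "\<dots> = ?x" using x by (simp add: vector_scalar_commute)
      also have "\<dots> = \<phi> (?y t)" using \<psi>\<phi>(2)[OF tP(1)] by simp
      finally have "vconj (Tm \<Theta> (?y t)) = ?y t" using \<psi>\<phi>(1)[OF tP(5)] \<psi>\<phi>(1)[OF tP(2)] by metis
      then have fx: "Tm \<Theta> (?y t) = vconj (?y t)" by (metis vconj_simps(1))
      then have e: "emb (unemb (?y t)) = ?y t" by (rule emb_unemb)
      then have "unemb (?y t) \<in> realM \<Theta>" using fx by (simp add: realM_iff)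
      then show ?thesis using z[of "unemb (?y t)"] tP(6) e by simp
    qed
    have 1: "((\<lambda>t. complex_of_real t *s x) has_derivative (\<lambda>t. complex_of_real t *s x)) (at 0)"
      by (rule bounded_linear_imp_has_derivative)
         (rule bounded_linear_compose[OF bounded_linear_smult_left bounded_linear_of_real])
    have "(?y has_derivative (\<lambda>t. jac \<psi> 0 *v (complex_of_real t *s x))) (at 0)"
      by (rule has_derivative_compose[OF 1]) (use hol_jac[OF inv(7) 0] in simp)
    then have "((\<lambda>t. H (?y t)) has_derivative (\<lambda>t. jac H 0 *v (jac \<psi> 0 *v (complex_of_real t *s x)))) (at 0)"
      by (rule has_derivative_compose) (use hol_jac[OF H] \<psi>0 in simp)
    then have "((\<lambda>t. H (?y t) $ i) has_derivative (\<lambda>t. (jac H 0 *v (jac \<psi> 0 *v (complex_of_real t *s x))) $ i)) (at 0)"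
      by (rule bounded_linear.has_derivative[OF bounded_linear_vec_nth])
    then have "((\<lambda>t. 0) has_derivative (\<lambda>t. (jac H 0 *v (jac \<psi> 0 *v (complex_of_real t *s x))) $ i)) (at (0::real))"
      by (rule has_derivative_transform_within_open[OF _ oT]) (use zP vanish in auto)
    from has_derivative_unique[OF this has_derivative_const]
    have "(jac H 0 *v (jac \<psi> 0 *v (complex_of_real 1 *s x))) $ i = 0" by metis
    then have "(jac H 0 *v (jac \<psi> 0 *v x)) $ i = 0" by simp
    moreover have "jac H 0 *v x = jac H 0 *v (jac \<psi> 0 *v x) + jac H 0 *v (jac \<psi> 0 *v x)"
      using j\<psi>[of x] by (metis matrix_vector_right_distrib)
    ultimately show ?thesis by simp
  qed
  have all: "(jac H 0 *v x) $ i = 0" for x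
  proof -
    \<comment> \<open>\<open>s\<close> is the image of \<open>x\<close> under the linear involution;
      \<open>x + s\<close> and \<open>\<i> *s (x - s)\<close> are fixed vectors of which
      \<open>x\<close> is a complex combination.\<close>
    define s where "s = vconj (A *v x)"
    have As: "A *v s = vconj x"
    proof -
      have "vconj (A *v s) = B *v vconj s" using Bc by simp
      also have "\<dots> = x" by (simp add: s_def matrix_vector_mul_assoc BA)
      finally show ?thesis by (metis vconj_simps(1))
    qed
    have Ax: "A *v x = vconj s" by (simp add: s_def)
    have 1: "(jac H 0 *v (x + s)) $ i = 0"
      by (rule fixed) (simp add: matrix_vector_right_distrib As Ax add.commute)
    have 2: "(jac H 0 *v (\<i> *s (x - s))) $ i = 0"
      by (rule fixed) (simp add: matrix_vector_mult_diff_distrib vector_scalar_commute As Ax vec_eq_iff algebra_simps)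
    have "(jac H 0 *v (x - s)) $ i = 0" using 2 unfolding vector_scalar_commute vector_smult_component by simp
    then show ?thesis using 1 by (simp add: matrix_vector_right_distrib matrix_vector_mult_diff_distrib)
  qed
  have "jac H 0 $ i $ j = 0" for j
    using all[of "axis j 1"] by (simp add: matrix_vector_mult_def axis_def if_distrib cong: if_cong)
  then have "row i (jac H 0) = 0" by (simp add: row_def vec_eq_iff)
  then show ?thesis by (rule det_zero_row)
qed

lemma minimal_imp_full:
  assumes "minimal_at (realM \<Theta>) 0" shows full
proof (rule ccontr)
  assume "\<not> full"
  then obtain V H I i where S: "straightening 0 V H I" and i: "i \<notin> I" by (rule not_full_straightening)
  have V: "open V" "0 \<in> V" "hol H V" "det (jac H 0) \<noteq> 0" using S by (auto simp: straightening_def)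
  have "open (emb -` V)" "0 \<in> emb -` V" using V by (auto intro!: open_vimage continuous_on_emb)
  then obtain W where W: "open W" "0 \<in> W" "realM \<Theta> \<inter> W \<subseteq> cr_reach (realM \<Theta>) (emb -` V) 0"
    using assms unfolding minimal_at_def by blast
  have "det (jac H 0) = 0"
    by (rule hol_vanishing_realM[OF V(3,2) W(1,2)]) (use straightening_cr_reach[OF S i] W(3) in blast)
  then show False using V(4) by simp
qed

end

section \<open>Holomorphic ordinary differential equations\<close>

lemma norm_jn_diff: "norm (jn a x - jn a y) = norm (x - y)"
proof -
  have "(\<Sum>i\<in>UNIV <+> UNIV. (norm ((jn a x - jn a y) $ i))\<^sup>2) = (\<Sum>i\<in>UNIV. (norm ((x - y) $ i))\<^sup>2)"
    by (subst sum.Plus) auto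
  then show ?thesis by (simp only: norm_vec_def L2_set_def UNIV_Plus_UNIV)
qed

lemma jn_closure_pdisc: "a \<in> pdisc s \<Longrightarrow> y \<in> pdisc s \<Longrightarrow> jn a y \<in> closure (pdisc s)"
  using closure_subset by (force simp: jn_pdisc)

lemma vector_field_lipschitz:
  assumes h: "hol (\<lambda>v. X (jl v) (jr v)) (pdisc r)" and s: "s < r"
  obtains L where "L \<ge> 0"
    "\<And>\<theta> x y. \<lbrakk>\<theta> \<in> pdisc s; x \<in> pdisc s; y \<in> pdisc s\<rbrakk> \<Longrightarrow> norm (X \<theta> x - X \<theta> y) \<le> L * norm (x - y)"
proof -
  obtain L where L: "L \<ge> 0" "\<And>u v. u \<in> closure (pdisc s) \<Longrightarrow> v \<in> closure (pdisc s) \<Longrightarrow>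
      norm (X (jl u) (jr u) - X (jl v) (jr v)) \<le> L * norm (u - v)"
    using hol_lipschitz[OF h compact_closure_pdisc closure_pdisc_subset[OF s] convex_closure_pdisc] by blast
  have "norm (X \<theta> x - X \<theta> y) \<le> L * norm (x - y)" if "\<theta> \<in> pdisc s" "x \<in> pdisc s" "y \<in> pdisc s" for \<theta> x y
    using L(2)[OF jn_closure_pdisc[OF that(1,2)] jn_closure_pdisc[OF that(1,3)]] by (simp add: norm_jn_diff)
  then show ?thesis using that L(1) by blast
qed

lemma vector_field_bound:
  assumes h: "hol (\<lambda>v. X (jl v) (jr v)) (pdisc r)" and s: "s < r"
  obtains B where "B \<ge> 0" "\<And>\<theta> x. \<lbrakk>\<theta> \<in> pdisc s; x \<in> pdisc s\<rbrakk> \<Longrightarrow> norm (X \<theta> x) \<le> B"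
proof -
  have "compact ((\<lambda>v. X (jl v) (jr v)) ` closure (pdisc s))"
    using continuous_on_subset[OF hol_continuous_on[OF h] closure_pdisc_subset[OF s]] compact_closure_pdisc
    by (rule compact_continuous_image)
  then have "bounded ((\<lambda>v. X (jl v) (jr v)) ` closure (pdisc s))" by (rule compact_imp_bounded)
  then obtain B where B: "\<forall>x\<in>(\<lambda>v. X (jl v) (jr v)) ` closure (pdisc s). norm x \<le> B"
    unfolding bounded_iff by auto
  have "norm (X \<theta> x) \<le> max B 0" if "\<theta> \<in> pdisc s" "x \<in> pdisc s" for \<theta> x
  proof -
    have "norm (X (jl (jn \<theta> x)) (jr (jn \<theta> x))) \<le> B" using B jn_closure_pdisc[OF that] by blast
    then show ?thesis by simp
  qed
  then show ?thesis using that[of "max B 0"] by simp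
qed

lemma ode_unique:
  fixes X :: "complex^'q::finite \<Rightarrow> complex^'n::finite \<Rightarrow> complex^'n"
  assumes h: "hol (\<lambda>v. X (jl v) (jr v)) (pdisc r)" and s: "s < r" and \<theta>: "\<theta> \<in> pdisc s"
    and c: "\<And>t. t \<in> {0..1} \<Longrightarrow> c t \<in> pdisc s" "\<And>t. t \<in> {0..1} \<Longrightarrow> c' t \<in> pdisc s"
    and D: "\<And>t. t \<in> {0..1} \<Longrightarrow> (c has_vector_derivative X \<theta> (c t)) (at t within {0..1})"
      "\<And>t. t \<in> {0..1} \<Longrightarrow> (c' has_vector_derivative X \<theta> (c' t)) (at t within {0..1})"
    and 0: "c 0 = c' 0" and t: "t \<in> {0..1::real}"
  shows "c t = c' t"
proof -
  obtain L where L: "L \<ge> 0"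
    "\<And>\<theta> x y. \<lbrakk>\<theta> \<in> pdisc s; x \<in> pdisc s; y \<in> pdisc s\<rbrakk> \<Longrightarrow> norm (X \<theta> x - X \<theta> y) \<le> L * norm (x - y)"
    by (rule vector_field_lipschitz[OF h s]) (rule that)
  have "c t - c' t = 0"
  proof (rule gronwall_zero[where T = 1 and K = L and z = "\<lambda>t. c t - c' t" and z' = "\<lambda>t. X \<theta> (c t) - X \<theta> (c' t)"])
    fix t :: real assume t: "t \<in> {0..1}"
    show "((\<lambda>t. c t - c' t) has_vector_derivative X \<theta> (c t) - X \<theta> (c' t)) (at t within {0..1})"
      by (rule has_vector_derivative_diff[OF D(1)[OF t] D(2)[OF t]])
    show "norm (X \<theta> (c t) - X \<theta> (c' t)) \<le> L * norm (c t - c' t)"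
      by (rule L(2)[OF \<theta> c(1)[OF t] c(2)[OF t]])
  qed (use 0 t in auto)
  then show ?thesis by simp
qed

text \<open>The increments are dominated by a geometric series of sum 2e, so convergence is uniform
  and \<open>shol_uniform_limit\<close> applies to the components.\<close>

lemma shol_limit_geometric:
  fixes P :: "nat \<Rightarrow> complex^'p \<Rightarrow> complex^'n"
  assumes h: "\<And>n. hol (P n) U" and d: "\<And>n v. v \<in> U \<Longrightarrow> norm (P (Suc n) v - P n v) \<le> e * (1/2) ^ n"
  obtains G where "hol G U" "\<And>n v. v \<in> U \<Longrightarrow> norm (P n v - G v) \<le> 2 * e * (1/2) ^ n"
proof -
  have diff: "norm (P (n + k) v - P n v) \<le> 2 * e * (1/2) ^ n" if v: "v \<in> U" for n k v
  proof -
    have "0 \<le> norm (P (Suc 0) v - P 0 v)" by simp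
    also have "\<dots> \<le> e * (1/2) ^ 0" by (rule d[OF v])
    finally have e0: "e \<ge> 0" by simp
    have "norm (P (n + k) v - P n v) \<le> 2 * e * (1/2) ^ n * (1 - (1/2) ^ k)"
    proof (induction k)
      case (Suc k)
      have "norm (P (n + Suc k) v - P n v) \<le> norm (P (Suc (n + k)) v - P (n + k) v) + norm (P (n + k) v - P n v)"
        using norm_triangle_ineq[of "P (Suc (n + k)) v - P (n + k) v" "P (n + k) v - P n v"] by simp
      also have "\<dots> \<le> e * (1/2) ^ (n + k) + 2 * e * (1/2) ^ n * (1 - (1/2) ^ k)"
        by (intro add_mono d v Suc)
      also have "\<dots> = 2 * e * (1/2) ^ n * (1 - (1/2) ^ Suc k)" by (simp add: power_add algebra_simps)
      finally show ?case .
    qed simp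
    also have "\<dots> \<le> 2 * e * (1/2) ^ n" using e0 by (simp add: mult_left_le)
    finally show ?thesis .
  qed
  have lim0: "(\<lambda>n. 2 * e * (1/2) ^ n) \<longlonglongrightarrow> 0"
    by (intro tendsto_mult_right_zero LIMSEQ_realpow_zero) auto
  have conv: "convergent (\<lambda>n. P n v)" if v: "v \<in> U" for v
  proof (rule Cauchy_convergent, rule CauchyI')
    fix \<epsilon>::real assume "\<epsilon> > 0"
    then obtain N where N: "\<And>n. n \<ge> N \<Longrightarrow> 2 * e * (1/2) ^ n < \<epsilon>"
      using order_tendstoD(2)[OF lim0] unfolding eventually_sequentially by blast
    have "dist (P m v) (P n v) < \<epsilon>" if "m \<ge> N" "n > m" for m n
      using diff[OF v, of m "n - m"] N[OF that(1)] that by (simp add: dist_norm norm_minus_commute)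
    then show "\<exists>M. \<forall>m\<ge>M. \<forall>n>m. dist (P m v) (P n v) < \<epsilon>" by blast
  qed
  define G where "G v = lim (\<lambda>n. P n v)" for v
  have G: "(\<lambda>n. P n v) \<longlonglongrightarrow> G v" if "v \<in> U" for v
    using conv[OF that] by (simp add: G_def convergent_LIMSEQ_iff)
  have b: "norm (P n v - G v) \<le> 2 * e * (1/2) ^ n" if v: "v \<in> U" for n v
  proof (rule Lim_bounded)
    show "(\<lambda>k. norm (P n v - P k v)) \<longlonglongrightarrow> norm (P n v - G v)" by (intro tendsto_intros G v)
    show "\<forall>k\<ge>n. norm (P n v - P k v) \<le> 2 * e * (1/2) ^ n"
      using diff[OF v, of n] by (metis le_add_diff_inverse norm_minus_commute)
  qed
  have "hol G U"
  proof (rule hol_vecI)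
    show "open U" using hol_open[OF h] .
    fix i
    show "shol (\<lambda>v. G v $ i) U"
    proof (rule shol_uniform_limit)
      show "shol (\<lambda>v. P n v $ i) U" for n by (rule hol_nth[OF h])
      show "uniform_limit U (\<lambda>n v. P n v $ i) (\<lambda>v. G v $ i) sequentially"
      proof (rule uniform_limitI)
        fix \<epsilon>::real assume "\<epsilon> > 0"
        then have "\<forall>\<^sub>F n in sequentially. 2 * e * (1/2) ^ n < \<epsilon>" using order_tendstoD(2)[OF lim0] by blast
        then show "\<forall>\<^sub>F n in sequentially. \<forall>v\<in>U. dist (P n v $ i) (G v $ i) < \<epsilon>"
        proof (rule eventually_mono, intro ballI)
          fix n v assume n: "2 * e * (1/2) ^ n < \<epsilon>" and v: "v \<in> U"
          have "dist (P n v $ i) (G v $ i) \<le> norm (P n v - G v)"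
            using Finite_Cartesian_Product.norm_nth_le[of "P n v - G v" i] by (simp add: dist_norm)
          then show "dist (P n v $ i) (G v $ i) < \<epsilon>" using b[OF v, of n] n by simp
        qed
      qed
    qed
  qed
  then show ?thesis using that b by blast
qed

text \<open>Substitution turns the integral over the unit interval into the integral of
  \<open>h\<close> from 0 to \<open>t\<close>; the fixed interval is the form in which
  \<open>hol_integral\<close> applies. The condition \<open>a > 1\<close> leaves room for two-sided
  derivatives at the times 1 and -1.\<close>

lemma scaled_integral_derivative:
  fixes h :: "real \<Rightarrow> complex^'n"
  assumes a: "a > 1" and h: "continuous_on {-a..a} h"
    and eq: "\<And>t. t \<in> {-a..a} \<Longrightarrow> y t = y0 + integral {0..1} (\<lambda>s. t *\<^sub>R h (s * t))" and t: "\<bar>t\<bar> \<le> 1"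
  shows "(y has_vector_derivative h t) (at t)"
proof -
  define G where "G u = integral {-a..u} h" for u
  have G: "(G has_vector_derivative h u) (at u within {-a..a})" if "u \<in> {-a..a}" for u
    unfolding G_def by (rule integral_has_vector_derivative[OF h that])
  have yG: "y u = y0 + (G u - G 0)" if u: "u \<in> {-a..a}" for u
  proof -
    have "((\<lambda>s. u *\<^sub>R h (s * u)) has_integral (G (1 * u) - G (0 * u))) {0..1}"
    proof (rule fundamental_theorem_of_calculus)
      fix s :: real assume s: "s \<in> {0..1}"
      have in_a: "x * u \<in> {-a..a}" if "x \<in> {0..1}" for x
      proof -
        have "\<bar>x * u\<bar> \<le> 1 * a" unfolding abs_mult using that u by (intro mult_mono) auto
        then show ?thesis by auto
      qed
      have D: "((\<lambda>s. s * u) has_real_derivative u) (at s within {0..1})" by (auto intro!: derivative_eq_intros)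
      have "(G has_vector_derivative h (s * u)) (at (s * u) within (\<lambda>s. s * u) ` {0..1})"
        by (rule has_vector_derivative_within_subset[OF G]) (use in_a s in auto)
      from vector_diff_chain_within[OF D[unfolded has_real_derivative_iff_has_vector_derivative] this]
      show "((\<lambda>s. G (s * u)) has_vector_derivative u *\<^sub>R h (s * u)) (at s within {0..1})" by (simp add: o_def)
    qed simp
    from integral_unique[OF this] have "integral {0..1} (\<lambda>s. u *\<^sub>R h (s * u)) = G u - G 0" by simp
    then show ?thesis using eq[OF u] by simp
  qed
  have ta: "t \<in> {-a<..<a}" using t a by auto
  have "(G has_vector_derivative h t) (at t)"
    using G[of t] ta by (metis at_within_Icc_at atLeastAtMost_iff greaterThanLessThan_iff less_imp_le)
  then have "((\<lambda>u. y0 + (G u - G 0)) has_vector_derivative h t) (at t)"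
    by (auto intro!: derivative_eq_intros)
  then show ?thesis
    by (rule has_vector_derivative_transform_within_open[OF _ open_greaterThanLessThan ta]) (use yG in auto)
qed

text \<open>Picard iteration for the time-one map. The field is linear in \<theta>, so flowing for
  time t along \<theta> is flowing for time 1 along t \<theta>; small parameters play the role of
  short times, and the iterates carry the holomorphic dependence on \<theta> and y to the
  limit.\<close>

lemma ode_flow:
  fixes X :: "complex^'q::finite \<Rightarrow> complex^'n::finite \<Rightarrow> complex^'n"
  assumes r: "r > 0" and h: "hol (\<lambda>v. X (jl v) (jr v)) (pdisc r)"
    and lin: "\<And>c \<theta> y. X (c *s \<theta>) y = c *s X \<theta> y"
  obtains r' \<Psi> where "r' > 0" "r' \<le> r / 4" "hol (\<lambda>v. \<Psi> (jl v) (jr v)) (pdisc r')"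
    "\<And>\<theta> y. \<theta> \<in> pdisc r' \<Longrightarrow> y \<in> pdisc r' \<Longrightarrow> \<Psi> \<theta> y \<in> pdisc (3 * r / 4)"
    "\<And>y. y \<in> pdisc r' \<Longrightarrow> \<Psi> 0 y = y"
    "\<And>\<theta> y t. \<theta> \<in> pdisc r' \<Longrightarrow> y \<in> pdisc r' \<Longrightarrow> \<bar>t\<bar> \<le> 1 \<Longrightarrow>
       ((\<lambda>t. \<Psi> (complex_of_real t *s \<theta>) y) has_vector_derivative X \<theta> (\<Psi> (complex_of_real t *s \<theta>) y)) (at t)"
proof -
  let ?q = "3 * r / 4"
  have qr: "?q < r" using r by simp
  obtain L where L: "L \<ge> 0"
    "\<And>\<theta> x y. \<lbrakk>\<theta> \<in> pdisc ?q; x \<in> pdisc ?q; y \<in> pdisc ?q\<rbrakk> \<Longrightarrow> norm (X \<theta> x - X \<theta> y) \<le> L * norm (x - y)"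
    using vector_field_lipschitz[OF h qr] by blast
  obtain B where B: "B \<ge> 0" "\<And>\<theta> x. \<lbrakk>\<theta> \<in> pdisc ?q; x \<in> pdisc ?q\<rbrakk> \<Longrightarrow> norm (X \<theta> x) \<le> B"
    using vector_field_bound[OF h qr] by blast
  \<comment> \<open>For parameters scaled by \<open>k\<close> the field has Lipschitz constant at
    most 1/2, which gives contraction, and norm below \<open>r / 4\<close>, so that start point and
    integral together stay in the polydisc of radius \<open>r / 2\<close>.\<close>
  define k where "k = min 1 (min (1 / (2 * (L + 1))) (r / (8 * (B + 1))))"
  have k: "0 < k" "k \<le> 1" "k * L \<le> 1/2" "k * B < r / 4"
  proof -
    show "0 < k" "k \<le> 1" using L B r by (auto simp: k_def)
    have "k * L \<le> (1 / (2 * (L + 1))) * L" using L by (intro mult_right_mono) (auto simp: k_def)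
    also have "\<dots> \<le> 1/2" using L by (simp add: field_simps)
    finally show "k * L \<le> 1/2" .
    have "k * B \<le> (r / (8 * (B + 1))) * B" using B by (intro mult_right_mono) (auto simp: k_def)
    also have "\<dots> < r / 4" using B(1) r by (simp add: field_simps add_pos_nonneg)
    finally show "k * B < r / 4" .
  qed
  \<comment> \<open>The first bound makes \<theta> divided by \<open>k\<close> an admissible
    parameter, the second is the share left to the start point.\<close>
  define r' where "r' = min (k * r / 2) (r / 4)"
  have r': "r' > 0" "r' \<le> r / 4" "r' \<le> k * r / 2" using k r by (auto simp: r'_def)
  have sc: "\<exists>\<theta>'\<in>pdisc ?q. \<theta> = complex_of_real k *s \<theta>'" if "\<theta> \<in> pdisc r'" for \<theta> :: "complex^'q"
  proof (intro bexI)
    show "\<theta> = complex_of_real k *s (complex_of_real (1/k) *s \<theta>)" using k by simp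
    have "cmod (\<theta> $ i) < r'" for i using that by (simp add: pdisc_def)
    then have "cmod (\<theta> $ i) < k * r / 2" for i using r'(3) less_le_trans by blast
    then have "cmod (\<theta> $ i) / k < r / 2" for i using k by (simp add: field_simps)
    moreover have "r / 2 < ?q" using r by simp
    ultimately have "cmod (\<theta> $ i) / k < ?q" for i using less_trans by blast
    then show "complex_of_real (1/k) *s \<theta> \<in> pdisc ?q" using k by (simp add: pdisc_def norm_mult norm_divide)
  qed
  have XL: "norm (X \<theta> x - X \<theta> y) \<le> 1/2 * norm (x - y)" if "\<theta> \<in> pdisc r'" "x \<in> pdisc ?q" "y \<in> pdisc ?q" for \<theta> x y
  proof -
    from sc[OF that(1)] obtain \<theta>' where \<theta>': "\<theta>' \<in> pdisc ?q" "\<theta> = complex_of_real k *s \<theta>'" by blast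
    have "norm (X \<theta> x - X \<theta> y) = k * norm (X \<theta>' x - X \<theta>' y)"
      unfolding \<theta>'(2) lin vec.scale_right_diff_distrib[symmetric] norm_smult using k by simp
    also have "\<dots> \<le> k * (L * norm (x - y))" using k by (intro mult_left_mono L \<theta>' that) auto
    also have "\<dots> \<le> 1/2 * norm (x - y)" using mult_right_mono[OF k(3) norm_ge_zero[of "x - y"]] by (simp only: mult.assoc)
    finally show ?thesis .
  qed
  have XB: "norm (X \<theta> x) \<le> k * B" if "\<theta> \<in> pdisc r'" "x \<in> pdisc ?q" for \<theta> x
  proof -
    from sc[OF that(1)] obtain \<theta>' where \<theta>': "\<theta>' \<in> pdisc ?q" "\<theta> = complex_of_real k *s \<theta>'" by blast
    have "norm (X \<theta> x) = k * norm (X \<theta>' x)" unfolding \<theta>'(2) lin norm_smult using k by simp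
    also have "\<dots> \<le> k * B" using k by (intro mult_left_mono B \<theta>' that) auto
    finally show ?thesis .
  qed
  have r'r: "\<theta> \<in> pdisc r' \<Longrightarrow> \<theta> \<in> pdisc r" for \<theta> :: "complex^'q" using pdisc_mono[of r' r] r'(2) r by auto
  \<comment> \<open>Rescales the parameter and keeps the point: the iterate at time \<open>s\<close>
    along the same trajectory.\<close>
  define scl where "scl s v = jn (complex_of_real s *s jl v) (jr v)" for s and v :: "complex^('q+'n)"
  have scl_dom: "scl s v \<in> pdisc r'" if "v \<in> pdisc r'" "\<bar>s\<bar> \<le> 1" for s v
  proof -
    have "jl v \<in> pdisc r'" "jr v \<in> pdisc r'" using that(1) by (auto simp: pdisc_def)
    then show ?thesis using pdisc_smult[of "jl v" r' "complex_of_real s"] that(2) by (simp add: scl_def jn_pdisc)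
  qed
  have scl_hol: "hol (scl s) (pdisc r')" for s
    unfolding scl_def by (intro hol_jn hol_smult shol_const hol_jl hol_jr) auto
  have jlr: "jl v \<in> pdisc r'" "jr v \<in> pdisc r'" if "v \<in> pdisc r'" for v :: "complex^('q+'n)"
    using that by (auto simp: pdisc_def)
  define P where "P = rec_nat (\<lambda>v. jr v) (\<lambda>n p v. jr v + integral {0..1} (\<lambda>s. X (jl v) (p (scl s v))))"
  have P0: "P 0 v = jr v" and PS: "P (Suc n) v = jr v + integral {0..1} (\<lambda>s. X (jl v) (P n (scl s v)))" for n v
    by (simp_all add: P_def)
  have cont: "continuous_on ({0..1} \<times> pdisc r') (\<lambda>(s,v). X (jl v) (p (scl s v)))"
    if p: "hol p (pdisc r')" "\<And>v. v \<in> pdisc r' \<Longrightarrow> p v \<in> pdisc ?q" for p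
  proof -
    have c1: "continuous_on ({0..1} \<times> pdisc r') (\<lambda>x. jl (snd x) :: complex^'q)"
      unfolding jl_def by (intro continuous_on_vec_lambda continuous_intros)
    have c2: "continuous_on ({0..1} \<times> pdisc r') (\<lambda>x. scl (fst x) (snd x))"
      unfolding scl_def jn_def
    proof (rule continuous_on_vec_lambda)
      fix i
      show "continuous_on ({0..1} \<times> pdisc r') (\<lambda>x::real \<times> (complex^('q+'n)). case i of Inl a \<Rightarrow> (complex_of_real (fst x) *s jl (snd x)) $ a | Inr b \<Rightarrow> jr (snd x) $ b)"
        by (cases i) (auto intro!: continuous_intros)
    qed
    have c3: "continuous_on ({0..1} \<times> pdisc r') (\<lambda>x. p (scl (fst x) (snd x)))"
      by (rule continuous_on_compose2[OF hol_continuous_on[OF p(1)] c2]) (use scl_dom in auto)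
    show ?thesis unfolding case_prod_unfold
      by (rule continuous_on_compose2_jn[OF h c1 c3])
         (use jlr r'r p(2)[OF scl_dom] pdisc_mono[of ?q r] r in auto)
  qed
  have cont_s: "continuous_on {0..1} (\<lambda>s. X (jl v) (p (scl s v)))"
    if p: "hol p (pdisc r')" "\<And>v. v \<in> pdisc r' \<Longrightarrow> p v \<in> pdisc ?q" and v: "v \<in> pdisc r'" for p v
  proof -
    have "continuous_on {0..1} ((\<lambda>(s,v). X (jl v) (p (scl s v))) \<circ> (\<lambda>s. (s, v)))"
      by (rule continuous_on_compose, intro continuous_intros, rule continuous_on_subset[OF cont[OF p]]) (use v in auto)
    then show ?thesis by (simp add: o_def)
  qed
  have P: "hol (P n) (pdisc r') \<and> (\<forall>v\<in>pdisc r'. P n v \<in> pdisc (r / 2))" for n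
  proof (induction n)
    case 0
    have "hol jr (pdisc r' :: (complex^('q+'n)) set)" by (rule hol_jr) simp
    moreover have "P 0 = jr" by (simp add: P0 fun_eq_iff)
    ultimately show ?case using jlr(2) pdisc_mono[of r' "r/2"] r'(2) r by auto
  next
    case (Suc n)
    have q: "\<And>v. v \<in> pdisc r' \<Longrightarrow> P n v \<in> pdisc ?q" using Suc pdisc_mono[of "r/2" ?q] r by auto
    have hn: "hol (P n) (pdisc r')" using Suc by simp
    have "hol (\<lambda>v. integral {0..1} (\<lambda>s. X (jl v) (P n (scl s v)))) (pdisc r')"
    proof (rule hol_integral[OF open_pdisc _ cont[OF hn q]])
      fix s :: real assume s: "s \<in> {0..1}"
      have sd: "\<And>v. v \<in> pdisc r' \<Longrightarrow> scl s v \<in> pdisc r'" using scl_dom s by auto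
      have "hol (\<lambda>v. P n (scl s v)) (pdisc r')"
        by (rule hol_compose[OF hn scl_hol]) (use sd in auto)
      then show "hol (\<lambda>v. X (jl v) (P n (scl s v))) (pdisc r')"
        by (rule hol_compose2[OF h hol_jl[OF open_pdisc]])
           (use jlr r'r q[OF sd] pdisc_mono[of ?q r] r in auto)
    qed
    then have "hol (P (Suc n)) (pdisc r')"
      unfolding PS[abs_def] by (intro hol_add hol_jr) auto
    moreover have "P (Suc n) v \<in> pdisc (r / 2)" if v: "v \<in> pdisc r'" for v
    proof -
      have "norm (integral {0..1} (\<lambda>s. X (jl v) (P n (scl s v)))) \<le> (k * B) * (1 - 0)"
        by (rule integral_bound[OF _ cont_s[OF hn q v]]) (use XB jlr[OF v] q scl_dom[OF v] in auto)
      then have "integral {0..1} (\<lambda>s. X (jl v) (P n (scl s v))) \<in> pdisc (r / 4)"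
        using k(4) by (intro pdisc_of_norm) simp
      moreover have "jr v \<in> pdisc (r / 4)" using jlr(2)[OF v] pdisc_mono[OF r'(2)] by auto
      ultimately have "P (Suc n) v \<in> pdisc (r / 4 + r / 4)" unfolding PS by (intro pdisc_add)
      then show ?thesis by simp
    qed
    ultimately show ?case by blast
  qed
  have hP: "hol (P n) (pdisc r')" for n using P by simp
  have Pq: "P n v \<in> pdisc ?q" if "v \<in> pdisc r'" for n v
    using P that pdisc_mono[of "r/2" ?q] r by auto
  have intdiff: "norm (integral {0..1} (\<lambda>s. X (jl v) (p (scl s v))) - integral {0..1} (\<lambda>s. X (jl v) (p' (scl s v)))) \<le> 1/2 * e"
    if p: "hol p (pdisc r')" "\<And>v. v \<in> pdisc r' \<Longrightarrow> p v \<in> pdisc ?q"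
      and p': "hol p' (pdisc r')" "\<And>v. v \<in> pdisc r' \<Longrightarrow> p' v \<in> pdisc ?q"
      and v: "v \<in> pdisc r'" and e: "\<And>v. v \<in> pdisc r' \<Longrightarrow> norm (p v - p' v) \<le> e" for p p' v e
  proof -
    have cp: "continuous_on {0..1} (\<lambda>s. X (jl v) (p (scl s v)))" by (rule cont_s) (use p v in auto)
    have cp': "continuous_on {0..1} (\<lambda>s. X (jl v) (p' (scl s v)))" by (rule cont_s) (use p' v in auto)
    note i = integrable_continuous_interval[OF cp] integrable_continuous_interval[OF cp']
    have "norm (integral {0..1} (\<lambda>s. X (jl v) (p (scl s v)) - X (jl v) (p' (scl s v)))) \<le> (1/2 * e) * (1 - 0)"
    proof (rule integral_bound)
      show "continuous_on {0..1} (\<lambda>s. X (jl v) (p (scl s v)) - X (jl v) (p' (scl s v)))"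
        by (rule continuous_on_diff[OF cp cp'])
      fix s :: real assume "s \<in> {0..1}"
      then have sv: "scl s v \<in> pdisc r'" using scl_dom[OF v] by simp
      have "norm (X (jl v) (p (scl s v)) - X (jl v) (p' (scl s v))) \<le> 1/2 * norm (p (scl s v) - p' (scl s v))"
        by (rule XL) (use jlr[OF v] p(2)[OF sv] p'(2)[OF sv] in auto)
      also have "\<dots> \<le> 1/2 * e" using e[OF sv] by simp
      finally show "norm (X (jl v) (p (scl s v)) - X (jl v) (p' (scl s v))) \<le> 1/2 * e" .
    qed simp
    then show ?thesis by (simp add: integral_diff[OF i])
  qed
  have step: "norm (P (Suc n) v - P n v) \<le> (k * B) * (1/2) ^ n" if v: "v \<in> pdisc r'" for n v
    using v
  proof (induction n arbitrary: v)
    case 0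
    have "norm (integral {0..1} (\<lambda>s. X (jl v) (P 0 (scl s v)))) \<le> (k * B) * (1 - 0)"
      by (rule integral_bound[OF _ cont_s[OF hP Pq 0]]) (use XB jlr[OF 0] Pq scl_dom[OF 0] in auto)
    then show ?case by (simp add: PS P0)
  next
    case (Suc n)
    have "norm (P (Suc (Suc n)) v - P (Suc n) v) =
        norm (integral {0..1} (\<lambda>s. X (jl v) (P (Suc n) (scl s v))) - integral {0..1} (\<lambda>s. X (jl v) (P n (scl s v))))"
      by (subst PS, subst PS[of n]) simp
    also have "\<dots> \<le> 1/2 * ((k * B) * (1/2) ^ n)"
      by (rule intdiff[OF hP Pq hP Pq Suc.prems Suc.IH])
    finally show ?case by simp
  qed
  obtain G where G: "hol G (pdisc r')" "\<And>n v. v \<in> pdisc r' \<Longrightarrow> norm (P n v - G v) \<le> 2 * (k * B) * (1/2) ^ n"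
    using shol_limit_geometric[OF hP step] by blast
  have lim0: "(\<lambda>n. 2 * (k * B) * (1/2) ^ n) \<longlonglongrightarrow> 0"
    by (intro tendsto_mult_right_zero LIMSEQ_realpow_zero) auto
  have PG: "(\<lambda>n. P n v) \<longlonglongrightarrow> G v" if "v \<in> pdisc r'" for v
    by (rule Lim_null_comparison[THEN LIM_zero_cancel, OF _ lim0]) (use G(2)[OF that] in auto)
  have Gq: "G v \<in> pdisc ?q" if v: "v \<in> pdisc r'" for v
  proof -
    have "norm (G v $ i) \<le> r / 2" for i
    proof (rule Lim_bounded)
      show "(\<lambda>n. norm (P n v $ i)) \<longlonglongrightarrow> norm (G v $ i)" by (intro tendsto_intros PG v)
      show "\<forall>n\<ge>0. norm (P n v $ i) \<le> r / 2" using P v by (auto simp: pdisc_def less_imp_le)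
    qed
    moreover have "r / 2 < ?q" using r by simp
    ultimately have "norm (G v $ i) < ?q" for i using le_less_trans by blast
    then show ?thesis by (simp add: pdisc_def)
  qed
  have inteq: "G v = jr v + integral {0..1} (\<lambda>s. X (jl v) (G (scl s v)))" if v: "v \<in> pdisc r'" for v
  proof -
    let ?I = "\<lambda>p. integral {0..1} (\<lambda>s. X (jl v) (p (scl s v)))"
    have "norm (?I (P n) - ?I G) \<le> 2 * (k * B) * (1/2) ^ n" for n
    proof -
      have "norm (?I (P n) - ?I G) \<le> 1/2 * (2 * (k * B) * (1/2) ^ n)"
        by (rule intdiff[OF hP Pq G(1) Gq v G(2)])
      also have "\<dots> \<le> 2 * (k * B) * (1/2) ^ n" using k B by simp
      finally show ?thesis .
    qed
    then have "(\<lambda>n. ?I (P n)) \<longlonglongrightarrow> ?I G"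
      by (intro Lim_null_comparison[THEN LIM_zero_cancel, OF _ lim0]) auto
    then have "(\<lambda>n. P (Suc n) v) \<longlonglongrightarrow> jr v + ?I G" unfolding PS by (intro tendsto_intros)
    then show ?thesis using LIMSEQ_unique LIMSEQ_Suc[OF PG[OF v]] by blast
  qed
  define \<Psi> where "\<Psi> \<theta> y = G (jn \<theta> y)" for \<theta> y
  show ?thesis
  proof (rule that[of r' \<Psi>, OF r'(1,2)])
    show "hol (\<lambda>v. \<Psi> (jl v) (jr v)) (pdisc r')" using G(1) by (simp add: \<Psi>_def)
    show "\<Psi> \<theta> y \<in> pdisc ?q" if "\<theta> \<in> pdisc r'" "y \<in> pdisc r'" for \<theta> y
      unfolding \<Psi>_def by (rule Gq) (use that in \<open>simp add: jn_pdisc\<close>)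
    show "\<Psi> 0 y = y" if "y \<in> pdisc r'" for y
    proof -
      have X0: "X 0 z = 0" for z using lin[of 0 0 z] by simp
      show ?thesis unfolding \<Psi>_def using inteq[of "jn 0 y"] that r'(1) by (simp add: jn_pdisc X0)
    qed
    show "((\<lambda>t. \<Psi> (complex_of_real t *s \<theta>) y) has_vector_derivative X \<theta> (\<Psi> (complex_of_real t *s \<theta>) y)) (at t)"
      if \<theta>: "\<theta> \<in> pdisc r'" and y: "y \<in> pdisc r'" and t: "\<bar>t\<bar> \<le> 1" for \<theta> y t
    proof -
      let ?S = "(\<lambda>t. complex_of_real t *s \<theta>) -` pdisc r'"
      have ct: "continuous_on UNIV (\<lambda>t::real. complex_of_real t *s \<theta>)"
        using continuous_on_compose2[OF linear_continuous_on[OF bounded_linear_smult_left], of UNIV complex_of_real UNIV \<theta>]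
        by (auto intro!: continuous_intros)
      have "open ?S" by (rule open_vimage[OF open_pdisc ct])
      moreover have "1 \<in> ?S" using \<theta> by simp
      ultimately obtain e where e: "e > 0" "ball 1 e \<subseteq> ?S" using openE by blast
      \<comment> \<open>Openness of the polydisc leaves room beyond time 1.\<close>
      define a where "a = 1 + e / 2"
      have a: "a > 1" using e by (simp add: a_def)
      have "a \<in> ball 1 e" using e by (simp add: a_def dist_real_def)
      then have a\<theta>: "complex_of_real a *s \<theta> \<in> pdisc r'" using e(2) by auto
      have dom: "complex_of_real u *s \<theta> \<in> pdisc r'" if "u \<in> {-a..a}" for u
      proof -
        have "complex_of_real (u / a) *s (complex_of_real a *s \<theta>) \<in> pdisc r'"
          by (rule pdisc_smult[OF a\<theta>]) (use that a in \<open>auto simp: norm_divide abs_le_iff\<close>)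
        then show ?thesis using a by simp
      qed
      let ?h = "\<lambda>u. X \<theta> (G (jn (complex_of_real u *s \<theta>) y))"
      have jd: "jn (complex_of_real u *s \<theta>) y \<in> pdisc r'" if "u \<in> {-a..a}" for u
        using dom[OF that] y by (simp add: jn_pdisc)
      have "continuous_on {-a..a} (\<lambda>u. jn (complex_of_real u *s \<theta>) y)"
        unfolding jn_def
      proof (rule continuous_on_vec_lambda)
        fix i
        show "continuous_on {-a..a} (\<lambda>u. case i of Inl b \<Rightarrow> (complex_of_real u *s \<theta>) $ b | Inr b \<Rightarrow> y $ b)"
          by (cases i) (auto intro!: continuous_intros)
      qed
      then have cG: "continuous_on {-a..a} (\<lambda>u. G (jn (complex_of_real u *s \<theta>) y))"
        by (rule continuous_on_compose2[OF hol_continuous_on[OF G(1)]]) (use jd in auto)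
      have ch: "continuous_on {-a..a} ?h"
        by (rule continuous_on_compose2_jn[OF h continuous_on_const cG])
           (use r'r[OF \<theta>] Gq[OF jd] pdisc_mono[of ?q r] r in auto)
      have "((\<lambda>t. G (jn (complex_of_real t *s \<theta>) y)) has_vector_derivative ?h t) (at t)"
      proof (rule scaled_integral_derivative[OF a ch _ t])
        fix u assume u: "u \<in> {-a..a}"
        have "X (complex_of_real u *s \<theta>) (G (jn (complex_of_real s *s (complex_of_real u *s \<theta>)) y)) = u *\<^sub>R ?h (s * u)" for s
          by (simp add: lin scaleR_vec_smult)
        then show "G (jn (complex_of_real u *s \<theta>) y) = y + integral {0..1} (\<lambda>s. u *\<^sub>R ?h (s * u))"
          using inteq[OF jd[OF u]] by (simp add: scl_def)
      qed
      then show ?thesis by (simp add: \<Psi>_def)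
    qed
  qed
qed

section \<open>Real chains and minimality\<close>

text \<open>The conjugation that the involution induces on coefficients (a, b) along the two
  families. Its fixed points, with b the conjugate of a, are the coefficients of real sections of
  the complex tangent bundle.\<close>

definition cJ :: "complex^('m::finite + 'm) \<Rightarrow> complex^('m + 'm)" where
  "cJ \<theta> = jn (vconj (jr \<theta>)) (vconj (jl \<theta>))"

lemma jn_linear:
  "jn (a + a') (b + b') = jn a b + jn a' b'" "c *s jn a b = jn (c *s a) (c *s b)" "- jn a b = jn (- a) (- b)"
  "jl (u + v) = jl u + jl v" "jr (u + v) = jr u + jr v" "jl (c *s u) = c *s jl u" "jr (c *s u) = c *s jr u"
  "jl (- u) = - jl u" "jr (- u) = - jr u" "jn 0 0 = 0"
  unfolding vec_eq_iff split_sum_all by simp_all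

lemma cJ_simps [simp]: "cJ (cJ \<theta>) = \<theta>" "cJ (u + v) = cJ u + cJ v" "cJ (c *s u) = cnj c *s cJ u" "cJ 0 = 0"
  "cJ (jn a b) = jn (vconj b) (vconj a)" "cJ u \<in> pdisc s \<longleftrightarrow> u \<in> pdisc s"
proof -
  show "cJ u \<in> pdisc s \<longleftrightarrow> u \<in> pdisc s"
    using jn_pdisc[of "jl u" "jr u" s] by (auto simp: cJ_def jn_pdisc)
qed (unfold cJ_def vec_eq_iff split_sum_all, simp_all)

lemma cJ_diff [simp]: "cJ (u - v) = cJ u - cJ v"
  unfolding cJ_def vec_eq_iff split_sum_all by simp

lemma cJ_sum: "cJ (\<Sum>i\<in>A. f i) = (\<Sum>i\<in>A. cJ (f i))"
  by (induction A rule: infinite_finite_induct) auto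

context segre begin

text \<open>The complexification of those real fields: the coefficients along the two families
  become independent complex parameters.\<close>

definition XX :: "complex^('m + 'm) \<Rightarrow> complex^('m + ('m + 'd)) \<Rightarrow> complex^('m + ('m + 'd))" where
  "XX \<theta> y = Y 0 (jl \<theta>) y + Y 1 (jr \<theta>) y"

lemma XX_smult: "XX (c *s \<theta>) y = c *s XX \<theta> y"
  by (simp add: XX_def Y_def jn_linear vector_scalar_commute vec.scale_right_distrib)

lemma XX_hol: "hol (\<lambda>v. XX (jl v) (jr v)) (pdisc r)"
proof -
  have jrr: "jr ` pdisc r \<subseteq> (pdisc r :: (complex^('m + ('m + 'd))) set)" by (auto simp: pdisc_def)
  have "hol (\<lambda>v. \<Sum>a\<in>UNIV. (f v $ a) *s Y j (axis a 1) (jr v)) (pdisc r)"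
    if "hol f (pdisc r)" for f :: "complex^(('m + 'm) + ('m + ('m + 'd))) \<Rightarrow> complex^'m" and j
    by (intro hol_sum hol_smult hol_nth[OF that] hol_compose[OF Y_hol hol_jr[OF open_pdisc] jrr]) auto
  then have h: "hol (\<lambda>v. Y j (f v) (jr v)) (pdisc r)"
    if "hol f (pdisc r)" for f :: "complex^(('m + 'm) + ('m + ('m + 'd))) \<Rightarrow> complex^'m" and j
    using that by (subst Y_linear)
  have "hol (\<lambda>v::complex^(('m + 'm) + ('m + ('m + 'd))). jl (jl v) :: complex^'m) (pdisc r)"
    by (rule hol_compose[OF hol_jl[OF open_UNIV] hol_jl]) auto
  moreover have "hol (\<lambda>v::complex^(('m + 'm) + ('m + ('m + 'd))). jr (jl v) :: complex^'m) (pdisc r)"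
    by (rule hol_compose[OF hol_jr[OF open_UNIV] hol_jl]) auto
  ultimately show ?thesis unfolding XX_def by (intro hol_add h)
qed

lemma Tm_sg: "y \<in> pdisc R \<Longrightarrow> Tm \<Theta> (vconj (Tm \<Theta> y)) = vconj y"
  using Tb_Tm by (metis Tb_def vconj_simps(1))

text \<open>The differential of the involution exchanges the families up to conjugation, which on
  the coefficients is \<open>cJ\<close>.\<close>

lemma XX_conj:
  assumes y: "y \<in> pdisc r" and sy: "vconj (Tm \<Theta> y) \<in> pdisc r"
  shows "vconj (jac (Tm \<Theta>) y *v XX \<theta> y) = XX (cJ \<theta>) (vconj (Tm \<Theta> y))"
proof -
  have yR: "y \<in> pdisc R" by (rule r_R[OF y])
  have TyR: "Tm \<Theta> y \<in> pdisc R" using Tm_io_R[OF y, of 0] r_pos' by simp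
  have inv: "jac (Tm \<Theta>) y ** jac (Tb \<Theta>) (Tm \<Theta> y) = mat 1"
  proof -
    have "jac (\<lambda>v. Tm \<Theta> (Tb \<Theta> v)) (Tm \<Theta> y) = jac (Tm \<Theta>) y ** jac (Tb \<Theta>) (Tm \<Theta> y)"
      using jac_compose[OF Tm_hol Tb_hol TyR] Tb_Tm[OF yR] yR by simp
    moreover have "((\<lambda>v. Tm \<Theta> (Tb \<Theta> v)) has_derivative (\<lambda>h. h)) (at (Tm \<Theta> y))"
      by (rule has_derivative_transform_within_open[OF has_derivative_ident open_pdisc TyR]) (simp add: Tm_Tb)
    then have "jac (\<lambda>v. Tm \<Theta> (Tb \<Theta> v)) (Tm \<Theta> y) = mat 1" by (intro jac_unique) simp
    ultimately show ?thesis by simp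
  qed
  have "jac (Tm \<Theta>) y *v XX \<theta> y = jac (Tm \<Theta>) y *v io (jl \<theta>) + io (jr \<theta>)"
    unfolding XX_def Y_even[OF y] Y_odd[OF y] by (simp add: matrix_vector_right_distrib matrix_vector_mul_assoc inv)
  then have "vconj (jac (Tm \<Theta>) y *v XX \<theta> y) = vconj (jac (Tm \<Theta>) y *v io (jl \<theta>)) + io (vconj (jr \<theta>))"
    by simp
  also have "vconj (jac (Tm \<Theta>) y *v io (jl \<theta>)) = jac (Tb \<Theta>) (vconj y) *v io (vconj (jl \<theta>))"
    using jac_Tb[OF yR, of "io (jl \<theta>)"] by simp
  also have "\<dots> = Y 1 (vconj (jl \<theta>)) (vconj (Tm \<Theta> y))" unfolding Y_odd[OF sy] Tm_sg[OF yR] ..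
  finally show ?thesis unfolding XX_def Y_even[OF sy] by (simp add: cJ_def add.commute)
qed

lemma pw_Y_odd:
  assumes y: "y \<in> pdisc r" shows "pw (Y 1 b y) = 0"
proof -
  have "pw (Sf \<Theta> 1 s y) = pw y" for s
  proof -
    have "Tm \<Theta> y + io s = mk (pz y + s) (pw y) (Zf \<Theta> y)" by (rule chart_eqI) (simp_all add: Tm_def)
    then show ?thesis by (simp add: Sf_def Tb_mk)
  qed
  then have nth: "Sf \<Theta> 1 s y $ Inl a = y $ Inl a" for s a by (metis proj_nth(1))
  have "Y 1 b y $ Inl a = 0" for a
  proof -
    have "((\<lambda>s. Sf \<Theta> 1 (s *s b) y $ Inl a) has_derivative (\<lambda>s. (s *s Y 1 b y) $ Inl a)) (at 0)"
      by (rule bounded_linear.has_derivative[OF bounded_linear_vec_nth St_line_derivative[OF y]])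
    then have "((\<lambda>s::complex. y $ Inl a) has_derivative (\<lambda>s. (s *s Y 1 b y) $ Inl a)) (at 0)" unfolding nth .
    from has_derivative_unique[OF this has_derivative_const] have "(1 *s Y 1 b y) $ Inl a = 0" by metis
    then show ?thesis by simp
  qed
  then show ?thesis by (simp add: vec_eq_iff)
qed

lemma unemb_XX:
  assumes y: "y \<in> pdisc r"
  shows "unemb (XX (jn a b) y) = (a, vconj (px (Y 1 b y)))"
  using pw_Y_odd[OF y] by (simp add: XX_def unemb_def Y_even[OF y])

text \<open>Multiplication by \<i> amounts to multiplying the coefficient a by \<i>. Tangency to M
  for all coefficients therefore already gives complex tangency.\<close>

lemma cmult_unemb_XX:
  assumes y: "y \<in> pdisc r"
  shows "cmult \<i> (unemb (XX (jn a (vconj a)) y)) = unemb (XX (jn (\<i> *s a) (vconj (\<i> *s a))) y)"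
proof -
  have "Y 1 (cnj \<i> *s vconj a) y = cnj \<i> *s Y 1 (vconj a) y" by (simp only: Y_def vector_scalar_commute)
  then show ?thesis unfolding unemb_XX[OF y] by (simp add: cmult_def)
qed

end

text \<open>Two radii: \<Psi> is defined on \<open>r1\<close>, and starting in \<open>r2\<close>
  keeps both the flow and the involution within \<open>r1\<close>, so that the result can serve as a
  start point again and solutions can be compared.\<close>

locale crflow = segre \<Theta> R r for \<Theta> :: "('m::finite,'d::finite) germfun" and R r +
  fixes \<Psi> :: "complex^('m + 'm) \<Rightarrow> complex^('m + ('m + 'd)) \<Rightarrow> complex^('m + ('m + 'd))" and r1 r2 :: real
  assumes r12: "0 < r2" "r2 \<le> r1" "r1 \<le> r / 4"
    and Psi_hol: "hol (\<lambda>v. \<Psi> (jl v) (jr v)) (pdisc r1)"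
    and Psi_dom: "\<theta> \<in> pdisc r1 \<Longrightarrow> y \<in> pdisc r1 \<Longrightarrow> \<Psi> \<theta> y \<in> pdisc (3 * r / 4)"
    and Psi_zero: "y \<in> pdisc r1 \<Longrightarrow> \<Psi> 0 y = y"
    and Psi_deriv: "\<theta> \<in> pdisc r1 \<Longrightarrow> y \<in> pdisc r1 \<Longrightarrow> \<bar>t\<bar> \<le> 1 \<Longrightarrow>
       ((\<lambda>t. \<Psi> (complex_of_real t *s \<theta>) y) has_vector_derivative XX \<theta> (\<Psi> (complex_of_real t *s \<theta>) y)) (at t)"
    and Psi_dom2: "\<theta> \<in> pdisc r2 \<Longrightarrow> y \<in> pdisc r2 \<Longrightarrow> \<Psi> \<theta> y \<in> pdisc r1"
    and Sf_dom2: "s \<in> pdisc r2 \<Longrightarrow> y \<in> pdisc r2 \<Longrightarrow> Sf \<Theta> 1 s y \<in> pdisc (3 * r / 4)"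
    and Tm_dom1: "y \<in> pdisc r1 \<Longrightarrow> Tm \<Theta> y \<in> pdisc (3 * r / 4)"
    and Tm_dom2: "y \<in> pdisc r2 \<Longrightarrow> Tm \<Theta> y \<in> pdisc r1"

lemma (in segre) crflow_exists: obtains \<Psi> r1 r2 where "crflow \<Theta> R r \<Psi> r1 r2"
proof -
  obtain r0 \<Psi> where P: "r0 > 0" "r0 \<le> r / 4" "hol (\<lambda>v. \<Psi> (jl v) (jr v)) (pdisc r0)"
    "\<And>\<theta> y. \<theta> \<in> pdisc r0 \<Longrightarrow> y \<in> pdisc r0 \<Longrightarrow> \<Psi> \<theta> y \<in> pdisc (3 * r / 4)"
    "\<And>y. y \<in> pdisc r0 \<Longrightarrow> \<Psi> 0 y = y"
    "\<And>\<theta> y t. \<theta> \<in> pdisc r0 \<Longrightarrow> y \<in> pdisc r0 \<Longrightarrow> \<bar>t\<bar> \<le> 1 \<Longrightarrow>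
       ((\<lambda>t. \<Psi> (complex_of_real t *s \<theta>) y) has_vector_derivative XX \<theta> (\<Psi> (complex_of_real t *s \<theta>) y)) (at t)"
    by (rule ode_flow[OF r_pos' XX_hol XX_smult]) (rule that)
  have small: "\<exists>\<delta>>0. pdisc \<delta> \<subseteq> pdisc \<rho> \<inter> g -` pdisc a"
    if g: "continuous_on (pdisc \<rho>) g" "g 0 = 0" "a > 0" "\<rho> > 0" for g :: "complex^'x::finite \<Rightarrow> complex^'y::finite" and \<rho> a
  proof -
    have "open (pdisc \<rho> \<inter> g -` pdisc a)" using that by (simp add: continuous_on_open_vimage Int_commute)
    then obtain \<delta> where "\<delta> > 0" "pdisc \<delta> \<subseteq> pdisc \<rho> \<inter> g -` pdisc a" by (rule pdisc_nbhd) (use g in simp)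
    then show ?thesis by blast
  qed
  obtain \<delta>1 where \<delta>1: "\<delta>1 > 0" "pdisc \<delta>1 \<subseteq> pdisc R \<inter> Tm \<Theta> -` pdisc (3 * r / 4)"
    using small[OF hol_continuous_on[OF Tm_hol] Tm_0, of "3 * r / 4"] r_pos' R_pos by auto
  define r1 where "r1 = min r0 \<delta>1"
  have r1: "r1 > 0" "r1 \<le> r0" "r1 \<le> \<delta>1" using P \<delta>1 by (auto simp: r1_def)
  have into: "x \<in> pdisc r1 \<Longrightarrow> x \<in> pdisc r0" for x :: "complex^'x::finite" using pdisc_mono[OF r1(2)] by auto
  have h1: "hol (\<lambda>v. \<Psi> (jl v) (jr v)) (pdisc r1)" by (rule hol_subset[OF P(3) open_pdisc pdisc_mono[OF r1(2)]])
  obtain \<delta>2 where \<delta>2: "\<delta>2 > 0" "pdisc \<delta>2 \<subseteq> pdisc r1 \<inter> (\<lambda>v. \<Psi> (jl v) (jr v)) -` pdisc r1"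
    using small[OF hol_continuous_on[OF h1], of r1] P(1,5) r1 by auto
  obtain \<delta>3 where \<delta>3: "\<delta>3 > 0" "pdisc \<delta>3 \<subseteq> pdisc r \<inter> (\<lambda>v. Sf \<Theta> 1 (jl v) (jr v)) -` pdisc (3 * r / 4)"
    using small[OF hol_continuous_on[OF St_hol[of 1]], of "3 * r / 4"] r_pos' St_zero[of 0 1] by auto
  obtain \<delta>4 where \<delta>4: "\<delta>4 > 0" "pdisc \<delta>4 \<subseteq> pdisc R \<inter> Tm \<Theta> -` pdisc r1"
    using small[OF hol_continuous_on[OF Tm_hol] Tm_0, of r1] r1 R_pos by auto
  define r2 where "r2 = min (min r1 \<delta>2) (min \<delta>3 \<delta>4)"
  have r2: "r2 > 0" "r2 \<le> r1" "r2 \<le> \<delta>2" "r2 \<le> \<delta>3" "r2 \<le> \<delta>4" using r1 \<delta>2 \<delta>3 \<delta>4 by (auto simp: r2_def)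
  have "crflow \<Theta> R r \<Psi> r1 r2"
  proof
    show "0 < r2" "r2 \<le> r1" by (rule r2)+
    show "r1 \<le> r / 4" using r1 P by simp
    show "hol (\<lambda>v. \<Psi> (jl v) (jr v)) (pdisc r1)" by (rule h1)
    show "\<Psi> \<theta> y \<in> pdisc (3 * r / 4)" if "\<theta> \<in> pdisc r1" "y \<in> pdisc r1" for \<theta> y by (rule P(4)[OF into into, OF that])
    show "\<Psi> 0 y = y" if "y \<in> pdisc r1" for y by (rule P(5)[OF into[OF that]])
    show "((\<lambda>t. \<Psi> (complex_of_real t *s \<theta>) y) has_vector_derivative XX \<theta> (\<Psi> (complex_of_real t *s \<theta>) y)) (at t)"
      if "\<theta> \<in> pdisc r1" "y \<in> pdisc r1" "\<bar>t\<bar> \<le> 1" for \<theta> y t by (rule P(6)[OF into[OF that(1)] into[OF that(2)] that(3)])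
    show "\<Psi> \<theta> y \<in> pdisc r1" if "\<theta> \<in> pdisc r2" "y \<in> pdisc r2" for \<theta> y
    proof -
      have "jn \<theta> y \<in> pdisc r2" using that by (simp add: jn_pdisc)
      then have "jn \<theta> y \<in> pdisc \<delta>2" using pdisc_mono[OF r2(3)] by blast
      then have "jn \<theta> y \<in> (\<lambda>v. \<Psi> (jl v) (jr v)) -` pdisc r1" using \<delta>2(2) by blast
      then show ?thesis by simp
    qed
    show "Sf \<Theta> 1 s y \<in> pdisc (3 * r / 4)" if "s \<in> pdisc r2" "y \<in> pdisc r2" for s y
    proof -
      have "jn s y \<in> pdisc r2" using that by (simp add: jn_pdisc)
      then have "jn s y \<in> pdisc \<delta>3" using pdisc_mono[OF r2(4)] by blast
      then have "jn s y \<in> (\<lambda>v. Sf \<Theta> 1 (jl v) (jr v)) -` pdisc (3 * r / 4)" using \<delta>3(2) by blast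
      then show ?thesis by simp
    qed
    show "Tm \<Theta> y \<in> pdisc (3 * r / 4)" if "y \<in> pdisc r1" for y
      using that pdisc_mono[OF r1(3)] \<delta>1(2) by blast
    show "Tm \<Theta> y \<in> pdisc r1" if "y \<in> pdisc r2" for y
      using that pdisc_mono[OF r2(5)] \<delta>4(2) by blast
  qed
  then show ?thesis using that by blast
qed

context crflow begin

lemma r1_q: "x \<in> pdisc r1 \<Longrightarrow> x \<in> pdisc (3 * r / 4)" for x :: "complex^'x::finite"
  using pdisc_mono[of r1 "3 * r / 4"] r12 r_pos' by auto

lemma q_r: "x \<in> pdisc (3 * r / 4) \<Longrightarrow> x \<in> pdisc r" for x :: "complex^'x::finite"
  using pdisc_mono[of "3 * r / 4" r] r_pos' by auto

lemma r2_r1: "x \<in> pdisc r2 \<Longrightarrow> x \<in> pdisc r1" for x :: "complex^'x::finite"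
  using pdisc_mono[OF r12(2)] by auto

lemma t_dom: "\<theta> \<in> pdisc s \<Longrightarrow> t \<in> {0..1} \<Longrightarrow> complex_of_real t *s \<theta> \<in> pdisc s"
  by (rule pdisc_smult) auto

lemma Psi_deriv': "\<theta> \<in> pdisc r1 \<Longrightarrow> y \<in> pdisc r1 \<Longrightarrow> t \<in> {0..1} \<Longrightarrow>
    ((\<lambda>t. \<Psi> (complex_of_real t *s \<theta>) y) has_vector_derivative XX \<theta> (\<Psi> (complex_of_real t *s \<theta>) y)) (at t within {0..1})"
  by (rule has_vector_derivative_at_within[OF Psi_deriv]) auto

text \<open>The identities for \<Psi> below are obtained from this, by exhibiting a second solution
  of the same initial value problem.\<close>

lemma Psi_unique:
  assumes \<theta>: "\<theta> \<in> pdisc r1" and y: "c 0 \<in> pdisc r1"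
    and c: "\<And>t. t \<in> {0..1} \<Longrightarrow> c t \<in> pdisc (3 * r / 4)"
    and D: "\<And>t. t \<in> {0..1} \<Longrightarrow> (c has_vector_derivative XX \<theta> (c t)) (at t within {0..1})"
  shows "c 1 = \<Psi> \<theta> (c 0)"
proof -
  have "c 1 = \<Psi> (complex_of_real 1 *s \<theta>) (c 0)"
  proof (rule ode_unique[OF XX_hol, where s = "3 * r / 4" and \<theta> = \<theta> and c = c and c' = "\<lambda>t. \<Psi> (complex_of_real t *s \<theta>) (c 0)"])
    show "\<Psi> (complex_of_real t *s \<theta>) (c 0) \<in> pdisc (3 * r / 4)" if "t \<in> {0..1}" for t
      by (rule Psi_dom[OF t_dom[OF \<theta> that] y])
    show "((\<lambda>t. \<Psi> (complex_of_real t *s \<theta>) (c 0)) has_vector_derivative XX \<theta> (\<Psi> (complex_of_real t *s \<theta>) (c 0))) (at t within {0..1})"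
      if "t \<in> {0..1}" for t by (rule Psi_deriv'[OF \<theta> y that])
  qed (use r_pos' r1_q[OF \<theta>] c D Psi_zero[OF y] in auto)
  then show ?thesis by simp
qed

lemma Psi_inv:
  assumes \<theta>: "\<theta> \<in> pdisc r2" and y: "y \<in> pdisc r2"
  shows "\<Psi> (- \<theta>) (\<Psi> \<theta> y) = y"
proof -
  \<comment> \<open>The solution run backwards from its end point.\<close>
  let ?c = "\<lambda>t. \<Psi> (complex_of_real (1 - t) *s \<theta>) y"
  have t1: "\<theta> \<in> pdisc r1" "y \<in> pdisc r1" using \<theta> y r2_r1 by auto
  have "?c 1 = \<Psi> (- \<theta>) (?c 0)"
  proof (rule Psi_unique)
    show "- \<theta> \<in> pdisc r1" using t1 by simp
    show "?c 0 \<in> pdisc r1" using Psi_dom2[OF \<theta> y] by simp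
    fix t :: real assume t: "t \<in> {0..1}"
    show "?c t \<in> pdisc (3 * r / 4)" by (rule Psi_dom[OF t_dom[OF t1(1)] t1(2)]) (use t in auto)
    have D: "((\<lambda>t. \<Psi> (complex_of_real t *s \<theta>) y) has_vector_derivative XX \<theta> (?c t)) (at (1 - t))"
      by (rule Psi_deriv[OF t1]) (use t in auto)
    have "((\<lambda>t. 1 - t) has_vector_derivative (- 1)) (at t)" by (auto intro!: derivative_eq_intros)
    from vector_diff_chain_at[OF this] D
    have "((\<lambda>t. \<Psi> (complex_of_real t *s \<theta>) y) \<circ> (\<lambda>t. 1 - t) has_vector_derivative (- 1) *\<^sub>R XX \<theta> (?c t)) (at t)" by blast
    moreover have "(- 1) *\<^sub>R XX \<theta> (?c t) = XX (- \<theta>) (?c t)"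
      using XX_smult[of "-1" \<theta> "?c t"] by (simp add: vec.scale_minus_left)
    ultimately have "(?c has_vector_derivative XX (- \<theta>) (?c t)) (at t)" by (simp add: o_def)
    then show "(?c has_vector_derivative XX (- \<theta>) (?c t)) (at t within {0..1})" by (rule has_vector_derivative_at_within)
  qed
  then show ?thesis using Psi_zero[OF t1(2)] by simp
qed

text \<open>With one block of coefficients 0 the combined flow is a Segre step; thus chains of
  \<Psi> include the Segre chains.\<close>

lemma Psi_Sf_even:
  assumes s: "s \<in> pdisc r2" and y: "y \<in> pdisc r2"
  shows "\<Psi> (jn s 0) y = Sf \<Theta> 0 s y"
proof -
  let ?c = "\<lambda>t. y + complex_of_real t *s io s"
  have "?c 1 = \<Psi> (jn s 0) (?c 0)"
  proof (rule Psi_unique)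
    show "jn s 0 \<in> pdisc r1" using s r2_r1 r12 by (simp add: jn_pdisc)
    show "?c 0 \<in> pdisc r1" using y r2_r1 by simp
    fix t :: real assume t: "t \<in> {0..1}"
    have "io s \<in> pdisc r2" using s r12 by (simp add: io_pdisc)
    then have "?c t \<in> pdisc (r2 + r2)" by (intro pdisc_add y t_dom t)
    then show c: "?c t \<in> pdisc (3 * r / 4)" using pdisc_mono[of "r2 + r2" "3 * r / 4"] r12 r_pos' by auto
    have bl: "bounded_linear (\<lambda>t. complex_of_real t *s io s)"
      by (rule bounded_linear_compose[OF bounded_linear_smult_left bounded_linear_of_real])
    have "(?c has_vector_derivative (0 + complex_of_real 1 *s io s)) (at t within {0..1})"
      by (intro has_vector_derivative_add has_vector_derivative_const bounded_linear.has_vector_derivative[OF bl])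
         (rule has_vector_derivative_id)
    moreover have "XX (jn s 0) (?c t) = io s" using Y_even[OF q_r[OF c]] by (simp add: XX_def)
    ultimately show "(?c has_vector_derivative XX (jn s 0) (?c t)) (at t within {0..1})" by simp
  qed
  then show ?thesis by (simp add: Sf_def)
qed

lemma Psi_Sf_odd:
  assumes s: "s \<in> pdisc r2" and y: "y \<in> pdisc r2"
  shows "\<Psi> (jn 0 s) y = Sf \<Theta> 1 s y"
proof -
  let ?c = "\<lambda>t. Sf \<Theta> 1 (complex_of_real t *s s) y"
  have yr: "y \<in> pdisc r" "s \<in> pdisc r" using y s r2_r1 r1_q q_r by auto
  have c0: "?c 0 = y" using St_zero[OF yr(1), of 1] by simp
  have "?c 1 = \<Psi> (jn 0 s) (?c 0)"
  proof (rule Psi_unique)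
    show "jn 0 s \<in> pdisc r1" using s r2_r1 r12 by (simp add: jn_pdisc)
    show "?c 0 \<in> pdisc r1" using y r2_r1 c0 by simp
    fix t :: real assume t: "t \<in> {0..1}"
    show c: "?c t \<in> pdisc (3 * r / 4)" by (rule Sf_dom2[OF t_dom[OF s t] y])
    have "(?c has_vector_derivative Y 1 s (?c t)) (at t within {0..1})"
      by (rule flow_curve[OF yr(2,1)]) (use t q_r[OF c] in auto)
    then show "(?c has_vector_derivative XX (jn 0 s) (?c t)) (at t within {0..1})" by (simp add: XX_def)
  qed
  then show ?thesis using c0 by simp
qed

lemma Psi_conj:
  assumes \<theta>: "\<theta> \<in> pdisc r2" and y: "y \<in> pdisc r2"
  shows "vconj (Tm \<Theta> (\<Psi> \<theta> y)) = \<Psi> (cJ \<theta>) (vconj (Tm \<Theta> y))"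
proof -
  let ?c = "\<lambda>t. vconj (Tm \<Theta> (\<Psi> (complex_of_real t *s \<theta>) y))"
  have t1: "\<theta> \<in> pdisc r1" "y \<in> pdisc r1" using \<theta> y r2_r1 by auto
  have "?c 1 = \<Psi> (cJ \<theta>) (?c 0)"
  proof (rule Psi_unique)
    show "cJ \<theta> \<in> pdisc r1" using t1 by simp
    show "?c 0 \<in> pdisc r1" using Tm_dom2[OF y] Psi_zero[OF t1(2)] by simp
    fix t :: real assume t: "t \<in> {0..1}"
    let ?y = "\<Psi> (complex_of_real t *s \<theta>) y"
    have y1: "?y \<in> pdisc r1" by (rule Psi_dom2[OF t_dom[OF \<theta> t] y])
    show c: "?c t \<in> pdisc (3 * r / 4)" using Tm_dom1[OF y1] by simp
    have yr: "?y \<in> pdisc r" using y1 r1_q q_r by blast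
    have "((\<lambda>t. Tm \<Theta> (\<Psi> (complex_of_real t *s \<theta>) y)) has_derivative (\<lambda>h. jac (Tm \<Theta>) ?y *v (h *\<^sub>R XX \<theta> ?y))) (at t within {0..1})"
      by (rule has_derivative_compose[OF Psi_deriv'[OF t1 t, unfolded has_vector_derivative_def] hol_jac[OF Tm_hol r_R[OF yr]]])
    then have "((\<lambda>t. Tm \<Theta> (\<Psi> (complex_of_real t *s \<theta>) y)) has_vector_derivative (jac (Tm \<Theta>) ?y *v XX \<theta> ?y)) (at t within {0..1})"
      by (simp only: has_vector_derivative_def scaleR_vec_smult vector_scalar_commute)
    then have "(?c has_vector_derivative vconj (jac (Tm \<Theta>) ?y *v XX \<theta> ?y)) (at t within {0..1})"
      by (rule bounded_linear.has_vector_derivative[OF bounded_linear_vconj])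
    then show "(?c has_vector_derivative XX (cJ \<theta>) (?c t)) (at t within {0..1})"
      unfolding XX_conj[OF yr q_r[OF c]] .
  qed
  then show ?thesis using Psi_zero[OF t1(2)] by simp
qed

text \<open>All positions carry the same step, since the combined flow already contains both
  families.\<close>

sublocale C: chain_sys "\<lambda>_::nat. \<Psi>" r2
proof
  show "0 < r2" by (rule r12)
  show "hol (\<lambda>v. \<Psi> (jl v) (jr v)) (pdisc r2)" by (rule hol_subset[OF Psi_hol open_pdisc pdisc_mono[OF r12(2)]])
  show "\<Psi> 0 y = y" if "y \<in> pdisc r2" for y using Psi_zero r2_r1 that by blast
  show "\<Psi> (- s) (\<Psi> s y) = y" if "s \<in> pdisc r2" "y \<in> pdisc r2" for s y by (rule Psi_inv[OF that])
qed simp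

definition lft :: "(nat \<Rightarrow> complex^'m) \<Rightarrow> nat \<Rightarrow> complex^('m + 'm)" where
  "lft ws j = (if even j then jn (ws j) 0 else jn 0 (ws j))"

lemma chain_lft:
  assumes "\<And>j. j < k \<Longrightarrow> ws j \<in> pdisc r2" "\<And>j. j \<le> k \<Longrightarrow> F 0 j ws \<in> pdisc r2"
  shows "C.F 0 k (lft ws) = F 0 k ws"
  using assms
proof (induction k)
  case (Suc k)
  have IH: "C.F 0 k (lft ws) = F 0 k ws" by (rule Suc.IH) (use Suc.prems in auto)
  have s: "ws k \<in> pdisc r2" "F 0 k ws \<in> pdisc r2" using Suc.prems(1)[of k] Suc.prems(2)[of k] by auto
  have "\<Psi> (lft ws k) (F 0 k ws) = Sf \<Theta> k (ws k) (F 0 k ws)"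
  proof (cases "even k")
    case True
    then show ?thesis using Psi_Sf_even[OF s] St_par'[of k 0] by (simp add: lft_def)
  next
    case False
    then show ?thesis using Psi_Sf_odd[OF s] St_par'[of k 1] by (simp add: lft_def)
  qed
  then show ?case using IH by simp
qed simp

lemma chain_conj:
  assumes "C.small k \<delta>" "\<theta> \<in> chain_dom k \<delta>" "j \<le> k"
  shows "C.F 0 j (\<lambda>i. cJ (\<theta> i)) = vconj (Tm \<Theta> (C.F 0 j \<theta>))"
  using assms(3)
proof (induction j)
  case 0
  then show ?case by (simp add: Tm_0)
next
  case (Suc j)
  have "\<theta> j \<in> pdisc r2" using assms(2) Suc.prems pdisc_mono[OF C.small_le[OF assms(1)]] by (auto simp: chain_dom_def)
  moreover have "C.F 0 j \<theta> \<in> pdisc r2" using C.smallD[OF assms(1) _ assms(2), of 0 j] C.small_pos[OF assms(1)] Suc.prems by simp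
  ultimately show ?case using Suc Psi_conj by simp
qed

text \<open>Every direction is a complex combination of two \<open>cJ\<close>-fixed ones, so the
  derivatives in fixed directions still span the column space, and the determinant can be built from
  them.\<close>

lemma real_directions:
  assumes s: "C.small k \<delta>" and \<theta>: "\<theta> \<in> chain_dom k \<delta>" and rk: "CARD('m + ('m + 'd)) \<le> rk (C.F 0 k) \<theta>"
  obtains d where "\<And>i j. cJ (d i j) = d i j"
    "det (colmat (\<lambda>i::'m + ('m + 'd). dirD (C.F 0 k) \<theta> (d i))) \<noteq> 0"
proof -
  have Q: "(0::complex^('m + ('m + 'd))) \<in> pdisc \<delta>" using C.small_pos[OF s] by simp
  let ?S = "dirD (C.F 0 k) \<theta> ` {e. \<forall>j. cJ (e j) = e j}"
  have "range (dirD (C.F 0 k) \<theta>) \<subseteq> vec.span ?S"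
  proof clarify
    fix e :: "nat \<Rightarrow> complex^('m + 'm)"
    let ?e1 = "\<lambda>j. e j + cJ (e j)" and ?e2 = "\<lambda>j. \<i> *s (e j - cJ (e j))"
    have "e = (\<lambda>j. (1/2) *s ?e1 j + (- \<i>/2) *s ?e2 j)" by (simp add: fun_eq_iff vec_eq_iff field_simps)
    then have "dirD (C.F 0 k) \<theta> e = (1/2) *s dirD (C.F 0 k) \<theta> ?e1 + (- \<i>/2) *s dirD (C.F 0 k) \<theta> ?e2"
      using C.dirD_add[OF s Q \<theta>, of "1/2" ?e1 "- \<i>/2" ?e2] by metis
    moreover have "?e1 \<in> {e. \<forall>j. cJ (e j) = e j}" "?e2 \<in> {e. \<forall>j. cJ (e j) = e j}"
      by (auto simp: vec_eq_iff algebra_simps)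
    ultimately show "dirD (C.F 0 k) \<theta> e \<in> vec.span ?S"
      by (simp only:) (intro vec.span_add vec.span_scale vec.span_base imageI)
  qed
  then have "CARD('m + ('m + 'd)) \<le> vec.dim (vec.span ?S)"
    using rk vec.dim_subset unfolding rk_def by (meson order_trans)
  then have "CARD('m + ('m + 'd)) \<le> vec.dim ?S" by simp
  then obtain I f where I: "card I = CARD('m + ('m + 'd))" "\<And>j. j \<in> I \<Longrightarrow> f j \<in> ?S" "det (colmat f) \<noteq> 0"
    by (rule exists_colmat) (rule that)
  have "I = UNIV" using I(1) by (metis card_subset_eq finite subset_UNIV)
  then have "\<forall>i. \<exists>e. f i = dirD (C.F 0 k) \<theta> e \<and> (\<forall>j. cJ (e j) = e j)" using I(2) by blast
  then obtain d where d: "\<And>i. f i = dirD (C.F 0 k) \<theta> (d i)" "\<And>i j. cJ (d i j) = d i j" by metis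
  have "f = (\<lambda>i. dirD (C.F 0 k) \<theta> (d i))" using d(1) by auto
  then show ?thesis using that[of d, OF d(2)] I(3) by simp
qed

lemma rk_lft:
  assumes s: "small k \<delta>" and sC: "C.small k \<delta>"
    and F2: "\<And>ws j. ws \<in> chain_dom k \<delta> \<Longrightarrow> j \<le> k \<Longrightarrow> F 0 j ws \<in> pdisc r2" and ws: "ws \<in> chain_dom k \<delta>"
  shows "rk (F 0 k) ws \<le> rk (C.F 0 k) (lft ws)"
proof -
  have Q: "(0::complex^('m + ('m + 'd))) \<in> pdisc \<delta>" using small_pos[OF s] by simp
  have dom: "lft ws \<in> chain_dom k \<delta>" if "ws \<in> chain_dom k \<delta>" for ws
    using that small_pos[OF s] by (auto simp: chain_dom_def lft_def jn_pdisc)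
  have eq: "C.F 0 k (lft ws) = F 0 k ws" if "ws \<in> chain_dom k \<delta>" for ws
    by (rule chain_lft) (use that F2 pdisc_mono[OF C.small_le[OF sC]] in \<open>auto simp: chain_dom_def\<close>)
  have "dirD (F 0 k) ws e = dirD (C.F 0 k) (lft ws) (lft e)" for e
  proof -
    let ?W = "{l. (\<lambda>i. ws i + l *s e i) \<in> chain_dom k \<delta>}"
    have l: "(\<lambda>j. lft ws j + s *s lft e j) = lft (\<lambda>j. ws j + s *s e j)" for s
      by (auto simp: lft_def fun_eq_iff jn_linear simp flip: jn_linear(1))
    have "((\<lambda>s. F 0 k (\<lambda>j. ws j + s *s e j)) has_derivative (\<lambda>s. s *s dirD (C.F 0 k) (lft ws) (lft e))) (at 0)"
    proof (rule has_derivative_transform_within_open[OF C.chain_line_deriv[OF sC Q dom[OF ws], of "lft e"] line_dom(1)])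
      show "0 \<in> ?W" using ws by simp
      show "C.F 0 k (\<lambda>j. lft ws j + s *s lft e j) = F 0 k (\<lambda>j. ws j + s *s e j)" if "s \<in> ?W" for s
        unfolding l by (rule eq) (use that in simp)
    qed
    from deriv_vec[OF this] show ?thesis by (simp add: dirD_def)
  qed
  then have "range (dirD (F 0 k) ws) \<subseteq> range (dirD (C.F 0 k) (lft ws))" by auto
  then show ?thesis unfolding rk_def by (rule vec.dim_subset)
qed

text \<open>Since Segre chains are chains of \<Psi>, the latter attain full rank. The rank is made
  full at a \<open>cJ\<close>-fixed parameter, and appending the reversal moves the end point to
  0.\<close>

lemma real_submersion:
  assumes full and \<epsilon>: "\<epsilon> > 0"
  obtains k ws \<delta> where "C.small k \<delta>" "ws \<in> chain_dom k \<delta>" "\<delta> \<le> \<epsilon>" "\<And>j. cJ (ws j) = ws j" "C.F 0 k ws = 0"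
    "CARD('m + ('m + 'd)) \<le> rk (C.F 0 k) ws"
    "\<And>\<theta> j. \<theta> \<in> chain_dom k \<delta> \<Longrightarrow> j \<le> k \<Longrightarrow> C.F 0 j \<theta> \<in> pdisc \<epsilon>"
proof -
  define K where "K = segre_type \<Theta>"
  \<comment> \<open>All \<mu> steps are reversed here, without merging the middle ones; for
    minimality the length of the chain is irrelevant.\<close>
  let ?N = "2 * K + 1"
  let ?n = "CARD('m + ('m + 'd))"
  obtain \<delta>1 where \<delta>1: "C.small ?N \<delta>1" by (rule C.small_ex)
  obtain \<delta>2 where \<delta>2: "small K \<delta>2" by (rule small_ex)
  obtain \<delta>3 where \<delta>3: "\<delta>3 > 0" "\<And>Q \<theta> j. Q \<in> pdisc \<delta>3 \<Longrightarrow> \<theta> \<in> chain_dom K \<delta>3 \<Longrightarrow> j \<le> K \<Longrightarrow> F Q j \<theta> \<in> pdisc r2"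
    using chain_small[OF r12(1), of K] by metis
  obtain \<delta>4 where \<delta>4: "\<delta>4 > 0" "\<delta>4 \<le> \<epsilon>" "\<And>Q \<theta> j. Q \<in> pdisc \<delta>4 \<Longrightarrow> \<theta> \<in> chain_dom ?N \<delta>4 \<Longrightarrow> j \<le> ?N \<Longrightarrow> C.F Q j \<theta> \<in> pdisc \<epsilon>"
    using C.chain_small[OF \<epsilon>, of ?N] by metis
  define \<delta> where "\<delta> = min (min \<delta>1 \<delta>2) (min \<delta>3 \<delta>4)"
  have \<delta>: "\<delta> > 0" "\<delta> \<le> \<delta>1" "\<delta> \<le> \<delta>2" "\<delta> \<le> \<delta>3" "\<delta> \<le> \<delta>4" "\<delta> \<le> \<epsilon>"
    using C.small_pos[OF \<delta>1] small_pos[OF \<delta>2] \<delta>3 \<delta>4 by (auto simp: \<delta>_def)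
  have sN: "C.small ?N \<delta>" by (rule C.small_mono[OF \<delta>1 \<delta>(1,2)])
  have sK: "C.small K \<delta>" by (rule C.small_len[OF sN]) simp
  have sF: "small K \<delta>" by (rule small_mono[OF \<delta>2 \<delta>(1,3)])
  have Q: "(0::complex^('m + ('m + 'd))) \<in> pdisc \<delta>" using \<delta> by simp
  have F2: "F 0 j ws \<in> pdisc r2" if "ws \<in> chain_dom K \<delta>" "j \<le> K" for ws j
    using \<delta>3(2)[of 0 ws j] \<delta>3(1) that chain_dom_mono[OF \<delta>(4)] by auto
  obtain ws where ws: "ws \<in> chain_dom K \<delta>" "?n \<le> rk (F 0 K) ws"
    using gen_segre_r[of K] \<open>full\<close> \<delta>(1) unfolding gen_def full_def K_def card_sum by (metis add.assoc mult_2)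
  let ?\<theta> = "lft ws"
  have \<theta>: "?\<theta> \<in> chain_dom K \<delta>" using ws(1) \<delta>(1) by (auto simp: chain_dom_def lft_def jn_pdisc)
  have "?n \<le> vec.dim (range (dirD (C.F 0 K) ?\<theta>))" using rk_lft[OF sF sK F2 ws(1)] ws(2) by (simp add: rk_def)
  then obtain I f where I: "card I = ?n" "\<And>j. j \<in> I \<Longrightarrow> f j \<in> range (dirD (C.F 0 K) ?\<theta>)" "det (colmat f) \<noteq> 0"
    by (rule exists_colmat) (rule that)
  have IU: "I = UNIV" using I(1) by (metis card_subset_eq finite subset_UNIV)
  then have "\<forall>i. \<exists>e. f i = dirD (C.F 0 K) ?\<theta> e" using I(2) by blast
  then obtain d where d: "\<And>i. f i = dirD (C.F 0 K) ?\<theta> (d i)" by metis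
  text \<open>The parameters form the complexification of the \<open>cJ\<close>-fixed ones, so a determinant that does not
    vanish identically does not vanish at some \<open>cJ\<close>-fixed parameter.\<close>
  define u where "u j = (1/2) *s (?\<theta> j + cJ (?\<theta> j))" for j
  define v where "v j = (- \<i>/2) *s (?\<theta> j - cJ (?\<theta> j))" for j
  have uv: "u j + \<i> *s v j = ?\<theta> j" for j by (simp add: u_def v_def vec_eq_iff field_simps)
  have cu: "cJ (u j) = u j" and cv: "cJ (v j) = v j" for j
    by (auto simp: u_def v_def vec_eq_iff algebra_simps)
  have du: "u \<in> chain_dom K \<delta>"
  proof -
    have "u j \<in> pdisc \<delta>" if "j < K" for j
    proof -
      have "?\<theta> j \<in> pdisc \<delta>" using \<theta> that by (simp add: chain_dom_def)
      then have "(1/2) *\<^sub>R ?\<theta> j + (1/2) *\<^sub>R cJ (?\<theta> j) \<in> pdisc \<delta>" by (intro convexD[OF convex_pdisc]) auto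
      then show ?thesis by (simp add: u_def scaleR_vec_smult vec.scale_right_distrib)
    qed
    then show ?thesis by (simp add: chain_dom_def)
  qed
  have "(\<lambda>j. dirD (C.F 0 K) ?\<theta> (d j)) = f" using d by auto
  \<comment> \<open>The parameter \<open>?\<theta>\<close> is the point l = \<i> of the complex line
    u + l v; its points with real l are \<open>cJ\<close>-fixed because u and v are.\<close>
  then have nz: "det (colmat (\<lambda>j. if j \<in> UNIV then dirD (C.F 0 K) (\<lambda>i. u i + \<i> *s v i) (d j) else f j)) \<noteq> 0"
    using I(3) by (simp add: uv)
  obtain t where t: "(\<lambda>i. u i + complex_of_real t *s v i) \<in> chain_dom K \<delta>"
    "det (colmat (\<lambda>j. if j \<in> UNIV then dirD (C.F 0 K) (\<lambda>i. u i + complex_of_real t *s v i) (d j) else f j)) \<noteq> 0"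
    by (rule C.det_nonzero_near[OF sK Q du _ nz, of 1]) (use \<theta> uv in simp_all)
  define \<omega> where "\<omega> i = u i + complex_of_real t *s v i" for i
  have \<omega>: "\<omega> \<in> chain_dom K \<delta>" "\<And>j. cJ (\<omega> j) = \<omega> j"
    using t(1) cu cv by (simp_all add: \<omega>_def[abs_def])
  have "card (UNIV :: ('m + ('m + 'd)) set) \<le> vec.dim (range (dirD (C.F 0 K) \<omega>))"
    by (rule card_le_dim_colmat[OF t(2)]) (simp add: \<omega>_def[abs_def])
  then have rk\<omega>: "?n \<le> rk (C.F 0 K) \<omega>" by (simp add: rk_def)
  let ?w = "C.rev_par K \<omega>"
  have w: "?w \<in> chain_dom ?N \<delta>" by (rule C.rev_par_dom[OF \<delta>(1) \<omega>(1)])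
  have neg: "cJ (- x) = - x" if "cJ x = x" for x :: "complex^('m + 'm)"
    using cJ_diff[of 0 x] that by simp
  have cw: "cJ (?w j) = ?w j" for j using \<omega>(2) neg by (simp add: C.rev_par_def)
  have "dirD (C.F 0 K) \<omega> = dirD (C.F 0 K) ?w"
    by (rule ext, rule C.dirD_cong_base) (simp add: C.rev_par_def)
  then have "rk (C.F 0 K) \<omega> = rk (C.F 0 K) ?w" by (simp add: rk_def)
  also have "\<dots> \<le> rk (C.F 0 ?N) ?w" by (rule C.rk_mono[OF sN Q w]) simp
  finally have rkw: "?n \<le> rk (C.F 0 ?N) ?w" using rk\<omega> by simp
  have F0: "C.F 0 ?N ?w = 0" by (rule C.chain_rev_par[OF sK Q \<omega>(1)])
  have eps: "C.F 0 j \<theta> \<in> pdisc \<epsilon>" if "\<theta> \<in> chain_dom ?N \<delta>" "j \<le> ?N" for \<theta> j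
    using \<delta>4(3)[of 0 \<theta> j] \<delta>4(1) that chain_dom_mono[OF \<delta>(5)] by auto
  show ?thesis by (rule that[OF sN w \<delta>(6) cw F0 rkw eps])
qed

end

section \<open>Real flows as CR curves, and the points they reach\<close>

context crflow begin

lemma Psi_real:
  assumes "\<theta> \<in> pdisc r2" "cJ \<theta> = \<theta>" "y \<in> pdisc r2" "Tm \<Theta> y = vconj y"
  shows "Tm \<Theta> (\<Psi> \<theta> y) = vconj (\<Psi> \<theta> y)"
  using Psi_conj[OF assms(1,3)] assms(2,4) by (metis vconj_simps(1))

text \<open>For a \<open>cJ\<close>-fixed parameter the flow preserves the fixed points of the
  involution, so it gives a curve in M whose initial velocity is the asserted vector.\<close>

lemma Psi_curve_tangent:
  assumes a: "a \<in> pdisc r2" and q: "q \<in> realM \<Theta>" "emb q \<in> pdisc r2"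
  shows "unemb (XX (jn a (vconj a)) (emb q)) \<in> tangent_vecs (realM \<Theta>) q"
proof -
  let ?\<theta> = "jn a (vconj a)"
  let ?\<gamma> = "\<lambda>t::real. unemb (\<Psi> (complex_of_real t *s ?\<theta>) (emb q))"
  have \<theta>: "?\<theta> \<in> pdisc r2" "cJ ?\<theta> = ?\<theta>" using a by (simp_all add: jn_pdisc)
  have q1: "emb q \<in> pdisc r1" "?\<theta> \<in> pdisc r1" by (rule r2_r1[OF q(2)], rule r2_r1[OF \<theta>(1)])
  have "?\<gamma> t \<in> realM \<Theta>" if "\<bar>t\<bar> < 1" for t
  proof -
    have "complex_of_real t *s ?\<theta> \<in> pdisc r2" using that by (intro pdisc_smult \<theta>) simp
    moreover have "cJ (complex_of_real t *s ?\<theta>) = complex_of_real t *s ?\<theta>" using \<theta>(2) by (simp only: cJ_simps complex_cnj_complex_of_real)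
    ultimately have "Tm \<Theta> (\<Psi> (complex_of_real t *s ?\<theta>) (emb q)) = vconj (\<Psi> (complex_of_real t *s ?\<theta>) (emb q))"
      using q by (intro Psi_real) (auto simp: realM_iff)
    then show ?thesis using emb_unemb by (metis realM_iff)
  qed
  moreover have "(?\<gamma> has_vector_derivative unemb (XX ?\<theta> (emb q))) (at 0)"
  proof -
    have "((\<lambda>t. \<Psi> (complex_of_real t *s ?\<theta>) (emb q)) has_vector_derivative XX ?\<theta> (\<Psi> (complex_of_real 0 *s ?\<theta>) (emb q))) (at 0)"
      by (rule Psi_deriv[OF q1(2,1)]) simp
    then have "((\<lambda>t. \<Psi> (complex_of_real t *s ?\<theta>) (emb q)) has_vector_derivative XX ?\<theta> (emb q)) (at 0)"
      using Psi_zero[OF q1(1)] by simp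
    then show ?thesis by (rule bounded_linear.has_vector_derivative[OF bounded_linear_unemb])
  qed
  moreover have "?\<gamma> 0 = q" using Psi_zero[OF q1(1)] by simp
  ultimately show ?thesis unfolding tangent_vecs_def by (intro CollectI exI[of _ ?\<gamma>] exI[of _ 1]) auto
qed

text \<open>The cut-off makes the section continuous on all of \<open>M\<close>, as the open set in the definition of
  minimality may be large.\<close>
definition cut :: "real \<Rightarrow> ('m,'d) pt \<Rightarrow> real" where
  "cut \<rho> q = max 0 (min 1 (2 - norm q / \<rho>))"

text \<open>The value 0 outside the domain of the fields fits continuously, since the cut-off
  already vanishes for \<open>norm q \<ge> 2 * \<rho>\<close>.\<close>

definition sect :: "real \<Rightarrow> complex^'m \<Rightarrow> ('m,'d) pt \<Rightarrow> ('m,'d) pt" where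
  "sect \<rho> a q = (if emb q \<in> pdisc r2 then unemb (XX (complex_of_real (cut \<rho> q) *s jn a (vconj a)) (emb q)) else 0)"

lemma cut_bounds: "0 \<le> cut \<rho> q" "cut \<rho> q \<le> 1"
  by (auto simp: cut_def)

lemma Tc_section_sect:
  assumes \<rho>: "\<rho> > 0" "ball 0 (3 * \<rho>) \<subseteq> (emb -` pdisc r2 :: ('m,'d) pt set)" and a: "a \<in> pdisc r2"
  shows "Tc_section (realM \<Theta>) V (sect \<rho> a)"
  unfolding Tc_section_def
proof (intro conjI ballI)
  let ?\<theta> = "jn a (vconj a)"
  \<comment> \<open>Continuity is checked on two open sets covering the space: the domain of the
    fields, and a region where the cut-off vanishes.\<close>
  let ?O = "emb -` pdisc r2 :: ('m,'d) pt set" and ?P = "{q :: ('m,'d) pt. 2 * \<rho> < norm q}"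
  have \<theta>: "?\<theta> \<in> pdisc r2" using a by (simp add: jn_pdisc)
  have X0: "XX 0 y = 0" for y using XX_smult[of 0 0 y] by simp
  have oO: "open ?O" by (intro open_vimage open_pdisc continuous_on_emb)
  have oP: "open ?P" by (intro open_Collect_less continuous_intros)
  have "continuous_on ?O (\<lambda>q. complex_of_real (cut \<rho> q))"
    unfolding cut_def using \<rho>(1) by (auto intro!: continuous_intros)
  then have cc: "continuous_on ?O (\<lambda>q. complex_of_real (cut \<rho> q) *s ?\<theta>)"
    by (rule bounded_linear.continuous_on[OF bounded_linear_smult_left])
  have "continuous_on ?O (\<lambda>q. XX (complex_of_real (cut \<rho> q) *s ?\<theta>) (emb q))"
  proof (rule continuous_on_compose2_jn[OF XX_hol cc continuous_on_emb])
    fix q :: "('m,'d) pt" assume q: "q \<in> ?O"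
    have "complex_of_real (cut \<rho> q) *s ?\<theta> \<in> pdisc r2" using cut_bounds[of \<rho> q] by (intro pdisc_smult \<theta>) simp
    then show "complex_of_real (cut \<rho> q) *s ?\<theta> \<in> pdisc r" by (intro q_r r1_q r2_r1)
    show "emb q \<in> pdisc r" by (intro q_r r1_q r2_r1) (use q in simp)
  qed
  then have "continuous_on ?O (\<lambda>q. unemb (XX (complex_of_real (cut \<rho> q) *s ?\<theta>) (emb q)))"
    by (rule bounded_linear.continuous_on[OF bounded_linear_unemb])
  then have 1: "continuous_on ?O (sect \<rho> a)"
    by (rule continuous_on_eq) (simp add: sect_def)
  have 2: "continuous_on ?P (sect \<rho> a)"
  proof (rule continuous_on_eq[OF continuous_on_const[of _ 0]])
    fix q :: "('m,'d) pt" assume "q \<in> ?P"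
    then have "2 - norm q / \<rho> \<le> 0" using \<rho>(1) by (simp add: field_simps)
    then have "cut \<rho> q = 0" by (simp add: cut_def)
    then show "0 = sect \<rho> a q" by (simp add: sect_def X0 unemb_def zero_prod_def)
  qed
  have "?O \<union> ?P = UNIV"
  proof -
    have "q \<in> ?O" if "q \<notin> ?P" for q
    proof -
      have "q \<in> ball 0 (3 * \<rho>)" using that \<rho>(1) by simp
      then show ?thesis using \<rho>(2) by blast
    qed
    then show ?thesis by blast
  qed
  then have "continuous_on UNIV (sect \<rho> a)" using continuous_on_open_Un[OF oO oP 1 2] by simp
  then show "continuous_on (realM \<Theta> \<inter> V) (sect \<rho> a)" by (rule continuous_on_subset) simp
  fix q assume q: "q \<in> realM \<Theta> \<inter> V"
  show "sect \<rho> a q \<in> cplx_tangent (realM \<Theta>) q"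
  proof (cases "emb q \<in> pdisc r2")
    case True
    let ?a = "complex_of_real (cut \<rho> q) *s a"
    have a': "?a \<in> pdisc r2" using cut_bounds[of \<rho> q] by (intro pdisc_smult a) simp
    have ia: "\<i> *s ?a \<in> pdisc r2" by (rule pdisc_smult[OF a']) simp
    have yr: "emb q \<in> pdisc r" by (intro q_r r1_q r2_r1 True)
    have s: "sect \<rho> a q = unemb (XX (jn ?a (vconj ?a)) (emb q))" using True by (simp add: sect_def jn_linear)
    show ?thesis
      unfolding cplx_tangent_def s
      using Psi_curve_tangent[OF a' _ True] Psi_curve_tangent[OF ia _ True] q cmult_unemb_XX[OF yr, of ?a] by simp
  next
    case False
    have z: "0 \<in> tangent_vecs (realM \<Theta>) q"
      unfolding tangent_vecs_def using q
      by (intro CollectI exI[of _ "\<lambda>_. q"] exI[of _ 1]) auto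
    have "cmult \<i> (0 :: ('m,'d) pt) = 0" by (simp add: cmult_def zero_prod_def)
    then show ?thesis using False z by (simp add: sect_def cplx_tangent_def)
  qed
qed

text \<open>A chain with \<open>cJ\<close>-fixed parameters is a concatenation of CR curves. Near
  the origin the local inverse of the submersion intertwines the involution with conjugation, so
  every real point comes from such parameters.\<close>

lemma full_imp_minimal:
  assumes full shows "minimal_at (realM \<Theta>) 0"
  unfolding minimal_at_def
proof (intro allI impI)
  fix V :: "('m,'d) pt set" assume V: "open V \<and> 0 \<in> V"
  have "open (emb -` pdisc r2 :: ('m,'d) pt set)" "0 \<in> (emb -` pdisc r2 :: ('m,'d) pt set)"
    using r12 by (auto intro!: open_vimage continuous_on_emb)
  then obtain e where e: "e > 0" "ball 0 e \<subseteq> (emb -` pdisc r2 :: ('m,'d) pt set)" using openE by blast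
  \<comment> \<open>The chains stay in the ball of radius \<rho>, where the cut-off is 1; it
    vanishes beyond 2 \<rho>, and the fields are defined on the ball of radius 3 \<rho> = e.\<close>
  define \<rho> where "\<rho> = e / 3"
  have \<rho>: "\<rho> > 0" "ball 0 (3 * \<rho>) \<subseteq> (emb -` pdisc r2 :: ('m,'d) pt set)" using e by (auto simp: \<rho>_def)
  have "open (unemb -` (V \<inter> ball 0 \<rho>) \<inter> pdisc r2)" using V by (intro open_Int open_vimage continuous_on_unemb) auto
  moreover have "0 \<in> unemb -` (V \<inter> ball 0 \<rho>) \<inter> pdisc r2"
    using V \<rho>(1) r12 by (simp add: unemb_def zero_prod_def[symmetric])
  ultimately obtain \<epsilon> where \<epsilon>: "\<epsilon> > 0" "pdisc \<epsilon> \<subseteq> unemb -` (V \<inter> ball 0 \<rho>) \<inter> pdisc r2" by (rule pdisc_nbhd)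
  obtain k ws \<delta> where sub: "C.small k \<delta>" "ws \<in> chain_dom k \<delta>" "\<delta> \<le> \<epsilon>" "\<And>j. cJ (ws j) = ws j" "C.F 0 k ws = 0"
    "CARD('m + ('m + 'd)) \<le> rk (C.F 0 k) ws"
    "\<And>\<theta> j. \<theta> \<in> chain_dom k \<delta> \<Longrightarrow> j \<le> k \<Longrightarrow> C.F 0 j \<theta> \<in> pdisc \<epsilon>"
    by (rule real_submersion[OF assms \<epsilon>(1)]) (rule that)
  have Q: "(0::complex^('m + ('m + 'd))) \<in> pdisc \<delta>" using C.small_pos[OF sub(1)] by simp
  have \<epsilon>D: "unemb y \<in> V" "norm (unemb y) < \<rho>" "y \<in> pdisc r2" if "y \<in> pdisc \<epsilon>" for y
    using \<epsilon>(2) that by auto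
  have reach: "unemb (C.F 0 j \<theta>) \<in> cr_reach (realM \<Theta>) V 0 \<and> Tm \<Theta> (C.F 0 j \<theta>) = vconj (C.F 0 j \<theta>)"
    if \<theta>: "\<theta> \<in> chain_dom k \<delta>" "\<And>j. cJ (\<theta> j) = \<theta> j" and "j \<le> k" for \<theta> j
    using that(3)
  proof (induction j)
    case 0
    have "(0::('m,'d) pt) \<in> realM \<Theta>" by (simp add: realM_iff Tm_0)
    moreover have "unemb 0 = (0::('m,'d) pt)" by (simp add: unemb_def zero_prod_def)
    ultimately show ?case using V by (auto simp: Tm_0 intro: cr_reach.start)
  next
    case (Suc j)
    let ?y = "C.F 0 j \<theta>" and ?a = "jl (\<theta> j)"
    have \<theta>j: "\<theta> j = jn ?a (vconj ?a)"
    proof -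
      have "jr (cJ (\<theta> j)) = vconj (jl (\<theta> j))" by (simp add: cJ_def)
      then have "jr (\<theta> j) = vconj ?a" using \<theta>(2) by simp
      then show ?thesis by (metis jn_jl_jr)
    qed
    have \<theta>2: "\<theta> j \<in> pdisc r2" using \<theta>(1) Suc.prems pdisc_mono[OF C.small_le[OF sub(1)]] by (auto simp: chain_dom_def)
    then have a: "?a \<in> pdisc r2" using \<theta>j by (metis jn_pdisc)
    have y: "?y \<in> pdisc r2" "Tm \<Theta> ?y = vconj ?y" using \<epsilon>D(3) sub(7)[OF \<theta>(1), of j] Suc by auto
    let ?c = "\<lambda>t. \<Psi> (complex_of_real t *s \<theta> j) ?y"
    have c\<epsilon>: "?c t \<in> pdisc \<epsilon>" and cr: "Tm \<Theta> (?c t) = vconj (?c t)" if t: "t \<in> {0..1}" for t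
    proof -
      let ?\<theta> = "\<theta>(j := complex_of_real t *s \<theta> j)"
      have "?\<theta> \<in> chain_dom k \<delta>" using \<theta>(1) t by (auto simp: chain_dom_def intro!: t_dom)
      then have "C.F 0 (Suc j) ?\<theta> \<in> pdisc \<epsilon>" using Suc.prems by (rule sub(7))
      moreover have "C.F 0 j ?\<theta> = ?y" by (rule chain_cong) auto
      ultimately show "?c t \<in> pdisc \<epsilon>" by simp
      show "Tm \<Theta> (?c t) = vconj (?c t)"
        by (rule Psi_real[OF t_dom[OF \<theta>2 t] _ y]) (simp add: \<theta>(2))
    qed
    let ?\<gamma> = "\<lambda>t. unemb (?c t)"
    have emb\<gamma>: "emb (?\<gamma> t) = ?c t" if "t \<in> {0..1}" for t by (rule emb_unemb[OF cr[OF that]])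
    have y1: "?y \<in> pdisc r1" "\<theta> j \<in> pdisc r1" by (rule r2_r1[OF y(1)], rule r2_r1[OF \<theta>2])
    have s1: "unemb ?y \<in> cr_reach (realM \<Theta>) V 0" using Suc by simp
    have s2: "Tc_section (realM \<Theta>) V (sect \<rho> ?a)" by (rule Tc_section_sect[OF \<rho> a])
    have s3: "?\<gamma> 0 = unemb ?y" using Psi_zero[OF y1(1)] by simp
    have s4: "\<forall>t\<in>{0..1}. ?\<gamma> t \<in> realM \<Theta> \<inter> V"
    proof
      fix t :: real assume t: "t \<in> {0..1}"
      have "?\<gamma> t \<in> realM \<Theta>" using cr[OF t] by (simp only: realM_iff emb\<gamma>[OF t])
      then show "?\<gamma> t \<in> realM \<Theta> \<inter> V" using \<epsilon>D(1)[OF c\<epsilon>[OF t]] by simp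
    qed
    have s5: "\<forall>t\<in>{0..1}. (?\<gamma> has_vector_derivative sect \<rho> ?a (?\<gamma> t)) (at t within {0..1})"
    proof
      fix t :: real assume t: "t \<in> {0..1}"
      have "norm (?\<gamma> t) / \<rho> < 1" using \<epsilon>D(2)[OF c\<epsilon>[OF t]] \<rho>(1) by simp
      then have "cut \<rho> (?\<gamma> t) = 1" by (simp add: cut_def)
      then have "sect \<rho> ?a (?\<gamma> t) = unemb (XX (\<theta> j) (?c t))"
        unfolding sect_def emb\<gamma>[OF t] using \<epsilon>D(3)[OF c\<epsilon>[OF t]] \<theta>j[symmetric] by simp
      then show "(?\<gamma> has_vector_derivative sect \<rho> ?a (?\<gamma> t)) (at t within {0..1})"
        using bounded_linear.has_vector_derivative[OF bounded_linear_unemb Psi_deriv'[OF y1(2,1) t]] by simp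
    qed
    have "?\<gamma> 1 \<in> cr_reach (realM \<Theta>) V 0"
      by (rule cr_reach.step[of "unemb ?y" _ V 0 "sect \<rho> ?a" 1 ?\<gamma>, OF s1 s2 zero_le_one s3 _ s5])
         (use s4 in \<open>simp only: case_prod_beta prod.collapse\<close>)
    then show ?case using cr[of 1] by simp
  qed
  obtain d where d: "\<And>i j. cJ (d i j) = d i j" "det (colmat (\<lambda>i::'m + ('m + 'd). dirD (C.F 0 k) ws (d i))) \<noteq> 0"
    by (rule real_directions[OF sub(1,2,6)]) (rule that)
  let ?G = "\<lambda>u. C.F 0 k (lin ws d u)"
  let ?D = "{u. lin ws d u \<in> chain_dom k \<delta>}"
  have hG: "hol ?G ?D" by (rule C.chain_hol[OF sub(1) Q])
  have det: "det (jac ?G 0) \<noteq> 0" using d(2) by (simp add: jac_lin colmat_def)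
  have 0: "0 \<in> ?D" using sub(2) by simp
  obtain U' V' H where inv: "open U'" "U' \<subseteq> ?D" "0 \<in> U'" "open V'" "?G 0 \<in> V'" "homeomorphism U' V' ?G H" "hol H V'"
    by (rule hol_inverse_function[OF hG 0 det]) (rule that)
  have GH: "\<And>u. u \<in> U' \<Longrightarrow> H (?G u) = u" "\<And>y. y \<in> V' \<Longrightarrow> ?G (H y) = y"
    using inv(6) by (auto simp: homeomorphism_def)
  obtain \<eta> where \<eta>: "\<eta> > 0" "pdisc \<eta> \<subseteq> U'" by (rule pdisc_nbhd[OF inv(1,3)])
  let ?V2 = "V' \<inter> H -` pdisc \<eta>"
  have oV2: "open ?V2" using hol_continuous_on[OF inv(7)] inv(4) by (simp add: continuous_on_open_vimage Int_commute)
  have 02: "0 \<in> ?V2" using GH(1)[OF inv(3)] inv(5) sub(5) \<eta>(1) by simp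
  have "unemb y \<in> cr_reach (realM \<Theta>) V 0" if y: "y \<in> ?V2" "Tm \<Theta> y = vconj y" for y
  proof -
    define u where "u = H y"
    have u: "u \<in> pdisc \<eta>" "?G u = y" using y GH(2) by (auto simp: u_def)
    have uU: "u \<in> U'" "vconj u \<in> U'" using u(1) \<eta>(2) by auto
    have dom: "lin ws d u \<in> chain_dom k \<delta>" using uU inv(2) by auto
    have cl: "(\<lambda>j. cJ (lin ws d u j)) = lin ws d (vconj u)"
      by (simp add: fun_eq_iff lin_def sub(4) cJ_sum d(1))
    have "?G (vconj u) = vconj (Tm \<Theta> (?G u))"
      using chain_conj[OF sub(1) dom order_refl] unfolding cl .
    then have "?G (vconj u) = ?G u" using u(2) y(2) by simp
    \<comment> \<open>The point is fixed by the involution, so \<open>u\<close> and its conjugate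
      have the same image. Both lie in \<open>U'\<close> because polydiscs are stable under
      conjugation, and \<open>?G\<close> is injective there.\<close>
    then have "vconj u = u" using GH(1)[OF uU(1)] GH(1)[OF uU(2)] by simp
    then have "cJ (lin ws d u j) = lin ws d u j" for j using cl by (metis (no_types))
    then show ?thesis using reach[OF dom _ order_refl] u(2) by simp
  qed
  note key = this
  have "realM \<Theta> \<inter> emb -` ?V2 \<subseteq> cr_reach (realM \<Theta>) V 0"
  proof
    fix q assume q: "q \<in> realM \<Theta> \<inter> emb -` ?V2"
    then have "unemb (emb q) \<in> cr_reach (realM \<Theta>) V 0" by (intro key) (auto simp: realM_iff)
    then show "q \<in> cr_reach (realM \<Theta>) V 0" by simp
  qed
  moreover have "open (emb -` ?V2 :: ('m,'d) pt set)" by (intro open_vimage oV2 continuous_on_emb)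
  moreover have "0 \<in> (emb -` ?V2 :: ('m,'d) pt set)" using 02 by simp
  ultimately show "\<exists>W. open W \<and> 0 \<in> W \<and> realM \<Theta> \<inter> W \<subseteq> cr_reach (realM \<Theta>) V 0" by blast
qed

end

section \<open>The cycle of equivalences\<close>

context segre begin

lemma minimal_iff_full: "minimal_at (realM \<Theta>) 0 \<longleftrightarrow> full"
proof
  assume full
  obtain \<Psi> r1 r2 where "crflow \<Theta> R r \<Psi> r1 r2" by (rule crflow_exists)
  then interpret crflow \<Theta> R r \<Psi> r1 r2 .
  show "minimal_at (realM \<Theta>) 0" by (rule full_imp_minimal[OF \<open>full\<close>])
qed (rule minimal_imp_full)

lemma equivalences:
  defines "\<mu> \<equiv> segre_type \<Theta>"
  shows "minimal_at (realM \<Theta>) 0 \<longleftrightarrow> flow_orbit_open \<Theta>"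
    and "flow_orbit_open \<Theta> \<longleftrightarrow>
       (\<exists>\<delta>0>0. \<forall>\<delta>. 0 < \<delta> \<and> \<delta> < \<delta>0 \<longrightarrow>
          contains_nbhd_in (complexM \<Theta>) 0 (Gamma \<Theta> (2*\<mu>-1) ` chain_dom (2*\<mu>-1) \<delta>))"
    and "flow_orbit_open \<Theta> \<longleftrightarrow>
       (\<forall>\<epsilon>>0. \<exists>ws. ws \<in> chain_dom (2*\<mu>-1) \<epsilon> \<and> Gamma \<Theta> (2*\<mu>-1) ws = 0 \<and>
          jac_rank (2*\<mu>-1) (Gamma \<Theta> (2*\<mu>-1)) ws = 2 * CARD('m) + CARD('d) \<and>
          jac_rank (2*\<mu>-1) (Gammab \<Theta> (2*\<mu>-1)) (\<lambda>j. vconj (ws j)) = 2 * CARD('m) + CARD('d))"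
    and "flow_orbit_open \<Theta> \<longleftrightarrow>
       (\<exists>\<delta>0>0. \<forall>\<delta>. 0 < \<delta> \<and> \<delta> < \<delta>0 \<longrightarrow>
          contains_nbhd_in UNIV 0 (fst ` Gammab \<Theta> (2*\<mu>-2) ` chain_dom (2*\<mu>-2) \<delta>) \<and>
          contains_nbhd_in UNIV 0 (snd ` Gamma \<Theta> (2*\<mu>-2) ` chain_dom (2*\<mu>-2) \<delta>))"
proof -
  let ?f = "\<exists>\<delta>0>0. \<forall>\<delta>. 0 < \<delta> \<and> \<delta> < \<delta>0 \<longrightarrow>
          contains_nbhd_in (complexM \<Theta>) 0 (Gamma \<Theta> (2*\<mu>-1) ` chain_dom (2*\<mu>-1) \<delta>)"
  let ?g = "\<forall>\<epsilon>>0. \<exists>ws. ws \<in> chain_dom (2*\<mu>-1) \<epsilon> \<and> Gamma \<Theta> (2*\<mu>-1) ws = 0 \<and>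
          jac_rank (2*\<mu>-1) (Gamma \<Theta> (2*\<mu>-1)) ws = 2 * CARD('m) + CARD('d) \<and>
          jac_rank (2*\<mu>-1) (Gammab \<Theta> (2*\<mu>-1)) (\<lambda>j. vconj (ws j)) = 2 * CARD('m) + CARD('d)"
  let ?h = "\<exists>\<delta>0>0. \<forall>\<delta>. 0 < \<delta> \<and> \<delta> < \<delta>0 \<longrightarrow>
          contains_nbhd_in UNIV 0 (fst ` Gammab \<Theta> (2*\<mu>-2) ` chain_dom (2*\<mu>-2) \<delta>) \<and>
          contains_nbhd_in UNIV 0 (snd ` Gamma \<Theta> (2*\<mu>-2) ` chain_dom (2*\<mu>-2) \<delta>)"
  \<comment> \<open>The cycle runs from full rank through submersion, neighbourhood, projections and
    open orbit back to full rank; \<open>minimal_iff_full\<close> attaches minimality to it.\<close>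
  have fg: "?g" if full using full_submersion[OF that] by (auto simp: \<mu>_def)
  have gf: "?f" if "?g" by (rule submersion_imp_nbhd) (use that in blast)
  \<comment> \<open>The number 2 \<mu> - 2 is even, so the last of the 2 \<mu> - 1 steps belongs to
    the first family, which fixes \<tau>.\<close>
  have S: "2 * \<mu> - 1 = Suc (2 * \<mu> - 2)" "even (2 * \<mu> - 2)" using segre_type_facts(3) by (auto simp: \<mu>_def)
  have fh: "?h" if f: "?f"
  proof -
    obtain \<delta>0 where \<delta>0: "\<delta>0 > 0" "\<And>\<delta>. 0 < \<delta> \<Longrightarrow> \<delta> < \<delta>0 \<Longrightarrow>
        contains_nbhd_in (complexM \<Theta>) 0 (Gamma \<Theta> (2*\<mu>-1) ` chain_dom (2*\<mu>-1) \<delta>)" using f by blast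
    have s: "contains_nbhd_in UNIV 0 (snd ` Gamma \<Theta> (2*\<mu>-2) ` chain_dom (2*\<mu>-2) \<delta>)" if "0 < \<delta>" "\<delta> < \<delta>0" for \<delta>
      by (rule nbhd_imp_projection[OF _ S(2)]) (use \<delta>0(2)[OF that] S(1) in simp)
    then have "contains_nbhd_in UNIV 0 (fst ` Gammab \<Theta> (2*\<mu>-2) ` chain_dom (2*\<mu>-2) \<delta>)" if "0 < \<delta>" "\<delta> < \<delta>0" for \<delta>
      unfolding Gammab_image by (rule contains_nbhd_snd_fst) (rule that)+
    then show ?thesis using s \<delta>0(1) by blast
  qed
  have he: "flow_orbit_open \<Theta>" if "?h" by (rule projection_imp_orbit_open[of "2*\<mu>-2"]) (use that in blast)
  have ef: full if "flow_orbit_open \<Theta>" by (rule orbit_open_imp_full[OF that])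
  show "minimal_at (realM \<Theta>) 0 \<longleftrightarrow> flow_orbit_open \<Theta>" using minimal_iff_full fg gf fh he ef by blast
  show "flow_orbit_open \<Theta> \<longleftrightarrow> ?f" using fg gf fh he ef by blast
  show "flow_orbit_open \<Theta> \<longleftrightarrow> ?g" using fg gf fh he ef by blast
  show "flow_orbit_open \<Theta> \<longleftrightarrow> ?h" using fg gf fh he ef by blast
qed

end

theorem theorem2p6:
  fixes \<Theta> :: "complex^'m::finite \<Rightarrow> complex^'m \<Rightarrow> complex^'d::finite \<Rightarrow> complex^'d"
  assumes conv: "conv_power_series \<Theta>"
    and p_in_M: "\<Theta> 0 0 0 = 0"
    and reality: "\<exists>\<epsilon>>0. \<forall>w z \<zeta> \<xi>. w \<in> pdisc \<epsilon> \<and> z \<in> pdisc \<epsilon> \<and> \<zeta> \<in> pdisc \<epsilon> \<and> \<xi> \<in> pdisc \<epsilon> \<longrightarrow>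
                    (z = \<xi> + \<i> *s Theta_bar \<Theta> w \<zeta> \<xi> \<longleftrightarrow> \<xi> = z - \<i> *s \<Theta> \<zeta> w z)"
  defines "\<mu> \<equiv> segre_type \<Theta>"
  shows "\<mu> \<le> CARD('d) + 2 \<and>
    (minimal_at (realM \<Theta>) 0 \<longleftrightarrow> flow_orbit_open \<Theta>) \<and>
    (flow_orbit_open \<Theta> \<longleftrightarrow>
       (\<exists>\<delta>0>0. \<forall>\<delta>. 0 < \<delta> \<and> \<delta> < \<delta>0 \<longrightarrow>
          contains_nbhd_in (complexM \<Theta>) 0 (Gamma \<Theta> (2*\<mu>-1) ` chain_dom (2*\<mu>-1) \<delta>))) \<and>
    (flow_orbit_open \<Theta> \<longleftrightarrow>
       (\<exists>\<delta>0>0. \<forall>\<delta>. 0 < \<delta> \<and> \<delta> < \<delta>0 \<longrightarrow>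
          contains_nbhd_in (complexM \<Theta>) 0 (Gammab \<Theta> (2*\<mu>-1) ` chain_dom (2*\<mu>-1) \<delta>))) \<and>
    (flow_orbit_open \<Theta> \<longleftrightarrow>
       (\<forall>\<epsilon>>0. \<exists>ws. ws \<in> chain_dom (2*\<mu>-1) \<epsilon> \<and> Gamma \<Theta> (2*\<mu>-1) ws = 0 \<and>
          jac_rank (2*\<mu>-1) (Gamma \<Theta> (2*\<mu>-1)) ws = 2 * CARD('m) + CARD('d) \<and>
          jac_rank (2*\<mu>-1) (Gammab \<Theta> (2*\<mu>-1)) (\<lambda>j. vconj (ws j)) = 2 * CARD('m) + CARD('d))) \<and>
    (flow_orbit_open \<Theta> \<longleftrightarrow>
       (\<exists>\<delta>0>0. \<forall>\<delta>. 0 < \<delta> \<and> \<delta> < \<delta>0 \<longrightarrow>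
          contains_nbhd_in UNIV 0 (fst ` Gammab \<Theta> (2*\<mu>-2) ` chain_dom (2*\<mu>-2) \<delta>) \<and>
          contains_nbhd_in UNIV 0 (snd ` Gamma \<Theta> (2*\<mu>-2) ` chain_dom (2*\<mu>-2) \<delta>)))"
proof -
  obtain R r where "segre \<Theta> R r" by (rule segre_exists[OF conv p_in_M reality])
  then interpret segre \<Theta> R r .
  show ?thesis
    \<comment> \<open>The involution reduces the statement for \<open>Gammab\<close> to the one for
      \<open>Gamma\<close>.\<close>
    unfolding \<mu>_def contains_nbhd_Gammab_iff
    by (intro conjI segre_type_facts(1) equivalences)
qed

end
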